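(* Let $m\ge1$, $M=\mathbb{Z}^{2m}\backslash\mathbb{R}^{2m}$, let $\omega$ and $\omega'$ be two translation-invariant symplectic structures on $M$ representing integer cohomology classes, and let $h$ and $h'$ be flat metrics on $M$. Then the following are equivalent: (i) $\mathrm{Spec}(\omega,h)=\mathrm{Spec}(\omega',h')$. (ii) $\mathrm{Spec}(k\omega,h)=\mathrm{Spec}(k\omega',h')$ for all $k\in\mathbb{Z}^+$. (iii) The linear transformations $h^\sharp\circ\omega^\flat$ and $h'^\sharp\circ\omega'^\flat$ of $\mathbb{R}^{2m}$ (equivalently the matrices $\boldsymbol{h}^{-1}\boldsymbol{\omega}$ and $\boldsymbol{h'}^{-1}\boldsymbol{\omega'}$) have the same eigenvalue spectrum, and $V_\omega=V_{\omega'}$.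
   Context: A metric or $2$-form on $M=\mathbb{Z}^{2m}\backslash\mathbb{R}^{2m}$ is translation-invariant if its pullback to $\mathbb{R}^{2m}$ is invariant under all translations; it is then identified with a bilinear form on $\mathbb{R}^{2m}$. "Flat metric on $M$" means translation-invariant Riemannian metric. $\boldsymbol{h}$ and $\boldsymbol{\omega}$ denote the Gram matrices of the bilinear forms $h$ and $\omega$ with respect to the standard basis of $\mathbb{R}^{2m}$ (similarly for $h',\omega'$). For a nondegenerate bilinear form $B$ on a finite-dimensional real vector space $V$, $B^\flat:V\to V^*$ is the isomorphism $(B^\flat(u))(v)=B(v,u)$ and $B^\sharp:V^*\to V$ is its inverse. Eigenvalue spectra are counted with multiplicity. $V_\omega=\sqrt{\det\boldsymbol{\omega}}$ is the symplectic volume of $M$. Let $L$ be a Hermitian complex line bundle over $M$ with Chern class $[\omega]$, and $\nabla$ a Hermitian connection on $L$ with curvature $-2\pi i\omega$; denote also by $\nabla$ the induced connection on $L^{\otimes k}$, $k\in\mathbb{Z}^+$. Let $\Delta=-\operatorname{trace}(\nabla^2)$ be the associated Laplacian (trace with respect to $h$) on sections of $L^{\otimes k}$, and $\widehat H_k=\frac{\hbar^2}{2}\Delta$ with $\hbar=1/k$. $\mathrm{Spec}(k\omega,h)$ denotes the spectrum of $\widehat H_k$, with multiplicities; it does not depend on the choices of $L$ and $\nabla$. $\mathrm{Spec}(\omega,h)$ is the case $k=1$. *)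

theory Defs
  imports
    "HOL-Analysis.Analysis"
    "HOL-Library.Function_Algebras"
    "HOL-Computational_Algebra.Polynomial"
begin

section \<open>Translation-invariant forms on the torus\<close>

text \<open>
  The torus is the quotient of \<^typ>\<open>real^'n\<close> by its integer lattice. Translation-invariant metrics
  and 2-forms on it are identified with bilinear forms on \<^typ>\<open>real^'n\<close>, and functions on it with
  lattice-periodic functions on \<^typ>\<open>real^'n\<close>.
\<close>

definition int_lattice :: "(real^'n) set" where
  "int_lattice = {v. \<forall>p. v $ p \<in> \<int>}"

definition nondegenerate :: "(real^'n \<Rightarrow> real^'n \<Rightarrow> real) \<Rightarrow> bool" where
  "nondegenerate B \<longleftrightarrow> (\<forall>u. (\<forall>v. B u v = 0) \<longrightarrow> u = 0)"

text \<open>Closedness is automatic, since the coefficients of the form are constant.\<close>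

definition symplectic_form :: "(real^'n \<Rightarrow> real^'n \<Rightarrow> real) \<Rightarrow> bool" where
  "symplectic_form \<omega> \<longleftrightarrow> bilinear \<omega> \<and> (\<forall>u. \<omega> u u = 0) \<and> nondegenerate \<omega>"

text \<open>
  The class of \<^term>\<open>\<omega>\<close> is integral iff its periods are integers. The second homology of the torus
  is generated by the 2-tori spanned by pairs of lattice vectors \<^term>\<open>u\<close>, \<^term>\<open>v\<close>, and the period of
  the constant form \<^term>\<open>\<omega>\<close> over such a 2-torus is \<^term>\<open>\<omega> u v\<close>.
\<close>

definition integral_class :: "(real^'n \<Rightarrow> real^'n \<Rightarrow> real) \<Rightarrow> bool" where
  "integral_class \<omega> \<longleftrightarrow> (\<forall>u\<in>int_lattice. \<forall>v\<in>int_lattice. \<omega> u v \<in> \<int>)"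

definition flat_metric :: "(real^'n \<Rightarrow> real^'n \<Rightarrow> real) \<Rightarrow> bool" where
  "flat_metric h \<longleftrightarrow> bilinear h \<and> (\<forall>u v. h u v = h v u) \<and> (\<forall>u. u \<noteq> 0 \<longrightarrow> h u u > 0)"

definition gram :: "(real^'n \<Rightarrow> real^'n \<Rightarrow> real) \<Rightarrow> real^'n^'n" where
  "gram B = (\<chi> p q. B (axis p 1) (axis q 1))"

definition symplectic_volume :: "(real^'n \<Rightarrow> real^'n \<Rightarrow> real) \<Rightarrow> real" where
  "symplectic_volume \<omega> = sqrt (det (gram \<omega>))"

text \<open>
  Covectors are represented as functions. For nondegenerate bilinear \<^term>\<open>B\<close> the map \<open>flat B\<close> is an
  injection whose range consists of all linear functionals, and \<open>sharp B\<close> is its inverse there; its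
  values on functions that are not linear are irrelevant.
\<close>

definition flat :: "(real^'n \<Rightarrow> real^'n \<Rightarrow> real) \<Rightarrow> real^'n \<Rightarrow> (real^'n \<Rightarrow> real)" where
  "flat B u = (\<lambda>v. B v u)"

definition sharp :: "(real^'n \<Rightarrow> real^'n \<Rightarrow> real) \<Rightarrow> (real^'n \<Rightarrow> real) \<Rightarrow> real^'n" where
  "sharp B = inv (flat B)"

definition charpoly :: "real^'n^'n \<Rightarrow> complex poly" where
  "charpoly A = det (\<chi> p q. (if p = q then [:0, 1:] else 0) - [:complex_of_real (A $ p $ q):])"

text \<open>All complex eigenvalues, with algebraic multiplicity.\<close>

definition eigenvalue_spectrum :: "real^'n^'n \<Rightarrow> complex multiset" where
  "eigenvalue_spectrum A = proots (charpoly A)"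


section \<open>Hermitian line bundles with connection over the torus\<close>

definition partial_deriv :: "'n \<Rightarrow> (real^'n \<Rightarrow> complex) \<Rightarrow> real^'n \<Rightarrow> complex" where
  "partial_deriv p f x = frechet_derivative f (at x) (axis p 1)"

primrec Ck_on :: "nat \<Rightarrow> (real^'n \<Rightarrow> complex) \<Rightarrow> (real^'n) set \<Rightarrow> bool" where
  "Ck_on 0 f U \<longleftrightarrow> continuous_on U f"
| "Ck_on (Suc k) f U \<longleftrightarrow> f differentiable_on U \<and> (\<forall>p. Ck_on k (partial_deriv p f) U)"

text \<open>Intended for open sets \<^term>\<open>U\<close>.\<close>

definition smooth_on :: "(real^'n \<Rightarrow> complex) \<Rightarrow> (real^'n) set \<Rightarrow> bool" where
  "smooth_on f U \<longleftrightarrow> (\<forall>k. Ck_on k f U)"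

definition periodic_set :: "(real^'n) set \<Rightarrow> bool" where
  "periodic_set U \<longleftrightarrow> (\<forall>x. \<forall>v\<in>int_lattice. x \<in> U \<longleftrightarrow> x + v \<in> U)"

definition periodic_on :: "(real^'n) set \<Rightarrow> (real^'n \<Rightarrow> complex) \<Rightarrow> bool" where
  "periodic_on U f \<longleftrightarrow> (\<forall>x\<in>U. \<forall>v\<in>int_lattice. f (x + v) = f x)"

text \<open>
  A Hermitian line bundle with Hermitian connection is given by local data: an open cover of the
  torus by sets \<open>chart L i\<close> (as periodic subsets of \<^typ>\<open>real^'n\<close>), each carrying a unitary frame
  \<open>e\<^sub>i\<close>. The transition functions are determined by \<open>e\<^sub>j = trans L i j * e\<^sub>i\<close>, and the connection is
  \<open>\<nabla>\<^sub>p e\<^sub>i = conn L i p * e\<^sub>i\<close> along the \<open>p\<close>-th coordinate field.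
\<close>

record ('i, 'n) line_bundle =
  chart :: "'i \<Rightarrow> (real^'n) set"
  trans :: "'i \<Rightarrow> 'i \<Rightarrow> real^'n \<Rightarrow> complex"
  conn :: "'i \<Rightarrow> 'n \<Rightarrow> real^'n \<Rightarrow> complex"

text \<open>
  The last clause expresses \<open>\<nabla> e\<^sub>j = \<nabla> (trans L i j * e\<^sub>i)\<close> on overlaps. The connection is Hermitian
  because its coefficients in unitary frames are imaginary.
\<close>

definition hermitian_line_bundle :: "('i, 'n::finite) line_bundle \<Rightarrow> bool" where
  "hermitian_line_bundle L \<longleftrightarrow>
     (\<forall>i. open (chart L i) \<and> periodic_set (chart L i)) \<and>
     (\<Union>i. chart L i) = UNIV \<and>
     (\<forall>i j. smooth_on (trans L i j) (chart L i \<inter> chart L j) \<and>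
            periodic_on (chart L i \<inter> chart L j) (trans L i j) \<and>
            (\<forall>x \<in> chart L i \<inter> chart L j. norm (trans L i j x) = 1)) \<and>
     (\<forall>i j k. \<forall>x \<in> chart L i \<inter> chart L j \<inter> chart L k.
            trans L i j x * trans L j k x = trans L i k x) \<and>
     (\<forall>i p. smooth_on (conn L i p) (chart L i) \<and>
            periodic_on (chart L i) (conn L i p) \<and>
            (\<forall>x \<in> chart L i. Re (conn L i p x) = 0)) \<and>
     (\<forall>i j p. \<forall>x \<in> chart L i \<inter> chart L j.
            trans L i j x * conn L j p x =
              partial_deriv p (trans L i j) x + trans L i j x * conn L i p x)"

text \<open>
  Curvature \<open>-2\<pi>i\<omega>\<close>. By Chern--Weil theory the (real) Chern class, represented by \<open>i/(2\<pi>)\<close> times the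
  curvature, is then the class of \<^term>\<open>\<omega>\<close>.
\<close>

definition prequantum_bundle ::
    "(real^'n \<Rightarrow> real^'n \<Rightarrow> real) \<Rightarrow> ('i, 'n::finite) line_bundle \<Rightarrow> bool" where
  "prequantum_bundle \<omega> L \<longleftrightarrow> hermitian_line_bundle L \<and>
     (\<forall>i p q. \<forall>x \<in> chart L i.
        partial_deriv p (conn L i q) x - partial_deriv q (conn L i p) x =
          - 2 * pi * \<i> * complex_of_real (\<omega> (axis p 1) (axis q 1)))"

text \<open>The \<^term>\<open>k\<close>-th tensor power with the induced connection, in the frames \<open>e\<^sub>i \<otimes> \<dots> \<otimes> e\<^sub>i\<close>.\<close>

definition tensor_power :: "nat \<Rightarrow> ('i, 'n::finite) line_bundle \<Rightarrow> ('i, 'n) line_bundle" where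
  "tensor_power k L =
     \<lparr>chart = chart L,
      trans = (\<lambda>i j x. trans L i j x ^ k),
      conn = (\<lambda>i p x. of_nat k * conn L i p x)\<rparr>"

text \<open>
  A smooth section is the family of its coefficients in the frames \<open>e\<^sub>i\<close>, each extended by \<open>0\<close> outside
  the chart so that the representation is unique.
\<close>

definition sections :: "('i, 'n::finite) line_bundle \<Rightarrow> ('i \<Rightarrow> real^'n \<Rightarrow> complex) set" where
  "sections L = {s.
     (\<forall>i. smooth_on (s i) (chart L i) \<and> periodic_on (chart L i) (s i) \<and>
          (\<forall>x. x \<notin> chart L i \<longrightarrow> s i x = 0)) \<and>
     (\<forall>i j. \<forall>x \<in> chart L i \<inter> chart L j. s i x = trans L i j x * s j x)}"

definition scale_section ::
    "complex \<Rightarrow> ('i \<Rightarrow> real^'n \<Rightarrow> complex) \<Rightarrow> 'i \<Rightarrow> real^'n \<Rightarrow> complex" where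
  "scale_section c s = (\<lambda>i x. c * s i x)"

lemma vector_space_scale_section: "vector_space scale_section"
  by unfold_locales (auto simp: scale_section_def algebra_simps fun_eq_iff)

definition covariant_deriv ::
    "('i, 'n::finite) line_bundle \<Rightarrow> 'n \<Rightarrow> ('i \<Rightarrow> real^'n \<Rightarrow> complex) \<Rightarrow> 'i \<Rightarrow> real^'n \<Rightarrow> complex" where
  "covariant_deriv L p s = (\<lambda>i x.
     if x \<in> chart L i then partial_deriv p (s i) x + conn L i p x * s i x else 0)"

text \<open>
  The coordinate fields are parallel for the Levi-Civita connection of a translation-invariant
  metric, so the second covariant derivative has components \<open>\<nabla>\<^sub>p \<nabla>\<^sub>q\<close>.
\<close>

definition bundle_laplacian ::
    "(real^'n \<Rightarrow> real^'n \<Rightarrow> real) \<Rightarrow> ('i, 'n::finite) line_bundle \<Rightarrow>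
       ('i \<Rightarrow> real^'n \<Rightarrow> complex) \<Rightarrow> 'i \<Rightarrow> real^'n \<Rightarrow> complex" where
  "bundle_laplacian h L s = (\<lambda>i x.
     - (\<Sum>p\<in>UNIV. \<Sum>q\<in>UNIV. complex_of_real (matrix_inv (gram h) $ p $ q) *
          covariant_deriv L p (covariant_deriv L q s) i x))"

definition hamiltonian ::
    "nat \<Rightarrow> (real^'n \<Rightarrow> real^'n \<Rightarrow> real) \<Rightarrow> ('i, 'n::finite) line_bundle \<Rightarrow>
       ('i \<Rightarrow> real^'n \<Rightarrow> complex) \<Rightarrow> 'i \<Rightarrow> real^'n \<Rightarrow> complex" where
  "hamiltonian k h L s =
     (let hbar = 1 / real k
      in scale_section (complex_of_real (hbar^2 / 2)) (bundle_laplacian h (tensor_power k L) s))"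

text \<open>
  The spectrum as multiplicity function. On a compact manifold the spectrum of the (elliptic,
  formally self-adjoint) Hamiltonian consists of eigenvalues with smooth eigensections, and all
  eigenspaces are finite-dimensional, so \<^const>\<open>vector_space.dim\<close> is the true dimension.
\<close>

definition hamiltonian_spectrum ::
    "nat \<Rightarrow> (real^'n \<Rightarrow> real^'n \<Rightarrow> real) \<Rightarrow> ('i, 'n::finite) line_bundle \<Rightarrow> complex \<Rightarrow> nat" where
  "hamiltonian_spectrum k h L = (\<lambda>\<mu>. vector_space.dim scale_section
     {s \<in> sections (tensor_power k L). hamiltonian k h L s = scale_section \<mu> s})"

end

theory Submission
  imports Defs "HOL-Complex_Analysis.Cauchy_Integral_Formula" "HOL-Probability.Distributions"
begin

text \<open>
  The bundle pulled back to \<open>\<real>\<^sup>2\<^sup>m\<close> has a global unitary frame in which the connection form is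
  \<open>- i \<pi> \<omega>(x, \<cdot>)\<close>, because the difference to that connection is flat. Sections of the \<open>k\<close>-th power become
  functions with \<open>f (x + v) = c v exp (i \<pi> k \<omega>(v, x)) f x\<close> for lattice vectors \<open>v\<close>, and covariant
  derivatives become operators \<open>D u\<close> with \<open>[D u, D w] = - 2 \<pi> i k \<omega>(u, w)\<close>. In an \<open>h\<close>-orthonormal
  basis adapted to \<open>\<omega>\<close>, where \<open>h\<^sup>-\<^sup>1 \<omega>\<close> has eigenvalues \<open>\<plusminus> i a\<^sub>p\<close>, the Laplacian is a sum of \<open>m\<close>
  commuting harmonic oscillators. Since it is nonnegative (maximum principle), its eigenvalues are
  \<open>2 \<pi> k \<Sum>\<^sub>p (2 n\<^sub>p + 1) a\<^sub>p\<close> with \<open>n\<^sub>p \<in> \<nat>\<close>, and each tuple \<open>n\<close> contributes the dimension of the vacuum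
  space, the joint kernel of the lowering operators. This space has a reproducing kernel given by a
  theta series, constant on the diagonal up to terms that integrate to zero, which yields its dimension in
  terms of the symplectic volume. Conversely, the lowest eigenvalue and its multiplicity determine
  \<open>\<Sum>\<^sub>p a\<^sub>p\<close> and the volume, and the remaining multiplicities then determine the \<open>a\<^sub>p\<close> one by one.
\<close>

section \<open>Smooth functions\<close>

text \<open>Multiplicities are algebraic dimensions of spaces of smooth eigensections, so the
  argument stays clear of Hilbert spaces and elliptic theory. Two facts usually drawn from there get
  a substitute. The lower bound of the Laplacian comes from the maximum principle rather than from
  integration by parts; it makes the lowering operators nilpotent on eigenspaces, and the
  commutation relations then make them surjective, so dimensions follow from exact sequences. Finite
  dimension and size of the vacuum space come from Bessel's inequality for the theta kernel,
  integrated over the torus: \<open>r\<close> orthonormal vacua satisfy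
  \<open>r * Z \<le> 1\<close>, with equality for a maximal system. \<open>Z\<close> is a Gaussian
  integral, namely a constant depending only on the dimension, divided by the symplectic volume; the
  constant stays unevaluated because it cancels when two spectra are compared. The bundle enters
  only through the modulus and the cocycle identity of its multiplier \<open>c\<close>, which is why
  the choice of bundle and connection leaves no trace. The global frame is found by continuation
  over growing balls.\<close>

lemma partial_deriv_eqI:
  "(f has_derivative f') (at x) \<Longrightarrow> partial_deriv p f x = f' (axis p 1)"
  unfolding partial_deriv_def using frechet_derivative_at by fastforce

lemma differentiable_on_open_at:
  "open U \<Longrightarrow> f differentiable_on U \<longleftrightarrow> (\<forall>x\<in>U. f differentiable (at x))"
  by (simp add: differentiable_on_eq_differentiable_at)

lemma frechet_works:
  "f differentiable (at x) \<Longrightarrow> (f has_derivative frechet_derivative f (at x)) (at x)"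
  by (simp add: frechet_derivative_works)

lemma partial_deriv_cong:
  assumes "open U" "x \<in> U" "\<And>x. x \<in> U \<Longrightarrow> f x = g x"
  shows "partial_deriv p f x = partial_deriv p g x"
proof -
  have "(f has_derivative D) (at x) \<longleftrightarrow> (g has_derivative D) (at x)" for D
    using assms has_derivative_transform_within_open by (metis (no_types, lifting))
  then show ?thesis by (simp add: partial_deriv_def frechet_derivative_def)
qed

lemma frechet_derivative_sum:
  fixes f :: "real^'n \<Rightarrow> complex"
  assumes "f differentiable (at x)"
  shows "frechet_derivative f (at x) u = (\<Sum>p\<in>UNIV. complex_of_real (u $ p) * partial_deriv p f x)"
proof -
  interpret bounded_linear "frechet_derivative f (at x)"
    using frechet_works[OF assms] has_derivative_bounded_linear by blast
  have "frechet_derivative f (at x) u = frechet_derivative f (at x) (\<Sum>p\<in>UNIV. (u $ p) *\<^sub>R axis p 1)"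
    by (simp add: basis_expansion flip: scalar_mult_eq_scaleR)
  also have "\<dots> = (\<Sum>p\<in>UNIV. complex_of_real (u $ p) * partial_deriv p f x)"
    by (simp only: sum scaleR partial_deriv_def) (simp add: scaleR_conv_of_real)
  finally show ?thesis .
qed

text \<open>For open \<open>U\<close> a derivative at a point of \<open>U\<close> depends only on
  values in \<open>U\<close>. The rules below need this because their formulas for partial
  derivatives hold on \<open>U\<close> only.\<close>

lemma Ck_on_cong:
  assumes "open U" "\<And>x. x \<in> U \<Longrightarrow> f x = g x"
  shows "Ck_on k f U \<longleftrightarrow> Ck_on k g U"
  using assms(2)
proof (induction k arbitrary: f g)
  case 0
  then show ?case using continuous_on_cong[OF refl, of U f g] by simp
next
  case (Suc k)
  have "Ck_on k (partial_deriv p f) U \<longleftrightarrow> Ck_on k (partial_deriv p g) U" for p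
    by (rule Suc.IH) (rule partial_deriv_cong[OF assms(1) _ Suc.prems])
  moreover have "f differentiable_on U \<longleftrightarrow> g differentiable_on U"
    unfolding differentiable_on_open_at[OF assms(1)] differentiable_def
    using Suc.prems assms(1) has_derivative_transform_within_open by (metis (no_types, lifting))
  ultimately show ?case by simp
qed

lemma Ck_on_congI:
  "Ck_on k g U \<Longrightarrow> open U \<Longrightarrow> (\<And>x. x \<in> U \<Longrightarrow> f x = g x) \<Longrightarrow> Ck_on k f U"
  using Ck_on_cong by blast

lemma Ck_on_subset: "Ck_on k f U \<Longrightarrow> V \<subseteq> U \<Longrightarrow> Ck_on k f V"
  by (induction k arbitrary: f) (auto intro: continuous_on_subset differentiable_on_subset)

lemma Ck_on_SucD: "Ck_on (Suc k) f U \<Longrightarrow> Ck_on k f U"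
  by (induction k arbitrary: f) (auto intro: differentiable_imp_continuous_on)

lemma Ck_on_Union:
  assumes "\<And>i. i \<in> I \<Longrightarrow> open (U i)" "\<And>i. i \<in> I \<Longrightarrow> Ck_on k f (U i)"
  shows "Ck_on k f (\<Union>i\<in>I. U i)"
  using assms(2)
proof (induction k arbitrary: f)
  case 0
  then show ?case using assms(1) by (simp add: continuous_on_open_UN)
next
  case (Suc k)
  then have "f differentiable (at x)" if "x \<in> U i" "i \<in> I" for x i
    using that differentiable_on_open_at[OF assms(1)[OF that(2)], of f] by auto
  then show ?case using Suc assms(1)
    by (auto simp: differentiable_on_open_at open_UN)
qed

lemma Ck_on_const:
  fixes U :: "(real^'n) set"
  shows "Ck_on k (\<lambda>x. c) U"
proof (induction k arbitrary: c)
  case (Suc k)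
  have "partial_deriv p (\<lambda>x. c) = (\<lambda>x::real^'n. 0)" for p :: 'n
    by (rule ext, rule partial_deriv_eqI[OF has_derivative_const])
  then show ?case using Suc by simp
qed simp

lemma Ck_on_add:
  assumes "open U"
  shows "Ck_on k f U \<Longrightarrow> Ck_on k g U \<Longrightarrow> Ck_on k (\<lambda>x. f x + g x) U"
proof (induction k arbitrary: f g)
  case (Suc k)
  have df: "f differentiable (at x)" "g differentiable (at x)" if "x \<in> U" for x
    using Suc.prems that assms by (auto simp: differentiable_on_open_at)
  have "partial_deriv p (\<lambda>x. f x + g x) x = partial_deriv p f x + partial_deriv p g x" if "x \<in> U" for p x
    using partial_deriv_eqI[OF has_derivative_add[OF df[OF that, THEN frechet_works]]]
    by (simp add: partial_deriv_def)
  moreover have "Ck_on k (\<lambda>x. partial_deriv p f x + partial_deriv p g x) U" for p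
    using Suc.prems by (intro Suc.IH) auto
  ultimately have "Ck_on k (partial_deriv p (\<lambda>x. f x + g x)) U" for p
    by (rule Ck_on_congI[OF _ assms, rotated])
  then show ?case using Suc.prems by (auto intro: differentiable_on_add)
qed (simp add: continuous_on_add)

lemma Ck_on_mult:
  assumes "open U"
  shows "Ck_on k f U \<Longrightarrow> Ck_on k g U \<Longrightarrow> Ck_on k (\<lambda>x. f x * g x) U"
proof (induction k arbitrary: f g)
  case (Suc k)
  have df: "f differentiable (at x)" "g differentiable (at x)" if "x \<in> U" for x
    using Suc.prems that assms by (auto simp: differentiable_on_open_at)
  have "partial_deriv p (\<lambda>x. f x * g x) x = f x * partial_deriv p g x + partial_deriv p f x * g x"
    if "x \<in> U" for p x
    using partial_deriv_eqI[OF has_derivative_mult[OF df[OF that, THEN frechet_works]]]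
    by (simp add: partial_deriv_def)
  moreover have "Ck_on k (\<lambda>x. f x * partial_deriv p g x + partial_deriv p f x * g x) U" for p
    using Suc.prems Ck_on_SucD[OF Suc.prems(1)] Ck_on_SucD[OF Suc.prems(2)]
    by (intro Ck_on_add assms Suc.IH) auto
  ultimately have "Ck_on k (partial_deriv p (\<lambda>x. f x * g x)) U" for p
    by (rule Ck_on_congI[OF _ assms, rotated])
  then show ?case using Suc.prems by (auto intro: differentiable_on_mult)
qed (simp add: continuous_on_mult)

lemma Ck_on_exp:
  assumes "open U"
  shows "Ck_on k f U \<Longrightarrow> Ck_on k (\<lambda>x. exp (f x)) U"
proof (induction k arbitrary: f)
  case (Suc k)
  have df: "f differentiable (at x)" if "x \<in> U" for x
    using Suc.prems that assms by (auto simp: differentiable_on_open_at)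
  have d: "((\<lambda>x. exp (f x)) has_derivative (\<lambda>h. exp (f x) * frechet_derivative f (at x) h)) (at x)"
    if "x \<in> U" for x
    using has_derivative_compose[OF frechet_works[OF df[OF that]], of exp "(*) (exp (f x))"]
    by (simp add: DERIV_exp flip: has_field_derivative_def)
  have "partial_deriv p (\<lambda>x. exp (f x)) x = exp (f x) * partial_deriv p f x"
    if "x \<in> U" for p x
    using partial_deriv_eqI[OF d[OF that]] by (simp add: partial_deriv_def)
  moreover have "Ck_on k (\<lambda>x. exp (f x) * partial_deriv p f x) U" for p
    using Suc.prems Ck_on_SucD[OF Suc.prems(1)] by (intro Ck_on_mult assms Suc.IH) auto
  ultimately have "Ck_on k (partial_deriv p (\<lambda>x. exp (f x))) U" for p
    by (rule Ck_on_congI[OF _ assms, rotated])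
  then show ?case using d assms by (auto simp: differentiable_on_open_at differentiable_def)
qed (simp add: continuous_on_exp)

lemma Ck_on_cnj:
  assumes "open U"
  shows "Ck_on k f U \<Longrightarrow> Ck_on k (\<lambda>x. cnj (f x)) U"
proof (induction k arbitrary: f)
  case (Suc k)
  have df: "f differentiable (at x)" if "x \<in> U" for x
    using Suc.prems that assms by (auto simp: differentiable_on_open_at)
  have d: "((\<lambda>x. cnj (f x)) has_derivative (\<lambda>h. cnj (frechet_derivative f (at x) h))) (at x)"
    if "x \<in> U" for x
    by (intro has_derivative_cnj frechet_works df that)
  have "partial_deriv p (\<lambda>x. cnj (f x)) x = cnj (partial_deriv p f x)"
    if "x \<in> U" for p x
    using partial_deriv_eqI[OF d[OF that]] by (simp add: partial_deriv_def)
  moreover have "Ck_on k (\<lambda>x. cnj (partial_deriv p f x)) U" for p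
    using Suc.prems by (intro Suc.IH) auto
  ultimately have "Ck_on k (partial_deriv p (\<lambda>x. cnj (f x))) U" for p
    by (rule Ck_on_congI[OF _ assms, rotated])
  then show ?case using d assms by (auto simp: differentiable_on_open_at differentiable_def)
qed (simp add: continuous_on_cnj)

lemma Ck_on_linear:
  assumes "bounded_linear l"
  shows "Ck_on k l U"
proof (cases k)
  case 0
  then show ?thesis using assms by (simp add: linear_continuous_on)
next
  case (Suc j)
  have d: "(l has_derivative l) (at x within S)" for x S
    using assms by (rule bounded_linear_imp_has_derivative)
  have "partial_deriv p l = (\<lambda>x. l (axis p 1))" for p
    using partial_deriv_eqI[OF d] by (auto simp: fun_eq_iff)
  then show ?thesis using Suc d by (auto simp: Ck_on_const differentiable_on_def differentiable_def)
qed

lemma smooth_on_const: "smooth_on (\<lambda>x. c) U"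
  by (simp add: smooth_on_def Ck_on_const)

lemma smooth_on_add:
  "open U \<Longrightarrow> smooth_on f U \<Longrightarrow> smooth_on g U \<Longrightarrow> smooth_on (\<lambda>x. f x + g x) U"
  by (simp add: smooth_on_def Ck_on_add)

lemma smooth_on_mult:
  "open U \<Longrightarrow> smooth_on f U \<Longrightarrow> smooth_on g U \<Longrightarrow> smooth_on (\<lambda>x. f x * g x) U"
  by (simp add: smooth_on_def Ck_on_mult)

lemma smooth_on_minus:
  "open U \<Longrightarrow> smooth_on f U \<Longrightarrow> smooth_on (\<lambda>x. - f x) U"
  using smooth_on_mult[OF _ smooth_on_const[of "-1"]] by fastforce

lemma smooth_on_diff:
  "open U \<Longrightarrow> smooth_on f U \<Longrightarrow> smooth_on g U \<Longrightarrow> smooth_on (\<lambda>x. f x - g x) U"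
  using smooth_on_add[OF _ _ smooth_on_minus, of U f g] by simp

lemma smooth_on_sum:
  "open U \<Longrightarrow> (\<And>i. i \<in> I \<Longrightarrow> smooth_on (f i) U) \<Longrightarrow> smooth_on (\<lambda>x. \<Sum>i\<in>I. f i x) U"
  by (induction I rule: infinite_finite_induct) (auto intro: smooth_on_const smooth_on_add)

lemma smooth_on_power:
  "open U \<Longrightarrow> smooth_on f U \<Longrightarrow> smooth_on (\<lambda>x. f x ^ k) U"
  by (induction k) (auto intro: smooth_on_const smooth_on_mult)

lemma smooth_on_exp: "open U \<Longrightarrow> smooth_on f U \<Longrightarrow> smooth_on (\<lambda>x. exp (f x)) U"
  by (simp add: smooth_on_def Ck_on_exp)

lemma smooth_on_cnj: "open U \<Longrightarrow> smooth_on f U \<Longrightarrow> smooth_on (\<lambda>x. cnj (f x)) U"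
  by (simp add: smooth_on_def Ck_on_cnj)

lemma smooth_on_linear: "bounded_linear l \<Longrightarrow> smooth_on l U"
  by (simp add: smooth_on_def Ck_on_linear)

lemma smooth_on_of_real_linear:
  fixes l :: "real^'n \<Rightarrow> real"
  shows "linear l \<Longrightarrow> smooth_on (\<lambda>x. complex_of_real (l x)) U"
  by (intro smooth_on_linear bounded_linear_compose[OF bounded_linear_of_real])
    (simp add: linear_linear)

lemma smooth_on_subset: "smooth_on f U \<Longrightarrow> V \<subseteq> U \<Longrightarrow> smooth_on f V"
  by (auto simp: smooth_on_def intro: Ck_on_subset)

lemma smooth_on_cong:
  "open U \<Longrightarrow> (\<And>x. x \<in> U \<Longrightarrow> f x = g x) \<Longrightarrow> smooth_on f U \<longleftrightarrow> smooth_on g U"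
  by (simp add: smooth_on_def Ck_on_cong[of U f g])

lemma smooth_on_Union:
  assumes "\<And>i. i \<in> I \<Longrightarrow> open (U i)" "\<And>i. i \<in> I \<Longrightarrow> smooth_on f (U i)"
  shows "smooth_on f (\<Union>i\<in>I. U i)"
  using Ck_on_Union[of I U] assms by (auto simp: smooth_on_def)

lemma smooth_on_partial_deriv: "smooth_on f U \<Longrightarrow> smooth_on (partial_deriv p f) U"
  unfolding smooth_on_def by (metis Ck_on.simps(2))

lemma smooth_on_imp_differentiable:
  "smooth_on f U \<Longrightarrow> open U \<Longrightarrow> x \<in> U \<Longrightarrow> f differentiable (at x)"
  unfolding smooth_on_def by (metis Ck_on.simps(2) differentiable_on_open_at)

lemma smooth_on_imp_continuous_on: "smooth_on f U \<Longrightarrow> continuous_on U f"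
  unfolding smooth_on_def by (metis Ck_on.simps(1))

text \<open>\<open>Ck_on\<close> peels off one derivative at a time, so a class of differentiable
  functions closed under partial derivatives needs no bookkeeping of orders. It serves families
  whose derivatives keep their shape, such as exponential series and translates.\<close>

lemma smooth_on_coinduct:
  assumes "X f"
    and "\<And>f. X f \<Longrightarrow> f differentiable_on U \<and> (\<forall>p. X (partial_deriv p f))"
  shows "smooth_on f U"
proof -
  have "Ck_on k f U" for k
    using assms(1)
    by (induction k arbitrary: f) (use assms(2) in \<open>auto intro: differentiable_imp_continuous_on\<close>)
  then show ?thesis by (simp add: smooth_on_def)
qed

lemma smooth_on_frechet:
  assumes "smooth_on f U" "open U"
  shows "smooth_on (\<lambda>x. frechet_derivative f (at x) u) U"
proof -
  have "smooth_on (\<lambda>x. \<Sum>p\<in>UNIV. complex_of_real (u $ p) * partial_deriv p f x) U"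
    using assms by (intro smooth_on_sum smooth_on_mult smooth_on_const smooth_on_partial_deriv)
  then show ?thesis
    by (rule smooth_on_cong[OF assms(2), THEN iffD2, rotated])
      (rule frechet_derivative_sum[OF smooth_on_imp_differentiable[OF assms]])
qed

lemma smooth_has_derivative:
  "smooth_on f UNIV \<Longrightarrow> (f has_derivative frechet_derivative f (at x)) (at x)"
  using smooth_on_imp_differentiable[of f UNIV x] frechet_works by auto

lemma smooth_has_vector_derivative_line:
  assumes "smooth_on f UNIV"
  shows "((\<lambda>t. f (x + t *\<^sub>R u)) has_vector_derivative frechet_derivative f (at (x + t *\<^sub>R u)) u) (at t within S)"
proof -
  interpret bounded_linear "frechet_derivative f (at (x + t *\<^sub>R u))"
    using smooth_has_derivative[OF assms] has_derivative_bounded_linear by blast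
  have "((\<lambda>t. x + t *\<^sub>R u) has_derivative (\<lambda>h. h *\<^sub>R u)) (at t within S)"
    by (auto intro!: derivative_eq_intros)
  then show ?thesis
    using has_derivative_compose[OF _ smooth_has_derivative[OF assms], of "\<lambda>t. x + t *\<^sub>R u" "\<lambda>h. h *\<^sub>R u" t S]
    by (simp add: has_vector_derivative_def scaleR)
qed

text \<open>This symmetry removes the second-order terms from the commutator of two covariant
  derivatives, leaving only the curvature.\<close>

lemma smooth_second_derivative_commute:
  assumes f: "smooth_on f UNIV"
  shows "frechet_derivative (\<lambda>y. frechet_derivative f (at y) u) (at x) w =
         frechet_derivative (\<lambda>y. frechet_derivative f (at y) w) (at x) u"
proof -
  define fu where "fu = (\<lambda>y. frechet_derivative f (at y) u)"
  define fw where "fw = (\<lambda>y. frechet_derivative f (at y) w)"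
  define fwu where "fwu = (\<lambda>y. frechet_derivative fw (at y) u)"
  have su: "smooth_on fu UNIV" and sw: "smooth_on fw UNIV"
    unfolding fu_def fw_def by (rule smooth_on_frechet[OF f open_UNIV])+
  then have swu: "smooth_on fwu UNIV" unfolding fwu_def by (intro smooth_on_frechet open_UNIV)
  have c: "continuous_on S (\<lambda>y. g (k y))" if "smooth_on g UNIV" "continuous_on S k"
    for g :: "real^'a \<Rightarrow> complex" and k :: "'b::topological_space \<Rightarrow> _" and S
    using smooth_on_imp_continuous_on[OF that(1)] that(2) by (auto intro: continuous_on_compose2)
  \<comment> \<open>the fundamental theorem of calculus along \<open>w\<close>, differentiated along \<open>u\<close> under the integral\<close>
  have ftc: "f (y + t *\<^sub>R w) - f y = integral (cbox 0 t) (\<lambda>\<tau>. fw (y + \<tau> *\<^sub>R w))" if "t \<ge> 0" for y t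
  proof -
    have "((\<lambda>\<tau>. fw (y + \<tau> *\<^sub>R w)) has_integral f (y + t *\<^sub>R w) - f (y + 0 *\<^sub>R w)) {0..t}"
      unfolding fw_def using that
      by (intro fundamental_theorem_of_calculus smooth_has_vector_derivative_line f)
    then show ?thesis by (metis cbox_interval integral_unique scaleR_zero_left add_0_right)
  qed
  have eq: "fu (x + t *\<^sub>R w) - fu x = integral (cbox 0 t) (\<lambda>\<tau>. fwu (x + \<tau> *\<^sub>R w))" if "t \<ge> 0" for t
  proof -
    have "((\<lambda>s. integral (cbox 0 t) (\<lambda>\<tau>. fw (x + s *\<^sub>R u + \<tau> *\<^sub>R w))) has_vector_derivative
        integral (cbox 0 t) (\<lambda>\<tau>. fwu (x + 0 *\<^sub>R u + \<tau> *\<^sub>R w))) (at 0 within UNIV)"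
    proof (rule leibniz_rule_vector_derivative)
      show "((\<lambda>s. fw (x + s *\<^sub>R u + \<tau> *\<^sub>R w)) has_vector_derivative fwu (x + s *\<^sub>R u + \<tau> *\<^sub>R w)) (at s within UNIV)"
        for s \<tau>
        using smooth_has_vector_derivative_line[OF sw, of "x + \<tau> *\<^sub>R w" u s]
        by (simp add: fwu_def algebra_simps)
      show "(\<lambda>\<tau>. fw (x + s *\<^sub>R u + \<tau> *\<^sub>R w)) integrable_on cbox 0 t" for s
        by (intro integrable_continuous c sw continuous_intros)
      show "continuous_on (UNIV \<times> cbox 0 t) (\<lambda>(s, \<tau>). fwu (x + s *\<^sub>R u + \<tau> *\<^sub>R w))"
        unfolding case_prod_beta by (intro c swu continuous_intros)
    qed auto
    moreover have "((\<lambda>s. f (x + s *\<^sub>R u + t *\<^sub>R w) - f (x + s *\<^sub>R u)) has_vector_derivative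
       fu (x + t *\<^sub>R w) - fu x) (at 0)"
      using has_vector_derivative_diff[OF smooth_has_vector_derivative_line[OF f, of "x + t *\<^sub>R w" u 0 UNIV]
          smooth_has_vector_derivative_line[OF f, of x u 0 UNIV]]
      by (simp add: fu_def algebra_simps)
    ultimately have "fu (x + t *\<^sub>R w) - fu x = integral (cbox 0 t) (\<lambda>\<tau>. fwu (x + 0 *\<^sub>R u + \<tau> *\<^sub>R w))"
      unfolding ftc[OF that] by (rule vector_derivative_unique_at[rotated])
    then show ?thesis by simp
  qed
  \<comment> \<open>\<open>eq\<close> is available for nonnegative \<open>t\<close> only, so both
    sides are differentiated one-sidedly at 0; such derivatives are unique because 0 is not isolated
    in the interval.\<close>
  have "((\<lambda>t. integral {0..t} (\<lambda>\<tau>. fwu (x + \<tau> *\<^sub>R w))) has_vector_derivative fwu (x + 0 *\<^sub>R w)) (at 0 within {0..1})"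
    by (rule integral_has_vector_derivative) (auto intro!: c swu continuous_intros)
  moreover have "((\<lambda>t. fu (x + t *\<^sub>R w) - fu x) has_vector_derivative frechet_derivative fu (at (x + 0 *\<^sub>R w)) w) (at 0 within {0..1})"
    using has_vector_derivative_diff[OF smooth_has_vector_derivative_line[OF su, of x w 0 "{0..1}"]
        has_vector_derivative_const[of "fu x"]] by simp
  then have "((\<lambda>t. integral {0..t} (\<lambda>\<tau>. fwu (x + \<tau> *\<^sub>R w))) has_vector_derivative frechet_derivative fu (at (x + 0 *\<^sub>R w)) w) (at 0 within {0..1})"
    by (rule has_vector_derivative_transform[rotated 2]) (auto simp: eq)
  moreover have "at (0::real) within {0..1} \<noteq> bot"
    by (simp add: at_within_Icc_at_right)
  ultimately have "fwu (x + 0 *\<^sub>R w) = frechet_derivative fu (at (x + 0 *\<^sub>R w)) w"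
    by (intro vector_derivative_unique_within)
  then show ?thesis
    unfolding fu_def fw_def fwu_def by simp
qed

section \<open>Symplectic linear algebra\<close>

lemma flat_metricD:
  assumes "flat_metric h"
  shows "bilinear h" "h u v = h v u" "u \<noteq> 0 \<Longrightarrow> h u u > 0" "h u u \<ge> 0"
proof -
  show b: "bilinear h" "h u v = h v u" "u \<noteq> 0 \<Longrightarrow> h u u > 0"
    using assms unfolding flat_metric_def by auto
  show "h u u \<ge> 0"
    using assms unfolding flat_metric_def by (cases "u = 0") (auto simp: bilinear_rzero less_imp_le)
qed

lemma bilinear_continuous_on:
  fixes B :: "real^'n \<Rightarrow> real^'n \<Rightarrow> real"
  assumes "bilinear B" "continuous_on S f" "continuous_on S g"
  shows "continuous_on S (\<lambda>x. B (f x) (g x))"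
  using bounded_bilinear.continuous_on assms bilinear_conv_bounded_bilinear by blast

text \<open>The minimum over the Euclidean unit sphere is attained, hence positive, and homogeneity
  does the rest. The bound makes unit spheres of \<open>h\<close> compact and Gaussians summable
  over the lattice.\<close>

lemma pos_def_bound:
  fixes h :: "real^'n \<Rightarrow> real^'n \<Rightarrow> real"
  assumes "bilinear h" "\<And>u. u \<noteq> 0 \<Longrightarrow> h u u > 0"
  obtains c where "c > 0" "\<And>x. c * (norm x)\<^sup>2 \<le> h x x"
proof -
  have "continuous_on (sphere 0 1) (\<lambda>x. h x x)"
    by (intro bilinear_continuous_on assms continuous_intros)
  moreover have "sphere (0::real^'n) 1 \<noteq> {}" by simp
  ultimately obtain u where u: "u \<in> sphere 0 1" "\<And>x. x \<in> sphere 0 1 \<Longrightarrow> h u u \<le> h x x"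
    using continuous_attains_inf[OF compact_sphere, of 0 1 "\<lambda>x. h x x"] by blast
  have "h u u > 0" using assms(2)[of u] u(1) by (cases "u = 0") auto
  moreover have "h u u * (norm x)\<^sup>2 \<le> h x x" for x
  proof (cases "x = 0")
    case True
    then show ?thesis by (simp add: bilinear_rzero assms)
  next
    case False
    have "h u u \<le> h (x /\<^sub>R norm x) (x /\<^sub>R norm x)" using False by (intro u(2)) simp
    also have "\<dots> = h x x / (norm x)\<^sup>2"
      by (simp add: bilinear_lmul[OF assms(1)] bilinear_rmul[OF assms(1)] power2_eq_square field_simps)
    finally show ?thesis using False by (simp add: field_simps)
  qed
  ultimately show thesis by (rule that)
qed

text \<open>The equality case of Cauchy-Schwarz, or a Lagrange multiplier: if \<open>l\<close> were
  not \<open>a\<close> times the functional of \<open>f\<close>, then tilting \<open>f\<close>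
  towards the \<open>h\<close>-orthogonal part \<open>w'\<close> of \<open>w\<close> would push
  \<open>l\<close> above its bound.\<close>

lemma functional_attaining_bound:
  fixes h :: "real^'n \<Rightarrow> real^'n \<Rightarrow> real"
  assumes h: "flat_metric h" and S: "subspace S" and l: "linear l" and a: "a > 0"
    and bound: "\<And>v. v \<in> S \<Longrightarrow> (h v v) = 1 \<Longrightarrow> l v \<le> a"
    and f: "f \<in> S" "h f f = 1" "l f = a" and w: "w \<in> S"
  shows "l w = a * h f w"
proof (rule ccontr)
  note hb = flat_metricD(1)[OF h]
  note bl = bilinear_ladd[OF hb] bilinear_radd[OF hb] bilinear_lmul[OF hb] bilinear_rmul[OF hb]
    bilinear_lsub[OF hb] bilinear_rsub[OF hb]
  interpret l: linear l by fact
  assume neq: "l w \<noteq> a * h f w"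
  define w' where "w' = w - h f w *\<^sub>R f"
  define c where "c = l w'"
  define q where "q = h w' w'"
  have w'S: "w' \<in> S" using S f w by (simp add: w'_def subspace_diff subspace_scale)
  have c: "c \<noteq> 0" using neq f by (simp add: c_def w'_def l.diff l.scaleR mult.commute)
  have fw': "h f w' = 0" using f by (simp add: w'_def bl)
  then have wf': "h w' f = 0" using flat_metricD(2)[OF h] by simp
  \<comment> \<open>The bound on the unit sphere, applied to both normalised multiples of
    \<open>v\<close>, in a homogeneous form that needs no further normalisation.\<close>
  have sq: "(l v)\<^sup>2 \<le> a\<^sup>2 * h v v" if v: "v \<in> S" for v
  proof (cases "v = 0")
    case True then show ?thesis by (simp add: l.zero bilinear_rzero[OF hb])
  next
    case False
    have pos: "h v v > 0" using flat_metricD(3)[OF h False] .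
    have "\<bar>l v\<bar> \<le> a * sqrt (h v v)"
    proof -
      have n: "h (s *\<^sub>R v) (s *\<^sub>R v) = 1" if "s = 1 / sqrt (h v v) \<or> s = - 1 / sqrt (h v v)" for s
      proof -
        have "(s * sqrt (h v v))\<^sup>2 = 1" using that pos by auto
        then have "s\<^sup>2 * h v v = 1" using pos by (simp add: power_mult_distrib)
        then show ?thesis by (simp add: bl mult.assoc power2_eq_square)
      qed
      have "l (s *\<^sub>R v) \<le> a" if "s = 1 / sqrt (h v v) \<or> s = - 1 / sqrt (h v v)" for s
        using bound[OF subspace_scale[OF S v] n[OF that]] .
      from this[of "1 / sqrt (h v v)"] this[of "- 1 / sqrt (h v v)"]
      show ?thesis using pos by (simp add: l.scaleR l.neg field_simps abs_le_iff)
    qed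
    then have "\<bar>l v\<bar>\<^sup>2 \<le> (a * sqrt (h v v))\<^sup>2" by (intro power_mono) auto
    then show ?thesis using pos by (simp add: power_mult_distrib)
  qed
  \<comment> \<open>Tilting \<open>f\<close> by \<open>k * c\<close> times \<open>w'\<close> gives
    \<open>2 * a + k * c\<^sup>2 \<le> a\<^sup>2 * q * k\<close>. This \<open>k\<close> makes the
    right side equal to \<open>a - k\<close>, which is too small; the summand 1 keeps the
    denominator positive when \<open>q\<close> is 0.\<close>
  define k where "k = a / (a\<^sup>2 * q + 1)"
  have q: "q \<ge> 0" using flat_metricD(4)[OF h] by (simp add: q_def)
  have k: "k > 0" using a q by (simp add: k_def add_nonneg_pos)
  have "(l (f + (k * c) *\<^sub>R w'))\<^sup>2 \<le> a\<^sup>2 * h (f + (k * c) *\<^sub>R w') (f + (k * c) *\<^sub>R w')"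
    by (intro sq subspace_add subspace_scale S f w'S)
  then have "(a + k * c * c)\<^sup>2 \<le> a\<^sup>2 * (1 + (k * c)\<^sup>2 * q)"
    using f fw' wf' by (simp add: l.add l.scaleR bl c_def[symmetric] q_def[symmetric] power2_eq_square algebra_simps)
  then have "k * c\<^sup>2 * (2 * a + k * c\<^sup>2) \<le> k * c\<^sup>2 * (a\<^sup>2 * q * k)"
    by (simp add: power2_eq_square algebra_simps)
  then have "2 * a + k * c\<^sup>2 \<le> a\<^sup>2 * q * k" using k c by (simp add: mult_le_cancel_left_pos)
  moreover have "k * (a\<^sup>2 * q + 1) = a"
    unfolding k_def using q a by (simp add: add_nonneg_eq_0_iff)
  then have "a\<^sup>2 * q * k = a - k" by (simp add: algebra_simps)
  moreover have "k * c\<^sup>2 \<ge> 0" using k by simp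
  ultimately show False using k a by linarith
qed

text \<open>Maximise \<omega> over pairs of \<open>h\<close>-unit vectors of \<open>S\<close>. At a
  maximising pair both functionals obtained by freezing one argument attain their bound
  \<open>a\<close>, so each is \<open>a\<close> times an \<open>h\<close>-functional. This
  variational step replaces the spectral theorem for skew operators.\<close>

lemma symplectic_plane:
  fixes h \<omega> :: "real^'n \<Rightarrow> real^'n \<Rightarrow> real"
  assumes h: "flat_metric h" and \<omega>: "bilinear \<omega>" "\<And>u. \<omega> u u = 0" and S: "subspace S"
    and nd: "\<And>u. u \<in> S \<Longrightarrow> (\<And>v. v \<in> S \<Longrightarrow> \<omega> u v = 0) \<Longrightarrow> u = 0" and ne: "S \<noteq> {0}"
  obtains e f a where "e \<in> S" "f \<in> S" "a > 0" "h e e = 1" "h f f = 1" "h e f = 0"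
    "\<And>w. w \<in> S \<Longrightarrow> \<omega> e w = a * h f w" "\<And>w. w \<in> S \<Longrightarrow> \<omega> w f = a * h e w"
proof -
  note hb = flat_metricD(1)[OF h]
  note bl = bilinear_lmul[OF hb] bilinear_rmul[OF hb]
    bilinear_lmul[OF \<omega>(1)] bilinear_rmul[OF \<omega>(1)]
  define K where "K = {u \<in> S. h u u = 1}"
  obtain c where c: "c > 0" "\<And>x. c * (norm x)\<^sup>2 \<le> h x x"
    using pos_def_bound[OF hb] flat_metricD(3)[OF h] by metis
  have "norm u \<le> sqrt (1 / c)" if "u \<in> K" for u
    using that c(1) c(2)[of u] by (intro real_le_rsqrt) (simp add: K_def field_simps)
  then have "bounded K" using bounded_iff by blast
  moreover have "closed {u. h u u = 1}"
    by (intro closed_Collect_eq bilinear_continuous_on hb continuous_intros)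
  then have "closed K" using closed_Int[OF closed_subspace[OF S]] by (simp add: K_def Collect_conj_eq)
  ultimately have K: "compact (K \<times> K)" using compact_Times compact_eq_bounded_closed by blast
  obtain u where u: "u \<in> S" "u \<noteq> 0" using ne subspace_0[OF S] by auto
  then obtain v where v: "v \<in> S" "\<omega> u v \<noteq> 0" using nd by blast
  then have v0: "v \<noteq> 0" using bilinear_rzero[OF \<omega>(1)] by auto
  define un where "un x = x /\<^sub>R sqrt (h x x)" for x
  have unK: "un x \<in> K" if "x \<in> S" "x \<noteq> 0" for x
    using flat_metricD(3)[OF h that(2)] subspace_scale[OF S that(1)]
    by (auto simp: K_def un_def bl field_simps)
  have "continuous_on (K \<times> K) (\<lambda>p. \<omega> (fst p) (snd p))"
    by (intro bilinear_continuous_on \<omega> continuous_intros)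
  moreover have "K \<times> K \<noteq> {}" using unK u by auto
  ultimately obtain p where p: "p \<in> K \<times> K" "\<And>q. q \<in> K \<times> K \<Longrightarrow> \<omega> (fst q) (snd q) \<le> \<omega> (fst p) (snd p)"
    using continuous_attains_sup[OF K, of "\<lambda>p. \<omega> (fst p) (snd p)"] by blast
  define e f where "e = fst p" and "f = snd p"
  define a where "a = \<omega> e f"
  have ef: "e \<in> S" "f \<in> S" "h e e = 1" "h f f = 1" using p(1) by (auto simp: K_def e_def f_def)
  have max: "\<omega> x y \<le> a" if "x \<in> S" "y \<in> S" "h x x = 1" "h y y = 1" for x y
    using p(2)[of "(x, y)"] that by (simp add: K_def a_def e_def f_def)
  have "a > 0"
  proof -
    define s where "s = sgn (\<omega> u v)"
    have "\<omega> (un u) (un (s *\<^sub>R v)) \<le> a"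
      using unK[of u] unK[of "s *\<^sub>R v"] u v v0 by (intro max) (auto simp: K_def s_def sgn_eq_0_iff subspace_scale[OF S])
    moreover have "\<omega> (un u) (un (s *\<^sub>R v)) > 0"
    proof -
      have "h u u > 0" "h (s *\<^sub>R v) (s *\<^sub>R v) > 0"
        using flat_metricD(3)[OF h] u v v0 by (auto simp: s_def sgn_eq_0_iff)
      moreover have "\<omega> (un u) (un (s *\<^sub>R v)) = (\<omega> u v * sgn (\<omega> u v)) / (sqrt (h u u) * sqrt (h (s *\<^sub>R v) (s *\<^sub>R v)))"
      unfolding un_def bilinear_lmul[OF \<omega>(1)] bilinear_rmul[OF \<omega>(1)] by (simp add: s_def divide_simps)
      ultimately show ?thesis using v by (simp add: abs_sgn[symmetric])
    qed
    ultimately show ?thesis by simp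
  qed
  have 1: "\<omega> e w = a * h f w" if "w \<in> S" for w
  proof (rule functional_attaining_bound[OF h S _ \<open>a > 0\<close>])
    show "linear (\<omega> e)" using \<omega>(1) by (simp add: bilinear_def)
  qed (use ef max that in \<open>auto simp: a_def\<close>)
  have 2: "\<omega> w f = a * h e w" if "w \<in> S" for w
  proof (rule functional_attaining_bound[OF h S _ \<open>a > 0\<close>, of "\<lambda>w. \<omega> w f"])
    show "linear (\<lambda>w. \<omega> w f)" using \<omega>(1) by (simp add: bilinear_def)
  qed (use ef max that in \<open>auto simp: a_def\<close>)
  have "h e f = 0" using 1[OF ef(1)] \<omega>(2) \<open>a > 0\<close> flat_metricD(2)[OF h] by simp
  then show thesis using that 1 2 ef \<open>a > 0\<close> by blast
qed

lemma alternating_skew: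
  fixes \<omega> :: "real^'n \<Rightarrow> real^'n \<Rightarrow> real"
  assumes "bilinear \<omega>" "\<And>u. \<omega> u u = 0"
  shows "\<omega> u v = - \<omega> v u"
proof -
  have "\<omega> (u + v) (u + v) = 0" using assms by blast
  then show ?thesis
    using assms(2)[of u] assms(2)[of v] by (simp add: bilinear_ladd[OF assms(1)] bilinear_radd[OF assms(1)])
qed

text \<open>Split off one plane and recurse into its \<open>h\<close>-orthogonal complement in
  \<open>S\<close>. Completeness is put as triviality of the orthogonal complement, which passes
  through the recursion without any talk of bases.\<close>

lemma symplectic_splitting:
  fixes h \<omega> :: "real^'n \<Rightarrow> real^'n \<Rightarrow> real"
  assumes h: "flat_metric h" and \<omega>: "bilinear \<omega>" "\<And>u. \<omega> u u = 0" and S: "subspace S"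
    and nd: "\<And>u. u \<in> S \<Longrightarrow> (\<And>v. v \<in> S \<Longrightarrow> \<omega> u v = 0) \<Longrightarrow> u = 0"
  shows "\<exists>N (e :: nat \<Rightarrow> real^'n) f a. (\<forall>i<N. e i \<in> S \<and> f i \<in> S \<and> a i > 0) \<and>
    (\<forall>i<N. \<forall>j<N. h (e i) (e j) = of_bool (i = j) \<and> h (f i) (f j) = of_bool (i = j) \<and> h (e i) (f j) = 0 \<and>
       \<omega> (e i) (e j) = 0 \<and> \<omega> (f i) (f j) = 0 \<and> \<omega> (e i) (f j) = (if i = j then a i else 0)) \<and>
    (\<forall>w\<in>S. (\<forall>i<N. h (e i) w = 0 \<and> h (f i) w = 0) \<longrightarrow> w = 0)"
  using S nd
proof (induction "dim S" arbitrary: S rule: less_induct)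
  case less
  note hb = flat_metricD(1)[OF h]
  note bl = bilinear_lmul[OF hb] bilinear_rmul[OF hb] bilinear_radd[OF hb] bilinear_rsub[OF hb]
    bilinear_lmul[OF \<omega>(1)] bilinear_rmul[OF \<omega>(1)] bilinear_radd[OF \<omega>(1)]
  show ?case
  proof (cases "S = {0}")
    case True
    then show ?thesis by (intro exI[of _ 0]) auto
  next
    case False
    obtain e f a where ef: "e \<in> S" "f \<in> S" "a > 0" "h e e = 1" "h f f = 1" "h e f = 0"
      and ew: "\<And>w. w \<in> S \<Longrightarrow> \<omega> e w = a * h f w" and wf: "\<And>w. w \<in> S \<Longrightarrow> \<omega> w f = a * h e w"
      using symplectic_plane[OF h \<omega> less.prems False] by metis
    \<comment> \<open>By \<open>ew\<close> and \<open>wf\<close> this complement is also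
      \<omega>-orthogonal to the plane, hence \<omega> stays nondegenerate on it.\<close>
    define S' where "S' = {w \<in> S. h e w = 0 \<and> h f w = 0}"
    have subS': "subspace S'"
      using less.prems(1) unfolding subspace_def S'_def by (auto simp: bl bilinear_rzero[OF hb])
    have "e \<notin> S'" using ef by (simp add: S'_def)
    then have "S' \<subset> S" using ef(1) S'_def by blast
    then have dim: "dim S' < dim S"
      using subS' less.prems(1) by (intro dim_psubset) (simp add: span_eq_iff[THEN iffD2])
    have fe: "h f e = 0" using ef flat_metricD(2)[OF h] by simp
    have nd': "u = 0" if u: "u \<in> S'" "\<And>v. v \<in> S' \<Longrightarrow> \<omega> u v = 0" for u
    proof (rule less.prems(2))
      show uS: "u \<in> S" using u by (simp add: S'_def)
      fix v assume v: "v \<in> S"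
      define v' where "v' = v - h e v *\<^sub>R e - h f v *\<^sub>R f"
      have "v' \<in> S'"
        using v ef fe less.prems(1) by (auto simp: S'_def v'_def bl intro!: subspace_diff subspace_scale)
      then have "\<omega> u v' = 0" using u by simp
      moreover have "v = v' + h e v *\<^sub>R e + h f v *\<^sub>R f" by (simp add: v'_def)
      then have "\<omega> u v = \<omega> u (v' + h e v *\<^sub>R e + h f v *\<^sub>R f)" by simp
      moreover have "\<omega> u e = 0" "\<omega> u f = 0"
        using ew[OF uS] wf[OF uS] u(1) alternating_skew[OF \<omega>, of u e] by (auto simp: S'_def)
      ultimately show "\<omega> u v = 0" by (simp add: bl)
    qed
    obtain N and E F :: "nat \<Rightarrow> real^'n" and A where IH0: "(\<forall>i<N. E i \<in> S' \<and> F i \<in> S' \<and> A i > 0) \<and>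
    (\<forall>i<N. \<forall>j<N. h (E i) (E j) = of_bool (i = j) \<and> h (F i) (F j) = of_bool (i = j) \<and> h (E i) (F j) = 0 \<and>
       \<omega> (E i) (E j) = 0 \<and> \<omega> (F i) (F j) = 0 \<and> \<omega> (E i) (F j) = (if i = j then A i else 0)) \<and>
    (\<forall>w\<in>S'. (\<forall>i<N. h (E i) w = 0 \<and> h (F i) w = 0) \<longrightarrow> w = 0)"
    proof (atomize_elim, rule less.hyps[OF dim subS'])
      show "u = 0" if "u \<in> S'" "\<And>v. v \<in> S' \<Longrightarrow> \<omega> u v = 0" for u
        using that by (rule nd')
    qed
    note IH = IH0[THEN conjunct1, rule_format] IH0[THEN conjunct2, THEN conjunct1, rule_format]
      IH0[THEN conjunct2, THEN conjunct2, rule_format]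
    have orth: "h e w = 0" "h f w = 0" "h w e = 0" "h w f = 0"
      "\<omega> e w = 0" "\<omega> w e = 0" "\<omega> f w = 0" "\<omega> w f = 0" if "w \<in> S'" for w
      using that ew[of w] wf[of w] flat_metricD(2)[OF h, of w e] flat_metricD(2)[OF h, of w f]
        alternating_skew[OF \<omega>, of w e] alternating_skew[OF \<omega>, of f w] by (auto simp: S'_def)
    let ?E = "E(N := e)" and ?F = "F(N := f)" and ?A = "A(N := a)"
    have 1: "\<forall>i<Suc N. ?E i \<in> S \<and> ?F i \<in> S \<and> ?A i > 0"
      using IH(1) ef by (auto simp: less_Suc_eq S'_def)
    have "\<omega> e f = a" using ew[OF ef(2)] ef by simp
    then have 2: "h (?E i) (?E j) = of_bool (i = j) \<and> h (?F i) (?F j) = of_bool (i = j) \<and> h (?E i) (?F j) = 0 \<and>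
       \<omega> (?E i) (?E j) = 0 \<and> \<omega> (?F i) (?F j) = 0 \<and> \<omega> (?E i) (?F j) = (if i = j then ?A i else 0)"
      if ij: "i < Suc N" "j < Suc N" for i j
    proof -
      consider "i < N" "j < N" | "i = N" "j < N" | "i < N" "j = N" | "i = N" "j = N" using ij by linarith
      then show ?thesis
      proof cases
        case 1
        then show ?thesis using IH(2)[OF 1] by simp
      next
        case 2
        then show ?thesis using orth IH(1)[OF 2(2)] by simp
      next
        case 3
        then show ?thesis using orth IH(1)[OF 3(1)] by simp
      next
        case 4
        then show ?thesis using ef \<omega>(2) \<open>\<omega> e f = a\<close> by simp
      qed
    qed
    have 3: "\<forall>w\<in>S. (\<forall>i<Suc N. h (?E i) w = 0 \<and> h (?F i) w = 0) \<longrightarrow> w = 0"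
    proof (intro ballI impI)
      fix w assume w: "w \<in> S" and 0: "\<forall>i<Suc N. h (?E i) w = 0 \<and> h (?F i) w = 0"
      have "h e w = 0" "h f w = 0" using 0[rule_format, of N] by auto
      then have "w \<in> S'" using w by (simp add: S'_def)
      moreover have "h (E i) w = 0 \<and> h (F i) w = 0" if "i < N" for i using 0[rule_format, of i] that by simp
      ultimately show "w = 0" by (rule IH(3))
    qed
    show ?thesis using 1 2 3 by blast
  qed
qed

section \<open>Ladder operators and the spectra of sums of oscillators\<close>

text \<open>For positive entries this counts the tuples of naturals \<open>n\<close> with
  \<open>\<Sum> n_p * a_p = x\<close>, the degeneracy of a level of independent oscillators. Larger
  \<open>k\<close> than the cut-off leave a negative remainder, which contributes nothing; for
  negative \<open>x\<close> the sum still has the harmless term \<open>k = 0\<close>.\<close>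

primrec tuple_count :: "real list \<Rightarrow> real \<Rightarrow> nat" where
  "tuple_count [] x = of_bool (x = 0)"
| "tuple_count (a # as) x = (\<Sum>k\<le>nat \<lfloor>x / a\<rfloor>. tuple_count as (x - real k * a))"

lemma tuple_count_neg: "(\<And>a. a \<in> set as \<Longrightarrow> a > 0) \<Longrightarrow> x < 0 \<Longrightarrow> tuple_count as x = 0"
proof (induction as arbitrary: x)
  case (Cons a as)
  have "x - real k * a < 0" for k
    using Cons.prems by (smt (verit) list.set_intros(1) mult_nonneg_nonneg of_nat_0_le_iff)
  then show ?case using Cons by simp
qed simp

text \<open>Tuples are split by whether their first entry is zero. This mirrors kernel and image of
  a lowering operator, which is how the count meets the dimensions of eigenspaces.\<close>

lemma tuple_count_rec:
  assumes "\<And>b. b \<in> set (a # as) \<Longrightarrow> b > 0"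
  shows "tuple_count (a # as) x = tuple_count as x + tuple_count (a # as) (x - a)"
proof (cases "x < a")
  case True
  have a: "a > 0" using assms by simp
  then have "x / a < 1" using True by simp
  then have "\<lfloor>x / a\<rfloor> < 1" by linarith
  then have "nat \<lfloor>x / a\<rfloor> = 0" by simp
  moreover have "tuple_count (a # as) (x - a) = 0" using assms True by (intro tuple_count_neg) auto
  ultimately show ?thesis by simp
next
  case False
  have a: "a > 0" using assms by simp
  have "x / a \<ge> 1" using False a by simp
  then have "nat \<lfloor>x / a\<rfloor> = Suc (nat \<lfloor>(x - a) / a\<rfloor>)"
    using a by (simp add: diff_divide_distrib Suc_nat_eq_nat_zadd1)
  then show ?thesis by (simp add: sum.atMost_Suc_shift algebra_simps del: sum.atMost_Suc)
qed

lemma tuple_count_zero: "(\<And>a. a \<in> set as \<Longrightarrow> a > 0) \<Longrightarrow> tuple_count as 0 = 1"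
proof (induction as)
  case (Cons a as)
  then have "tuple_count (a # as) (0 - a) = 0" by (intro tuple_count_neg) auto
  then show ?case using tuple_count_rec[of a as 0] Cons by simp
qed simp

lemma tuple_count_gap: "(\<And>a. a \<in> set as \<Longrightarrow> a > x) \<Longrightarrow> x > 0 \<Longrightarrow> tuple_count as x = 0"
proof (induction as)
  case (Cons a as)
  have pos: "b > 0" if "b \<in> set (a # as)" for b using Cons.prems that by force
  then have "tuple_count (a # as) (x - a) = 0" using Cons.prems by (intro tuple_count_neg) auto
  then show ?case using tuple_count_rec[OF pos] Cons by simp
qed simp

text \<open>The smallest positive number with nonzero count is the smallest entry, so the two heads
  agree; a common head can then be cancelled, like a common factor of generating functions.\<close>

lemma tuple_count_inject:
  assumes "\<And>a. a \<in> set as \<Longrightarrow> a > 0" "\<And>b. b \<in> set bs \<Longrightarrow> b > 0" "sorted as" "sorted bs"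
    "length as = length bs" "\<And>x. tuple_count as x = tuple_count bs x"
  shows "as = bs"
  using assms
proof (induction as arbitrary: bs)
  case (Cons a as)
  obtain b bs' where bs: "bs = b # bs'" using Cons.prems by (cases bs) auto
  have pos: "c > 0" if "c \<in> set (a # as)" for c using Cons.prems that by blast
  have pos': "c > 0" if "c \<in> set (b # bs')" for c using Cons.prems that bs by blast
  have 1: "tuple_count (a # as) a > 0" using tuple_count_rec[OF pos, of a as a] tuple_count_zero[OF pos, of "a # as"] by simp
  have 2: "tuple_count (b # bs') b > 0" using tuple_count_rec[OF pos', of b bs' b] tuple_count_zero[OF pos', of "b # bs'"] by simp
  have "\<not> a < b"
  proof
    assume "a < b"
    then have "c > a" if "c \<in> set bs" for c using that Cons.prems(4) by (auto simp: bs)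
    then have "tuple_count bs a = 0" using pos[of a] by (intro tuple_count_gap) auto
    then show False using 1 Cons.prems(6)[of a] by (simp del: tuple_count.simps)
  qed
  moreover have "\<not> b < a"
  proof
    assume "b < a"
    then have "c > b" if "c \<in> set (a # as)" for c using that Cons.prems(3) by auto
    then have "tuple_count (a # as) b = 0" using pos'[of b] by (intro tuple_count_gap) auto
    then show False using 2 Cons.prems(6)[of b] by (simp add: bs del: tuple_count.simps)
  qed
  ultimately have "a = b" by simp
  \<comment> \<open>By \<open>tuple_count_rec\<close> the count of the tail at \<open>x\<close> is
    the difference of the full counts at \<open>x\<close> and at \<open>x - a\<close>, and these
    agree for both lists.\<close>
  have "as = bs'"
  proof (rule Cons.IH)
    show "tuple_count as x = tuple_count bs' x" for x
      using tuple_count_rec[OF pos, of a as x] tuple_count_rec[OF pos', of b bs' x] Cons.prems(6)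
      by (simp add: bs \<open>a = b\<close> del: tuple_count.simps)
  qed (use Cons.prems bs in auto)
  then show ?case using bs \<open>a = b\<close> by simp
qed simp

text \<open>\<open>dim\<close> alone is also 0 for infinite-dimensional spaces. An explicit finite
  basis records finiteness together with the dimension, and so can be fed into exact
  sequences.\<close>

definition has_dim :: "('a::field \<Rightarrow> 'b::ab_group_add \<Rightarrow> 'b) \<Rightarrow> 'b set \<Rightarrow> nat \<Rightarrow> bool" where
  "has_dim scl S n \<longleftrightarrow> (\<exists>b. (\<forall>i<n. b i \<in> S) \<and> (\<forall>s\<in>S. \<exists>u. s = (\<Sum>i<n. scl (u i) (b i))) \<and>
     (\<forall>u. (\<Sum>i<n. scl (u i) (b i)) = 0 \<longrightarrow> (\<forall>i<n. u i = 0)))"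

lemma (in vector_space) has_dim_imp_dim:
  assumes "has_dim scale S n"
  shows "dim S = n"
proof -
  obtain b where b: "\<And>i. i < n \<Longrightarrow> b i \<in> S" "\<And>s. s \<in> S \<Longrightarrow> \<exists>u. s = (\<Sum>i<n. scale (u i) (b i))"
    "\<And>u i. (\<Sum>i<n. scale (u i) (b i)) = 0 \<Longrightarrow> i < n \<Longrightarrow> u i = 0"
    using assms unfolding has_dim_def by metis
  have inj: "inj_on b {..<n}"
  proof (rule inj_onI, rule ccontr)
    fix i j assume ij: "i \<in> {..<n}" "j \<in> {..<n}" "b i = b j" "i \<noteq> j"
    let ?u = "\<lambda>k. if k = i then 1 else if k = j then - 1 else 0"
    have "(\<Sum>k<n. scale (?u k) (b k)) = (\<Sum>k\<in>{i, j}. scale (?u k) (b k))"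
      by (rule sum.mono_neutral_right) (use ij in auto)
    also have "\<dots> = 0" using ij by simp
    finally show False using b(3)[of ?u i] ij by simp
  qed
  show ?thesis
  proof (rule dim_unique[of "b ` {..<n}"])
    show "b ` {..<n} \<subseteq> S" using b by auto
    show "S \<subseteq> span (b ` {..<n})"
    proof
      fix s assume "s \<in> S"
      then obtain u where u: "s = (\<Sum>i<n. scale (u i) (b i))" using b(2) by blast
      show "s \<in> span (b ` {..<n})" unfolding u by (intro span_sum span_scale span_base imageI)
    qed
    show "independent (b ` {..<n})"
    proof (rule independent_if_scalars_zero)
      fix f x assume f: "(\<Sum>x\<in>b ` {..<n}. scale (f x) x) = 0" and x: "x \<in> b ` {..<n}"
      then have "(\<Sum>i<n. scale (f (b i)) (b i)) = 0" by (simp add: sum.reindex[OF inj])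
      then show "f x = 0" using b(3)[of "\<lambda>i. f (b i)"] x by auto
    qed simp
    show "card (b ` {..<n}) = n" using inj by (simp add: card_image)
  qed
qed

lemma (in vector_space) has_dim_zero: "has_dim scale {0} 0"
  by (auto simp: has_dim_def)

lemma sum_lessThan_add: "sum f {..<k + n :: nat} = sum f {..<k} + (\<Sum>i<n. f (k + i))"
  for f :: "nat \<Rightarrow> 'a::comm_monoid_add"
  by (induction n) (simp_all add: add.assoc)

text \<open>Rank and nullity for a map that is linear on \<open>S\<close> only, as a differential
  operator is on smooth functions. A basis of the kernel is followed by preimages of a basis of the
  image.\<close>

lemma (in vector_space_pair) has_dim_exact_sequence:
  assumes S: "vs1.subspace S"
    and T: "\<And>x y. x \<in> S \<Longrightarrow> y \<in> S \<Longrightarrow> T (x + y) = T x + T y"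
      "\<And>c x. x \<in> S \<Longrightarrow> T (s1 c x) = s2 c (T x)"
    and img: "T ` S = S'"
    and k: "has_dim s1 {x \<in> S. T x = 0} k" and n: "has_dim s2 S' n"
  shows "has_dim s1 S (k + n)"
proof -
  obtain b where b: "\<And>i. i < k \<Longrightarrow> b i \<in> S" "\<And>i. i < k \<Longrightarrow> T (b i) = 0"
    "\<And>s. s \<in> S \<Longrightarrow> T s = 0 \<Longrightarrow> \<exists>u. s = (\<Sum>i<k. s1 (u i) (b i))"
    "\<And>u i. (\<Sum>i<k. s1 (u i) (b i)) = 0 \<Longrightarrow> i < k \<Longrightarrow> u i = 0"
  proof -
    obtain b where "\<forall>i<k. b i \<in> {x \<in> S. T x = 0}"
      "\<forall>s\<in>{x \<in> S. T x = 0}. \<exists>u. s = (\<Sum>i<k. s1 (u i) (b i))"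
      "\<forall>u. (\<Sum>i<k. s1 (u i) (b i)) = 0 \<longrightarrow> (\<forall>i<k. u i = 0)"
      using k unfolding has_dim_def by blast
    then show thesis by (intro that[of b]) auto
  qed
  obtain b' where b': "\<And>i. i < n \<Longrightarrow> b' i \<in> S'" 
    "\<And>s. s \<in> S' \<Longrightarrow> \<exists>u. s = (\<Sum>i<n. s2 (u i) (b' i))"
    "\<And>u i. (\<Sum>i<n. s2 (u i) (b' i)) = 0 \<Longrightarrow> i < n \<Longrightarrow> u i = 0"
    using n unfolding has_dim_def by metis
  have "\<forall>i. \<exists>p. i < n \<longrightarrow> p \<in> S \<and> T p = b' i" using b'(1) img by (metis imageE)
  then obtain p where p: "\<And>i. i < n \<Longrightarrow> p i \<in> S" "\<And>i. i < n \<Longrightarrow> T (p i) = b' i" by metis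
  have T0: "T 0 = 0" using T(1)[of 0 0] vs1.subspace_0[OF S] by simp
  have Tsum: "T (\<Sum>i<j. s1 (u i) (c i)) = (\<Sum>i<j. s2 (u i) (T (c i))) \<and> (\<Sum>i<j. s1 (u i) (c i)) \<in> S"
    if "\<And>i. i < j \<Longrightarrow> c i \<in> S" for u c and j :: nat
    using that by (induction j) (auto simp: T0 T vs1.subspace_0[OF S] vs1.subspace_add[OF S] vs1.subspace_scale[OF S])
  define B where "B i = (if i < k then b i else p (i - k))" for i
  have Bsum: "(\<Sum>i<k + n. s1 (u i) (B i)) = (\<Sum>i<k. s1 (u i) (b i)) + (\<Sum>i<n. s1 (u (k + i)) (p i))" for u
    by (simp add: sum_lessThan_add B_def)
  show ?thesis unfolding has_dim_def
  proof (intro exI[of _ B] conjI allI impI ballI)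
    show "B i \<in> S" if "i < k + n" for i using that b(1) p(1) by (auto simp: B_def)
  next
    fix s assume s: "s \<in> S"
    then obtain u' where u': "T s = (\<Sum>i<n. s2 (u' i) (b' i))" using b'(2) img by blast
    define s' where "s' = s - (\<Sum>i<n. s1 (u' i) (p i))"
    have "(\<Sum>i<n. s1 (u' i) (p i)) \<in> S" using Tsum p by blast
    then have s'S: "s' \<in> S" using s S by (simp add: s'_def vs1.subspace_diff)
    have "T s = T (s' + (\<Sum>i<n. s1 (u' i) (p i)))" by (simp add: s'_def)
    also have "\<dots> = T s' + (\<Sum>i<n. s2 (u' i) (b' i))"
      using T(1)[OF s'S] Tsum[of n p u'] p by simp
    finally have "T s' = 0" using u' by simp
    then obtain u where u: "s' = (\<Sum>i<k. s1 (u i) (b i))" using b(3) s'S by blast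
    show "\<exists>v. s = (\<Sum>i<k + n. s1 (v i) (B i))"
    proof
      show "s = (\<Sum>i<k + n. s1 ((\<lambda>i. if i < k then u i else u' (i - k)) i) (B i))"
        unfolding Bsum using u by (simp add: s'_def algebra_simps)
    qed
  next
    fix u i assume 0: "(\<Sum>i<k + n. s1 (u i) (B i)) = 0" and i: "i < k + n"
    have "T 0 = (\<Sum>i<k. s2 (u i) (T (b i))) + (\<Sum>i<n. s2 (u (k + i)) (T (p i)))"
      using Tsum[of k b u] Tsum[of n p "\<lambda>i. u (k + i)"] b(1) p(1) T(1) unfolding 0[symmetric] Bsum by auto
    then have "(\<Sum>i<n. s2 (u (k + i)) (b' i)) = 0" using b(2) p(2) by (simp add: T0)
    then have 1: "u (k + i) = 0" if "i < n" for i using b'(3)[of "\<lambda>i. u (k + i)"] that by blast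
    then have "(\<Sum>i<k. s1 (u i) (b i)) = 0" using 0 unfolding Bsum by simp
    then show "u i = 0" using b(4)[of u i] 1[of "i - k"] i by (cases "i < k") auto
  qed
qed

text \<open>The algebra of independent oscillators: \<open>A\<close> lowers, \<open>B\<close>
  raises, \<open>lam\<close> gives the commutators. Instead of an inner product making
  \<open>A\<close> and \<open>B\<close> adjoint there is only the lower bound \<open>- C\<close> for
  eigenvalues, which is all that the nilpotency of \<open>A\<close> takes.\<close>

locale ladder = vector_space scale for scale :: "complex \<Rightarrow> 'v::ab_group_add \<Rightarrow> 'v" +
  fixes Q :: "'v set" and A B :: "'p \<Rightarrow> 'v \<Rightarrow> 'v" and P :: "'p set" and lam :: "'p \<Rightarrow> real" and C :: real
  assumes Q: "subspace Q" and P: "finite P"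
    and A_in: "\<And>p s. p \<in> P \<Longrightarrow> s \<in> Q \<Longrightarrow> A p s \<in> Q"
    and B_in: "\<And>p s. p \<in> P \<Longrightarrow> s \<in> Q \<Longrightarrow> B p s \<in> Q"
    and A_add: "\<And>p s t. p \<in> P \<Longrightarrow> s \<in> Q \<Longrightarrow> t \<in> Q \<Longrightarrow> A p (s + t) = A p s + A p t"
    and B_add: "\<And>p s t. p \<in> P \<Longrightarrow> s \<in> Q \<Longrightarrow> t \<in> Q \<Longrightarrow> B p (s + t) = B p s + B p t"
    and A_scale: "\<And>p c s. p \<in> P \<Longrightarrow> s \<in> Q \<Longrightarrow> A p (scale c s) = scale c (A p s)"
    and B_scale: "\<And>p c s. p \<in> P \<Longrightarrow> s \<in> Q \<Longrightarrow> B p (scale c s) = scale c (B p s)"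
    and A_comm: "\<And>p q s. p \<in> P \<Longrightarrow> q \<in> P \<Longrightarrow> s \<in> Q \<Longrightarrow> A p (A q s) = A q (A p s)"
    and B_comm: "\<And>p q s. p \<in> P \<Longrightarrow> q \<in> P \<Longrightarrow> s \<in> Q \<Longrightarrow> B p (B q s) = B q (B p s)"
    and AB_comm: "\<And>p q s. p \<in> P \<Longrightarrow> q \<in> P \<Longrightarrow> s \<in> Q \<Longrightarrow>
      A p (B q s) = B q (A p s) + scale (if p = q then complex_of_real (lam p) else 0) s"
    and lam: "\<And>p. p \<in> P \<Longrightarrow> lam p > 0"
    and bounded_below: "\<And>s \<mu>. s \<in> Q \<Longrightarrow> (\<Sum>p\<in>P. B p (A p s)) = scale \<mu> s \<Longrightarrow> Re \<mu> < - C \<Longrightarrow> s = 0"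
    and C: "C \<ge> 0"
begin

definition H :: "'v \<Rightarrow> 'v" where "H s = (\<Sum>p\<in>P. B p (A p s))"

text \<open>Eigenvectors in which every mode outside \<open>J\<close> is in its ground state.
  Enlarging \<open>J\<close> one mode at a time interpolates between the vacuum and the full
  eigenspace.\<close>

definition E :: "'p set \<Rightarrow> complex \<Rightarrow> 'v set" where
  "E J \<mu> = {s \<in> Q. H s = scale \<mu> s \<and> (\<forall>p\<in>P - J. A p s = 0)}"

lemma A_zero: "p \<in> P \<Longrightarrow> A p 0 = 0"
  using A_add[of p 0 0] subspace_0[OF Q] by simp

lemma B_zero: "p \<in> P \<Longrightarrow> B p 0 = 0"
  using B_add[of p 0 0] subspace_0[OF Q] by simp

lemma A_sum: "p \<in> P \<Longrightarrow> (\<And>i. i \<in> I \<Longrightarrow> f i \<in> Q) \<Longrightarrow> A p (\<Sum>i\<in>I. f i) = (\<Sum>i\<in>I. A p (f i))"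
  by (induction I rule: infinite_finite_induct) (simp_all add: A_zero A_add subspace_sum[OF Q])

lemma B_sum: "p \<in> P \<Longrightarrow> (\<And>i. i \<in> I \<Longrightarrow> f i \<in> Q) \<Longrightarrow> B p (\<Sum>i\<in>I. f i) = (\<Sum>i\<in>I. B p (f i))"
  by (induction I rule: infinite_finite_induct) (simp_all add: B_zero B_add subspace_sum[OF Q])

lemma A_diff: "p \<in> P \<Longrightarrow> s \<in> Q \<Longrightarrow> t \<in> Q \<Longrightarrow> A p (s - t) = A p s - A p t"
  using A_add[of p "s - t" t] subspace_diff[OF Q, of s t] by (simp add: algebra_simps)

lemma B_diff: "p \<in> P \<Longrightarrow> s \<in> Q \<Longrightarrow> t \<in> Q \<Longrightarrow> B p (s - t) = B p s - B p t"
  using B_add[of p "s - t" t] subspace_diff[OF Q, of s t] by (simp add: algebra_simps)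

lemma H_add: "s \<in> Q \<Longrightarrow> t \<in> Q \<Longrightarrow> H (s + t) = H s + H t"
  by (simp add: H_def A_add B_add A_in sum.distrib)

lemma H_scale: "s \<in> Q \<Longrightarrow> H (scale c s) = scale c (H s)"
  by (simp add: H_def A_scale B_scale A_in scale_sum_right)

lemma A_H: assumes "p \<in> P" "s \<in> Q" shows "A p (H s) = H (A p s) + scale (lam p) (A p s)"
proof -
  have "A p (H s) = (\<Sum>q\<in>P. A p (B q (A q s)))"
    unfolding H_def using assms by (simp add: A_sum A_in B_in)
  also have "\<dots> = (\<Sum>q\<in>P. B q (A q (A p s)) + (if p = q then scale (lam p) (A p s) else 0))"
    using assms by (intro sum.cong) (auto simp: AB_comm A_in A_comm)
  finally show ?thesis using assms P by (simp add: sum.distrib H_def)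
qed

lemma H_B: assumes "p \<in> P" "s \<in> Q" shows "H (B p s) = B p (H s) + scale (lam p) (B p s)"
proof -
  have "H (B p s) = (\<Sum>q\<in>P. B p (B q (A q s)) + (if p = q then scale (lam p) (B p s) else 0))"
    unfolding H_def using assms
    by (intro sum.cong) (auto simp: AB_comm A_in B_in B_add B_scale B_comm subspace_scale[OF Q])
  then show ?thesis using assms P by (simp add: sum.distrib H_def B_sum B_in A_in)
qed

lemma H_zero: "H 0 = 0"
  by (simp add: H_def A_zero B_zero)

lemma subspace_E: "J \<subseteq> P \<Longrightarrow> subspace (E J \<mu>)"
  unfolding subspace_def E_def using subspace_0[OF Q] H_zero
  by (auto simp: A_zero subspace_add[OF Q] subspace_scale[OF Q] A_add A_scale
      H_add H_scale scale_right_distrib mult.commute)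

lemma A_E: "p \<in> P \<Longrightarrow> J \<subseteq> P \<Longrightarrow> s \<in> E J \<mu> \<Longrightarrow> A p s \<in> E J (\<mu> - lam p)"
  using A_H[of p s] by (auto simp: E_def A_in A_scale scale_left_diff_distrib A_comm[of _ p] A_zero algebra_simps)

lemma B_E: "p \<in> J \<Longrightarrow> J \<subseteq> P \<Longrightarrow> s \<in> E J \<mu> \<Longrightarrow> B p s \<in> E J (\<mu> + lam p)"
  using H_B[of p s] by (auto simp: E_def B_in B_scale scale_left_distrib AB_comm B_zero subset_iff)

lemma E_trivial: "Re \<mu> < - C \<Longrightarrow> s \<in> E J \<mu> \<Longrightarrow> s = 0"
  using bounded_below[of s \<mu>] by (simp add: E_def H_def)

lemma A_funpow_E: "p \<in> P \<Longrightarrow> J \<subseteq> P \<Longrightarrow> s \<in> E J \<mu> \<Longrightarrow> (A p ^^ k) s \<in> E J (\<mu> - of_nat k * complex_of_real (lam p))"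
proof (induction k)
  case (Suc k)
  then show ?case using A_E[OF Suc.prems(1,2) Suc.IH[OF Suc.prems]] by (simp add: algebra_simps)
qed simp

text \<open>Each application of \<open>A p\<close> lowers the eigenvalue by the fixed positive
  amount \<open>lam p\<close>, and below \<open>- C\<close> there are no eigenvectors.\<close>

lemma A_nilpotent:
  assumes "p \<in> P" "J \<subseteq> P" "s \<in> E J \<mu>"
  shows "\<exists>k. (A p ^^ k) s = 0"
proof -
  obtain k :: nat where "(Re \<mu> + C) / lam p < k" using reals_Archimedean2 by blast
  then have "Re (\<mu> - of_nat k * complex_of_real (lam p)) < - C" using lam[OF assms(1)] by (simp add: field_simps)
  then show ?thesis using E_trivial A_funpow_E[OF assms] by blast
qed

text \<open>\<open>B p A p + \<kappa>\<close> is inverted by induction on the nilpotency degree of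
  the right side: applying \<open>A p\<close> to the equation turns \<kappa> into
  \<open>\<kappa> + lam p\<close> and lowers the degree by one. Nonnegativity of
  \<open>B p A p\<close> is thus never invoked.\<close>

lemma number_operator_solve:
  assumes p: "p \<in> J" and J: "J \<subseteq> P"
  shows "(A p ^^ k) t = 0 \<Longrightarrow> \<kappa> > 0 \<Longrightarrow> t \<in> E J \<mu> \<Longrightarrow>
    \<exists>w\<in>E J \<mu>. B p (A p w) + scale (complex_of_real \<kappa>) w = t"
proof (induction k arbitrary: t \<kappa> \<mu>)
  case 0
  then show ?case using p J subspace_0[OF subspace_E[OF J, of \<mu>]] by (intro bexI[of _ 0]) (auto simp: A_zero B_zero)
next
  case (Suc k)
  have pP: "p \<in> P" using p J by blast
  have "(A p ^^ k) (A p t) = 0" using Suc.prems(1) by (simp add: funpow_swap1)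
  then obtain y where y: "y \<in> E J (\<mu> - lam p)" "B p (A p y) + scale (complex_of_real (\<kappa> + lam p)) y = A p t"
    using Suc.IH[of "A p t" "\<kappa> + lam p" "\<mu> - lam p"] Suc.prems lam[OF pP] A_E[OF pP J] by (meson add_pos_pos)
  \<comment> \<open>The solution \<open>y\<close> of the reduced equation plays the part of
    \<open>A p w\<close>; solving the original equation for its undifferentiated term then dictates
    \<open>w\<close>.\<close>
  define w where "w = scale (1 / complex_of_real \<kappa>) (t - B p y)"
  have By: "B p y \<in> E J \<mu>" using B_E[OF p J y(1)] by simp
  then have wE: "w \<in> E J \<mu>"
    unfolding w_def using Suc.prems(3) by (intro subspace_scale subspace_diff subspace_E J)
  have Q': "t \<in> Q" "y \<in> Q" "B p y \<in> Q" using Suc.prems(3) y(1) By by (auto simp: E_def)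
  have "B p (A p (t - B p y)) = B p (B p (A p y) + scale (complex_of_real (\<kappa> + lam p)) y) - B p (A p (B p y))"
    using Q' pP y(2) by (simp add: A_diff B_diff A_in)
  also have "\<dots> = scale (complex_of_real \<kappa>) (B p y)"
    using Q' pP by (simp add: AB_comm A_in B_in B_add B_scale subspace_scale[OF Q] subspace_add[OF Q] scale_left_distrib algebra_simps)
  finally have *: "B p (A p (t - B p y)) = scale (complex_of_real \<kappa>) (B p y)" .
  have "B p (A p w) = scale (1 / complex_of_real \<kappa>) (B p (A p (t - B p y)))"
    unfolding w_def using Q' pP by (simp add: A_scale B_scale A_in subspace_diff[OF Q])
  then have "B p (A p w) = B p y" using * Suc.prems(2) by simp
  moreover have "scale (complex_of_real \<kappa>) w = t - B p y"
    using Suc.prems(2) by (simp add: w_def)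
  ultimately show ?case using wE by (intro bexI[of _ w]) auto
qed

text \<open>Since \<open>A p B p\<close> equals \<open>B p A p + lam p\<close>, a solution
  \<open>w\<close> of the number operator equation with \<kappa> \<open>= lam p\<close> gives the
  preimage \<open>B p w\<close>.\<close>

lemma A_surj:
  assumes "p \<in> J" "J \<subseteq> P"
  shows "A p ` E J \<mu> = E J (\<mu> - lam p)"
proof (intro subset_antisym subsetI)
  have pP: "p \<in> P" using assms by blast
  show "s \<in> A p ` E J \<mu> \<Longrightarrow> s \<in> E J (\<mu> - lam p)" for s using A_E[OF pP assms(2)] by blast
  fix t assume t: "t \<in> E J (\<mu> - lam p)"
  obtain k where "(A p ^^ k) t = 0" using A_nilpotent[OF pP assms(2) t] by blast
  then obtain w where w: "w \<in> E J (\<mu> - lam p)" "B p (A p w) + scale (complex_of_real (lam p)) w = t"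
    using number_operator_solve[OF assms _ lam[OF pP] t] by blast
  have "A p (B p w) = t" using w pP by (simp add: AB_comm E_def)
  moreover have "B p w \<in> E J \<mu>" using B_E[OF assms w(1)] by simp
  ultimately show "t \<in> A p ` E J \<mu>" by blast
qed

text \<open>Adding a mode \<open>p\<close>, the operator \<open>A p\<close> maps the eigenspace onto
  the one shifted by \<open>lam p\<close>, with the eigenspace of the remaining modes as kernel. The
  dimensions therefore obey the recursion of \<open>tuple_count\<close>, scaled by the vacuum
  dimension \<open>d\<close>.\<close>

lemma has_dim_E:
  assumes vac: "has_dim scale {s \<in> Q. \<forall>p\<in>P. A p s = 0} d"
  shows "distinct ps \<Longrightarrow> set ps \<subseteq> P \<Longrightarrow>
    has_dim scale (E (set ps) \<mu>) (if Im \<mu> = 0 then d * tuple_count (map lam ps) (Re \<mu>) else 0)"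
proof (induction ps arbitrary: \<mu>)
  case Nil
  have E: "E {} \<mu> = {s \<in> Q. (\<forall>p\<in>P. A p s = 0) \<and> scale \<mu> s = 0}"
    by (auto simp: E_def H_def B_zero)
  show ?case
  proof (cases "\<mu> = 0")
    case True
    then show ?thesis using vac E by simp
  next
    case False
    then have "E {} \<mu> = {0}" using subspace_0[OF Q] by (auto simp: E A_zero)
    moreover have "(if Im \<mu> = 0 then d * tuple_count (map lam []) (Re \<mu>) else 0) = 0"
      using False by (auto simp: complex_eq_iff)
    ultimately show ?thesis by (simp only: list.set has_dim_zero)
  qed
next
  case (Cons p ps)
  let ?J = "set (p # ps)"
  have p: "p \<in> P" "p \<in> ?J" "?J \<subseteq> P" "p \<notin> set ps" using Cons.prems by auto
  have pos: "a > 0" if "a \<in> set (map lam (p # ps))" for a using that Cons.prems lam by auto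
  interpret vector_space_pair scale scale ..
  \<comment> \<open>The inner induction counts how often \<open>lam p\<close> can be subtracted
    before the eigenvalue falls below \<open>- C\<close>, where both sides are zero.\<close>
  have "has_dim scale (E ?J \<mu>) (if Im \<mu> = 0 then d * tuple_count (map lam (p # ps)) (Re \<mu>) else 0)"
    if "Re \<mu> < - C + real k * lam p" for k
    using that
  proof (induction k arbitrary: \<mu>)
    case 0
    then have "E ?J \<mu> = {0}" using E_trivial subspace_0[OF subspace_E[OF p(3)]] by fastforce
    moreover have "tuple_count (map lam (p # ps)) (Re \<mu>) = 0" using 0 C pos by (intro tuple_count_neg) auto
    ultimately show ?case using has_dim_zero by (simp del: tuple_count.simps)
  next
    case (Suc k)
    have "has_dim scale (E ?J (\<mu> - lam p)) (if Im (\<mu> - lam p) = 0 then d * tuple_count (map lam (p # ps)) (Re (\<mu> - lam p)) else 0)"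
      using Suc.prems by (intro Suc.IH) (simp add: algebra_simps)
    moreover have "{x \<in> E ?J \<mu>. A p x = 0} = E (set ps) \<mu>"
      using p by (auto simp: E_def)
    then have "has_dim scale {x \<in> E ?J \<mu>. A p x = 0} (if Im \<mu> = 0 then d * tuple_count (map lam ps) (Re \<mu>) else 0)"
      using Cons by simp
    ultimately have "has_dim scale (E ?J \<mu>) ((if Im \<mu> = 0 then d * tuple_count (map lam ps) (Re \<mu>) else 0) +
       (if Im (\<mu> - lam p) = 0 then d * tuple_count (map lam (p # ps)) (Re (\<mu> - lam p)) else 0))"
      using p by (intro has_dim_exact_sequence[where T = "A p", OF subspace_E _ _ A_surj])
        (auto simp: E_def A_add A_scale)
    moreover have "tuple_count (map lam (p # ps)) (Re \<mu>) =
      tuple_count (map lam ps) (Re \<mu>) + tuple_count (map lam (p # ps)) (Re \<mu> - lam p)"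
      using tuple_count_rec[of "lam p" "map lam ps" "Re \<mu>"] pos by simp
    ultimately show ?case by (cases "Im \<mu> = 0") (simp_all add: distrib_left del: tuple_count.simps)
  qed
  moreover obtain k :: nat where "(Re \<mu> + C) / lam p < k" using reals_Archimedean2 by blast
  then have "Re \<mu> < - C + real k * lam p" using lam[OF p(1)] by (simp add: field_simps)
  ultimately show ?case by blast
qed

end

section \<open>Symplectic frames\<close>

text \<open>A relabelling of the planes of \<open>symplectic_splitting\<close> by the coordinate
  type: \<sigma> exchanges the two vectors of a plane, and \<open>s\<close> is 1 on the first and -1
  on the second of them.\<close>

lemma symplectic_basis:
  fixes h \<omega> :: "real^'n \<Rightarrow> real^'n \<Rightarrow> real"
  assumes h: "flat_metric h" and \<omega>: "symplectic_form \<omega>"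
  obtains b :: "'n \<Rightarrow> real^'n" and \<sigma> :: "'n \<Rightarrow> 'n" and s a :: "'n \<Rightarrow> real"
  where "\<And>p q. h (b p) (b q) = of_bool (p = q)" "\<And>p. \<sigma> (\<sigma> p) = p"
    "\<And>p. s p = 1 \<or> s p = - 1" "\<And>p. s (\<sigma> p) = - s p" "\<And>p. a p > 0" "\<And>p. a (\<sigma> p) = a p"
    "\<And>p q. \<omega> (b p) (b q) = (if q = \<sigma> p then s p * a p else 0)"
proof -
  have \<omega>': "bilinear \<omega>" "\<And>u. \<omega> u u = 0" "\<And>u. (\<And>v. \<omega> u v = 0) \<Longrightarrow> u = 0"
    using \<omega> by (auto simp: symplectic_form_def nondegenerate_def)
  note hb = flat_metricD(1)[OF h]
  obtain N and e f :: "nat \<Rightarrow> real^'n" and a where nf0: "(\<forall>i<N. e i \<in> UNIV \<and> f i \<in> UNIV \<and> a i > 0) \<and>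
    (\<forall>i<N. \<forall>j<N. h (e i) (e j) = of_bool (i = j) \<and> h (f i) (f j) = of_bool (i = j) \<and> h (e i) (f j) = 0 \<and>
       \<omega> (e i) (e j) = 0 \<and> \<omega> (f i) (f j) = 0 \<and> \<omega> (e i) (f j) = (if i = j then a i else 0)) \<and>
    (\<forall>w\<in>UNIV. (\<forall>i<N. h (e i) w = 0 \<and> h (f i) w = 0) \<longrightarrow> w = 0)"
  proof (atomize_elim, rule symplectic_splitting[OF h \<omega>'(1,2)])
    show "u = 0" if "\<And>v. v \<in> UNIV \<Longrightarrow> \<omega> u v = 0" for u using \<omega>'(3) that by blast
  qed auto
  note nf = nf0[THEN conjunct1, rule_format] nf0[THEN conjunct2, THEN conjunct1, rule_format]
      nf0[THEN conjunct2, THEN conjunct2, rule_format, OF UNIV_I]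
  define K where "K = {..<N} \<times> (UNIV :: bool set)"
  define B where "B k = (if snd k then e (fst k) else f (fst k))" for k :: "nat \<times> bool"
  have orth: "h (B k) (B l) = of_bool (k = l)" if "k \<in> K" "l \<in> K" for k l
    using that nf(2)[of "fst k" "fst l"] nf(2)[of "fst l" "fst k"] flat_metricD(2)[OF h, of "f (fst k)" "e (fst l)"]
    by (auto simp: K_def B_def prod_eq_iff)
  have complete: "w = 0" if "\<And>k. k \<in> K \<Longrightarrow> h (B k) w = 0" for w
    using nf(3)[of w] that[of "(_, True)"] that[of "(_, False)"] by (auto simp: K_def B_def)
  have fin: "finite K" by (simp add: K_def)
  have inj: "inj_on B K"
  proof (rule inj_onI)
    fix k l assume "k \<in> K" "l \<in> K" "B k = B l"
    then show "k = l" using orth[of k k] orth[of k l] by (simp split: if_splits)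
  qed
  have hsum: "h u (\<Sum>i\<in>I. c i *\<^sub>R g i) = (\<Sum>i\<in>I. c i * h u (g i))" for u c and g :: "nat \<times> bool \<Rightarrow> real^'n" and I
  proof -
    interpret linear "h u" using hb by (simp add: bilinear_def)
    show ?thesis by (simp add: sum scaleR)
  qed
  have "independent (B ` K)"
  proof (rule real_vector.independent_if_scalars_zero)
    show "finite (B ` K)" using fin by simp
    fix c x assume 0: "(\<Sum>x\<in>B ` K. c x *\<^sub>R x) = 0" and "x \<in> B ` K"
    then obtain k where k: "k \<in> K" "x = B k" by blast
    have "0 = h (B k) (\<Sum>l\<in>K. c (B l) *\<^sub>R B l)" using 0 by (simp add: sum.reindex[OF inj] bilinear_rzero[OF hb])
    also have "\<dots> = (\<Sum>l\<in>K. if k = l then c (B l) else 0)" unfolding hsum using orth k by (intro sum.cong) auto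
    also have "\<dots> = c x" using fin k by simp
    finally show "c x = 0" by simp
  qed
  moreover have "w \<in> span (B ` K)" for w
  proof -
    let ?w = "\<Sum>l\<in>K. h (B l) w *\<^sub>R B l"
    have "h (B k) (w - ?w) = 0" if "k \<in> K" for k
    proof -
      have "h (B k) ?w = (\<Sum>l\<in>K. if k = l then h (B l) w else 0)" unfolding hsum using orth that by (intro sum.cong) auto
      then show ?thesis using fin that by (simp add: bilinear_rsub[OF hb])
    qed
    then have "w = ?w" using complete[of "w - ?w"] by simp
    moreover have "?w \<in> span (B ` K)" by (intro span_sum span_scale span_base imageI)
    ultimately show ?thesis by simp
  qed
  then have "UNIV \<subseteq> span (B ` K)" by blast
  \<comment> \<open>Being a basis, the frame has as many members as there are coordinates, so the
    pairs in \<open>K\<close> can be indexed by coordinates.\<close>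
  ultimately have "card (B ` K) = dim (UNIV :: (real^'n) set)" by (intro basis_card_eq_dim) auto
  then have "card K = card (UNIV :: 'n set)" using inj by (simp add: card_image)
  then obtain \<phi> where \<phi>: "bij_betw \<phi> (UNIV :: 'n set) K"
    using finite_same_card_bij[of "UNIV :: 'n set" K] fin by auto
  define flip :: "nat \<times> bool \<Rightarrow> nat \<times> bool" where "flip k = (fst k, \<not> snd k)" for k
  define \<sigma> where "\<sigma> p = inv_into UNIV \<phi> (flip (\<phi> p))" for p
  have K: "\<phi> p \<in> K" for p using \<phi> by (auto simp: bij_betw_def)
  then have KN: "fst (\<phi> p) < N" for p by (metis K_def lessThan_iff mem_Times_iff)
  have "flip (\<phi> p) \<in> K" for p using K[of p] by (auto simp: flip_def K_def)
  then have \<phi>\<sigma>: "\<phi> (\<sigma> p) = flip (\<phi> p)" for p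
    unfolding \<sigma>_def using \<phi> by (intro f_inv_into_f) (auto simp: bij_betw_def)
  have inj\<phi>: "\<phi> p = \<phi> q \<longleftrightarrow> p = q" for p q using \<phi> by (auto simp: bij_betw_def inj_eq)
  have \<sigma>iff: "q = \<sigma> p \<longleftrightarrow> \<phi> q = flip (\<phi> p)" for p q using inj\<phi> \<phi>\<sigma> by metis
  show thesis
  proof (rule that[of "B \<circ> \<phi>" \<sigma> "\<lambda>p. if snd (\<phi> p) then 1 else - 1" "\<lambda>p. a (fst (\<phi> p))"])
    show "h ((B \<circ> \<phi>) p) ((B \<circ> \<phi>) q) = of_bool (p = q)" for p q using orth K inj\<phi> by simp
    show "\<sigma> (\<sigma> p) = p" for p using inj\<phi>[of "\<sigma> (\<sigma> p)" p] by (simp add: \<phi>\<sigma> flip_def)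
    show "\<omega> ((B \<circ> \<phi>) p) ((B \<circ> \<phi>) q) = (if q = \<sigma> p then (if snd (\<phi> p) then 1 else - 1) * a (fst (\<phi> p)) else 0)" for p q
      unfolding \<sigma>iff using nf(2)[of "fst (\<phi> p)" "fst (\<phi> q)"] nf(2)[of "fst (\<phi> q)" "fst (\<phi> p)"] KN[of p] KN[of q]
        alternating_skew[OF \<omega>'(1,2), of "f (fst (\<phi> p))" "e (fst (\<phi> q))"]
      by (auto simp: B_def flip_def prod_eq_iff)
  qed (use nf(1) KN in \<open>auto simp: \<phi>\<sigma> flip_def\<close>)
qed

lemma bilinear_gram:
  fixes B :: "real^'n \<Rightarrow> real^'n \<Rightarrow> real"
  assumes "bilinear B"
  shows "B x y = (\<Sum>p\<in>UNIV. \<Sum>q\<in>UNIV. x $ p * gram B $ p $ q * y $ q)"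
proof -
  interpret r: linear "B u" for u using assms by (simp add: bilinear_def)
  interpret l: linear "\<lambda>u. B u v" for v using assms by (simp add: bilinear_def)
  have e: "z = (\<Sum>p\<in>UNIV. (z $ p) *\<^sub>R axis p 1)" for z :: "real^'n"
    by (simp add: basis_expansion flip: scalar_mult_eq_scaleR)
  have "B x y = B (\<Sum>p\<in>UNIV. (x $ p) *\<^sub>R axis p 1) (\<Sum>p\<in>UNIV. (y $ p) *\<^sub>R axis p 1)"
    using e[of x] e[of y] by simp
  also have "\<dots> = (\<Sum>p\<in>UNIV. \<Sum>q\<in>UNIV. x $ p * gram B $ p $ q * y $ q)"
    by (subst sum.swap) (simp add: l.sum l.scaleR r.sum r.scaleR gram_def sum_distrib_left mult_ac)
  finally show ?thesis .
qed

definition column_matrix :: "('n \<Rightarrow> real^'n) \<Rightarrow> real^'n^'n" where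
  "column_matrix b = (\<chi> i p. b p $ i)"

lemma gram_column_matrix:
  assumes "bilinear B"
  shows "transpose (column_matrix b) ** gram B ** column_matrix b = (\<chi> p q. B (b p) (b q))"
proof -
  have "(transpose (column_matrix b) ** gram B ** column_matrix b) $ p $ q = B (b p) (b q)" for p q
  proof -
    have "(transpose (column_matrix b) ** gram B ** column_matrix b) $ p $ q =
       (\<Sum>j\<in>UNIV. \<Sum>i\<in>UNIV. b p $ i * gram B $ i $ j * b q $ j)"
      by (simp add: matrix_matrix_mult_def transpose_def column_matrix_def sum_distrib_right)
    also have "\<dots> = B (b p) (b q)" unfolding bilinear_gram[OF assms, of "b p" "b q"] by (rule sum.swap)
    finally show ?thesis .
  qed
  then show ?thesis by (simp add: vec_eq_iff)
qed

lemma matrix_diff_ldistrib: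
  fixes A :: "'a::ring_1^'n^'m" and B C :: "'a^'k^'n"
  shows "A ** (B - C) = A ** B - A ** C"
  by (simp add: vec_eq_iff matrix_matrix_mult_def right_diff_distrib sum_subtractf)

lemma matrix_diff_rdistrib:
  fixes A B :: "'a::ring_1^'n^'m" and C :: "'a^'k^'n"
  shows "(A - B) ** C = A ** C - B ** C"
  by (simp add: vec_eq_iff matrix_matrix_mult_def left_diff_distrib sum_subtractf)

lemma matrix_add_rdistrib':
  fixes A B :: "'a::semiring_1^'n^'m" and C :: "'a^'k^'n"
  shows "(A + B) ** C = A ** C + B ** C"
  by (simp add: vec_eq_iff matrix_matrix_mult_def distrib_right sum.distrib)

lemma matrix_inv_eqI:
  fixes A :: "real^'n^'n"
  assumes "A ** X = mat 1"
  shows "matrix_inv A = X"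
proof -
  have "invertible A" using assms matrix_left_right_inverse unfolding invertible_def by blast
  then have "matrix_inv A ** A = mat 1" unfolding invertible_def matrix_inv_def
    by (metis (mono_tags, lifting) someI_ex)
  then have "matrix_inv A = matrix_inv A ** (A ** X)" using assms by simp
  also have "\<dots> = X" using \<open>matrix_inv A ** A = mat 1\<close> by (simp add: matrix_mul_assoc)
  finally show ?thesis .
qed

locale symplectic_frame =
  fixes h \<omega> :: "real^'n \<Rightarrow> real^'n \<Rightarrow> real" and b :: "'n \<Rightarrow> real^'n" and \<sigma> :: "'n \<Rightarrow> 'n" and s a :: "'n \<Rightarrow> real"
  assumes h: "flat_metric h" and \<omega>: "symplectic_form \<omega>"
    and orth: "\<And>p q. h (b p) (b q) = of_bool (p = q)" and \<sigma>: "\<And>p. \<sigma> (\<sigma> p) = p"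
    and s: "\<And>p. s p = 1 \<or> s p = - 1" "\<And>p. s (\<sigma> p) = - s p"
    and a: "\<And>p. a p > 0" "\<And>p. a (\<sigma> p) = a p"
    and \<omega>b: "\<And>p q. \<omega> (b p) (b q) = (if q = \<sigma> p then s p * a p else 0)"
begin

lemma column_matrix_orthonormal:
  "transpose (column_matrix b) ** gram h ** column_matrix b = mat 1"
  unfolding gram_column_matrix[OF flat_metricD(1)[OF h]] by (simp add: orth mat_def of_bool_def)

lemma matrix_inv_gram: "matrix_inv (gram h) = column_matrix b ** transpose (column_matrix b)"
proof (rule matrix_inv_eqI)
  have "transpose (column_matrix b) ** (gram h ** column_matrix b) = mat 1"
    using column_matrix_orthonormal by (simp add: matrix_mul_assoc)
  then show "gram h ** (column_matrix b ** transpose (column_matrix b)) = mat 1"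
    using matrix_left_right_inverse by (metis matrix_mul_assoc)
qed

lemma orthonormal_expansion: "x = (\<Sum>p\<in>UNIV. h (b p) x *\<^sub>R b p)"
proof -
  have "x = (column_matrix b ** transpose (column_matrix b) ** gram h) *v x"
    using column_matrix_orthonormal matrix_left_right_inverse by (metis matrix_mul_assoc matrix_vector_mul_lid)
  also have "\<dots> = column_matrix b *v (transpose (column_matrix b) *v (gram h *v x))"
    by (simp add: matrix_vector_mul_assoc matrix_mul_assoc)
  also have "(transpose (column_matrix b) *v (gram h *v x)) = (\<chi> p. h (b p) x)"
    unfolding bilinear_gram[OF flat_metricD(1)[OF h], of "b _" x]
    by (simp add: vec_eq_iff matrix_vector_mult_def transpose_def column_matrix_def sum_distrib_left mult_ac)
  finally show ?thesis
    by (simp add: vec_eq_iff matrix_vector_mult_def column_matrix_def sum_component mult.commute)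
qed

definition freq_modes :: "'n set" where "freq_modes = {p. s p = 1}"

lemma s_sq: "s p * s p = 1" "s p * (s p * x) = x" "x * s p * s p = x"
  using s(1)[of p] by auto

lemma a_neq: "a p \<noteq> 0" "sqrt (a p) * sqrt (a p) = a p" "\<bar>a p\<bar> = a p"
  using a(1)[of p] by auto

lemma \<sigma>_neq: "\<sigma> p \<noteq> p"
  using s[of p] by fastforce

text \<open>\<open>freq_modes\<close> contains exactly one index of each pair
  \<open>{p, \<sigma> p}\<close>.\<close>

lemma sum_modes:
  fixes g :: "'n \<Rightarrow> 'c::comm_monoid_add"
  assumes "\<And>p. g (\<sigma> p) = g p"
  shows "(\<Sum>p\<in>UNIV. g p) = (\<Sum>p\<in>freq_modes. g p) + (\<Sum>p\<in>freq_modes. g p)"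
proof -
  have inj: "inj_on \<sigma> freq_modes" using \<sigma> by (metis inj_onI)
  have "p \<in> freq_modes \<union> \<sigma> ` freq_modes" for p
  proof (cases "s p = 1")
    case False
    then have "\<sigma> p \<in> freq_modes" using s[of p] by (auto simp: freq_modes_def)
    then show ?thesis using \<sigma>[of p] by (metis UnI2 imageI)
  qed (simp add: freq_modes_def)
  then have "UNIV = freq_modes \<union> \<sigma> ` freq_modes" by blast
  moreover have "freq_modes \<inter> \<sigma> ` freq_modes = {}"
    using s(2) by (fastforce simp: freq_modes_def)
  ultimately have "(\<Sum>p\<in>UNIV. g p) = (\<Sum>p\<in>freq_modes. g p) + (\<Sum>p\<in>\<sigma> ` freq_modes. g p)"
    by (metis finite_class.finite sum.union_disjoint)
  then show ?thesis using assms by (simp add: sum.reindex[OF inj] o_def)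
qed

text \<open>\<open>h\<^sup>-\<^sup>1 \<omega>\<close> is similar to the matrix \<open>N\<close> of
  \<omega> in the orthonormal frame. As \<open>N\<close> is skew, \<open>X - N\<close> and
  \<open>X + N\<close> have the same determinant, and their product is diagonal with entries
  \<open>X\<^sup>2 + a_p\<^sup>2\<close>. So the square of the characteristic polynomial is known,
  and no block form is needed.\<close>

lemma eigenvalue_spectrum_frequencies:
  "eigenvalue_spectrum (matrix_inv (gram h) ** gram \<omega>) =
    (\<Sum>p\<in>freq_modes. {#\<i> * complex_of_real (a p), - \<i> * complex_of_real (a p)#})"
proof -
  define B where "B = column_matrix b"
  define N :: "real^'n^'n" where "N = (\<chi> p q. if q = \<sigma> p then s p * a p else 0)"
  define M where "M = matrix_inv (gram h) ** gram \<omega>"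
  define cm :: "real^'n^'n \<Rightarrow> complex poly^'n^'n" where "cm A = (\<chi> p q. [:complex_of_real (A $ p $ q):])" for A
  have cp: "charpoly A = det (mat [:0, 1:] - cm A)" for A
    unfolding charpoly_def cm_def by (rule arg_cong[of _ _ det]) (simp add: vec_eq_iff mat_def)
  have sumC: "(\<Sum>i\<in>I. [:f i:]) = [:\<Sum>i\<in>I. f i:]" for f :: "'n \<Rightarrow> complex" and I
    by (induction I rule: infinite_finite_induct) auto
  have cm_mult: "cm (A ** C) = cm A ** cm C" for A C
    by (simp add: cm_def vec_eq_iff matrix_matrix_mult_def sumC mult.commute)
  have cm1: "cm (mat 1) = mat 1" by (simp add: cm_def vec_eq_iff mat_def one_pCons)
  have matX: "mat k ** A = A ** mat k" for k and A :: "complex poly^'n^'n"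
    by (simp add: vec_eq_iff matrix_matrix_mult_def mat_def if_distrib if_distribR mult.commute cong: if_cong)
  have \<omega>bl: "bilinear \<omega>" using \<omega> by (simp add: symplectic_form_def)
  have N: "transpose B ** gram \<omega> ** B = N"
    unfolding B_def gram_column_matrix[OF \<omega>bl] N_def by (simp add: \<omega>b)
  have B1: "B ** (transpose B ** gram h) = mat 1"
    using column_matrix_orthonormal matrix_left_right_inverse unfolding B_def by (metis matrix_mul_assoc)
  have "M ** B = B ** N"
    unfolding M_def matrix_inv_gram N[symmetric] B_def by (simp add: matrix_mul_assoc)
  then have "(mat [:0, 1:] - cm M) ** cm B = cm B ** (mat [:0, 1:] - cm N)"
    using matX by (simp add: matrix_diff_ldistrib matrix_diff_rdistrib flip: cm_mult)
  then have "det (mat [:0, 1:] - cm M) * det (cm B) = det (cm B) * det (mat [:0, 1:] - cm N)"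
    by (metis det_mul)
  moreover have "det (cm B) * det (cm (transpose B ** gram h)) = 1"
    by (simp add: B1 cm1 flip: det_mul cm_mult)
  then have "det (cm B) \<noteq> 0" by auto
  ultimately have MN: "charpoly M = charpoly N" unfolding cp by (simp add: mult.commute)
  have cN: "cm N $ p $ q = (if q = \<sigma> p then [:complex_of_real (s p * a p):] else 0)" for p q
    by (simp add: cm_def N_def)
  have "transpose (mat [:0, 1:] - cm N) = mat [:0, 1:] + cm N"
    by (auto simp: vec_eq_iff transpose_def mat_def cN s a \<sigma>)
  then have cN2: "charpoly N = det (mat [:0, 1:] + cm N)" unfolding cp using det_transpose by metis
  have "(mat [:0, 1:] - cm N) ** (mat [:0, 1:] + cm N) =
    (\<chi> p q. if p = q then [:complex_of_real ((a p)\<^sup>2), 0, 1:] else 0)" (is "?L = ?R")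
  proof -
    have "?L $ p $ q = ?R $ p $ q" for p q
    proof -
      have "?L $ p $ q = (\<Sum>r\<in>UNIV. ((if p = r then [:0, 1:] else 0) - (if r = \<sigma> p then [:complex_of_real (s p * a p):] else 0))
         * (mat [:0, 1:] + cm N) $ r $ q)"
        by (simp add: matrix_matrix_mult_def mat_def cN)
      also have "\<dots> = [:0, 1:] * (mat [:0, 1:] + cm N) $ p $ q - [:complex_of_real (s p * a p):] * (mat [:0, 1:] + cm N) $ \<sigma> p $ q"
        by (simp add: left_diff_distrib sum_subtractf if_distrib[of "\<lambda>x. x * _"] cong: if_cong)
      also have "\<dots> = ?R $ p $ q"
        using \<sigma>_neq[of p] by (auto simp: mat_def cN \<sigma> s a power2_eq_square s_sq mult_ac simp flip: of_real_mult)
      finally show ?thesis .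
    qed
    then show ?thesis by (simp add: vec_eq_iff)
  qed
  then have "charpoly N * charpoly N = det ?R"
    by (metis cp cN2 det_mul)
  also have "\<dots> = (\<Prod>p\<in>UNIV. [:complex_of_real ((a p)\<^sup>2), 0, 1:])"
    by (subst det_diagonal) auto
  also have "\<dots> = (\<Prod>p\<in>UNIV. [:- \<i> * complex_of_real (a p), 1:] * [:\<i> * complex_of_real (a p), 1:])"
    by (intro prod.cong) (auto simp: power2_eq_square complex_eq_iff)
  finally have sq: "charpoly N * charpoly N = \<dots>" .
  moreover have "(\<Prod>p\<in>UNIV. [:- \<i> * complex_of_real (a p), 1:] * [:\<i> * complex_of_real (a p), 1:]) \<noteq> 0"
    by (subst prod_zero_iff) auto
  ultimately have "charpoly N \<noteq> 0" by auto
  then have "proots (charpoly N) + proots (charpoly N) = proots (charpoly N * charpoly N)"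
    by (simp add: proots_mult)
  also have "\<dots> = (\<Sum>p\<in>UNIV. proots ([:- \<i> * complex_of_real (a p), 1:] * [:\<i> * complex_of_real (a p), 1:]))"
    unfolding sq by (subst proots_prod) auto
  also have "\<dots> = (\<Sum>p\<in>UNIV. {#\<i> * complex_of_real (a p), - \<i> * complex_of_real (a p)#})"
    by (intro sum.cong refl) (subst proots_mult, auto)
  also have "\<dots> = (\<Sum>p\<in>freq_modes. {#\<i> * complex_of_real (a p), - \<i> * complex_of_real (a p)#}) +
     (\<Sum>p\<in>freq_modes. {#\<i> * complex_of_real (a p), - \<i> * complex_of_real (a p)#})"
    by (rule sum_modes) (simp add: a)
  finally have two: "proots (charpoly N) + proots (charpoly N) = \<dots>" .
  \<comment> \<open>A multiset is determined by its double; this extracts the roots of the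
    polynomial from those of its square.\<close>
  have cancel: "X = Y" if "X + X = Y + Y" for X Y :: "complex multiset"
  proof (rule multiset_eqI)
    fix x show "count X x = count Y x" using arg_cong[OF that, of "\<lambda>Z. count Z x"] by simp
  qed
  show ?thesis unfolding eigenvalue_spectrum_def M_def[symmetric] MN by (rule cancel[OF two])
qed

text \<open>The rescaling turns the coefficients \<open>a_p\<close> of \<omega> into 1. In these
  coordinates the frequencies vanish from the Gaussian integral, and only the volume of \<omega> is
  left.\<close>

definition scaled_basis :: "'n \<Rightarrow> real^'n" where "scaled_basis p = (1 / sqrt (a p)) *\<^sub>R b p"

text \<open>In the scaled basis \<omega> has the matrix \<open>J\<close> of a complex structure.
  Orthogonality gives \<open>det J\<close> up to sign, and the sign is settled without ordering the
  basis.\<close>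

lemma det_scaled_basis: "(det (column_matrix scaled_basis))\<^sup>2 * det (gram \<omega>) = 1"
proof -
  define T where "T = column_matrix scaled_basis"
  define J :: "real^'n^'n" where "J = (\<chi> p q. if q = \<sigma> p then s p else 0)"
  have \<omega>bl: "bilinear \<omega>" using \<omega> by (simp add: symplectic_form_def)
  have TJ: "transpose T ** gram \<omega> ** T = J"
    unfolding T_def gram_column_matrix[OF \<omega>bl] J_def scaled_basis_def
    using a(1) by (auto simp: vec_eq_iff \<omega>b bilinear_lmul[OF \<omega>bl] bilinear_rmul[OF \<omega>bl] a(2) a_neq)
  have JJ: "J ** J = - mat 1"
    by (auto simp: vec_eq_iff matrix_matrix_mult_def J_def mat_def if_distrib[of "\<lambda>x. x * _"] \<sigma> s s_sq cong: if_cong)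
  have "transpose J = - J"
    by (auto simp: vec_eq_iff transpose_def J_def \<sigma> s)
  then have "det J = det (- J)" using det_transpose by metis
  have "J ** transpose J = mat 1"
    using matrix_diff_ldistrib[of J 0 J] JJ by (simp add: \<open>transpose J = - J\<close>)
  then have "det J * det J = 1" by (metis det_I det_mul det_transpose)
  \<comment> \<open>From \<open>J ** J = - 1\<close> follows \<open>(1 + J)\<^sup>2 = 2 J\<close>,
    so \<open>det J\<close> is a square divided by a power of 2.\<close>
  moreover have "det J \<ge> 0"
  proof -
    have "(mat 1 + J) ** (mat 1 + J) = mat 2 ** J"
    proof -
      have "mat 2 ** J = J + J" by (auto simp: vec_eq_iff matrix_matrix_mult_def mat_def if_distrib[of "\<lambda>x. x * _"] cong: if_cong)
      then show ?thesis by (simp add: matrix_add_ldistrib matrix_add_rdistrib' JJ)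
    qed
    then have "det (mat 1 + J) * det (mat 1 + J) = det (mat 2 :: real^'n^'n) * det J" by (metis det_mul)
    moreover have "det (mat 2 :: real^'n^'n) = 2 ^ CARD('n)"
      by (subst det_diagonal) (auto simp: mat_def)
    ultimately have "2 ^ CARD('n) * det J \<ge> 0" by (metis zero_le_square)
    then show ?thesis using mult_le_cancel_left_pos[of "2 ^ CARD('n)" 0 "det J"] by simp
  qed
  ultimately have "det J = 1" by (metis abs_of_nonneg real_sqrt_abs2 real_sqrt_one)
  then show ?thesis using arg_cong[OF TJ, of det]
    by (simp add: det_mul det_transpose power2_eq_square mult_ac T_def)
qed

text \<open>It sends \<open>b p\<close> to \<open>s p\<close> times its partner. Up to sign this is
  the orthogonal factor in the polar decomposition of \<open>h\<^sup>-\<^sup>1 \<omega>\<close>, so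
  that \<omega> becomes a positive definite symmetric form once its second argument is
  rotated.\<close>

definition complex_structure :: "real^'n \<Rightarrow> real^'n" where
  "complex_structure x = (\<Sum>p\<in>UNIV. (h (b p) x * s p) *\<^sub>R b (\<sigma> p))"

lemma linear_complex_structure: "linear complex_structure"
proof -
  have hb: "bilinear h" using flat_metricD(1)[OF h] .
  show ?thesis unfolding complex_structure_def
    by (intro linear_compose_sum ballI linearI)
      (auto simp: bilinear_radd[OF hb] bilinear_rmul[OF hb] algebra_simps scaleR_add_left)
qed

lemma complex_structure_basis: "complex_structure (b q) = s q *\<^sub>R b (\<sigma> q)"
  by (simp add: complex_structure_def orth of_bool_def if_distrib[of "\<lambda>x. x * _"] if_distrib[of "\<lambda>x. x *\<^sub>R _"] cong: if_cong)

lemma complex_structure_square: "complex_structure (complex_structure x) = - x"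
proof -
  interpret J: linear complex_structure by (rule linear_complex_structure)
  have "complex_structure (complex_structure x) = complex_structure (complex_structure (\<Sum>p\<in>UNIV. h (b p) x *\<^sub>R b p))"
    using orthonormal_expansion by metis
  also have "\<dots> = (\<Sum>p\<in>UNIV. - (h (b p) x *\<^sub>R b p))"
    by (simp add: J.sum J.scaleR complex_structure_basis \<sigma> s s_sq)
  also have "\<dots> = - x" using orthonormal_expansion[of x] by (simp add: sum_negf)
  finally show ?thesis .
qed

lemma \<omega>_complex_structure:
  "\<omega> x (complex_structure y) = (\<Sum>p\<in>UNIV. a p * (h (b p) x * h (b p) y))"
proof -
  have bl: "bilinear \<omega>" using \<omega> by (simp add: symplectic_form_def)
  interpret J: linear complex_structure by (rule linear_complex_structure)
  interpret r: linear "\<omega> u" for u using bl by (simp add: bilinear_def)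
  interpret l: linear "\<lambda>u. \<omega> u v" for v using bl by (simp add: bilinear_def)
  have \<sigma>inj: "\<sigma> p = \<sigma> q \<longleftrightarrow> p = q" for p q using \<sigma> by metis
  have \<omega>J: "\<omega> (b p) (complex_structure (b q)) = (if p = q then a p else 0)" for p q
    by (simp add: complex_structure_basis r.scaleR \<omega>b \<sigma>inj s_sq)
  have "\<omega> x (complex_structure y) = \<omega> (\<Sum>p\<in>UNIV. h (b p) x *\<^sub>R b p) (complex_structure (\<Sum>p\<in>UNIV. h (b p) y *\<^sub>R b p))"
    using orthonormal_expansion by metis
  also have "\<dots> = (\<Sum>q\<in>UNIV. \<Sum>p\<in>UNIV. h (b q) y * (h (b p) x * \<omega> (b p) (complex_structure (b q))))"
    by (simp add: J.sum J.scaleR r.sum r.scaleR l.sum l.scaleR sum_distrib_left)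
  finally show ?thesis
    by (simp add: \<omega>J if_distrib[of "\<lambda>x. _ * x"] mult_ac cong: if_cong)
qed

lemma scaled_basis_isometry:
  "\<omega> (column_matrix scaled_basis *v z) (complex_structure (column_matrix scaled_basis *v w)) = z \<bullet> w"
proof -
  have hb: "bilinear h" using flat_metricD(1)[OF h] .
  interpret r: linear "h u" for u using hb by (simp add: bilinear_def)
  have e: "column_matrix scaled_basis *v z = (\<Sum>p\<in>UNIV. (z $ p / sqrt (a p)) *\<^sub>R b p)" for z
    by (simp add: vec_eq_iff matrix_vector_mult_def column_matrix_def scaled_basis_def sum_component mult.commute)
  have "h (b p) (column_matrix scaled_basis *v z) = z $ p / sqrt (a p)" for p z
    unfolding e by (simp add: r.sum r.scaleR orth of_bool_def if_distrib[of "\<lambda>x. _ * x"] cong: if_cong)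
  moreover have "a p * (u / sqrt (a p) * (v / sqrt (a p))) = u * v" for p u v
    using a_neq[of p] by (simp add: times_divide_times_eq)
  ultimately show ?thesis unfolding \<omega>_complex_structure by (simp add: inner_vec_def)
qed

end

section \<open>Linear changes of variables\<close>

text \<open>Stated with preimages so that it describes the image of Lebesgue measure under
  \<open>A\<close>; the factor is therefore the reciprocal of the absolute determinant.\<close>

definition lborel_scaling :: "real^'n^'n \<Rightarrow> real \<Rightarrow> bool" where
  "lborel_scaling A c \<longleftrightarrow> c > 0 \<and>
     (\<forall>S\<in>sets borel. emeasure lborel ((*v) A -` S) = ennreal c * emeasure lborel S)"

lemma borel_measurable_matrix [measurable]: "(*v) (A::real^'n^'n) \<in> borel_measurable borel"
  by (intro borel_measurable_continuous_onI linear_continuous_on)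
    (simp add: linear_linear matrix_vector_mul_linear)

lemma nn_integral_lborel_shift:
  fixes t :: "'a::euclidean_space"
  assumes [measurable]: "f \<in> borel_measurable borel"
  shows "(\<integral>\<^sup>+x. f (t + x) \<partial>lborel) = (\<integral>\<^sup>+x. f x \<partial>lborel)"
  by (subst (2) lborel_distr_plus[symmetric, of t]) (simp add: nn_integral_distr)

lemma unit_box_measure:
  "emeasure lborel (cbox (- One) One :: (real^'n) set) = ennreal (2 ^ CARD('n))"
  "emeasure lborel (box (- One) One :: (real^'n) set) = ennreal (2 ^ CARD('n))"
proof -
  have "(One - (- One)) \<bullet> b = 2" if "b \<in> Basis" for b :: "real^'n"
  proof -
    have "(One - (- One)) \<bullet> b = One \<bullet> b + One \<bullet> b"
      by (simp only: inner_add_left diff_minus_eq_add)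
    then show ?thesis using that by simp
  qed
  then have "(\<Prod>b\<in>(Basis :: (real^'n) set). (One - (- One)) \<bullet> b) = (\<Prod>b\<in>(Basis :: (real^'n) set). 2)"
    by (intro prod.cong refl)
  then show "emeasure lborel (cbox (- One) One :: (real^'n) set) = ennreal (2 ^ CARD('n))"
    "emeasure lborel (box (- One) One :: (real^'n) set) = ennreal (2 ^ CARD('n))"
    by (simp_all add: emeasure_lborel_cbox_eq emeasure_lborel_box_eq inner_simps)
qed

text \<open>Uniqueness of Haar measure, by Fubini applied to the indicator of
  \<open>{(x, y). A x + y \<in> S \<and> y \<in> B}\<close> for a box \<open>B\<close>.\<close>

lemma lborel_scaling_exists:
  fixes A :: "real^'n^'n"
  assumes "det A \<noteq> 0"
  obtains c where "lborel_scaling A c"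
proof -
  obtain A' where A': "A ** A' = mat 1" "A' ** A = mat 1"
    using assms invertible_det_nz unfolding invertible_def by blast
  then have AA': "A *v (A' *v y) = y" "A' *v (A *v y) = y" for y
    by (simp_all add: matrix_vector_mul_assoc)
  define B :: "(real^'n) set" where "B = box (- One) One"
  have [measurable]: "B \<in> sets borel" by (simp add: B_def)
  have lB: "emeasure lborel B = ennreal (2 ^ CARD('n))"
    unfolding B_def by (rule unit_box_measure)
  \<comment> \<open>The measure of the points that \<open>A\<close> sends into the reflected box;
    divided by the measure of \<open>B\<close> it is the factor sought.\<close>
  define K where "K = (\<integral>\<^sup>+x. indicator B (- (A *v x)) \<partial>lborel)"
  have eq: "emeasure lborel B * emeasure lborel ((*v) A -` S) = emeasure lborel S * K"
    if [measurable]: "S \<in> sets borel" for S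
  proof -
    have [measurable]: "(*v) A -` S \<in> sets borel"
      using measurable_sets[OF borel_measurable_matrix that, of A] by simp
    have "emeasure lborel B * emeasure lborel ((*v) A -` S) =
        (\<integral>\<^sup>+y. indicator B y * (\<integral>\<^sup>+x. indicator S (A *v x) \<partial>lborel) \<partial>lborel)"
      by (simp add: nn_integral_multc flip: nn_integral_indicator) (simp add: indicator_def)
    also have "\<dots> = (\<integral>\<^sup>+y. \<integral>\<^sup>+x. indicator B y * indicator S (A *v x + y) \<partial>lborel \<partial>lborel)"
    proof (rule nn_integral_cong)
      fix y
      have "(\<integral>\<^sup>+x. indicator S (A *v x) \<partial>lborel) = (\<integral>\<^sup>+x. indicator S (A *v (A' *v y + x)) \<partial>lborel)"
        by (subst nn_integral_lborel_shift) auto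
      also have "\<dots> = (\<integral>\<^sup>+x. indicator S (A *v x + y) \<partial>lborel)"
        by (simp add: matrix_vector_right_distrib AA' add.commute)
      finally show "indicator B y * (\<integral>\<^sup>+x. indicator S (A *v x) \<partial>lborel) =
          (\<integral>\<^sup>+x. indicator B y * indicator S (A *v x + y) \<partial>lborel)"
        by (simp add: nn_integral_cmult)
    qed
    also have "\<dots> = (\<integral>\<^sup>+x. \<integral>\<^sup>+y. indicator B y * indicator S (A *v x + y) \<partial>lborel \<partial>lborel)"
      by (rule lborel_pair.Fubini') measurable
    also have "\<dots> = (\<integral>\<^sup>+x. \<integral>\<^sup>+y. indicator B (y - A *v x) * indicator S y \<partial>lborel \<partial>lborel)"
    proof (rule nn_integral_cong)
      fix x :: "real^'n"
      show "(\<integral>\<^sup>+y. indicator B y * indicator S (A *v x + y) \<partial>lborel) =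
          (\<integral>\<^sup>+y. indicator B (y - A *v x) * indicator S y \<partial>lborel)"
        using nn_integral_lborel_shift[of "\<lambda>y. indicator B (y - A *v x) * indicator S y" "A *v x"] by simp
    qed
    also have "\<dots> = (\<integral>\<^sup>+y. \<integral>\<^sup>+x. indicator B (y - A *v x) * indicator S y \<partial>lborel \<partial>lborel)"
      by (rule lborel_pair.Fubini'[symmetric]) measurable
    also have "\<dots> = (\<integral>\<^sup>+y. indicator S y * K \<partial>lborel)"
    proof (rule nn_integral_cong)
      fix y
      have "K = (\<integral>\<^sup>+x. indicator B (- (A *v (- (A' *v y) + x))) \<partial>lborel)"
        unfolding K_def by (subst nn_integral_lborel_shift) auto
      also have "\<dots> = (\<integral>\<^sup>+x. indicator B (y - A *v x) \<partial>lborel)"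
        using matrix_vector_mult_diff_distrib[of A _ "A' *v y"]
        by (simp add: AA' uminus_add_conv_diff)
      finally show "(\<integral>\<^sup>+x. indicator B (y - A *v x) * indicator S y \<partial>lborel) = indicator S y * K"
        by (subst nn_integral_multc) (auto simp: mult.commute)
    qed
    finally show ?thesis by (simp add: nn_integral_multc)
  qed
  have "K < \<infinity>"
  proof -
    have "bounded ((*v) A' ` ((\<lambda>x. - x) ` B))"
      by (intro bounded_linear_image bounded_uminus)
        (auto simp: B_def matrix_vector_mul_bounded_linear image_image intro!: bounded_subset[OF bounded_cbox box_subset_cbox] bounded_linear_image bounded_linear_minus bounded_linear_ident)
    then obtain r where r: "(*v) A' ` ((\<lambda>x. - x) ` B) \<subseteq> ball 0 r" using bounded_subset_ballD by metis
    have "K \<le> (\<integral>\<^sup>+x. indicator (ball (0::real^'n) r) x \<partial>lborel)"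
      unfolding K_def
    proof (intro nn_integral_mono)
      fix x
      have "x \<in> ball 0 r" if "- (A *v x) \<in> B"
      proof -
        have "A' *v (- (- (A *v x))) \<in> ball 0 r" using r that by blast
        then show ?thesis by (simp add: AA')
      qed
      then show "indicator B (- (A *v x)) \<le> (indicator (ball 0 r) x :: ennreal)"
        by (auto simp: indicator_def)
    qed
    then show ?thesis using emeasure_lborel_ball_finite[of "0::real^'n" r] by (simp add: order_le_less_trans)
  qed
  then obtain k where k: "K = ennreal k" "k \<ge> 0" by (cases K) auto
  \<comment> \<open>For the whole space the left side of \<open>eq\<close> is infinite, which rules
    out the factor 0.\<close>
  have "k \<noteq> 0"
    using eq[of UNIV] k lB by auto
  define c where "c = k / 2 ^ CARD('n)"
  have "emeasure lborel ((*v) A -` S) = ennreal c * emeasure lborel S" if S: "S \<in> sets borel" for S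
  proof -
    have "ennreal (2 ^ CARD('n)) * emeasure lborel ((*v) A -` S) = emeasure lborel S * ennreal k"
      using eq[OF S] lB k by simp
    then have "ennreal (1 / 2 ^ CARD('n)) * (ennreal (2 ^ CARD('n)) * emeasure lborel ((*v) A -` S)) =
       ennreal (1 / 2 ^ CARD('n)) * (emeasure lborel S * ennreal k)" by simp
    moreover have "ennreal (1 / 2 ^ CARD('n)) * (ennreal (2 ^ CARD('n)) * x) = x" for x
      by (subst mult.assoc[symmetric], subst ennreal_mult[symmetric]) auto
    moreover have "ennreal (1 / 2 ^ CARD('n)) * (emeasure lborel S * ennreal k) = ennreal c * emeasure lborel S"
      unfolding c_def using k by (subst mult.left_commute, subst ennreal_mult[symmetric]) (auto simp: mult.commute)
    ultimately show ?thesis by simp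
  qed
  moreover have "c > 0" using k \<open>k \<noteq> 0\<close> by (simp add: c_def)
  ultimately show thesis using that unfolding lborel_scaling_def by blast
qed

text \<open>One set of positive finite measure already fixes the factor. A set that \<open>A\<close>
  leaves invariant thus gives the factor 1 without any determinant.\<close>

lemma lborel_scaling_eqI:
  fixes A :: "real^'n^'n"
  assumes "lborel_scaling A c" "S \<in> sets borel" "emeasure lborel ((*v) A -` S) = ennreal d * emeasure lborel S"
    "emeasure lborel S \<noteq> 0" "emeasure lborel S \<noteq> \<infinity>" "d \<ge> 0"
  shows "c = d"
proof -
  have "ennreal c * emeasure lborel S = ennreal d * emeasure lborel S"
    using assms unfolding lborel_scaling_def by simp
  moreover obtain k where "emeasure lborel S = ennreal k" "k > 0"
    using assms(4,5) by (cases "emeasure lborel S") (auto simp: less_le)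
  ultimately show ?thesis
    using assms(1,6) by (auto simp: lborel_scaling_def simp flip: ennreal_mult)
qed

lemma lborel_scaling_mult:
  assumes "lborel_scaling A c" "lborel_scaling B d"
  shows "lborel_scaling (A ** B) (c * d)"
proof -
  have "emeasure lborel ((*v) (A ** B) -` S) = ennreal (c * d) * emeasure lborel S" if S: "S \<in> sets borel" for S
  proof -
    have "(*v) (A ** B) -` S = (*v) B -` ((*v) A -` S)" by (auto simp: matrix_vector_mul_assoc)
    moreover have "(*v) A -` S \<in> sets borel" using measurable_sets[OF borel_measurable_matrix S, of A] by simp
    ultimately show ?thesis using assms S by (simp add: lborel_scaling_def ennreal_mult mult_ac)
  qed
  then show ?thesis using assms by (simp add: lborel_scaling_def)
qed

lemma lborel_scaling_unique:
  assumes "lborel_scaling A c" "lborel_scaling A d"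
  shows "c = d"
  by (rule lborel_scaling_eqI[OF assms(1), of "cbox (- One) One"])
    (use assms(2) in \<open>auto simp: lborel_scaling_def unit_box_measure\<close>)

lemma lborel_scaling_one: "lborel_scaling (mat 1) 1"
  by (simp add: lborel_scaling_def vimage_def)

lemma lborel_scaling_diagonal:
  fixes A :: "real^'n^'n"
  assumes "\<And>i j. i \<noteq> j \<Longrightarrow> A $ i $ j = 0" "det A \<noteq> 0"
  shows "lborel_scaling A (1 / \<bar>det A\<bar>)"
proof -
  have det: "det A = (\<Prod>i\<in>UNIV. A $ i $ i)" using assms(1) by (rule det_diagonal)
  define c where "c j = (A *v j) \<bullet> j" for j
  have cA: "c (axis i 1) = A $ i $ i" for i
    by (simp add: c_def inner_axis matrix_vector_mul_component matrix_vector_mult_basis column_def)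
  have B: "Basis = range (\<lambda>i::'n. axis i (1::real))" by (auto simp: Basis_vec_def)
  have inj: "inj (\<lambda>i::'n. axis i (1::real))" by (auto simp: inj_on_def axis_eq_axis)
  have T: "(*v) A = (\<lambda>x. 0 + (\<Sum>j\<in>Basis. (c j * (x \<bullet> j)) *\<^sub>R j))"
  proof
    fix x
    have "(\<Sum>j\<in>Basis. (c j * (x \<bullet> j)) *\<^sub>R j) = (\<Sum>k\<in>UNIV. (A $ k $ k * x $ k) *\<^sub>R axis k 1)"
      by (simp add: B sum.reindex[OF inj] cA inner_axis)
    then have "(\<Sum>j\<in>Basis. (c j * (x \<bullet> j)) *\<^sub>R j) $ i = A $ i $ i * x $ i" for i
      by (simp add: sum_component axis_def if_distrib[of "\<lambda>y. _ * y"] cong: if_cong)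
    moreover have "(A *v x) $ i = A $ i $ i * x $ i" for i
    proof -
      have "(A *v x) $ i = (\<Sum>j\<in>UNIV. if i = j then A $ i $ i * x $ i else 0)"
        unfolding matrix_vector_mult_def vec_lambda_beta using assms(1) by (intro sum.cong) auto
      then show ?thesis by simp
    qed
    ultimately show "A *v x = 0 + (\<Sum>j\<in>Basis. (c j * (x \<bullet> j)) *\<^sub>R j)" by (simp add: vec_eq_iff)
  qed
  have c0: "c j \<noteq> 0" if "j \<in> Basis" for j using that assms(2) unfolding B det by (auto simp: cA)
  have P: "(\<Prod>j\<in>Basis. \<bar>c j\<bar>) = \<bar>det A\<bar>" by (simp add: B prod.reindex[OF inj] cA det abs_prod)
  have L: "lborel = density (distr lborel borel ((*v) A)) (\<lambda>_. ennreal \<bar>det A\<bar>)"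
    unfolding T P[symmetric] using c0 by (rule lborel_affine_euclidean)
  have "emeasure lborel ((*v) A -` S) = ennreal (1 / \<bar>det A\<bar>) * emeasure lborel S" if S: "S \<in> sets borel" for S
  proof -
    have "emeasure lborel S = ennreal \<bar>det A\<bar> * emeasure lborel ((*v) A -` S)"
      by (subst L) (use S in \<open>simp add: emeasure_density_const emeasure_distr\<close>)
    then show ?thesis using assms(2) by (simp add: mult.assoc[symmetric] flip: ennreal_mult)
  qed
  then show ?thesis using assms(2) by (simp add: lborel_scaling_def)
qed

text \<open>Both the factor and the determinant are multiplicative, so elementary matrices suffice.
  A zero row makes the claim vacuous, a coordinate swap preserves the cube, and a shear is handled
  algebraically.\<close>

theorem lborel_scaling_det:
  fixes A :: "real^'n^'n"
  assumes "det A \<noteq> 0"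
  shows "lborel_scaling A (1 / \<bar>det A\<bar>)"
proof -
  have "det A \<noteq> 0 \<longrightarrow> lborel_scaling A (1 / \<bar>det A\<bar>)"
  proof (induction rule: induct_matrix_elementary)
    case (1 A B)
    then show ?case using lborel_scaling_mult[of A "1 / \<bar>det A\<bar>" B "1 / \<bar>det B\<bar>"] by (auto simp: det_mul abs_mult)
  next
    case (2 A i)
    then show ?case using det_zero_row by blast
  next
    case (3 A)
    then show ?case using lborel_scaling_diagonal by blast
  next
    case (4 m n)
    let ?A = "\<chi> i j. mat 1 $ i $ Transposition.transpose m n j :: real^'n^'n"
    have Ax: "?A *v x = (\<chi> i. x $ Transposition.transpose m n i)" for x
    proof -
      have "(?A *v x) $ i = (\<Sum>j\<in>UNIV. if j = Transposition.transpose m n i then x $ j else 0)" for i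
        unfolding matrix_vector_mult_def vec_lambda_beta by (intro sum.cong) (auto simp: mat_def)
      then show ?thesis by (simp add: vec_eq_iff)
    qed
    then have "(?A ** ?A) *v x = x" for x
      by (simp add: vec_eq_iff flip: matrix_vector_mul_assoc)
    then have "?A ** ?A = mat 1" by (metis matrix_eq matrix_vector_mul_lid)
    then have "det ?A * det ?A = 1" by (metis det_I det_mul)
    then have "(det ?A)\<^sup>2 = 1" by (simp add: power2_eq_square)
    then have d: "\<bar>det ?A\<bar> = 1" by (simp add: abs_square_eq_1)
    then have "det ?A \<noteq> 0" by auto
    then obtain c where c: "lborel_scaling ?A c" by (rule lborel_scaling_exists)
    have B: "Basis = range (\<lambda>i::'n. axis i (1::real))" by (auto simp: Basis_vec_def)
    have box: "x \<in> cbox (- One) One \<longleftrightarrow> (\<forall>i. \<bar>x $ i\<bar> \<le> 1)" for x :: "real^'n"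
    proof -
      have "x \<in> cbox (- One) One \<longleftrightarrow> (\<forall>b\<in>Basis. - 1 \<le> x \<bullet> b \<and> x \<bullet> b \<le> 1)"
        unfolding mem_box by (intro ball_cong refl) (simp add: inner_minus_left)
      then show ?thesis by (auto simp: B inner_axis abs_le_iff minus_le_iff)
    qed
    have perm: "(\<forall>i. \<bar>x $ Transposition.transpose m n i\<bar> \<le> 1) \<longleftrightarrow> (\<forall>i. \<bar>x $ i\<bar> \<le> 1)" for x :: "real^'n"
      by (metis Transposition.transpose_involutory)
    have "(*v) ?A -` cbox (- One) One = cbox (- One) One"
      by (rule set_eqI) (simp add: box Ax perm)
    then have "c = 1" by (intro lborel_scaling_eqI[OF c, of "cbox (- One) One"]) (auto simp: unit_box_measure)
    then show ?case using c d by simp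
  next
    case (5 m n c)
    let ?E = "\<lambda>c. \<chi> i j. if i = m \<and> j = n then c else of_bool (i = j) :: real^'n^'n"
    let ?D = "\<lambda>t. \<chi> i j. if i = j then (if i = m then t else 1) else 0 :: real^'n^'n"
    have Ev: "?E c *v x = (\<chi> i. if i = m then x $ m + c * x $ n else x $ i)" for c x
    proof -
      have "(?E c *v x) $ i = (\<Sum>j\<in>UNIV. (if j = i then x $ i else 0) + (if j = n then if i = m then c * x $ n else 0 else 0))" for i
        unfolding matrix_vector_mult_def vec_lambda_beta using 5 by (intro sum.cong) auto
      then show ?thesis by (auto simp: vec_eq_iff sum.distrib)
    qed
    have Dv: "?D t *v x = (\<chi> i. if i = m then t * x $ m else x $ i)" for t x
    proof -
      have "(?D t *v x) $ i = (\<Sum>j\<in>UNIV. if j = i then (if i = m then t * x $ m else x $ i) else 0)" for i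
        unfolding matrix_vector_mult_def vec_lambda_beta by (intro sum.cong) auto
      then show ?thesis by (simp add: vec_eq_iff)
    qed
    \<comment> \<open>Doubling a shear is conjugating it by a dilation of one axis. Any
      multiplicative invariant of the shear then equals its own square, so a nonzero determinant and
      the scaling factor are both 1.\<close>
    have EE: "?E c ** ?E c = ?D 2 ** ?E c ** ?D (1/2)"
      unfolding matrix_eq using 5 by (auto simp: vec_eq_iff Ev Dv algebra_simps simp flip: matrix_vector_mul_assoc)
    have idem: "x = 1" if "x * x = x" "x \<noteq> 0" for x :: real using that by simp
    have DD: "?D 2 ** ?D (1/2) = mat 1"
      unfolding matrix_eq by (auto simp: vec_eq_iff Dv simp flip: matrix_vector_mul_assoc)
    have dD: "det (?D 2) * det (?D (1/2)) = 1" using arg_cong[OF DD, of det] by (simp only: det_mul det_I)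
    have "det (?E c) * det (?E c) = det (?D 2) * det (?E c) * det (?D (1/2))"
      using arg_cong[OF EE, of det] by (simp only: det_mul)
    also have "\<dots> = (det (?D 2) * det (?D (1/2))) * det (?E c)" by (simp only: mult_ac)
    finally have "det (?E c) * det (?E c) = det (?E c)" by (simp only: dD mult_1)
    then have d1: "det (?E c) = 1" if "det (?E c) \<noteq> 0" using idem that by blast
    have s1: "lborel_scaling (?E c) 1" if nz: "det (?E c) \<noteq> 0"
    proof -
      obtain k where k: "lborel_scaling (?E c) k" using lborel_scaling_exists[OF nz] .
      have "det (?D 2) \<noteq> 0" using dD by fastforce
      then obtain u where u: "lborel_scaling (?D 2) u" by (rule lborel_scaling_exists)
      have "det (?D (1/2)) \<noteq> 0" using dD by fastforce
      then obtain v where v: "lborel_scaling (?D (1/2)) v" by (rule lborel_scaling_exists)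
      have "u * v = 1"
        by (rule lborel_scaling_unique[OF lborel_scaling_mult[OF u v, unfolded DD] lborel_scaling_one])
      moreover have "k * k = u * k * v"
        by (rule lborel_scaling_unique[OF lborel_scaling_mult[OF k k, unfolded EE]
            lborel_scaling_mult[OF lborel_scaling_mult[OF u k] v]])
      ultimately have "k * k = k" by (simp add: mult_ac)
      then show ?thesis using k by (auto simp: lborel_scaling_def)
    qed
    show ?case
    proof
      assume nz: "det (?E c) \<noteq> 0"
      show "lborel_scaling (?E c) (1 / \<bar>det (?E c)\<bar>)" using s1[OF nz] unfolding d1[OF nz] by simp
    qed
  qed
  then show ?thesis using assms by blast
qed

lemma lborel_scaling_distr:
  assumes "lborel_scaling A c"
  shows "distr lborel borel ((*v) A) = density lborel (\<lambda>_. ennreal c)"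
  by (rule measure_eqI) (use assms in \<open>auto simp: emeasure_distr emeasure_density_const lborel_scaling_def\<close>)

lemma lborel_scaling_integrable_iff:
  fixes f :: "real^'n \<Rightarrow> 'a::{banach, second_countable_topology}"
  assumes "lborel_scaling A c" and f [measurable]: "f \<in> borel_measurable borel"
  shows "integrable lborel (\<lambda>x. f (A *v x)) \<longleftrightarrow> integrable lborel f"
proof -
  have "integrable lborel (\<lambda>x. f (A *v x)) \<longleftrightarrow> integrable (distr lborel borel ((*v) A)) f"
    by (subst integrable_distr_eq) auto
  also have "\<dots> \<longleftrightarrow> integrable lborel (\<lambda>x. c *\<^sub>R f x)"
    unfolding lborel_scaling_distr[OF assms(1)] using assms(1)
    by (subst integrable_density) (auto simp: lborel_scaling_def)
  also have "\<dots> \<longleftrightarrow> integrable lborel f"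
    using assms(1) integrable_scaleR_right[of "1 / c" lborel "\<lambda>x. c *\<^sub>R f x"] by (auto simp: lborel_scaling_def)
  finally show ?thesis .
qed

lemma lborel_scaling_integral:
  fixes f :: "real^'n \<Rightarrow> 'a::{banach, second_countable_topology}"
  assumes "lborel_scaling A c" and f [measurable]: "f \<in> borel_measurable borel"
  shows "(\<integral>x. f (A *v x) \<partial>lborel) = c *\<^sub>R (\<integral>x. f x \<partial>lborel)"
proof -
  have "(\<integral>x. f (A *v x) \<partial>lborel) = (\<integral>x. f x \<partial>distr lborel borel ((*v) A))"
    by (subst integral_distr) auto
  also have "\<dots> = (\<integral>x. c *\<^sub>R f x \<partial>lborel)"
    unfolding lborel_scaling_distr[OF assms(1)] using assms(1)
    by (subst integral_density) (auto simp: lborel_scaling_def)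
  finally show ?thesis by simp
qed

section \<open>Lattice sums and integration over the torus\<close>

lemma
  fixes f :: "'n::finite \<Rightarrow> real \<Rightarrow> 'a::{real_normed_field, banach, second_countable_topology}"
  assumes f: "\<And>i. integrable lborel (f i)"
  shows lborel_vec_integrable_prod: "integrable lborel (\<lambda>x::real^'n. \<Prod>i\<in>UNIV. f i (x $ i))"
    and lborel_vec_integral_prod: "(\<integral>x. (\<Prod>i\<in>UNIV. f i ((x::real^'n) $ i)) \<partial>lborel) = (\<Prod>i\<in>UNIV. \<integral>t. f i t \<partial>lborel)"
proof -
  interpret product_sigma_finite "\<lambda>b::real^'n. lborel :: real measure" ..
  have B: "Basis = range (\<lambda>i::'n. axis i (1::real))" by (auto simp: Basis_vec_def)
  have inj: "inj (\<lambda>i::'n. axis i (1::real))" by (auto simp: inj_on_def axis_eq_axis)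
  define F where "F b = f (inv (\<lambda>i::'n. axis i (1::real)) b)" for b
  have F: "F (axis i 1) = f i" for i by (simp add: F_def inv_f_f[OF inj])
  have F': "integrable lborel (F b)" for b by (simp add: F_def f)
  have m [measurable]: "F b \<in> borel_measurable borel" for b using borel_measurable_integrable[OF F'] by simp
  have mf [measurable]: "f i \<in> borel_measurable borel" for i using borel_measurable_integrable[OF f] by simp
  have eq: "(\<Prod>i\<in>UNIV. f i (x $ i)) = (\<Prod>b\<in>Basis. F b (x \<bullet> b))" for x :: "real^'n"
    by (simp add: B prod.reindex[OF inj] F inner_axis)
  let ?g = "\<lambda>u::real^'n \<Rightarrow> real. \<Sum>b\<in>Basis. u b *\<^sub>R b"
  have eq': "(\<Prod>b\<in>Basis. F b (?g u \<bullet> b)) = (\<Prod>b\<in>Basis. F b (u b))" for u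
    by (intro prod.cong) (auto simp: inner_sum_left inner_Basis if_distrib cong: if_cong)
  have mm: "(\<lambda>x::real^'n. \<Prod>i\<in>UNIV. f i (x $ i)) \<in> borel_measurable borel"
    unfolding eq by measurable
  have g: "?g \<in> measurable (\<Pi>\<^sub>M b\<in>Basis. lborel) borel" by measurable
  have "integrable (\<Pi>\<^sub>M b\<in>Basis. lborel) (\<lambda>u. \<Prod>i\<in>UNIV. f i (?g u $ i))"
    unfolding eq eq' by (intro product_integrable_prod F' finite_Basis)
  then show "integrable lborel (\<lambda>x::real^'n. \<Prod>i\<in>UNIV. f i (x $ i))"
    by (subst lborel_eq, subst integrable_distr_eq[OF g mm])
  have "(\<integral>x. (\<Prod>i\<in>UNIV. f i ((x::real^'n) $ i)) \<partial>lborel) =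
      (\<integral>u. (\<Prod>i\<in>UNIV. f i (?g u $ i)) \<partial>(\<Pi>\<^sub>M b\<in>Basis. lborel))"
    by (subst lborel_eq, subst integral_distr[OF g mm]) simp
  also have "\<dots> = (\<Prod>b\<in>Basis. \<integral>t. F b t \<partial>lborel)"
    unfolding eq eq' by (intro product_integral_prod F' finite_Basis)
  also have "\<dots> = (\<Prod>i\<in>UNIV. \<integral>t. f i t \<partial>lborel)"
    by (simp add: B prod.reindex[OF inj] F)
  finally show "(\<integral>x. (\<Prod>i\<in>UNIV. f i ((x::real^'n) $ i)) \<partial>lborel) = (\<Prod>i\<in>UNIV. \<integral>t. f i t \<partial>lborel)" .
qed

lemma gaussian_integrable_real:
  assumes "a > 0"
  shows "integrable lborel (\<lambda>t::real. exp (- a * t\<^sup>2))"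
proof -
  define \<sigma> where "\<sigma> = sqrt (1 / (2 * a))"
  have \<sigma>: "\<sigma>\<^sup>2 = 1 / (2 * a)" using assms by (simp add: \<sigma>_def)
  have "\<sigma> > 0" using assms by (simp add: \<sigma>_def)
  then have "integrable lborel (\<lambda>t. sqrt (2 * pi * \<sigma>\<^sup>2) * normal_density 0 \<sigma> t)" by simp
  moreover have "sqrt (2 * pi * \<sigma>\<^sup>2) * normal_density 0 \<sigma> t = exp (- a * t\<^sup>2)" for t
    using assms unfolding normal_density_def \<sigma> by simp
  ultimately show ?thesis by simp
qed

lemma gaussian_integrable_vec:
  assumes "a > 0"
  shows "integrable lborel (\<lambda>x::real^'n. exp (- a * (x \<bullet> x)))"
proof -
  have "exp (- a * (x \<bullet> x)) = (\<Prod>i\<in>UNIV. exp (- a * (x $ i)\<^sup>2))" for x :: "real^'n"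
    by (simp add: inner_vec_def power2_eq_square sum_distrib_left flip: exp_sum)
  then show ?thesis using lborel_vec_integrable_prod[OF gaussian_integrable_real[OF assms]] by simp
qed

lemma int_lattice_closed:
  "0 \<in> int_lattice" "axis p 1 \<in> int_lattice" "v \<in> int_lattice \<Longrightarrow> - v \<in> int_lattice"
  "v \<in> int_lattice \<Longrightarrow> w \<in> int_lattice \<Longrightarrow> v + w \<in> int_lattice"
  "v \<in> int_lattice \<Longrightarrow> w \<in> int_lattice \<Longrightarrow> v - w \<in> int_lattice"
  by (auto simp: int_lattice_def axis_def)

lemma int_lattice_enum: "\<exists>\<gamma> :: nat \<Rightarrow> real^'n. bij_betw \<gamma> UNIV int_lattice"
proof -
  have "int_lattice = (\<lambda>k. \<chi> p. real_of_int (k p)) ` (UNIV :: ('n \<Rightarrow> int) set)"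
  proof (intro equalityI subsetI)
    fix v :: "real^'n" assume "v \<in> int_lattice"
    then have "v = (\<chi> p. real_of_int \<lfloor>v $ p\<rfloor>)" by (simp add: int_lattice_def vec_eq_iff)
    then show "v \<in> (\<lambda>k. \<chi> p. real_of_int (k p)) ` UNIV" by (rule image_eqI[of _ _ "\<lambda>p. \<lfloor>v $ p\<rfloor>"]) simp
  qed (auto simp: int_lattice_def)
  then have "countable (int_lattice :: (real^'n) set)" using countable_image[OF countableI_type] by metis
  moreover have "infinite (int_lattice :: (real^'n) set)"
  proof
    assume "finite (int_lattice :: (real^'n) set)"
    then have "finite ((\<lambda>k::nat. (\<chi> p. real k) :: real^'n) ` UNIV)"
      by (rule rev_finite_subset) (auto simp: int_lattice_def)
    moreover have "inj (\<lambda>k::nat. (\<chi> p. real k) :: real^'n)" by (auto simp: inj_on_def vec_eq_iff)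
    ultimately show False using finite_imageD by blast
  qed
  ultimately show ?thesis using bij_betw_from_nat_into by blast
qed

text \<open>Lattice sums become series over the naturals. The order is arbitrary, so reindexing by a
  lattice translation goes through absolute convergence.\<close>

definition lattice_enum :: "nat \<Rightarrow> real^'n" where
  "lattice_enum = (SOME \<gamma>. bij_betw \<gamma> UNIV int_lattice)"

lemma bij_lattice_enum: "bij_betw lattice_enum UNIV int_lattice"
  unfolding lattice_enum_def using int_lattice_enum by (rule someI_ex)

lemma lattice_enum_in: "lattice_enum n \<in> int_lattice"
  using bij_lattice_enum by (auto simp: bij_betw_def)

text \<open>Half-open, so that its lattice translates partition the space with no boundary
  overlaps.\<close>

definition unit_cell :: "(real^'n) set" where
  "unit_cell = {x. \<forall>p. 0 \<le> x $ p \<and> x $ p < 1}"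

definition cell_part :: "real^'n \<Rightarrow> real^'n" where
  "cell_part x = (\<chi> p. x $ p - real_of_int \<lfloor>x $ p\<rfloor>)"

lemma cell_part_in: "cell_part x \<in> unit_cell"
  by (auto simp: cell_part_def unit_cell_def) linarith

lemma cell_part_diff: "x - cell_part x \<in> int_lattice"
  by (auto simp: cell_part_def int_lattice_def)

lemma unit_cell_unique:
  assumes "x \<in> unit_cell" "y \<in> unit_cell" "x - y \<in> int_lattice"
  shows "x = y"
proof -
  have "x $ p = y $ p" for p
  proof -
    obtain k where k: "x $ p - y $ p = real_of_int k" using assms(3) by (auto simp: int_lattice_def elim!: Ints_cases)
    have "\<bar>x $ p - y $ p\<bar> < 1" using assms(1,2) by (auto simp: unit_cell_def abs_less_iff) (smt (verit))+
    then have "k = 0" unfolding k by linarith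
    then show ?thesis using k by simp
  qed
  then show ?thesis by (simp add: vec_eq_iff)
qed

lemma unit_cell_cbox: "unit_cell \<subseteq> cbox 0 (\<chi> p. 1)"
  by (auto simp: unit_cell_def mem_box_cart less_imp_le)

lemma bounded_unit_cell: "bounded unit_cell"
  using unit_cell_cbox bounded_cbox bounded_subset by blast

lemma borel_unit_cell [measurable]: "(unit_cell :: (real^'n) set) \<in> sets borel"
proof -
  have eq: "unit_cell = (\<Inter>p. {x::real^'n. 0 \<le> x $ p} \<inter> {x. x $ p < 1})" by (auto simp: unit_cell_def)
  have m: "{x::real^'n. 0 \<le> x $ p} \<in> sets borel" "{x::real^'n. x $ p < 1} \<in> sets borel" for p
    by (auto intro!: borel_closed borel_open closed_Collect_le open_Collect_less continuous_intros)
  show ?thesis unfolding eq by (intro sets.finite_INT sets.Int m) auto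
qed

definition torus :: "(real^'n) measure" where "torus = restrict_space lborel unit_cell"

lemma space_torus: "space torus = unit_cell"
  by (simp add: torus_def space_restrict_space)

lemma torus_measurable [measurable_dest]: "f \<in> borel_measurable borel \<Longrightarrow> f \<in> borel_measurable torus"
  unfolding torus_def by (rule measurable_restrict_space1) simp

lemma finite_measure_torus: "finite_measure (torus :: (real^'n) measure)"
proof
  have "emeasure lborel (unit_cell :: (real^'n) set) \<le> emeasure lborel (cbox 0 ((\<chi> p. 1) :: real^'n))"
    by (rule emeasure_mono[OF unit_cell_cbox]) simp
  then have "emeasure lborel (unit_cell :: (real^'n) set) < top"
    using emeasure_lborel_cbox_finite[of 0 "(\<chi> p. 1) :: real^'n"] by (simp add: order_le_less_trans)
  then show "emeasure torus (space torus :: (real^'n) set) \<noteq> \<infinity>"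
    by (simp add: space_torus torus_def emeasure_restrict_space)
qed

lemma torus_integrable:
  fixes f :: "real^'n \<Rightarrow> 'a::{banach, second_countable_topology}"
  assumes "continuous_on UNIV f"
  shows "integrable torus f"
proof -
  have "compact (f ` cbox 0 (\<chi> p. 1))"
    by (intro compact_continuous_image continuous_on_subset[OF assms]) auto
  then obtain C where C: "\<And>x. x \<in> cbox 0 (\<chi> p. 1) \<Longrightarrow> norm (f x) \<le> C"
    using compact_imp_bounded bounded_iff by (metis imageI)
  show ?thesis
    by (rule finite_measure.integrable_const_bound[OF finite_measure_torus, of _ C])
      (use C unit_cell_cbox borel_measurable_continuous_onI[OF assms] in \<open>auto simp: space_torus intro!: AE_I2 torus_measurable\<close>)
qed

lemma torus_integral_eq: "integral\<^sup>L torus f = (\<integral>x. indicator unit_cell x *\<^sub>R f x \<partial>lborel)"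
  for f :: "real^'n \<Rightarrow> 'a::{banach, second_countable_topology}"
  unfolding torus_def by (rule integral_restrict_space) simp

lemma torus_integrable_eq: "integrable torus f \<longleftrightarrow> integrable lborel (\<lambda>x. indicator unit_cell x *\<^sub>R f x)"
  for f :: "real^'n \<Rightarrow> 'a::{banach, second_countable_topology}"
  unfolding torus_def by (rule integrable_restrict_space) simp

lemma lborel_shift:
  fixes f :: "'b::euclidean_space \<Rightarrow> 'a::{banach, second_countable_topology}"
  assumes "f \<in> borel_measurable borel"
  shows lborel_integral_shift: "(\<integral>x. f (t + x) \<partial>lborel) = (\<integral>x. f x \<partial>lborel)"
    and lborel_integrable_shift: "integrable lborel (\<lambda>x. f (t + x)) \<longleftrightarrow> integrable lborel f"
proof -
  show "(\<integral>x. f (t + x) \<partial>lborel) = (\<integral>x. f x \<partial>lborel)"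
    by (subst (2) lborel_distr_plus[symmetric, of t], subst integral_distr) (use assms in auto)
  show "integrable lborel (\<lambda>x. f (t + x)) \<longleftrightarrow> integrable lborel f"
    by (subst (2) lborel_distr_plus[symmetric, of t], subst integrable_distr_eq) (use assms in auto)
qed

text \<open>The unfolding trick: the translates of the unit cell partition the space, so an integral
  over the space is a sum over the lattice of integrals over the torus. The summable norms allow sum
  and integral to be exchanged later.\<close>

lemma
  fixes f :: "real^'n \<Rightarrow> 'a::{banach, second_countable_topology}"
  assumes int: "integrable lborel f"
  shows unfold_integrable: "integrable torus (\<lambda>x. f (lattice_enum n + x))"
    and unfold_sums: "(\<lambda>n. \<integral>x. f (lattice_enum n + x) \<partial>torus) sums (\<integral>x. f x \<partial>lborel)"
    and unfold_summable_norm: "summable (\<lambda>n. \<integral>x. norm (f (lattice_enum n + x)) \<partial>torus)"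
proof -
  define c :: "nat \<Rightarrow> (real^'n) set" where "c n = (+) (lattice_enum n) ` unit_cell" for n
  define F where "F n x = indicator (c n) x *\<^sub>R f x" for n :: nat and x
  have ind: "indicator (c n) (lattice_enum n + x) = (indicator unit_cell x :: real)" for n x
    by (auto simp: c_def indicator_def image_iff)
  have [measurable]: "f \<in> borel_measurable borel" using borel_measurable_integrable[OF int] by simp
  have cm [measurable]: "c n \<in> sets borel" for n
  proof -
    have "c n = (\<lambda>x. - lattice_enum n + x) -` unit_cell"
      by (auto simp: c_def image_iff) (metis add.commute diff_add_cancel)
    moreover have "(\<lambda>x. - lattice_enum n + x) -` unit_cell \<in> sets borel"
      by (intro borel_measurable_continuous_onI[THEN measurable_sets_borel] continuous_intros) simp
    ultimately show ?thesis by simp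
  qed
  have Fint: "integrable lborel (F n)" for n
    unfolding F_def using int cm by (intro integrable_mult_indicator) auto
  have shift: "indicator unit_cell x *\<^sub>R f (lattice_enum n + x) = F n (lattice_enum n + x)" for n x
    by (simp add: F_def ind)
  show "integrable torus (\<lambda>x. f (lattice_enum n + x))" for n
    unfolding torus_integrable_eq shift using lborel_integrable_shift[of "F n"] Fint by auto
  have intF: "(\<integral>x. f (lattice_enum n + x) \<partial>torus) = (\<integral>x. F n x \<partial>lborel)" for n
    unfolding torus_integral_eq shift using lborel_integral_shift[of "F n"] Fint[THEN borel_measurable_integrable] by simp
  have intFn: "(\<integral>x. norm (f (lattice_enum n + x)) \<partial>torus) = (\<integral>x. norm (F n x) \<partial>lborel)" for n
  proof -
    have "indicator unit_cell x *\<^sub>R norm (f (lattice_enum n + x)) = norm (F n (lattice_enum n + x))" for x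
      by (simp add: F_def ind)
    then show ?thesis
      unfolding torus_integral_eq using lborel_integral_shift[of "\<lambda>x. norm (F n x)"] Fint[THEN borel_measurable_integrable] by simp
  qed
  \<comment> \<open>The translate containing \<open>x\<close> is found by taking integer parts of
    the coordinates; \<open>unit_cell_unique\<close> excludes a second one.\<close>
  have ex1: "\<exists>n. \<forall>k. x \<in> c k \<longleftrightarrow> k = n" for x :: "real^'n"
  proof -
    obtain n where n: "lattice_enum n = x - cell_part x"
      using bij_lattice_enum cell_part_diff unfolding bij_betw_def by (metis imageE)
    have "x \<in> c k \<longleftrightarrow> k = n" for k
    proof
      assume "x \<in> c k"
      then obtain y where y: "x = lattice_enum k + y" "y \<in> unit_cell" by (auto simp: c_def)
      have "y - cell_part x = lattice_enum n - lattice_enum k" using n y by simp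
      then have "y - cell_part x \<in> int_lattice" using int_lattice_closed(5) lattice_enum_in by metis
      then have "y = cell_part x" using unit_cell_unique y cell_part_in by blast
      then have "lattice_enum n = x - y" using n by simp
      also have "\<dots> = lattice_enum k" using y by simp
      finally have "(lattice_enum k :: real^'n) = lattice_enum n" by simp
      then show "k = n" by (rule injD[OF bij_betw_imp_inj_on[OF bij_lattice_enum]])
    next
      assume "k = n"
      then have "x = lattice_enum k + cell_part x" using n by simp
      then show "x \<in> c k" unfolding c_def using cell_part_in by blast
    qed
    then show ?thesis by blast
  qed
  have Fsum: "(\<lambda>k. F k x) sums f x" "(\<lambda>k. norm (F k x)) sums norm (f x)" for x
  proof -
    obtain n where n: "\<And>k. x \<in> c k \<longleftrightarrow> k = n" using ex1 by blast
    have "F k x = (if k = n then f x else 0)" "norm (F k x) = (if k = n then norm (f x) else 0)" for k using n by (auto simp: F_def)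
    then show "(\<lambda>k. F k x) sums f x" "(\<lambda>k. norm (F k x)) sums norm (f x)"
      using sums_single[of n "\<lambda>_. f x"] sums_single[of n "\<lambda>_. norm (f x)"] by simp_all
  qed
  have summ: "summable (\<lambda>n. \<integral>x. norm (F n x) \<partial>lborel)"
  proof (rule summableI_nonneg_bounded)
    fix N
    have "(\<Sum>n<N. \<integral>x. norm (F n x) \<partial>lborel) = (\<integral>x. (\<Sum>n<N. norm (F n x)) \<partial>lborel)"
      using Fint by (subst Bochner_Integration.integral_sum) auto
    also have "\<dots> \<le> (\<integral>x. norm (f x) \<partial>lborel)"
    proof (rule integral_mono)
      show "(\<Sum>n<N. norm (F n x)) \<le> norm (f x)" for x
        using sum_le_suminf[OF sums_summable[OF Fsum(2)], of "{..<N}" x] sums_unique[OF Fsum(2), of x] by simp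
    qed (use Fint int in auto)
    finally show "(\<Sum>n<N. \<integral>x. norm (F n x) \<partial>lborel) \<le> (\<integral>x. norm (f x) \<partial>lborel)" .
  qed simp
  then show "summable (\<lambda>n. \<integral>x. norm (f (lattice_enum n + x)) \<partial>torus)" by (simp add: intFn)
  have "(\<lambda>n. \<integral>x. F n x \<partial>lborel) sums (\<integral>x. (\<Sum>n. F n x) \<partial>lborel)"
    by (rule sums_integral[OF Fint _ summ]) (use Fsum(2) in \<open>auto intro: sums_summable\<close>)
  moreover have "(\<Sum>n. F n x) = f x" for x using sums_unique[OF Fsum(1)] by simp
  ultimately show "(\<lambda>n. \<integral>x. f (lattice_enum n + x) \<partial>torus) sums (\<integral>x. f x \<partial>lborel)"
    by (simp add: intF)
qed

lemma torus_measure_1: "(\<integral>x. 1 \<partial>(torus :: (real^'n) measure)) = (1::real)"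
proof -
  have "indicator unit_cell x *\<^sub>R 1 = (\<Prod>i\<in>UNIV. indicator {0..<1} (x $ i) :: real)" for x :: "real^'n"
    by (auto simp: unit_cell_def indicator_def)
  moreover have "integrable lborel (indicator {0..<1} :: real \<Rightarrow> real)" by simp
  ultimately show ?thesis
    unfolding torus_integral_eq using lborel_vec_integral_prod[of "\<lambda>i::'n. indicator {0..<1} :: real \<Rightarrow> real"] by simp
qed

lemma cis_character_integral_1:
  assumes "k \<noteq> 0"
  shows "integrable lborel (\<lambda>t. indicator {0..<1} t *\<^sub>R cis (2 * pi * real_of_int k * t))"
    "(\<integral>t. indicator {0..<1} t *\<^sub>R cis (2 * pi * real_of_int k * t) \<partial>lborel) = 0"
proof -
  define F where "F t = cis (2 * pi * real_of_int k * t) / (2 * pi * \<i> * of_int k)" for t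
  have cisd: "((\<lambda>t. cis (u * t)) has_vector_derivative \<i> * u * cis (u * t)) (at t within S)" for u t S
  proof -
    have "((\<lambda>z. exp (\<i> * u * z)) has_field_derivative \<i> * u * exp (\<i> * u * of_real t)) (at (of_real t))"
      by (auto intro!: derivative_eq_intros)
    from has_vector_derivative_real_field[OF this] show ?thesis
      by (simp add: cis_conv_exp mult.assoc)
  qed
  have F: "(F has_vector_derivative cis (2 * pi * real_of_int k * t)) (at t within S)" for t S
    unfolding F_def using has_vector_derivative_divide[OF cisd[of "2 * pi * real_of_int k" t S], of "2 * pi * \<i> * of_int k"] assms
    by simp
  have cont: "continuous_on S (\<lambda>t. cis (2 * pi * real_of_int k * t))" for S
    by (intro continuous_intros)
  have cm [measurable]: "(\<lambda>t. cis (2 * pi * real_of_int k * t)) \<in> borel_measurable borel"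
    by (intro borel_measurable_continuous_onI cont)
  have 1: "(\<integral>t. indicator {0..1} t *\<^sub>R cis (2 * pi * real_of_int k * t) \<partial>lborel) = F 1 - F 0"
    by (rule integral_FTC_atLeastAtMost) (use F cont in auto)
  have "cis (2 * pi * real_of_int k) = 1" using cis_multiple_2pi[of "real_of_int k"] by simp
  then have "F 1 = F 0" by (simp add: F_def)
  moreover have "(\<integral>t. indicator {0..<1} t *\<^sub>R cis (2 * pi * real_of_int k * t) \<partial>lborel) =
     (\<integral>t. indicator {0..1} t *\<^sub>R cis (2 * pi * real_of_int k * t) \<partial>lborel)"
  proof (rule integral_cong_AE)
    show "AE t in lborel. indicator {0..<1} t *\<^sub>R cis (2 * pi * real_of_int k * t) = indicator {0..1} t *\<^sub>R cis (2 * pi * real_of_int k * t)"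
      using AE_lborel_singleton[of 1] by eventually_elim (auto simp: indicator_def)
  qed measurable
  ultimately show "(\<integral>t. indicator {0..<1} t *\<^sub>R cis (2 * pi * real_of_int k * t) \<partial>lborel) = 0"
    using 1 by simp
  show "integrable lborel (\<lambda>t. indicator {0..<1} t *\<^sub>R cis (2 * pi * real_of_int k * t))"
  proof (rule Bochner_Integration.integrable_bound)
    show "integrable lborel (indicator {0..<1} :: real \<Rightarrow> real)" by simp
    show "(\<lambda>t. indicator {0..<1} t *\<^sub>R cis (2 * pi * real_of_int k * t)) \<in> borel_measurable lborel"
      by measurable
  qed (auto simp: indicator_def)
qed

text \<open>The integral factors over the coordinates, and one nonzero frequency makes its factor
  vanish.\<close>

lemma torus_character_integral:
  fixes k :: "'n::finite \<Rightarrow> int"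
  assumes "k p \<noteq> 0"
  shows "(\<integral>x. cis (2 * pi * (\<Sum>p\<in>UNIV. real_of_int (k p) * x $ p)) \<partial>torus) = 0"
proof -
  define f where "f p t = indicator {0..<1} t *\<^sub>R cis (2 * pi * real_of_int (k p) * t)" for p t
  have int: "integrable lborel (f p)" for p
  proof (cases "k p = 0")
    case True
    have "integrable lborel (indicator {0..<1} :: real \<Rightarrow> real)" by simp
    then have "integrable lborel (\<lambda>t::real. complex_of_real (indicator {0..<1} t))" by simp
    then show ?thesis using True by (simp add: f_def[abs_def] scaleR_conv_of_real)
  next
    case False
    then show ?thesis unfolding f_def by (rule cis_character_integral_1)
  qed
  have cs: "cis (\<Sum>p\<in>I. g p) = (\<Prod>p\<in>I. cis (g p))" for g :: "'n \<Rightarrow> real" and I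
    by (induction I rule: infinite_finite_induct) (auto simp flip: cis_mult)
  have "indicator unit_cell x *\<^sub>R cis (2 * pi * (\<Sum>p\<in>UNIV. real_of_int (k p) * x $ p)) = (\<Prod>p\<in>UNIV. f p (x $ p))" for x
  proof (cases "x \<in> unit_cell")
    case True
    then show ?thesis by (auto simp: f_def unit_cell_def sum_distrib_left cs indicator_def mult.assoc)
  next
    case False
    then obtain p where "\<not> (0 \<le> x $ p \<and> x $ p < 1)" by (auto simp: unit_cell_def)
    then have "f p (x $ p) = 0" by (auto simp: f_def)
    then have "(\<Prod>p\<in>UNIV. f p (x $ p)) = 0" by (auto simp: prod_zero_iff)
    then show ?thesis using False by simp
  qed
  then have "(\<integral>x. cis (2 * pi * (\<Sum>p\<in>UNIV. real_of_int (k p) * x $ p)) \<partial>torus) = (\<Prod>p\<in>UNIV. \<integral>t. f p t \<partial>lborel)"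
    unfolding torus_integral_eq by (simp add: lborel_vec_integral_prod[OF int])
  also have "(\<integral>t. f p t \<partial>lborel) = 0" unfolding f_def using assms by (rule cis_character_integral_1)
  then have "(\<Prod>p\<in>UNIV. \<integral>t. f p t \<partial>lborel) = 0" by (auto simp: prod_zero_iff)
  finally show ?thesis .
qed

text \<open>Each term is compared with the integral of a wider Gaussian over the cell at that
  lattice point; unfolding sums these integrals. The exponent is halved because moving inside a cell
  costs a factor 2 in the squared norm.\<close>

lemma lattice_gaussian_summable:
  assumes "\<kappa> > 0"
  shows "summable (\<lambda>n. exp (- \<kappa> * (norm (lattice_enum n :: real^'n))\<^sup>2))"
proof -
  let ?g = "\<lambda>x::real^'n. exp (- (\<kappa> / 2) * (x \<bullet> x))"
  have g: "integrable lborel ?g" using assms by (intro gaussian_integrable_vec) simp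
  obtain B where B: "B > 0" "\<And>x. x \<in> (unit_cell :: (real^'n) set) \<Longrightarrow> norm x \<le> B"
    using bounded_unit_cell bounded_pos by metis
  have s: "summable (\<lambda>n. exp (\<kappa> * B\<^sup>2) * (\<integral>x. norm (?g (lattice_enum n + x)) \<partial>torus))"
    by (intro summable_mult unfold_summable_norm g)
  show ?thesis
  proof (rule summable_comparison_test_ev[OF always_eventually s], rule allI)
    fix n
    let ?v = "lattice_enum n :: real^'n"
    have "exp (- \<kappa> * (norm ?v)\<^sup>2) \<le> exp (\<kappa> * B\<^sup>2) * norm (?g (?v + x))" if "x \<in> unit_cell" for x
    proof -
      have "(norm (?v + x))\<^sup>2 \<le> (norm ?v + B)\<^sup>2" using B(2)[OF that] norm_triangle_ineq[of ?v x] by (intro power_mono) auto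
      also have "\<dots> \<le> 2 * (norm ?v)\<^sup>2 + 2 * B\<^sup>2" using sum_squares_bound[of "norm ?v" B] by (simp add: power2_sum)
      finally have "- \<kappa> * (norm ?v)\<^sup>2 \<le> \<kappa> * B\<^sup>2 + - (\<kappa> / 2) * (norm (?v + x))\<^sup>2"
        using mult_left_mono[of "(norm (?v + x))\<^sup>2" "2 * (norm ?v)\<^sup>2 + 2 * B\<^sup>2" \<kappa>] assms by (simp add: algebra_simps)
      then have "exp (- \<kappa> * (norm ?v)\<^sup>2) \<le> exp (\<kappa> * B\<^sup>2) * exp (- (\<kappa> / 2) * (norm (?v + x))\<^sup>2)"
        by (simp flip: exp_add)
      then show ?thesis by (simp add: power2_norm_eq_inner)
    qed
    then have "(\<integral>x. exp (- \<kappa> * (norm ?v)\<^sup>2) \<partial>(torus :: (real^'n) measure)) \<le> (\<integral>x. exp (\<kappa> * B\<^sup>2) * norm (?g (?v + x)) \<partial>torus)"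
      by (intro integral_mono) (auto simp: space_torus intro!: torus_integrable continuous_intros)
    moreover have "(\<integral>x. exp (- \<kappa> * (norm ?v)\<^sup>2) \<partial>(torus :: (real^'n) measure)) = exp (- \<kappa> * (norm ?v)\<^sup>2)"
      using torus_measure_1[where 'n = 'n] by simp
    ultimately show "norm (exp (- \<kappa> * (norm ?v)\<^sup>2)) \<le> exp (\<kappa> * B\<^sup>2) * (\<integral>x. norm (?g (?v + x)) \<partial>torus)"
      by simp
  qed
qed

section \<open>Quasi-periodic functions\<close>

text \<open>\<open>c\<close> is the multiplier of sections on the covering space. The left side of
  its cocycle identity is symmetric in \<open>v\<close> and \<open>w\<close>, which is consistent
  only because \<omega> takes integer values on the lattice.\<close>

locale quasi_periodic =
  fixes \<omega> :: "real^'n \<Rightarrow> real^'n \<Rightarrow> real" and c :: "real^'n \<Rightarrow> complex"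
  assumes bl: "bilinear \<omega>" and alt: "\<And>u. \<omega> u u = 0"
    and norm_c: "\<And>v. v \<in> int_lattice \<Longrightarrow> norm (c v) = 1"
    and c_add: "\<And>v w. v \<in> int_lattice \<Longrightarrow> w \<in> int_lattice \<Longrightarrow> c (v + w) = c v * c w * cis (pi * \<omega> w v)"
begin

definition D :: "real^'n \<Rightarrow> (real^'n \<Rightarrow> complex) \<Rightarrow> real^'n \<Rightarrow> complex" where
  "D u f x = frechet_derivative f (at x) u - \<i> * pi * \<omega> x u * f x"

definition qp :: "(real^'n \<Rightarrow> complex) set" where
  "qp = {f. smooth_on f UNIV \<and> (\<forall>x. \<forall>v\<in>int_lattice. f (x + v) = c v * cis (pi * \<omega> v x) * f x)}"

lemma qp_smooth: "f \<in> qp \<Longrightarrow> smooth_on f UNIV"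
  by (simp add: qp_def)

lemmas bl_simps = bilinear_ladd[OF bl] bilinear_radd[OF bl] bilinear_lmul[OF bl] bilinear_rmul[OF bl]
  bilinear_lneg[OF bl] bilinear_rneg[OF bl] bilinear_lsub[OF bl] bilinear_rsub[OF bl]
  bilinear_lzero[OF bl] bilinear_rzero[OF bl]

lemma \<omega>_linear: "linear (\<lambda>x. \<omega> x u)" "linear (\<omega> u)"
  using bl by (auto simp: bilinear_def)

lemma skew: "\<omega> u v = - \<omega> v u"
  using alternating_skew[OF bl alt] .

lemma \<omega>_has_derivative:
  "((\<lambda>x. complex_of_real (\<omega> x u)) has_derivative (\<lambda>h. complex_of_real (\<omega> h u))) (at x)"
  by (intro bounded_linear_imp_has_derivative bounded_linear_compose[OF bounded_linear_of_real])
    (use \<omega>_linear in \<open>simp add: linear_linear\<close>)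

lemma smooth_D:
  assumes "smooth_on f UNIV"
  shows "smooth_on (D u f) UNIV"
proof -
  have "smooth_on (\<lambda>x. frechet_derivative f (at x) u - \<i> * pi * \<omega> x u * f x) UNIV"
    by (intro smooth_on_diff smooth_on_mult smooth_on_const smooth_on_frechet smooth_on_of_real_linear \<omega>_linear assms open_UNIV)
  then show ?thesis by (simp add: D_def[abs_def])
qed

lemma D_eqI:
  "(f has_derivative f') (at x) \<Longrightarrow> D u f x = f' u - \<i> * pi * \<omega> x u * f x"
  using frechet_derivative_at unfolding D_def by metis

lemma has_derivative_D:
  "smooth_on f UNIV \<Longrightarrow> (f has_derivative (\<lambda>u. D u f x + \<i> * pi * \<omega> x u * f x)) (at x)"
  using smooth_has_derivative[of f x] by (simp add: D_def)

lemma D_linear: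
  assumes "smooth_on f UNIV"
  shows "D (u + w) f x = D u f x + D w f x" "D (r *\<^sub>R u) f x = r * D u f x" "D (- u) f x = - D u f x"
proof -
  interpret bounded_linear "frechet_derivative f (at x)"
    using smooth_has_derivative[OF assms] has_derivative_bounded_linear by blast
  show "D (u + w) f x = D u f x + D w f x" "D (r *\<^sub>R u) f x = r * D u f x" "D (- u) f x = - D u f x"
    by (simp_all only: D_def add scaleR bl_simps neg) (simp_all add: scaleR_conv_of_real algebra_simps)
qed

lemma D_sum:
  assumes "smooth_on f UNIV"
  shows "D (\<Sum>i\<in>I. r i *\<^sub>R u i) f x = (\<Sum>i\<in>I. r i * D (u i) f x)"
proof (induction I rule: infinite_finite_induct)
  case (insert i I)
  then show ?case by (simp add: D_linear[OF assms])
qed (auto simp: D_def bl_simps linear_0[OF has_derivative_linear[OF smooth_has_derivative[OF assms]]])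

lemma D_add:
  assumes "smooth_on f UNIV" "smooth_on g UNIV"
  shows "D u (\<lambda>x. f x + g x) x = D u f x + D u g x"
  by (subst D_eqI[OF has_derivative_add[OF has_derivative_D[OF assms(1)] has_derivative_D[OF assms(2)]]])
    (simp add: algebra_simps)

lemma D_scale:
  assumes "smooth_on f UNIV"
  shows "D u (\<lambda>x. k * f x) x = k * D u f x"
  by (subst D_eqI[OF has_derivative_mult_right[OF has_derivative_D[OF assms]]])
    (simp add: algebra_simps)

lemma D_D:
  fixes f :: "real^'n \<Rightarrow> complex"
  assumes f: "smooth_on f UNIV"
  shows "D u (D w f) x = frechet_derivative (\<lambda>y. frechet_derivative f (at y) w) (at x) u
     - \<i> * pi * (\<omega> u w * f x + \<omega> x w * frechet_derivative f (at x) u + \<omega> x u * D w f x)"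
proof -
  have "((\<lambda>y. frechet_derivative f (at y) w - \<i> * pi * (complex_of_real (\<omega> y w) * f y)) has_derivative
     (\<lambda>h. frechet_derivative (\<lambda>y. frechet_derivative f (at y) w) (at x) h - \<i> * pi *
       (complex_of_real (\<omega> x w) * frechet_derivative f (at x) h + complex_of_real (\<omega> h w) * f x))) (at x)"
    by (intro has_derivative_diff has_derivative_mult_right has_derivative_mult \<omega>_has_derivative
        smooth_has_derivative smooth_on_frechet f open_UNIV)
  then have "(D w f has_derivative
     (\<lambda>h. frechet_derivative (\<lambda>y. frechet_derivative f (at y) w) (at x) h - \<i> * pi *
       (complex_of_real (\<omega> x w) * frechet_derivative f (at x) h + complex_of_real (\<omega> h w) * f x))) (at x)"
    by (simp add: D_def[abs_def] mult.assoc)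
  from D_eqI[OF this] show ?thesis by (simp add: algebra_simps)
qed

text \<open>In the expansion \<open>D_D\<close> everything is symmetric in the two directions except
  the term with \<open>\<omega> u w\<close>; exchanging them doubles it.\<close>

lemma D_commute:
  assumes f: "smooth_on f UNIV"
  shows "D u (D w f) x = D w (D u f) x - 2 * pi * \<i> * \<omega> u w * f x"
  unfolding D_D[OF f] smooth_second_derivative_commute[OF f, of w x u] using skew[of w u]
  by (simp add: D_def algebra_simps)

text \<open>Differentiating the multiplier \<open>cis (pi * \<omega> v x)\<close> produces exactly
  the amount by which the connection form changes under the translation by \<open>v\<close>, so the
  multiplier factors out of the covariant derivative.\<close>

lemma qp_D:
  assumes f: "f \<in> qp"
  shows "D u f \<in> qp"
proof -
  have sm: "smooth_on f UNIV" using f by (simp add: qp_def)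
  have "D u f (x + v) = c v * cis (pi * \<omega> v x) * D u f x" if v: "v \<in> int_lattice" for x v
  proof -
    have eq: "f (y + v) = c v * cis (pi * \<omega> v y) * f y" for y using f v by (simp add: qp_def)
    have "((\<lambda>y. f (y + v)) has_derivative frechet_derivative f (at (x + v))) (at x)"
      by (rule has_derivative_eq_rhs, rule has_derivative_compose[OF _ smooth_has_derivative[OF sm]])
        (auto intro!: derivative_eq_intros)
    moreover have "(\<lambda>y. f (y + v)) = (\<lambda>y. c v * (exp (\<i> * (pi * complex_of_real (\<omega> v y))) * f y))"
      by (simp add: fun_eq_iff eq cis_conv_exp mult.assoc)
    ultimately have d1: "((\<lambda>y. c v * (exp (\<i> * (pi * complex_of_real (\<omega> v y))) * f y)) has_derivative
        frechet_derivative f (at (x + v))) (at x)" by simp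
    have d2: "((\<lambda>y. c v * (exp (\<i> * (pi * complex_of_real (\<omega> v y))) * f y)) has_derivative
        (\<lambda>h. c v * (exp (\<i> * (pi * complex_of_real (\<omega> v x))) * frechet_derivative f (at x) h +
          exp (\<i> * (pi * complex_of_real (\<omega> v x))) * (\<i> * (pi * complex_of_real (\<omega> v h))) * f x))) (at x)"
    proof (intro has_derivative_mult_right has_derivative_mult smooth_has_derivative sm)
      have "((\<lambda>y. complex_of_real (\<omega> v y)) has_derivative (\<lambda>h. complex_of_real (\<omega> v h))) (at x)"
        by (intro bounded_linear_imp_has_derivative bounded_linear_compose[OF bounded_linear_of_real])
          (use \<omega>_linear in \<open>simp add: linear_linear\<close>)
      then have "((\<lambda>y. \<i> * (pi * complex_of_real (\<omega> v y))) has_derivative (\<lambda>h. \<i> * (pi * complex_of_real (\<omega> v h)))) (at x)"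
        by (intro has_derivative_mult_right)
      moreover have "(exp has_derivative (*) (exp z)) (at z)" for z :: complex
        using DERIV_exp by (simp add: has_field_derivative_def)
      ultimately show "((\<lambda>y. exp (\<i> * (pi * complex_of_real (\<omega> v y)))) has_derivative
        (\<lambda>h. exp (\<i> * (pi * complex_of_real (\<omega> v x))) * (\<i> * (pi * complex_of_real (\<omega> v h))))) (at x)"
        by (rule has_derivative_compose)
    qed
    note fd = has_derivative_unique[OF d1 d2]
    show ?thesis unfolding D_def fd eq cis_conv_exp bl_simps by (simp add: algebra_simps)
  qed
  then show ?thesis using smooth_D[OF sm] by (auto simp: qp_def)
qed

lemma qp_add: "f \<in> qp \<Longrightarrow> g \<in> qp \<Longrightarrow> (\<lambda>x. f x + g x) \<in> qp"
  by (auto simp: qp_def algebra_simps intro: smooth_on_add)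

lemma qp_scale: "f \<in> qp \<Longrightarrow> (\<lambda>x. k * f x) \<in> qp"
  by (auto simp: qp_def algebra_simps intro: smooth_on_mult smooth_on_const)

lemma qp_norm_periodic: "f \<in> qp \<Longrightarrow> v \<in> int_lattice \<Longrightarrow> norm (f (x + v)) = norm (f x)"
  by (auto simp: qp_def norm_mult norm_c)

text \<open>The multiplier has modulus 1, so the modulus of \<open>f\<close> is periodic and its
  maximum over the compact unit cube is global.\<close>

lemma qp_attains_sup:
  assumes "f \<in> qp"
  obtains x0 where "\<And>x. norm (f x) \<le> norm (f x0)"
proof -
  have "continuous_on (cbox 0 (\<chi> p. 1)) (\<lambda>x. norm (f x))"
    using smooth_on_imp_continuous_on[OF qp_smooth[OF assms]] continuous_on_subset
    by (intro continuous_intros) blast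
  moreover have "cbox 0 ((\<chi> p. 1) :: real^'n) \<noteq> {}"
    using subsetD[OF unit_cell_cbox cell_part_in, of "0 :: real^'n"] by blast
  ultimately obtain x0 where x0: "\<And>x. x \<in> cbox 0 (\<chi> p. 1) \<Longrightarrow> norm (f x) \<le> norm (f x0)"
    using continuous_attains_sup[OF compact_cbox, of 0 "\<chi> p. 1" "\<lambda>x. norm (f x)"] by blast
  have "norm (f x) \<le> norm (f x0)" for x
    using qp_norm_periodic[OF assms cell_part_diff, of "cell_part x" x] x0[of "cell_part x"]
      cell_part_in unit_cell_cbox by fastforce
  then show thesis by (rule that)
qed

text \<open>Maximum principle: at a maximum of \<open>norm f\<close> the second derivative of \<open>(norm f)\<^sup>2\<close>
  along every line is nonpositive.\<close>

lemma second_order_at_max: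
  assumes f: "f \<in> qp" and max: "\<And>x. norm (f x) \<le> norm (f x0)"
  shows "Re (cnj (f x0) * D u (D u f) x0) \<le> 0"
proof (rule ccontr)
  assume neg: "\<not> ?thesis"
  have sm: "smooth_on f UNIV" and smD: "smooth_on (D u f) UNIV" using qp_smooth qp_D f by auto
  define l where "l t = x0 + t *\<^sub>R u" for t
  \<comment> \<open>Half of the derivative of the squared modulus along the line: the connection
    term contributes an imaginary multiple of it and drops out of the real part.\<close>
  define \<psi> where "\<psi> t = Re (cnj (f (l t)) * D u f (l t))" for t
  have fl: "((\<lambda>t. g (l t)) has_vector_derivative D u g (l t) + \<i> * pi * \<omega> (l t) u * g (l t)) (at t)"
    if "smooth_on g UNIV" for t g
    unfolding l_def using smooth_has_vector_derivative_line[OF that, of x0 u t UNIV] by (simp add: D_def)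
  have cl: "((\<lambda>t. cnj (f (l t))) has_vector_derivative cnj (D u f (l t) + \<i> * pi * \<omega> (l t) u * f (l t))) (at t)" for t
    using fl[OF sm, of t] by (rule has_vector_derivative_cnj)
  have nsq: "(norm z)\<^sup>2 = Re z * Re z + Im z * Im z" for z
    by (simp add: cmod_power2) (simp add: power2_eq_square)
  have d1: "((\<lambda>t. (norm (f (l t)))\<^sup>2) has_real_derivative 2 * \<psi> t) (at t)" for t
  proof -
    have "((\<lambda>t. Re (cnj (f (l t)) * f (l t))) has_vector_derivative
       Re (cnj (f (l t)) * (D u f (l t) + \<i> * pi * \<omega> (l t) u * f (l t)) +
         cnj (D u f (l t) + \<i> * pi * \<omega> (l t) u * f (l t)) * f (l t))) (at t)"
      by (intro has_vector_derivative_mult fl cl sm bounded_linear.has_vector_derivative[OF bounded_linear_Re])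
    then show ?thesis
      by (simp add: \<psi>_def nsq has_real_derivative_iff_has_vector_derivative algebra_simps)
  qed
  have d2: "(\<psi> has_real_derivative (norm (D u f (l t)))\<^sup>2 + Re (cnj (f (l t)) * D u (D u f) (l t))) (at t)" for t
  proof -
    have "(\<psi> has_vector_derivative
       Re (cnj (f (l t)) * (D u (D u f) (l t) + \<i> * pi * \<omega> (l t) u * D u f (l t)) +
         cnj (D u f (l t) + \<i> * pi * \<omega> (l t) u * f (l t)) * D u f (l t))) (at t)"
      unfolding \<psi>_def[abs_def]
      by (intro has_vector_derivative_mult fl cl smD bounded_linear.has_vector_derivative[OF bounded_linear_Re])
    then show ?thesis
      by (simp add: nsq has_real_derivative_iff_has_vector_derivative algebra_simps)
  qed
  have l0: "l 0 = x0" by (simp add: l_def)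
  have le: "(norm (f (l t)))\<^sup>2 \<le> (norm (f (l 0)))\<^sup>2" for t using max by (simp add: l0 power_mono)
  have "2 * \<psi> 0 = 0" using DERIV_local_max[OF d1[of 0], of 1] le by auto
  then have \<psi>0: "\<psi> 0 = 0" by simp
  \<comment> \<open>If the claim failed, this derivative of \<psi> at 0 would be positive. Since
    \<psi> vanishes there, the squared modulus would increase strictly to the right of its
    maximum.\<close>
  have "(norm (D u f (l 0)))\<^sup>2 + Re (cnj (f (l 0)) * D u (D u f) (l 0)) > 0"
    using neg by (simp add: l0 add_nonneg_pos)
  from DERIV_pos_inc_right[OF d2 this] obtain d where d: "d > 0" "\<And>h. 0 < h \<Longrightarrow> h < d \<Longrightarrow> \<psi> h > 0"
    by (auto simp: \<psi>0)
  have "(norm (f (l 0)))\<^sup>2 < (norm (f (l (d / 2))))\<^sup>2"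
  proof (rule DERIV_pos_imp_increasing_open[of 0 "d / 2" "\<lambda>t. (norm (f (l t)))\<^sup>2"])
    show "\<exists>y. ((\<lambda>t. (norm (f (l t)))\<^sup>2) has_real_derivative y) (at x) \<and> 0 < y" if "0 < x" "x < d / 2" for x
      using d1[of x] d(2)[of x] that by (intro exI[of _ "2 * \<psi> x"]) auto
    show "continuous_on {0..d / 2} (\<lambda>t. (norm (f (l t)))\<^sup>2)"
      using d1 by (meson DERIV_continuous_on DERIV_subset subset_UNIV)
  qed (use d in auto)
  then show False using le[of "d / 2"] by simp
qed

text \<open>Multiply the eigenvalue equation at a maximum of the modulus by the conjugate of
  \<open>f\<close>: the second-order bound makes the real part of the left side nonnegative, so a
  negative eigenvalue forces the maximum to be 0.\<close>

lemma laplacian_eigenvalue_nonneg: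
  assumes f: "f \<in> qp" and eig: "\<And>x. - (\<Sum>p\<in>I. D (b p) (D (b p) f) x) = \<mu> * f x" and neg: "Re \<mu> < 0"
  shows "f x = 0"
proof -
  obtain x0 where x0: "\<And>x. norm (f x) \<le> norm (f x0)" using qp_attains_sup[OF f] by blast
  have "cnj (f x0) * (\<mu> * f x0) = \<mu> * (f x0 * cnj (f x0))" by (simp only: mult_ac)
  then have "cnj (f x0) * (- (\<Sum>p\<in>I. D (b p) (D (b p) f) x0)) = \<mu> * complex_of_real ((norm (f x0))\<^sup>2)"
    unfolding eig by (metis complex_norm_square)
  from arg_cong[OF this, of Re]
  have "Re \<mu> * (norm (f x0))\<^sup>2 = Re (cnj (f x0) * (- (\<Sum>p\<in>I. D (b p) (D (b p) f) x0)))"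
    by simp
  also have "\<dots> = - (\<Sum>p\<in>I. Re (cnj (f x0) * D (b p) (D (b p) f) x0))"
    by (simp only: mult_minus_right sum_distrib_left Re_sum uminus_complex.sel)
  finally have e: "Re \<mu> * (norm (f x0))\<^sup>2 = - (\<Sum>p\<in>I. Re (cnj (f x0) * D (b p) (D (b p) f) x0))" .
  have "(\<Sum>p\<in>I. Re (cnj (f x0) * D (b p) (D (b p) f) x0)) \<le> 0"
    by (intro sum_nonpos second_order_at_max[OF f x0])
  then have "0 \<le> Re \<mu> * (norm (f x0))\<^sup>2" unfolding e by linarith
  then have "(norm (f x0))\<^sup>2 \<le> 0" using neg by (simp add: zero_le_mult_iff)
  then have "norm (f x0) = 0" by simp
  then show ?thesis using x0[of x] by simp
qed

text \<open>Lowering operators are the case \<open>z = 1\<close> and raising operators the case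
  \<open>z = - 1\<close>, so a single commutator computation serves all pairs.\<close>

definition lad :: "complex \<Rightarrow> real^'n \<Rightarrow> real^'n \<Rightarrow> (real^'n \<Rightarrow> complex) \<Rightarrow> real^'n \<Rightarrow> complex" where
  "lad z u w f x = z * D u f x + \<i> * D w f x"

lemma lad_qp: "f \<in> qp \<Longrightarrow> lad z u w f \<in> qp"
  unfolding lad_def[abs_def] by (intro qp_add qp_scale qp_D)

lemma lad_add: "f \<in> qp \<Longrightarrow> g \<in> qp \<Longrightarrow> lad z u w (\<lambda>x. f x + g x) x = lad z u w f x + lad z u w g x"
  by (simp add: lad_def D_add qp_smooth algebra_simps)

lemma lad_scale: "f \<in> qp \<Longrightarrow> lad z u w (\<lambda>x. k * f x) x = k * lad z u w f x"
  by (simp add: lad_def D_scale qp_smooth algebra_simps)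

lemma D_lad: "f \<in> qp \<Longrightarrow> D v (lad z u w f) x = z * D v (D u f) x + \<i> * D v (D w f) x"
  unfolding lad_def[abs_def]
  by (subst D_add) (auto simp: D_scale qp_smooth qp_D intro!: qp_smooth qp_scale)

lemma lad_commute:
  assumes f: "f \<in> qp"
  shows "lad z u w (lad z' u' w' f) x = lad z' u' w' (lad z u w f) x
    - 2 * pi * \<i> * (z * z' * \<omega> u u' + \<i> * z * \<omega> u w' + \<i> * z' * \<omega> w u' - \<omega> w w') * f x"
proof -
  have sm: "smooth_on f UNIV" using f by (rule qp_smooth)
  have ii: "\<i> * (\<i> * r) = - r" for r by simp
  show ?thesis
    unfolding lad_def[of _ _ _ "lad _ _ _ f"] D_lad[OF f]
    unfolding D_commute[OF sm, of u u'] D_commute[OF sm, of u w'] D_commute[OF sm, of w u'] D_commute[OF sm, of w w']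
    by (simp add: algebra_simps ii)
qed

end

section \<open>The vacuum space\<close>

text \<open>\<open>J\<close> is a complex structure compatible with \<omega>, and \<open>T\<close>
  carries the Euclidean product to the resulting symmetric form, which reduces all Gaussian
  integrals to standard ones.\<close>

locale bergman = quasi_periodic \<omega> c for \<omega> :: "real^'n \<Rightarrow> real^'n \<Rightarrow> real" and c :: "real^'n \<Rightarrow> complex" +
  fixes J :: "real^'n \<Rightarrow> real^'n" and T :: "real^'n^'n"
  assumes integral: "integral_class \<omega>" and nondeg: "nondegenerate \<omega>"
    and J_linear: "linear J" and JJ: "\<And>x. J (J x) = - x" and J_sym: "\<And>x y. \<omega> x (J y) = \<omega> y (J x)"
    and T: "\<And>z w. \<omega> (T *v z) (J (T *v w)) = z \<bullet> w" and det_T: "det T \<noteq> 0"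
begin

definition Q :: "real^'n \<Rightarrow> real^'n \<Rightarrow> real" where "Q x y = \<omega> x (J y)"

text \<open>The Hermitian form of \<omega> and \<open>J\<close>, complex linear in its second
  argument; exponentials of it are thus holomorphic there.\<close>

definition P :: "real^'n \<Rightarrow> real^'n \<Rightarrow> complex" where "P x y = Complex (Q x y) (\<omega> x y)"

text \<open>The equations on \<open>D\<close> are the Cauchy-Riemann equations for \<open>J\<close>:
  these are the holomorphic sections.\<close>

definition vac :: "(real^'n \<Rightarrow> complex) set" where
  "vac = {f \<in> qp. \<forall>v x. D (J v) f x = \<i> * D v f x}"

sublocale J: linear J by (rule J_linear)

lemma Q_bilinear: "bilinear Q"
  unfolding Q_def[abs_def] bilinear_def
  by (auto intro!: linearI simp: J.add J.scaleR bl_simps)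

lemma Q_sym: "Q x y = Q y x"
  unfolding Q_def by (rule J_sym)

lemma Q_J: "Q x (J y) = - \<omega> x y" "\<omega> x (J y) = Q x y"
  by (simp_all add: Q_def JJ bl_simps)

lemma Q_simps: "Q (x + y) z = Q x z + Q y z" "Q x (y + z) = Q x y + Q x z" "Q (r *\<^sub>R x) y = r * Q x y"
  "Q x (r *\<^sub>R y) = r * Q x y" "Q (x - y) z = Q x z - Q y z" "Q x (y - z) = Q x y - Q x z"
  "Q (- x) y = - Q x y" "Q x (- y) = - Q x y" "Q 0 y = 0" "Q x 0 = 0"
  using bilinear_ladd[OF Q_bilinear] bilinear_radd[OF Q_bilinear] bilinear_lmul[OF Q_bilinear]
    bilinear_rmul[OF Q_bilinear] bilinear_lsub[OF Q_bilinear] bilinear_rsub[OF Q_bilinear]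
    bilinear_lneg[OF Q_bilinear] bilinear_rneg[OF Q_bilinear] bilinear_lzero[OF Q_bilinear] bilinear_rzero[OF Q_bilinear]
  by auto

lemma P_simps: "P (x + y) z = P x z + P y z" "P x (y + z) = P x y + P x z" "P (r *\<^sub>R x) y = r * P x y"
  "P x (r *\<^sub>R y) = r * P x y" "P (x - y) z = P x z - P y z" "P x (y - z) = P x y - P x z"
  by (simp_all add: P_def Q_simps bl_simps complex_eq_iff)

lemma P_J: "P x (J y) = \<i> * P x y"
  by (simp add: P_def Q_J complex_eq_iff)

lemma P_eq: "P x y = Q x y + \<i> * \<omega> x y"
  by (simp add: P_def complex_eq_iff)

lemma T_inv: obtains T' where "T ** T' = mat 1" "T' ** T = mat 1"
  using det_T invertible_det_nz unfolding invertible_def by blast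

lemma Q_T: "Q (T *v z) (T *v z) = z \<bullet> z"
  unfolding Q_def by (rule T)

lemma Q_pos: "Q x x \<ge> 0" "x \<noteq> 0 \<Longrightarrow> Q x x > 0"
proof -
  obtain T' where T': "T ** T' = mat 1" using T_inv by blast
  have "x = T *v (T' *v x)" by (simp add: matrix_vector_mul_assoc T')
  then have e: "Q x x = (T' *v x) \<bullet> (T' *v x)" using Q_T by metis
  then show "Q x x \<ge> 0" by simp
  assume "x \<noteq> 0"
  then have "T' *v x \<noteq> 0" using \<open>x = T *v (T' *v x)\<close> by (metis matrix_vector_mult_0_right)
  then show "Q x x > 0" using e by simp
qed

definition gauss :: "real^'n \<Rightarrow> real" where "gauss x = exp (- (pi / 2) * Q x x)"

text \<open>The integral of \<open>gauss\<close> squared. It is the constant of the reproducing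
  formula and turns out to be the reciprocal of the vacuum dimension.\<close>

definition Z :: real where "Z = (\<integral>x. exp (- pi * Q x x) \<partial>lborel)"

lemma continuous_Q [continuous_intros]:
  "continuous_on S f \<Longrightarrow> continuous_on S g \<Longrightarrow> continuous_on S (\<lambda>x. Q (f x) (g x))"
  by (rule bilinear_continuous_on[OF Q_bilinear])

lemma continuous_\<omega> [continuous_intros]:
  "continuous_on S f \<Longrightarrow> continuous_on S g \<Longrightarrow> continuous_on S (\<lambda>x. \<omega> (f x) (g x))"
  by (rule bilinear_continuous_on[OF bl])

lemma continuous_gauss [continuous_intros]:
  "continuous_on S f \<Longrightarrow> continuous_on S (\<lambda>x. gauss (f x))"
  unfolding gauss_def by (intro continuous_intros)

lemma scaling_T: "lborel_scaling T (1 / \<bar>det T\<bar>)"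
  by (rule lborel_scaling_det[OF det_T])

lemma gauss_integrable':
  assumes "a > 0" shows "integrable lborel (\<lambda>x. exp (- a * Q x x))"
proof -
  have m: "(\<lambda>x. exp (- a * Q x x)) \<in> borel_measurable borel"
    by (intro borel_measurable_continuous_onI continuous_intros)
  show ?thesis
    by (rule iffD1[OF lborel_scaling_integrable_iff[OF scaling_T m]]) (simp only: Q_T gaussian_integrable_vec[OF assms])
qed

lemma gauss_integrable: "integrable lborel gauss"
  unfolding gauss_def[abs_def] by (rule gauss_integrable') simp

lemma Z_eq: "Z = \<bar>det T\<bar> * (\<integral>x. exp (- pi * ((x :: real^'n) \<bullet> x)) \<partial>lborel)"
proof -
  have m: "(\<lambda>x. exp (- pi * Q x x)) \<in> borel_measurable borel"
    by (intro borel_measurable_continuous_onI continuous_intros)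
  show ?thesis using lborel_scaling_integral[OF scaling_T m] det_T by (simp add: Z_def Q_T)
qed

definition rot :: "real \<Rightarrow> real^'n \<Rightarrow> real^'n" where "rot t x = cos t *\<^sub>R x + sin t *\<^sub>R J x"

lemma linear_rot: "linear (rot t)"
  by (intro linearI) (simp_all add: rot_def J.add J.scaleR algebra_simps)

lemma Q_rot: "Q (rot t x) (rot t x) = Q x x"
proof -
  have "Q (J x) (J x) = Q x x" using Q_J(1)[of "J x" x] Q_J(2)[of x x] skew[of "J x" x] by simp
  moreover have "Q x (J x) = 0" "Q (J x) x = 0" using Q_J(1)[of x x] Q_sym[of "J x" x] by (simp_all add: alt)
  ultimately have "Q (rot t x) (rot t x) = cos t * cos t * Q x x + sin t * sin t * Q x x"
    by (simp add: rot_def Q_simps)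
  also have "\<dots> = ((cos t)\<^sup>2 + (sin t)\<^sup>2) * Q x x"
    by (simp only: distrib_right power2_eq_square)
  finally show ?thesis by simp
qed

lemma rot_inverse: "rot (- t) (rot t x) = x"
proof -
  have "rot (- t) (rot t x) = (cos t * cos t) *\<^sub>R x + (sin t * sin t) *\<^sub>R x"
    by (simp add: rot_def J.add J.scaleR JJ algebra_simps)
  also have "\<dots> = ((cos t)\<^sup>2 + (sin t)\<^sup>2) *\<^sub>R x"
    by (simp only: scaleR_add_left power2_eq_square)
  finally show ?thesis by simp
qed

text \<open>\<open>rot t\<close> preserves the ellipsoid on which \<open>Q x x\<close> is below 1, a
  set of positive finite measure, so it preserves Lebesgue measure.\<close>

lemma scaling_rot: "lborel_scaling (matrix (rot t)) 1"
proof -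
  have mv: "matrix (rot t) *v x = rot t x" for t x by (simp add: matrix_works linear_rot)
  have "matrix (rot (- t)) ** matrix (rot t) = mat 1"
    unfolding matrix_eq by (simp add: mv rot_inverse flip: matrix_vector_mul_assoc)
  then have "det (matrix (rot t)) \<noteq> 0" by (metis det_I det_mul mult_zero_right zero_neq_one)
  then obtain k where k: "lborel_scaling (matrix (rot t)) k" by (rule lborel_scaling_exists)
  define S where "S = {x. Q x x < 1}"
  have S [measurable]: "S \<in> sets borel"
    unfolding S_def by (intro borel_open open_Collect_less continuous_intros)
  have "(*v) T -` S = ball 0 1"
    by (auto simp: S_def Q_T dist_norm norm_eq_sqrt_inner real_sqrt_less_iff)
  then have "emeasure lborel (ball 0 1 :: (real^'n) set) = ennreal (1 / \<bar>det T\<bar>) * emeasure lborel S"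
    using scaling_T S unfolding lborel_scaling_def by metis
  moreover have "unit_ball_vol (real CARD('n)) \<noteq> 0"
    using unit_ball_vol_pos[of "real CARD('n)"] by linarith
  then have "emeasure lborel (ball 0 1 :: (real^'n) set) \<noteq> 0" "emeasure lborel (ball 0 1 :: (real^'n) set) \<noteq> \<infinity>"
    using emeasure_ball[of 1 "0::real^'n"] unit_ball_vol_pos[of "real CARD('n)"] by simp_all
  ultimately have "emeasure lborel S \<noteq> 0" "emeasure lborel S \<noteq> \<infinity>"
    using det_T by (auto simp: ennreal_mult_eq_top_iff)
  moreover have "(*v) (matrix (rot t)) -` S = S" by (auto simp: S_def mv Q_rot)
  ultimately have "k = 1" by (intro lborel_scaling_eqI[OF k S]) auto
  then show ?thesis using k by simp
qed

text \<open>Quasi-periodicity is dropped, because it does not survive magnetic translation to an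
  arbitrary point.\<close>

definition local_vac :: "(real^'n \<Rightarrow> complex) \<Rightarrow> bool" where
  "local_vac f \<longleftrightarrow> smooth_on f UNIV \<and> (\<forall>v x. D (J v) f x = \<i> * D v f x)"

text \<open>Multiplied by \<open>exp (\<pi>/2 Q x x)\<close> a vacuum function becomes holomorphic for the complex structure \<open>J\<close>.\<close>

lemma local_vac_circle_mean:
  fixes f :: "real^'n \<Rightarrow> complex"
  assumes f: "local_vac f"
  shows "((\<lambda>t. f (rot (2 * pi * t) x) / gauss x) has_integral f 0) {0..1}"
proof -
  have sm: "smooth_on f UNIV" and vac: "\<And>v x. D (J v) f x = \<i> * D v f x"
    using f by (auto simp: local_vac_def)
  define F where "F y = exp (complex_of_real (pi / 2 * Q y y)) * f y" for y
  define L where "L y v = exp (complex_of_real (pi / 2 * Q y y)) * (D v f y + pi * P y v * f y)" for y v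
  have F: "(F has_derivative L y) (at y)" for y
  proof -
    have "bounded_bilinear Q" using Q_bilinear bilinear_conv_bounded_bilinear by blast
    from has_derivative_of_real[OF bounded_bilinear.FDERIV[OF this has_derivative_ident has_derivative_ident]]
    have "((\<lambda>z. complex_of_real (Q z z)) has_derivative (\<lambda>v. complex_of_real (Q y v + Q v y))) (at y)" .
    then have "((\<lambda>z. complex_of_real (pi / 2) * complex_of_real (Q z z)) has_derivative
        (\<lambda>v. complex_of_real (pi / 2) * complex_of_real (Q y v + Q v y))) (at y)"
      by (rule has_derivative_mult_right)
    moreover have "complex_of_real (pi / 2) * complex_of_real (Q y v + Q v y) = pi * complex_of_real (Q y v)" for v
      using Q_sym[of v y] by simp
    ultimately have q: "((\<lambda>z. complex_of_real (pi / 2 * Q z z)) has_derivative (\<lambda>v. pi * complex_of_real (Q y v))) (at y)"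
      by simp
    have "((\<lambda>z. exp (complex_of_real (pi / 2 * Q z z))) has_derivative
        (\<lambda>v. exp (complex_of_real (pi / 2 * Q y y)) * (pi * complex_of_real (Q y v)))) (at y)"
      using q DERIV_exp[THEN has_field_derivative_imp_has_derivative]
      by (rule has_derivative_compose)
    from has_derivative_mult[OF this has_derivative_D[OF sm]]
    show ?thesis unfolding F_def[abs_def]
      by (rule has_derivative_eq_rhs) (simp add: L_def P_eq fun_eq_iff algebra_simps)
  qed
  have LJ: "L y (J v) = \<i> * L y v" for y v by (simp add: L_def vac P_J algebra_simps)
  have L_lin: "linear (L y)" for y using F has_derivative_linear by blast
  \<comment> \<open>The restriction of \<open>F\<close> to the complex line through
    \<open>x\<close>, where \<open>rot\<close> is multiplication by \<open>cis\<close>; Cauchy's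
    formula on the unit circle gives the mean.\<close>
  define g where "g w = F (Re w *\<^sub>R x + Im w *\<^sub>R J x)" for w
  have "(g has_field_derivative L (Re w *\<^sub>R x + Im w *\<^sub>R J x) x) (at w)" for w
  proof -
    let ?y = "Re w *\<^sub>R x + Im w *\<^sub>R J x"
    have "((\<lambda>w. Re w *\<^sub>R x + Im w *\<^sub>R J x) has_derivative (\<lambda>\<eta>. Re \<eta> *\<^sub>R x + Im \<eta> *\<^sub>R J x)) (at w)"
      by (intro derivative_intros has_derivative_scaleR_left bounded_linear_imp_has_derivative bounded_linear_Re bounded_linear_Im)
    from has_derivative_compose[OF this F]
    have "(g has_derivative (\<lambda>\<eta>. L ?y (Re \<eta> *\<^sub>R x + Im \<eta> *\<^sub>R J x))) (at w)"
      by (simp add: g_def[abs_def])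
    moreover have "L ?y (Re \<eta> *\<^sub>R x + Im \<eta> *\<^sub>R J x) = L ?y x * \<eta>" for \<eta>
    proof -
      interpret l: linear "L ?y" by (rule L_lin)
      show ?thesis by (simp only: l.add l.scaleR LJ) (simp add: complex_eq_iff algebra_simps)
    qed
    ultimately show ?thesis by (simp add: has_field_derivative_def)
  qed
  then have "g holomorphic_on cball 0 1"
    using holomorphic_onI field_differentiable_at_within field_differentiable_def by (metis (no_types, lifting))
  then have "((\<lambda>u. g u / (u - 0)) has_contour_integral (2 * of_real pi * \<i> * g 0)) (circlepath 0 1)"
    by (intro Cauchy_integral_circlepath_simple) auto
  then have "((\<lambda>t. g (circlepath 0 1 t) / circlepath 0 1 t * vector_derivative (circlepath 0 1) (at t within {0..1}))
      has_integral 2 * of_real pi * \<i> * g 0) {0..1}"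
    by (simp add: has_contour_integral_def)
  then have "((\<lambda>t. 2 * of_real pi * \<i> * g (cis (2 * pi * t))) has_integral 2 * of_real pi * \<i> * g 0) {0..1}"
  proof (rule has_integral_eq[rotated])
    fix t :: real assume t: "t \<in> {0..1}"
    have c: "circlepath 0 1 t = cis (2 * pi * t)" by (simp add: circlepath cis_conv_exp mult_ac)
    have v: "vector_derivative (circlepath 0 1) (at t within {0..1}) = 2 * of_real pi * \<i> * cis (2 * pi * t)"
      using t vector_derivative_circlepath01[of t 0 1] by (simp add: cis_conv_exp mult_ac)
    show "g (circlepath 0 1 t) / circlepath 0 1 t * vector_derivative (circlepath 0 1) (at t within {0..1}) =
        2 * of_real pi * \<i> * g (cis (2 * pi * t))"
      unfolding v c by simp
  qed
  then have "((\<lambda>t. (1 / (2 * of_real pi * \<i>)) * (2 * of_real pi * \<i> * g (cis (2 * pi * t)))) has_integral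
      (1 / (2 * of_real pi * \<i>)) * (2 * of_real pi * \<i> * g 0)) {0..1}"
    by (rule has_integral_mult_right)
  then have "((\<lambda>t. g (cis (2 * pi * t))) has_integral g 0) {0..1}" by simp
  moreover have "g 0 = f 0" by (simp add: g_def F_def Q_simps)
  moreover have "g (cis (2 * pi * t)) = f (rot (2 * pi * t) x) / gauss x" for t
  proof -
    have "g (cis (2 * pi * t)) = F (rot (2 * pi * t) x)" by (simp add: g_def rot_def)
    also have "\<dots> = exp (complex_of_real (pi / 2 * Q x x)) * f (rot (2 * pi * t) x)" by (simp add: F_def Q_rot)
    also have "\<dots> = f (rot (2 * pi * t) x) / gauss x"
      by (simp add: gauss_def exp_minus field_simps flip: exp_of_real)
    finally show ?thesis .
  qed
  ultimately show ?thesis by simp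
qed

text \<open>The Gaussian weight and Lebesgue measure are invariant under \<open>rot\<close>, so the
  integrand may be averaged over the circle action; the circle mean then leaves \<open>f 0\<close>
  times the square of \<open>gauss\<close>.\<close>

lemma local_vac_mean_value:
  fixes f :: "real^'n \<Rightarrow> complex"
  assumes f: "local_vac f" and bdd: "\<And>x. norm (f x) \<le> C"
  shows "(\<integral>x. gauss x * f x \<partial>lborel) = Z * f 0"
proof -
  have cont: "continuous_on UNIV f" using f smooth_on_imp_continuous_on by (auto simp: local_vac_def)
  have fm [measurable]: "f \<in> borel_measurable borel" by (rule borel_measurable_continuous_onI[OF cont])
  have gm [measurable]: "gauss \<in> borel_measurable borel" using gauss_integrable borel_measurable_integrable by force
  have int: "integrable lborel (\<lambda>x. gauss x * f x)"
  proof (rule Bochner_Integration.integrable_bound)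
    show "integrable lborel (\<lambda>x. C * gauss x)" using gauss_integrable by simp
    have "norm (gauss x * f x) \<le> norm (C * gauss x)" for x
      using mult_right_mono[OF bdd[of x], of "gauss x"] order_trans[OF norm_ge_zero bdd[of x]]
      by (simp add: norm_mult gauss_def mult.commute abs_mult)
    then show "AE x in lborel. norm (gauss x * f x) \<le> norm (C * gauss x)" by simp
  qed measurable
  \<comment> \<open>Integrated over \<open>x\<close> first, \<open>k\<close> gives the desired
    integral for every angle; integrated over the angle first, it gives the circle mean. Fubini
    equates the two.\<close>
  define k where "k = (\<lambda>(t, x). indicator {0..1} t *\<^sub>R (complex_of_real (gauss x) * f (rot (2 * pi * t) x)))"
  have rotc: "continuous_on UNIV (\<lambda>p. rot (2 * pi * fst p) (snd p))"
  proof -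
    have "continuous_on UNIV (\<lambda>p::real \<times> (real^'n). J (snd p))"
      by (intro continuous_on_compose2[OF linear_continuous_on[of J UNIV]] continuous_intros) (auto simp: linear_linear J_linear)
    then show ?thesis unfolding rot_def by (intro continuous_intros)
  qed
  have "continuous_on UNIV (\<lambda>p. complex_of_real (gauss (snd p)) * f (rot (2 * pi * fst p) (snd p)))"
    by (intro continuous_intros continuous_on_compose2[OF cont rotc]) auto
  then have [measurable]: "(\<lambda>p. complex_of_real (gauss (snd p)) * f (rot (2 * pi * fst p) (snd p))) \<in> borel_measurable (borel \<Otimes>\<^sub>M borel)"
    unfolding borel_prod by (rule borel_measurable_continuous_onI)
  have km: "k \<in> borel_measurable (lborel \<Otimes>\<^sub>M lborel)"
    unfolding k_def case_prod_beta by measurable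
  have mv: "matrix (rot t) *v x = rot t x" for t x by (simp add: matrix_works linear_rot)
  have rot_int: "(\<integral>x. gauss x * f (rot t x) \<partial>lborel) = (\<integral>x. gauss x * f x \<partial>lborel)"
    and rot_integrable: "integrable lborel (\<lambda>x. gauss x * f (rot t x))" 
    and rot_norm: "(\<integral>x. norm (gauss x * f (rot t x)) \<partial>lborel) = (\<integral>x. norm (gauss x * f x) \<partial>lborel)" for t
  proof -
    have e: "gauss x * f (rot t x) = (\<lambda>x. gauss x * f x) (matrix (rot t) *v x)" for x
      by (simp add: mv gauss_def Q_rot)
    show "(\<integral>x. gauss x * f (rot t x) \<partial>lborel) = (\<integral>x. gauss x * f x \<partial>lborel)"
      unfolding e by (subst lborel_scaling_integral[OF scaling_rot]) auto
    show "integrable lborel (\<lambda>x. gauss x * f (rot t x))"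
      unfolding e by (subst lborel_scaling_integrable_iff[OF scaling_rot]) (auto intro: int)
    show "(\<integral>x. norm (gauss x * f (rot t x)) \<partial>lborel) = (\<integral>x. norm (gauss x * f x) \<partial>lborel)"
      unfolding e by (subst lborel_scaling_integral[OF scaling_rot, of "\<lambda>x. norm (gauss x * f x)"]) auto
  qed
  have ind: "integrable lborel (\<lambda>t::real. indicator {0..1} t * r)" for r :: real
    by (intro integrable_mult_left) simp
  have kint: "integrable (lborel \<Otimes>\<^sub>M lborel) k"
  proof (rule lborel_pair.Fubini_integrable[OF km])
    have "(\<integral>x. norm (k (t, x)) \<partial>lborel) = indicator {0..1} t * (\<integral>x. norm (gauss x * f x) \<partial>lborel)" for t
      using rot_norm[of "2 * pi * t"] by (simp add: k_def)
    then show "integrable lborel (\<lambda>t. \<integral>x. norm (k (t, x)) \<partial>lborel)" using ind by simp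
    show "AE t in lborel. integrable lborel (\<lambda>x. k (t, x))"
      using rot_integrable by (simp add: k_def)
  qed
  have inner: "(\<integral>t. k (t, x) \<partial>lborel) = exp (- pi * Q x x) * f 0" for x
  proof -
    have ct: "continuous_on {0..1} (\<lambda>t. f (rot (2 * pi * t) x) / gauss x)"
      unfolding rot_def by (intro continuous_intros continuous_on_compose2[OF cont]) (auto simp: gauss_def)
    have si: "set_integrable lborel {0..1} (\<lambda>t. f (rot (2 * pi * t) x) / gauss x)"
      by (rule borel_integrable_atLeastAtMost'[OF ct])
    have "(LINT t:{0..1}|lborel. f (rot (2 * pi * t) x) / gauss x) = f 0"
      unfolding set_borel_integral_eq_integral(2)[OF si] by (rule integral_unique[OF local_vac_circle_mean[OF f]])
    then have e: "(\<integral>t. indicator {0..1} t *\<^sub>R (f (rot (2 * pi * t) x) / gauss x) \<partial>lborel) = f 0"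
      by (simp only: set_lebesgue_integral_def)
    have "k (t, x) = (gauss x)\<^sup>2 * (indicator {0..1} t *\<^sub>R (f (rot (2 * pi * t) x) / gauss x))" for t
      by (simp add: k_def power2_eq_square gauss_def field_simps)
    then have "(\<integral>t. k (t, x) \<partial>lborel) = (gauss x)\<^sup>2 * f 0"
      by (simp only: integral_mult_right_zero e)
    moreover have "(gauss x)\<^sup>2 = exp (- pi * Q x x)" by (simp add: gauss_def power2_eq_square flip: exp_add)
    ultimately show ?thesis by (simp flip: of_real_power)
  qed
  have "(\<integral>x. \<integral>t. k (t, x) \<partial>lborel \<partial>lborel) = (\<integral>t. \<integral>x. k (t, x) \<partial>lborel \<partial>lborel)"
    using lborel_pair.Fubini_integral[of "\<lambda>t x. k (t, x)"] kint by simp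
  moreover have "(\<integral>x. \<integral>t. k (t, x) \<partial>lborel \<partial>lborel) = Z * f 0"
    unfolding inner Z_def by simp
  moreover have "(\<integral>x. k (t, x) \<partial>lborel) = indicator {0..1} t *\<^sub>R (\<integral>x. gauss x * f x \<partial>lborel)" for t
    using rot_int[of "2 * pi * t"] by (simp add: k_def)
  then have "(\<integral>t. \<integral>x. k (t, x) \<partial>lborel \<partial>lborel) = (\<integral>x. gauss x * f x \<partial>lborel)"
    by simp
  ultimately show ?thesis by simp
qed

end

section \<open>Series of exponentials of linear functionals\<close>

lemma suminf_bij:
  fixes f :: "nat \<Rightarrow> 'a::banach"
  assumes "bij \<pi>" "summable (\<lambda>n. norm (f n))"
  shows "(\<Sum>n. f (\<pi> n)) = (\<Sum>n. f n)"
proof -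
  have "(f has_sum (\<Sum>n. f n)) UNIV"
    by (rule norm_summable_imp_has_sum[OF assms(2) summable_sums[OF summable_norm_cancel[OF assms(2)]]])
  then have "((\<lambda>n. f (\<pi> n)) has_sum (\<Sum>n. f n)) UNIV"
    using has_sum_reindex_bij_betw[of \<pi> UNIV UNIV f] assms(1) by simp
  then show ?thesis by (rule sums_unique[OF has_sum_imp_sums, symmetric])
qed

text \<open>The coefficients decay faster than every exponential of \<open>norm (w n)\<close>.
  Differentiation multiplies them by a factor of linear growth in \<open>norm (w n)\<close>, which
  such decay absorbs, so the class is closed under termwise derivatives.\<close>

lemma
  fixes \<kappa> :: "nat \<Rightarrow> complex" and l :: "nat \<Rightarrow> real^'n \<Rightarrow> complex" and w :: "nat \<Rightarrow> real^'n"
  assumes l: "\<And>n. linear (l n)" "\<And>n y. norm (l n y) \<le> L * norm (w n) * norm y"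
    and \<kappa>: "\<And>R. summable (\<lambda>n. norm (\<kappa> n) * exp (R * norm (w n)))"
  shows exp_series_has_derivative:
      "((\<lambda>y. \<Sum>n. \<kappa> n * exp (l n y)) has_derivative (\<lambda>u. \<Sum>n. \<kappa> n * l n u * exp (l n y))) (at y)"
    and exp_series_coeff: "summable (\<lambda>n. norm (\<kappa> n * l n u) * exp (R * norm (w n)))"
    and exp_series_summable: "summable (\<lambda>n. norm (\<kappa> n * exp (l n y)))"
proof -
  have L: "norm (l n y) \<le> \<bar>L\<bar> * norm (w n) * norm y" for n y
    using l(2)[of n y] by (rule order_trans) (intro mult_right_mono; simp)
  have ex: "norm (exp (l n y)) \<le> exp (\<bar>L\<bar> * r * norm (w n))" if "norm y \<le> r" for n y r
  proof -
    have "Re (l n y) \<le> norm (l n y)" by (rule complex_Re_le_cmod)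
    also have "\<dots> \<le> \<bar>L\<bar> * norm (w n) * norm y" by (rule L)
    also have "\<dots> \<le> \<bar>L\<bar> * norm (w n) * r" using that by (intro mult_left_mono) auto
    finally show ?thesis by (simp add: mult_ac)
  qed
  have wexp: "norm (w n) \<le> exp (norm (w n))" for n using exp_ge_add_one_self[of "norm (w n)"] by linarith
  show "summable (\<lambda>n. norm (\<kappa> n * exp (l n y)))" for y
  proof (rule summable_comparison_test'[OF \<kappa>[of "\<bar>L\<bar> * norm y"], of 0])
    show "norm (norm (\<kappa> n * exp (l n y))) \<le> norm (\<kappa> n) * exp (\<bar>L\<bar> * norm y * norm (w n))" for n
      using ex[of y "norm y" n] by (simp add: norm_mult mult_left_mono del: norm_exp_eq_Re)
  qed
  have b: "norm (\<kappa> n * l n u) * exp (R * norm (w n)) \<le> \<bar>L\<bar> * norm u * (norm (\<kappa> n) * exp ((R + 1) * norm (w n)))" for n u R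
  proof -
    have "norm (l n u) \<le> \<bar>L\<bar> * norm u * exp (norm (w n))"
      using L[of n u] mult_left_mono[OF wexp[of n], of "\<bar>L\<bar> * norm u"] by (simp add: mult_ac)
    then have "norm (\<kappa> n) * norm (l n u) * exp (R * norm (w n)) \<le> norm (\<kappa> n) * (\<bar>L\<bar> * norm u * exp (norm (w n))) * exp (R * norm (w n))"
      by (intro mult_right_mono mult_left_mono) auto
    also have "\<dots> = \<bar>L\<bar> * norm u * (norm (\<kappa> n) * exp ((R + 1) * norm (w n)))"
      by (simp add: distrib_right exp_add mult_ac)
    finally show ?thesis by (simp add: norm_mult)
  qed
  show summ': "summable (\<lambda>n. norm (\<kappa> n * l n u) * exp (R * norm (w n)))" for u R
    by (rule summable_comparison_test'[OF summable_mult[OF \<kappa>[of "R + 1"], of "\<bar>L\<bar> * norm u"], of 0])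
      (use b[of _ u R] in auto)
  define r where "r = norm y + 1"
  \<comment> \<open>A majorant for the derivatives that is uniform on the ball; one extra unit in
    the exponent pays for the linear factor \<open>l n h\<close>.\<close>
  define M where "M n = \<bar>L\<bar> * (norm (\<kappa> n) * exp ((\<bar>L\<bar> * r + 1) * norm (w n)))" for n
  have M: "summable M" unfolding M_def by (intro summable_mult \<kappa>)
  have bound: "norm (\<kappa> n * l n h * exp (l n x)) \<le> M n * norm h" if "x \<in> ball (0::real^'n) r" for n x h
  proof -
    have "norm (\<kappa> n * l n h * exp (l n x)) \<le> norm (\<kappa> n * l n h) * exp (\<bar>L\<bar> * r * norm (w n))"
      unfolding norm_mult[of "\<kappa> n * l n h"] using ex[of x r n] that by (intro mult_left_mono) auto
    also have "\<dots> \<le> M n * norm h" using b[of n h "\<bar>L\<bar> * r"] by (simp add: M_def mult_ac)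
    finally show ?thesis .
  qed
  have "\<exists>g. \<forall>x\<in>ball (0::real^'n) r. (\<lambda>n. \<kappa> n * exp (l n x)) sums (g x) \<and>
      (g has_derivative (\<lambda>h. \<Sum>n. \<kappa> n * l n h * exp (l n x))) (at x within ball (0::real^'n) r)"
  proof (rule has_derivative_series[where f' = "\<lambda>n (x::real^'n) h. \<kappa> n * l n h * exp (l n x)" and l = "\<Sum>n. \<kappa> n * exp (l n 0)" and x = 0])
    fix n x
    have "(l n has_derivative l n) (at x within ball (0::real^'n) r)"
      using l(1) by (intro bounded_linear_imp_has_derivative) (simp add: linear_linear)
    moreover have "(exp has_derivative (*) (exp z)) (at z)" for z :: complex
      using DERIV_exp by (simp add: has_field_derivative_def)
    ultimately have "((\<lambda>x. exp (l n x)) has_derivative (\<lambda>h. exp (l n x) * l n h)) (at x within ball (0::real^'n) r)"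
      by (rule has_derivative_compose)
    from has_derivative_mult_right[OF this, of "\<kappa> n"]
    show "((\<lambda>x. \<kappa> n * exp (l n x)) has_derivative (\<lambda>h. \<kappa> n * l n h * exp (l n x))) (at x within ball (0::real^'n) r)"
      by (simp add: mult_ac)
  next
    fix e :: real assume "e > 0"
    then have "\<forall>\<^sub>F n in sequentially. dist (\<Sum>i<n. M i) (\<Sum>n. M n) < e"
      using summable_LIMSEQ[OF M] tendstoD by blast
    then show "\<forall>\<^sub>F n in sequentially. \<forall>x\<in>ball (0::real^'n) r. \<forall>h. norm ((\<Sum>i<n. \<kappa> i * l i h * exp (l i x)) - (\<Sum>n. \<kappa> n * l n h * exp (l n x))) \<le> e * norm h"
    proof (eventually_elim, intro ballI allI)
      fix n x h assume n: "dist (\<Sum>i<n. M i) (\<Sum>n. M n) < e" and x: "x \<in> ball (0::real^'n) r"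
      let ?a = "\<lambda>i. \<kappa> i * l i h * exp (l i x)"
      have Ms: "summable (\<lambda>i. M i * norm h)" by (intro summable_mult2 M)
      have an: "summable (\<lambda>i. norm (?a i))"
        by (rule summable_comparison_test'[OF Ms, of 0]) (use bound[OF x] in auto)
      have "norm (sum ?a {..<n} - suminf ?a) = norm (\<Sum>i. ?a (i + n))"
        using suminf_minus_initial_segment[OF summable_norm_cancel[OF an], of n] by (simp add: norm_minus_commute)
      also have "\<dots> \<le> (\<Sum>i. norm (?a (i + n)))"
        by (rule summable_norm) (use an summable_ignore_initial_segment in blast)
      also have "\<dots> \<le> (\<Sum>i. M (i + n) * norm h)"
        using bound[OF x] summable_ignore_initial_segment[OF an, of n] summable_ignore_initial_segment[OF Ms, of n]
        by (intro suminf_le) auto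
      also have "\<dots> = (\<Sum>i. M (i + n)) * norm h"
        using summable_ignore_initial_segment[OF M, of n] by (rule suminf_mult2[symmetric])
      also have "(\<Sum>i. M (i + n)) \<le> e"
        using n suminf_minus_initial_segment[OF M, of n] by (simp add: dist_real_def)
      finally show "norm (sum ?a {..<n} - suminf ?a) \<le> e * norm h" by (simp add: mult_right_mono)
    qed
  next
    show "(0::real^'n) \<in> ball (0::real^'n) r" by (simp add: r_def add_nonneg_pos)
    show "(\<lambda>n. \<kappa> n * exp (l n 0)) sums (\<Sum>n. \<kappa> n * exp (l n 0))"
      by (rule summable_sums[OF summable_norm_cancel]) fact
  qed simp
  then obtain g where g: "\<And>x. x \<in> ball (0::real^'n) r \<Longrightarrow> (\<lambda>n. \<kappa> n * exp (l n x)) sums (g x)"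
    "\<And>x. x \<in> ball (0::real^'n) r \<Longrightarrow> (g has_derivative (\<lambda>h. \<Sum>n. \<kappa> n * l n h * exp (l n x))) (at x within ball (0::real^'n) r)"
    by blast
  have y: "y \<in> ball (0::real^'n) r" by (simp add: r_def)
  have "(g has_derivative (\<lambda>h. \<Sum>n. \<kappa> n * l n h * exp (l n y))) (at y)"
    using g(2)[OF y] y at_within_open[OF y open_ball] by simp
  then show "((\<lambda>y. \<Sum>n. \<kappa> n * exp (l n y)) has_derivative (\<lambda>u. \<Sum>n. \<kappa> n * l n u * exp (l n y))) (at y)"
    by (rule has_derivative_transform_within_open[OF _ open_ball y]) (use g(1) sums_unique in blast)
qed

lemma exp_series_smooth:
  fixes \<kappa> :: "nat \<Rightarrow> complex" and l :: "nat \<Rightarrow> real^'n \<Rightarrow> complex" and w :: "nat \<Rightarrow> real^'n"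
  assumes l: "\<And>n. linear (l n)" "\<And>n y. norm (l n y) \<le> L * norm (w n) * norm y"
    and \<kappa>: "\<And>R. summable (\<lambda>n. norm (\<kappa> n) * exp (R * norm (w n)))"
  shows "smooth_on (\<lambda>y. \<Sum>n. \<kappa> n * exp (l n y)) UNIV"
proof -
  define X where "X f \<longleftrightarrow> (\<exists>\<kappa>. (\<forall>R. summable (\<lambda>n. norm (\<kappa> n) * exp (R * norm (w n)))) \<and> f = (\<lambda>y. \<Sum>n. \<kappa> n * exp (l n y)))"
    for f :: "real^'n \<Rightarrow> complex"
  show ?thesis
  proof (rule smooth_on_coinduct[of X])
    show "X (\<lambda>y. \<Sum>n. \<kappa> n * exp (l n y))" unfolding X_def using \<kappa> by blast
  next
    fix f assume "X f"
    then obtain \<kappa> where k: "\<And>R. summable (\<lambda>n. norm (\<kappa> n) * exp (R * norm (w n)))" and f: "f = (\<lambda>y. \<Sum>n. \<kappa> n * exp (l n y))"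
      unfolding X_def by blast
    note d = exp_series_has_derivative[OF l k]
    have "f differentiable (at y)" for y unfolding f differentiable_def using d by blast
    moreover have "partial_deriv p f = (\<lambda>y. \<Sum>n. \<kappa> n * l n (axis p 1) * exp (l n y))" for p
      unfolding f using partial_deriv_eqI[OF d] by (rule ext)
    then have "X (partial_deriv p f)" for p
      unfolding X_def using exp_series_coeff[OF l k, of "axis p 1"] by (intro exI[of _ "\<lambda>n. \<kappa> n * l n (axis p 1)"]) auto
    ultimately show "f differentiable_on UNIV \<and> (\<forall>p. X (partial_deriv p f))"
      by (simp add: differentiable_on_def)
  qed
qed

section \<open>The theta kernel and its reproducing property\<close>

context bergman begin

lemma vac_qp: "f \<in> vac \<Longrightarrow> f \<in> qp"
  by (simp add: vac_def)

lemma vac_smooth: "f \<in> vac \<Longrightarrow> smooth_on f UNIV"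
  using vac_qp qp_smooth by blast

lemma vac_continuous: "f \<in> vac \<Longrightarrow> continuous_on UNIV f"
  using vac_smooth smooth_on_imp_continuous_on by blast

lemma vac_eq: "f \<in> vac \<Longrightarrow> D (J v) f x = \<i> * D v f x"
  by (simp add: vac_def)

lemma vac_add: "f \<in> vac \<Longrightarrow> g \<in> vac \<Longrightarrow> (\<lambda>x. f x + g x) \<in> vac"
  by (simp add: vac_def qp_add D_add qp_smooth algebra_simps)

lemma vac_scale: "f \<in> vac \<Longrightarrow> (\<lambda>x. k * f x) \<in> vac"
  by (simp add: vac_def qp_scale D_scale qp_smooth algebra_simps)

lemma qp_shift: "f \<in> qp \<Longrightarrow> v \<in> int_lattice \<Longrightarrow> f (v + x) = c v * cis (pi * \<omega> v x) * f x"
  by (simp add: qp_def add.commute[of v x])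

text \<open>Magnetic translations commute with the covariant derivatives. This one moves
  \<open>x\<close> to the origin, where the mean value property is available.\<close>

lemma translate_local_vac:
  fixes f :: "real^'n \<Rightarrow> complex"
  assumes f: "f \<in> vac"
  shows "local_vac (\<lambda>y. cis (- pi * \<omega> x y) * f (x + y))"
proof -
  have sm: "smooth_on f UNIV" using f by (rule vac_smooth)
  let ?e = "\<lambda>y. exp (\<i> * complex_of_real (- pi * \<omega> x y))"
  have lin: "linear (\<lambda>y. - pi * \<omega> x y)"
    using \<omega>_linear(2)[of x] by (simp add: linear_iff algebra_simps)
  have sme: "smooth_on ?e UNIV"
    by (intro smooth_on_exp smooth_on_mult smooth_on_const smooth_on_of_real_linear lin open_UNIV)
  have de: "(?e has_derivative (\<lambda>u. ?e y * (\<i> * complex_of_real (- pi * \<omega> x u)))) (at y)" for y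
  proof -
    have "((\<lambda>y. complex_of_real (- pi * \<omega> x y)) has_derivative (\<lambda>u. complex_of_real (- pi * \<omega> x u))) (at y)"
      by (intro bounded_linear_imp_has_derivative bounded_linear_compose[OF bounded_linear_of_real])
        (use lin in \<open>simp only: linear_linear\<close>)
    from has_derivative_mult_right[OF this, of \<i>] show ?thesis
      using DERIV_exp[THEN has_field_derivative_imp_has_derivative] by (rule has_derivative_compose)
  qed
  have df: "((\<lambda>y. f (x + y)) has_derivative frechet_derivative f (at (x + y))) (at y)" for y
    by (rule has_derivative_eq_rhs, rule has_derivative_compose[OF _ smooth_has_derivative[OF sm]])
      (auto intro!: derivative_eq_intros)
  have smt: "smooth_on (\<lambda>y. f (x + y)) UNIV"
  proof (rule smooth_on_coinduct[of "\<lambda>g. \<exists>h. smooth_on h UNIV \<and> g = (\<lambda>y. h (x + y))"])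
    show "\<exists>h. smooth_on h UNIV \<and> (\<lambda>y. f (x + y)) = (\<lambda>y. h (x + y))" using sm by blast
    fix g assume "\<exists>h. smooth_on h UNIV \<and> g = (\<lambda>y. h (x + y))"
    then obtain h where h: "smooth_on h UNIV" and g: "g = (\<lambda>y. h (x + y))" by blast
    have d: "(g has_derivative frechet_derivative h (at (x + y))) (at y)" for y unfolding g
      by (rule has_derivative_eq_rhs, rule has_derivative_compose[OF _ smooth_has_derivative[OF h]])
        (auto intro!: derivative_eq_intros)
    then have pd: "partial_deriv p g = (\<lambda>y. partial_deriv p h (x + y))" for p
      using partial_deriv_eqI[OF d] by (simp add: partial_deriv_def fun_eq_iff)
    show "g differentiable_on UNIV \<and> (\<forall>p. \<exists>h. smooth_on h UNIV \<and> partial_deriv p g = (\<lambda>y. h (x + y)))"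
    proof (intro conjI allI)
      show "g differentiable_on UNIV" using d by (auto simp: differentiable_on_def differentiable_def)
      show "\<exists>h. smooth_on h UNIV \<and> partial_deriv p g = (\<lambda>y. h (x + y))" for p
        using pd smooth_on_partial_deriv[OF h] by blast
    qed
  qed
  have "D v (\<lambda>y. ?e y * f (x + y)) y = ?e y * D v f (x + y)" for v y
    by (subst D_eqI[OF has_derivative_mult[OF de df]]) (simp add: D_def bl_simps algebra_simps)
  then have "local_vac (\<lambda>y. ?e y * f (x + y))"
    unfolding local_vac_def using smooth_on_mult[OF open_UNIV sme smt] vac_eq[OF f] by simp
  then show ?thesis by (simp add: cis_conv_exp)
qed

lemma vac_bounded:
  fixes f :: "real^'n \<Rightarrow> complex"
  assumes "f \<in> vac"
  obtains C where "\<And>x. norm (f x) \<le> C"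
  using qp_attains_sup[OF vac_qp[OF assms]] by metis

text \<open>The Gaussian moved from the origin to \<open>x\<close> by a magnetic translation, that
  is, the Bergman kernel of the covering space up to normalisation and conjugation.\<close>

definition kern :: "real^'n \<Rightarrow> real^'n \<Rightarrow> complex" where
  "kern x y = gauss (y - x) * cis (- pi * \<omega> x y)"

text \<open>What the cell translated by \<open>v\<close> contributes when the integral against
  \<open>kern\<close> is folded onto the torus; \<open>c\<close> and \<open>cis\<close> are the
  multiplier of the function integrated.\<close>

definition kern_term :: "real^'n \<Rightarrow> real^'n \<Rightarrow> real^'n \<Rightarrow> complex" where
  "kern_term x v y = kern x (v + y) * c v * cis (pi * \<omega> v y)"

text \<open>The conjugation compensates the one that \<open>ip\<close> applies to its second
  argument.\<close>

definition theta :: "real^'n \<Rightarrow> real^'n \<Rightarrow> complex" where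
  "theta x y = cnj (\<Sum>n. kern_term x (lattice_enum n) y)"

lemma continuous_kern: "continuous_on S f \<Longrightarrow> continuous_on S (\<lambda>y. kern x (f y))"
  unfolding kern_def by (intro continuous_intros)

lemma kern_reproducing:
  fixes f :: "real^'n \<Rightarrow> complex"
  assumes f: "f \<in> vac"
  shows "integrable lborel (\<lambda>y. kern x y * f y)" "(\<integral>y. kern x y * f y \<partial>lborel) = Z * f x"
proof -
  obtain C where C: "\<And>x. norm (f x) \<le> C" using vac_bounded[OF f] by blast
  have cont: "continuous_on UNIV f" using f by (rule vac_continuous)
  have gm: "(\<lambda>y. kern x y * f y) \<in> borel_measurable borel"
    by (intro borel_measurable_continuous_onI continuous_on_mult continuous_kern cont continuous_on_id)
  have e: "kern x (x + y) * f (x + y) = gauss y * (cis (- pi * \<omega> x y) * f (x + y))" for y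
    by (simp add: kern_def bl_simps alt)
  have "(\<integral>y. kern x y * f y \<partial>lborel) = (\<integral>y. gauss y * (cis (- pi * \<omega> x y) * f (x + y)) \<partial>lborel)"
    using lborel_integral_shift[OF gm, of x] by (simp add: e)
  also have "\<dots> = Z * (cis (- pi * \<omega> x 0) * f (x + 0))"
    by (rule local_vac_mean_value[where C = C, OF translate_local_vac[OF f]]) (use C in \<open>simp add: norm_mult\<close>)
  finally show "(\<integral>y. kern x y * f y \<partial>lborel) = Z * f x" by (simp add: bl_simps)
  have "integrable lborel (\<lambda>y. gauss y * (cis (- pi * \<omega> x y) * f (x + y)))"
  proof (rule Bochner_Integration.integrable_bound)
    show "integrable lborel (\<lambda>y. C * gauss y)" using gauss_integrable by simp
    have "norm (gauss y * (cis (- pi * \<omega> x y) * f (x + y))) \<le> norm (C * gauss y)" for y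
      using mult_right_mono[OF C[of "x + y"], of "gauss y"] order_trans[OF norm_ge_zero C[of "x + y"]]
      by (simp add: norm_mult gauss_def mult.commute abs_mult)
    then show "AE y in lborel. norm (gauss y * (cis (- pi * \<omega> x y) * f (x + y))) \<le> norm (C * gauss y)" by simp
    show "(\<lambda>y. gauss y * (cis (- pi * \<omega> x y) * f (x + y))) \<in> borel_measurable lborel"
      by (simp, intro borel_measurable_continuous_onI continuous_intros continuous_on_compose2[OF cont]) auto
  qed
  then show "integrable lborel (\<lambda>y. kern x y * f y)"
    using lborel_integrable_shift[OF gm, of x] by (simp add: e)
qed

text \<open>The complex conjugates of the terms of the theta series are, up to a common Gaussian factor,
  exponentials of linear functionals.\<close>

definition coef :: "real^'n \<Rightarrow> nat \<Rightarrow> complex" where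
  "coef x n = gauss (x - lattice_enum n) * cis (pi * \<omega> x (lattice_enum n)) * cnj (c (lattice_enum n))"

lemma gauss_diff: "gauss (y - w) = gauss y * exp (pi * Q w y) * gauss w"
  unfolding gauss_def exp_add[symmetric] by (simp add: Q_simps Q_sym[of y w] algebra_simps)

lemma cnj_kern_term:
  "cnj (kern_term x (lattice_enum n) y) = gauss y * (coef x n * exp (pi * P (x - lattice_enum n) y))"
proof -
  let ?v = "lattice_enum n" and ?w = "x - lattice_enum n"
  have "?v + y - x = y - ?w" by simp
  then have g: "gauss (?v + y - x) = gauss y * exp (pi * Q ?w y) * gauss ?w" using gauss_diff by metis
  have "exp (pi * P ?w y) = exp (pi * Q ?w y) * cis (pi * \<omega> ?w y)"
    unfolding P_eq by (simp add: cis_conv_exp distrib_left exp_add mult_ac flip: exp_of_real)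
  moreover have "cis (pi * \<omega> x (?v + y)) * cis (- pi * \<omega> ?v y) = cis (pi * \<omega> x ?v) * cis (pi * \<omega> ?w y)"
    by (simp add: cis_mult bl_simps algebra_simps)
  ultimately show ?thesis
    unfolding kern_term_def kern_def g coef_def by (simp add: cis_cnj mult_ac)
qed

lemma P_bound: obtains L where "\<And>w y. norm (pi * P w y) \<le> L * norm w * norm y"
proof -
  have "bounded_bilinear Q" "bounded_bilinear \<omega>" using Q_bilinear bl bilinear_conv_bounded_bilinear by blast+
  then obtain K1 K2 where K: "\<And>w y. norm (Q w y) \<le> norm w * norm y * K1" "\<And>w y. norm (\<omega> w y) \<le> norm w * norm y * K2"
    using bounded_bilinear.bounded by metis
  have "norm (pi * P w y) \<le> pi * (K1 + K2) * norm w * norm y" for w y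
  proof -
    have "norm (P w y) \<le> \<bar>Q w y\<bar> + \<bar>\<omega> w y\<bar>" using cmod_le[of "P w y"] by (simp add: P_def)
    also have "\<dots> \<le> norm w * norm y * (K1 + K2)" using K[of w y] by (simp add: distrib_left)
    finally have "pi * norm (P w y) \<le> pi * (norm w * norm y * (K1 + K2))" by (intro mult_left_mono) auto
    then show ?thesis by (simp add: norm_mult mult_ac)
  qed
  then show thesis by (rule that)
qed

lemma P_linear: "linear (\<lambda>y. pi * P w y)"
  by (intro linearI; simp only: P_simps) (simp_all add: algebra_simps scaleR_conv_of_real)

lemma coef_summable: "summable (\<lambda>n. norm (coef x n) * exp (R * norm (x - lattice_enum n)))"
proof -
  obtain q where q: "q > 0" "\<And>x. q * (norm x)\<^sup>2 \<le> Q x x"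
    using pos_def_bound[OF Q_bilinear] Q_pos(2) by metis
  define \<alpha> where "\<alpha> = pi / 2 * q"
  have \<alpha>: "\<alpha> > 0" using q by (simp add: \<alpha>_def)
  \<comment> \<open>Young's inequality absorbs \<open>R * t\<close> into half of the Gaussian
    exponent; the other half is compared with the squared norm of the lattice vector through
    \<open>norm v \<le> t + norm x\<close>. The two constants left over add up to
    \<open>C\<close>.\<close>
  define C where "C = R\<^sup>2 / (2 * \<alpha>) + \<alpha> / 2 * (norm x)\<^sup>2"
  have "summable (\<lambda>n. exp C * exp (- (\<alpha> / 4) * (norm (lattice_enum n :: real^'n))\<^sup>2))"
    using \<alpha> by (intro summable_mult lattice_gaussian_summable) simp
  then show ?thesis
  proof (rule summable_comparison_test'[of _ 0])
    fix n
    let ?v = "lattice_enum n :: real^'n"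
    define t where "t = norm (x - ?v)"
    have "norm (coef x n) = gauss (x - ?v)" using norm_c[OF lattice_enum_in] by (simp add: coef_def norm_mult gauss_def)
    also have "\<dots> \<le> exp (- \<alpha> * t\<^sup>2)"
      unfolding gauss_def \<alpha>_def using q(2)[of "x - ?v"] by (simp add: t_def mult_ac)
    finally have "norm (coef x n) * exp (R * t) \<le> exp (- \<alpha> * t\<^sup>2) * exp (R * t)" by (intro mult_right_mono) auto
    also have "\<dots> = exp (R * t - \<alpha> * t\<^sup>2)" by (simp add: exp_diff exp_minus divide_inverse)
    also have "\<dots> \<le> exp (C + - (\<alpha> / 4) * (norm ?v)\<^sup>2)"
    proof -
      have "R * t \<le> R\<^sup>2 / (2 * \<alpha>) + \<alpha> / 2 * t\<^sup>2"
      proof -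
        have "0 \<le> (R - \<alpha> * t)\<^sup>2 / (2 * \<alpha>)" using \<alpha> by simp
        also have "\<dots> = R\<^sup>2 / (2 * \<alpha>) + \<alpha> / 2 * t\<^sup>2 - R * t" using \<alpha> by (simp add: power2_eq_square field_simps)
        finally show ?thesis by simp
      qed
      moreover have "\<alpha> / 4 * (norm ?v)\<^sup>2 \<le> \<alpha> / 2 * t\<^sup>2 + \<alpha> / 2 * (norm x)\<^sup>2"
      proof -
        have "norm ?v \<le> t + norm x" using norm_triangle_ineq[of "?v - x" x] by (simp add: t_def norm_minus_commute)
        then have "(norm ?v)\<^sup>2 \<le> (t + norm x)\<^sup>2" by (intro power_mono) auto
        also have "\<dots> \<le> 2 * t\<^sup>2 + 2 * (norm x)\<^sup>2" using sum_squares_bound[of t "norm x"] by (simp add: power2_sum)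
        finally show ?thesis using mult_left_mono[of "(norm ?v)\<^sup>2" "2 * t\<^sup>2 + 2 * (norm x)\<^sup>2" "\<alpha> / 4"] \<alpha> by (simp add: algebra_simps)
      qed
      ultimately show ?thesis by (simp add: C_def)
    qed
    also have "\<dots> = exp C * exp (- (\<alpha> / 4) * (norm ?v)\<^sup>2)" by (rule exp_add)
    finally show "norm (norm (coef x n) * exp (R * norm (x - ?v))) \<le> exp C * exp (- (\<alpha> / 4) * (norm ?v)\<^sup>2)"
      by (simp add: t_def)
  qed
qed

lemma kern_term_summable: "summable (\<lambda>n. norm (kern_term x (lattice_enum n) y))"
proof -
  obtain L where L: "\<And>w y. norm (pi * P w y) \<le> L * norm w * norm y" using P_bound by blast
  have "summable (\<lambda>n. norm (coef x n * exp (pi * P (x - lattice_enum n) y)))"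
    by (rule exp_series_summable[OF P_linear L coef_summable])
  then have "summable (\<lambda>n. gauss y * norm (coef x n * exp (pi * P (x - lattice_enum n) y)))" by (rule summable_mult)
  moreover have "norm (kern_term x (lattice_enum n) y) = gauss y * norm (coef x n * exp (pi * P (x - lattice_enum n) y))" for n
    using arg_cong[OF cnj_kern_term[of x n y], of norm] by (simp only: complex_mod_cnj norm_mult norm_of_real) (simp add: gauss_def)
  ultimately show ?thesis by simp
qed

lemma theta_series: "theta x y = gauss y * (\<Sum>n. coef x n * exp (pi * P (x - lattice_enum n) y))"
proof -
  obtain L where L: "\<And>w y. norm (pi * P w y) \<le> L * norm w * norm y" using P_bound by blast
  have s: "summable (\<lambda>n. coef x n * exp (pi * P (x - lattice_enum n) y))"
    using exp_series_summable[OF P_linear L coef_summable] by (rule summable_norm_cancel)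
  have "theta x y = (\<Sum>n. cnj (kern_term x (lattice_enum n) y))"
    unfolding theta_def using bounded_linear.suminf[OF bounded_linear_cnj summable_norm_cancel[OF kern_term_summable]] .
  also have "\<dots> = gauss y * (\<Sum>n. coef x n * exp (pi * P (x - lattice_enum n) y))"
    unfolding cnj_kern_term by (rule suminf_mult[OF s])
  finally show ?thesis .
qed

text \<open>The derivative of the Gaussian prefactor and the connection term combine to
  \<open>- pi * P y v\<close>. Together with the exponents of the series, every dependence on
  \<open>v\<close> is then complex linear for \<open>J\<close>.\<close>

lemma theta_local_vac: "local_vac (theta x)"
proof -
  obtain L where L: "\<And>w y. norm (pi * P w y) \<le> L * norm w * norm y" using P_bound by blast
  define S where "S y = (\<Sum>n. coef x n * exp (pi * P (x - lattice_enum n) y))" for y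
  define S' where "S' y v = (\<Sum>n. coef x n * (pi * P (x - lattice_enum n) v) * exp (pi * P (x - lattice_enum n) y))" for y v
  have th: "theta x = (\<lambda>y. exp (- complex_of_real (pi / 2 * Q y y)) * S y)"
    by (simp add: fun_eq_iff theta_series S_def gauss_def flip: exp_of_real)
  have dS: "(S has_derivative S' y) (at y)" for y
    unfolding S_def[abs_def] S'_def[abs_def] by (rule exp_series_has_derivative[OF P_linear L coef_summable])
  have smS: "smooth_on S UNIV"
    unfolding S_def[abs_def] by (rule exp_series_smooth[OF P_linear L coef_summable])
  have "Q y y = (\<Sum>p\<in>UNIV. \<Sum>q\<in>UNIV. y $ p * gram Q $ p $ q * y $ q)" for y
    by (rule bilinear_gram[OF Q_bilinear])
  then have Qs: "complex_of_real (Q y y) = (\<Sum>p\<in>UNIV. \<Sum>q\<in>UNIV. complex_of_real (y $ p) * complex_of_real (gram Q $ p $ q) * complex_of_real (y $ q))" for y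
    by simp
  have comp: "linear (\<lambda>y::real^'n. y $ p)" for p by (intro linearI) auto
  have "smooth_on (\<lambda>y. exp (- (pi / 2 * complex_of_real (Q y y)))) UNIV"
    unfolding Qs by (intro smooth_on_exp smooth_on_minus smooth_on_mult smooth_on_sum smooth_on_const smooth_on_of_real_linear comp open_UNIV)
  then have sm: "smooth_on (theta x) UNIV" unfolding th using smS by (intro smooth_on_mult open_UNIV) simp_all
  have q: "((\<lambda>z. - complex_of_real (pi / 2 * Q z z)) has_derivative (\<lambda>v. - (pi * complex_of_real (Q y v)))) (at y)" for y
  proof -
    have "bounded_bilinear Q" using Q_bilinear bilinear_conv_bounded_bilinear by blast
    from has_derivative_of_real[OF bounded_bilinear.FDERIV[OF this has_derivative_ident has_derivative_ident]]
    have "((\<lambda>z. complex_of_real (Q z z)) has_derivative (\<lambda>v. complex_of_real (Q y v + Q v y))) (at y)" .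
    from has_derivative_mult_right[OF this]
    have "((\<lambda>z. - complex_of_real (pi / 2) * complex_of_real (Q z z)) has_derivative
        (\<lambda>v. - complex_of_real (pi / 2) * complex_of_real (Q y v + Q v y))) (at y)" .
    moreover have "- complex_of_real (pi / 2) * complex_of_real (Q y v + Q v y) = - (pi * complex_of_real (Q y v))" for v
      using Q_sym[of v y] by simp
    ultimately show ?thesis by simp
  qed
  have dE: "((\<lambda>z. exp (- complex_of_real (pi / 2 * Q z z))) has_derivative
        (\<lambda>v. exp (- complex_of_real (pi / 2 * Q y y)) * (- (pi * complex_of_real (Q y v))))) (at y)" for y
    using q DERIV_exp[THEN has_field_derivative_imp_has_derivative] by (rule has_derivative_compose)
  have D: "D v (theta x) y = exp (- complex_of_real (pi / 2 * Q y y)) * (S' y v - pi * P y v * S y)" for v y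
    unfolding th by (subst D_eqI[OF has_derivative_mult[OF dE dS]]) (simp add: P_eq algebra_simps)
  have "S' y (J v) = \<i> * S' y v" for y v
  proof -
    have s: "summable (\<lambda>n. coef x n * (pi * P (x - lattice_enum n) v) * exp (pi * P (x - lattice_enum n) y))"
      by (rule summable_norm_cancel, rule exp_series_summable[OF P_linear L exp_series_coeff[OF P_linear L coef_summable]])
    show ?thesis unfolding S'_def suminf_mult[OF s, symmetric] P_J by (simp add: mult_ac)
  qed
  then have "D (J v) (theta x) y = \<i> * D v (theta x) y" for v y
    unfolding D P_J by (simp add: algebra_simps)
  then show ?thesis using sm by (simp add: local_vac_def)
qed

lemma c_zero: "c 0 = 1"
proof -
  have "c (0 + 0) = c 0 * c 0" using c_add[OF int_lattice_closed(1,1)] by (simp add: bl_simps)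
  moreover have "c 0 \<noteq> 0" using norm_c[OF int_lattice_closed(1)] by auto
  ultimately show ?thesis by simp
qed

lemma kern_term_shift:
  assumes v: "v \<in> int_lattice" and w: "w \<in> int_lattice"
  shows "kern_term x w (y + v) = kern_term x (w + v) y * (cnj (c v) * cis (- pi * \<omega> v y))"
proof -
  obtain N where N: "\<omega> w v = real_of_int N" using integral v w by (auto simp: integral_class_def elim!: Ints_cases)
  have 1: "c (w + v) * cnj (c v) = c w * cis (pi * \<omega> v w)"
    using norm_c[OF v] complex_norm_square[of "c v"] by (simp add: c_add[OF w v] mult_ac)
  \<comment> \<open>Integrality enters here: \<open>cis (pi * \<omega> w v)\<close> and its
    conjugate agree because \<open>\<omega> w v\<close> is an integer.\<close>
  have 2: "cis (pi * \<omega> w (y + v)) = cis (pi * \<omega> v w) * cis (pi * \<omega> w y)"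
  proof -
    have "pi * \<omega> w (y + v) = pi * \<omega> v w + pi * \<omega> w y + 2 * pi * real_of_int N"
      using skew[of v w] N by (simp add: bl_simps algebra_simps)
    then have "cis (pi * \<omega> w (y + v)) = cis (pi * \<omega> v w) * cis (pi * \<omega> w y) * cis (2 * pi * real_of_int N)"
      by (simp only: cis_mult)
    then show ?thesis using cis_multiple_2pi[of "real_of_int N"] by simp
  qed
  have 3: "cis (pi * \<omega> (w + v) y) * cis (- pi * \<omega> v y) = cis (pi * \<omega> w y)"
    by (simp add: cis_mult bl_simps algebra_simps)
  have "kern_term x (w + v) y * (cnj (c v) * cis (- pi * \<omega> v y)) =
      kern x (w + v + y) * (c (w + v) * cnj (c v)) * (cis (pi * \<omega> (w + v) y) * cis (- pi * \<omega> v y))"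
    by (simp add: kern_term_def mult_ac)
  also have "\<dots> = kern x (w + (y + v)) * c w * (cis (pi * \<omega> v w) * cis (pi * \<omega> w y))"
    unfolding 1 3 by (simp add: mult_ac add_ac)
  finally show ?thesis by (simp only: kern_term_def 2)
qed

text \<open>Translation by a lattice vector permutes the terms of the series and multiplies each by
  the same factor.\<close>

lemma theta_vac: "theta x \<in> vac"
proof -
  have "theta x (y + v) = c v * cis (pi * \<omega> v y) * theta x y" if v: "v \<in> int_lattice" for y v
  proof -
    define \<pi>' where "\<pi>' = (\<lambda>n. inv lattice_enum (lattice_enum n + v))"
    have inj: "inj (lattice_enum :: nat \<Rightarrow> real^'n)" and ran: "range (lattice_enum :: nat \<Rightarrow> real^'n) = int_lattice"
      using bij_lattice_enum by (auto simp: bij_betw_def)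
    have \<pi>: "lattice_enum (\<pi>' n) = lattice_enum n + v" for n
      unfolding \<pi>'_def using int_lattice_closed(4)[OF lattice_enum_in v, of n] ran by (intro f_inv_into_f) simp
    have "bij \<pi>'"
    proof (rule bijI)
      show "inj \<pi>'"
      proof (rule injI)
        fix m n assume "\<pi>' m = \<pi>' n"
        then have "lattice_enum m + v = lattice_enum n + v" using \<pi> by metis
        then show "m = n" using inj by (simp add: inj_eq)
      qed
      show "surj \<pi>'"
      proof (rule surjI)
        fix n
        have "lattice_enum n - v \<in> range lattice_enum" using int_lattice_closed(5)[OF lattice_enum_in v, of n] ran by simp
        then have "lattice_enum (inv lattice_enum (lattice_enum n - v)) = lattice_enum n - v" by (rule f_inv_into_f)
        then show "\<pi>' (inv lattice_enum (lattice_enum n - v)) = n" by (simp add: \<pi>'_def inv_f_f[OF inj])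
      qed
    qed
    have "(\<Sum>n. kern_term x (lattice_enum n) (y + v)) =
        (\<Sum>n. kern_term x (lattice_enum (\<pi>' n)) y * (cnj (c v) * cis (- pi * \<omega> v y)))"
      by (simp add: kern_term_shift[OF v lattice_enum_in] \<pi>)
    also have "\<dots> = (\<Sum>n. kern_term x (lattice_enum n) y * (cnj (c v) * cis (- pi * \<omega> v y)))"
      by (rule suminf_bij[OF \<open>bij \<pi>'\<close>, of "\<lambda>n. kern_term x (lattice_enum n) y * (cnj (c v) * cis (- pi * \<omega> v y))"])
        (use kern_term_summable[of x y] norm_c[OF v] in \<open>simp add: norm_mult\<close>)
    also have "\<dots> = (\<Sum>n. kern_term x (lattice_enum n) y) * (cnj (c v) * cis (- pi * \<omega> v y))"
      using summable_norm_cancel[OF kern_term_summable] by (rule suminf_mult2[symmetric])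
    finally show ?thesis by (simp add: theta_def cis_cnj mult_ac)
  qed
  then show ?thesis using theta_local_vac by (simp add: vac_def qp_def local_vac_def)
qed

definition ip :: "(real^'n \<Rightarrow> complex) \<Rightarrow> (real^'n \<Rightarrow> complex) \<Rightarrow> complex" where
  "ip f g = (\<integral>x. f x * cnj (g x) \<partial>torus)"

text \<open>The reproducing formula on the covering space, folded onto the torus: quasi-periodicity
  of \<open>f\<close> gathers all translates of the kernel into \<open>theta\<close>.\<close>

lemma reproducing:
  fixes f :: "real^'n \<Rightarrow> complex"
  assumes f: "f \<in> vac"
  shows "ip f (theta x) = Z * f x"
proof -
  let ?F = "\<lambda>y. kern x y * f y"
  note int = kern_reproducing(1)[OF f, of x]
  have F: "?F (lattice_enum n + y) = kern_term x (lattice_enum n) y * f y" for n y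
    using qp_shift[OF vac_qp[OF f] lattice_enum_in] by (simp add: kern_term_def)
  have "(\<lambda>n. \<integral>y. ?F (lattice_enum n + y) \<partial>torus) sums (\<integral>y. (\<Sum>n. ?F (lattice_enum n + y)) \<partial>torus)"
  proof (rule sums_integral)
    show "integrable torus (\<lambda>y. ?F (lattice_enum n + y))" for n by (rule unfold_integrable[OF int])
    show "summable (\<lambda>n. \<integral>y. norm (?F (lattice_enum n + y)) \<partial>torus)" by (rule unfold_summable_norm[OF int])
    show "AE y in torus. summable (\<lambda>n. norm (?F (lattice_enum n + y)))"
      unfolding F norm_mult by (intro always_eventually allI summable_mult2 kern_term_summable)
  qed
  moreover have "(\<Sum>n. ?F (lattice_enum n + y)) = f y * cnj (theta x y)" for y
    unfolding F theta_def using suminf_mult2[OF summable_norm_cancel[OF kern_term_summable[of x y]], of "f y"] by (simp add: mult.commute)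
  ultimately have "(\<lambda>n. \<integral>y. ?F (lattice_enum n + y) \<partial>torus) sums ip f (theta x)" by (simp add: ip_def)
  moreover have "(\<lambda>n. \<integral>y. ?F (lattice_enum n + y) \<partial>torus) sums (Z * f x)"
    using unfold_sums[OF int] unfolding kern_reproducing(2)[OF f] .
  ultimately show ?thesis by (rule sums_unique2)
qed

text \<open>On the diagonal the term of a lattice vector \<open>v\<close> is a constant times a
  character of the torus, by integrality of \<omega>. By nondegeneracy this character is nontrivial
  for nonzero \<open>v\<close> and integrates to 0; the zero vector contributes 1.\<close>

lemma trace: "(\<integral>x. theta x x \<partial>torus) = 1"
proof -
  define t where "t n x = cnj (kern_term x (lattice_enum n) x)" for n and x :: "real^'n"
  have t: "t n x = gauss (lattice_enum n) * cnj (c (lattice_enum n)) * cis (- 2 * pi * \<omega> (lattice_enum n) x)" for n x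
  proof -
    have "cis (pi * \<omega> x (lattice_enum n + x)) * cis (- pi * \<omega> (lattice_enum n) x) = cis (- 2 * pi * \<omega> (lattice_enum n) x)"
      using skew[of x "lattice_enum n"] by (simp add: cis_mult bl_simps alt algebra_simps)
    then show ?thesis unfolding t_def kern_term_def kern_def by (simp add: cis_cnj mult_ac)
  qed
  have nt: "norm (t n x) = gauss (lattice_enum n)" for n x
    using norm_c[OF lattice_enum_in] by (simp add: t norm_mult gauss_def)
  have sg: "summable (\<lambda>n. gauss (lattice_enum n))"
    using kern_term_summable[of 0 0] norm_c[OF lattice_enum_in]
    by (simp add: kern_term_def kern_def norm_mult bl_simps gauss_def)
  have ct: "continuous_on UNIV (t n)" for n unfolding t[abs_def] by (intro continuous_intros)
  have "(\<lambda>n. \<integral>x. t n x \<partial>torus) sums (\<integral>x. (\<Sum>n. t n x) \<partial>torus)"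
  proof (rule sums_integral)
    show "integrable torus (t n)" for n by (rule torus_integrable[OF ct])
    show "AE x in torus. summable (\<lambda>n. norm (t n x))" using sg by (simp add: nt)
    have "(\<integral>x. norm (t n x) \<partial>torus) = gauss (lattice_enum n)" for n
      using torus_measure_1[where 'n = 'n] by (simp add: nt)
    then show "summable (\<lambda>n. \<integral>x. norm (t n x) \<partial>torus)" using sg by simp
  qed
  moreover have "(\<Sum>n. t n x) = theta x x" for x
    unfolding theta_def t_def
    by (rule bounded_linear.suminf[OF bounded_linear_cnj summable_norm_cancel[OF kern_term_summable], symmetric])
  ultimately have s: "(\<lambda>n. \<integral>x. t n x \<partial>torus) sums (\<integral>x. theta x x \<partial>torus)" by simp
  have "(0 :: real^'n) \<in> range lattice_enum"
    unfolding bij_betw_imp_surj_on[OF bij_lattice_enum] by (rule int_lattice_closed(1))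
  then obtain n0 where n0': "(0 :: real^'n) = lattice_enum n0" by (rule rangeE)
  note n0 = n0'[symmetric]
  have "(\<integral>x. t n x \<partial>torus) = (if n = n0 then 1 else 0)" for n
  proof (cases "n = n0")
    case True
    have "t n x = 1" for x by (simp add: t True n0 gauss_def Q_simps c_zero bl_simps)
    then show ?thesis using True torus_measure_1[where 'n = 'n] by simp
  next
    case False
    let ?v = "lattice_enum n :: real^'n"
    have v0: "?v \<noteq> 0"
    proof
      assume "?v = 0"
      then have "(lattice_enum n :: real^'n) = lattice_enum n0" using n0 by simp
      then have "n = n0" by (rule injD[OF bij_betw_imp_inj_on[OF bij_lattice_enum]])
      then show False using False by simp
    qed
    have "\<exists>k :: 'n \<Rightarrow> int. \<forall>p. real_of_int (k p) = - \<omega> ?v (axis p 1)"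
    proof -
      have "- \<omega> ?v (axis p 1) \<in> \<int>" for p
        using integral lattice_enum_in int_lattice_closed(2) by (auto simp: integral_class_def)
      then have "\<forall>p. \<exists>i. real_of_int i = - \<omega> ?v (axis p 1)" by (metis Ints_cases)
      then show ?thesis by (rule choice)
    qed
    then obtain k :: "'n \<Rightarrow> int" where k: "\<And>p. real_of_int (k p) = - \<omega> ?v (axis p 1)" by blast
    have exp: "- \<omega> ?v x = (\<Sum>p\<in>UNIV. real_of_int (k p) * x $ p)" for x
    proof -
      interpret r: linear "\<omega> ?v" by (rule \<omega>_linear(2))
      have "x = (\<Sum>p\<in>UNIV. (x $ p) *\<^sub>R axis p 1)" by (simp add: basis_expansion flip: scalar_mult_eq_scaleR)
      then have "\<omega> ?v x = \<omega> ?v (\<Sum>p\<in>UNIV. (x $ p) *\<^sub>R axis p 1)" by simp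
      then show ?thesis by (simp add: r.sum r.scaleR k sum_negf mult.commute)
    qed
    have "\<exists>p. k p \<noteq> 0"
    proof (rule ccontr)
      assume "\<nexists>p. k p \<noteq> 0"
      then have "\<omega> ?v x = 0" for x using exp[of x] by simp
      then show False using v0 nondeg by (auto simp: nondegenerate_def)
    qed
    then obtain p where p: "k p \<noteq> 0" by blast
    have "t n x = gauss ?v * cnj (c ?v) * cis (2 * pi * (\<Sum>p\<in>UNIV. real_of_int (k p) * x $ p))" for x
      by (simp add: t flip: exp)
    then show ?thesis using False torus_character_integral[of k, OF p] by simp
  qed
  then have "(\<lambda>n. \<integral>x. t n x \<partial>torus) sums 1" using sums_single[of n0 "\<lambda>_. 1"] by simp
  then show ?thesis using s sums_unique2 by blast
qed

end

section \<open>The dimension of the vacuum space\<close>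

definition fscale :: "complex \<Rightarrow> ('a \<Rightarrow> complex) \<Rightarrow> 'a \<Rightarrow> complex" where
  "fscale k f = (\<lambda>x. k * f x)"

lemma vector_space_fscale: "vector_space fscale"
  by unfold_locales (auto simp: fscale_def algebra_simps fun_eq_iff)

lemma sum_fun_apply: "(\<Sum>i\<in>I. f i) x = (\<Sum>i\<in>I. f i x)"
  by (induction I rule: infinite_finite_induct) auto

context bergman begin

lemma Z_pos: "Z > 0"
proof -
  have int: "integrable lborel (\<lambda>x. exp (- pi * Q x x))" by (rule gauss_integrable') simp
  have "Z \<ge> 0" unfolding Z_def by simp
  moreover have "Z \<noteq> 0"
  proof
    assume "Z = 0"
    then have "AE x in lborel. exp (- pi * Q x x) = 0"
      unfolding Z_def using integral_nonneg_eq_0_iff_AE[OF int] by simp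
    then have "ae_filter (lborel :: (real^'n) measure) = bot" by (simp add: trivial_limit_def)
    then show False by (simp add: ae_filter_eq_bot_iff)
  qed
  ultimately show ?thesis by simp
qed

lemma ip_integrable:
  "continuous_on UNIV f \<Longrightarrow> continuous_on UNIV g \<Longrightarrow> integrable torus (\<lambda>x. f x * cnj (g x))"
  by (intro torus_integrable continuous_intros)

lemma ip_add:
  "f \<in> vac \<Longrightarrow> g \<in> vac \<Longrightarrow> k \<in> vac \<Longrightarrow> ip (\<lambda>x. f x + g x) k = ip f k + ip g k"
  unfolding ip_def distrib_right
  by (intro Bochner_Integration.integral_add ip_integrable vac_continuous)

lemma ip_scale: "ip (\<lambda>x. a * f x) g = a * ip f g"
  by (simp add: ip_def mult.assoc)

lemma ip_cnj: "ip f g = cnj (ip g f)"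
proof -
  have "ip f g = (\<integral>x. cnj (g x * cnj (f x)) \<partial>torus)" unfolding ip_def by (simp add: mult.commute del: integral_cnj)
  also have "\<dots> = cnj (ip g f)" unfolding ip_def by (rule integral_bounded_linear'[OF bounded_linear_cnj bounded_linear_cnj]) simp
  finally show ?thesis .
qed

lemma ip_scale_right: "ip f (\<lambda>x. a * g x) = cnj a * ip f g"
  using ip_cnj[of f "\<lambda>x. a * g x"] ip_cnj[of f g] by (simp add: ip_scale)

lemma ip_self: "ip f f = complex_of_real (\<integral>x. (norm (f x))\<^sup>2 \<partial>torus)"
  unfolding ip_def by (simp add: complex_norm_square[symmetric] del: of_real_power)

text \<open>The vanishing integral gives zeros almost everywhere only; the reproducing formula
  upgrades this to every point.\<close>

lemma ip_self_eq_0: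
  assumes f: "f \<in> vac" and 0: "ip f f = 0"
  shows "f x = 0"
proof -
  have c: "continuous_on UNIV (\<lambda>x. (norm (f x))\<^sup>2)" by (intro continuous_intros vac_continuous f)
  have "(\<integral>x. (norm (f x))\<^sup>2 \<partial>torus) = 0" using 0 by (simp only: ip_self of_real_eq_0_iff)
  then have "AE x in torus. (norm (f x))\<^sup>2 = 0"
    using integral_nonneg_eq_0_iff_AE[OF torus_integrable[OF c]] by simp
  then have "AE y in torus. f y * cnj (theta x y) = 0" by eventually_elim simp
  moreover have "integrable torus (\<lambda>y. f y * cnj (theta x y))"
    by (intro ip_integrable vac_continuous f theta_vac)
  ultimately have "ip f (theta x) = 0"
    unfolding ip_def by (intro integral_eq_zero_AE)
  then show ?thesis using reproducing[OF f, of x] Z_pos by simp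
qed

lemma vac_zero: "(\<lambda>x. 0) \<in> vac"
  using vac_scale[OF theta_vac, of 0] by simp

lemma vac_sum: "(\<And>i. i \<in> I \<Longrightarrow> f i \<in> vac) \<Longrightarrow> (\<lambda>x. \<Sum>i\<in>I. f i x) \<in> vac"
  by (induction I rule: infinite_finite_induct) (auto intro: vac_zero vac_add)

lemma ip_sum: "(\<And>i. i \<in> I \<Longrightarrow> f i \<in> vac) \<Longrightarrow> g \<in> vac \<Longrightarrow> ip (\<lambda>x. \<Sum>i\<in>I. f i x) g = (\<Sum>i\<in>I. ip (f i) g)"
proof (induction I rule: infinite_finite_induct)
  case (insert i I)
  then show ?case using ip_add[of "f i" "\<lambda>x. \<Sum>i\<in>I. f i x" g] vac_sum[of I f] by simp
qed (simp_all add: ip_def)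

definition orthonormal :: "nat \<Rightarrow> (nat \<Rightarrow> real^'n \<Rightarrow> complex) \<Rightarrow> bool" where
  "orthonormal r s \<longleftrightarrow> (\<forall>i<r. s i \<in> vac) \<and> (\<forall>i<r. \<forall>j<r. ip (s i) (s j) = of_bool (i = j))"

text \<open>The component orthogonal to the system, as in Gram-Schmidt. The subtraction is written
  as adding a multiple so that the closure and linearity rules apply directly.\<close>

definition residual :: "nat \<Rightarrow> (nat \<Rightarrow> real^'n \<Rightarrow> complex) \<Rightarrow> (real^'n \<Rightarrow> complex) \<Rightarrow> real^'n \<Rightarrow> complex" where
  "residual r s g = (\<lambda>x. g x + - 1 * (\<Sum>i<r. ip g (s i) * s i x))"

lemma
  assumes s: "orthonormal r s" and g: "g \<in> vac"
  shows residual_vac: "residual r s g \<in> vac"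
    and residual_orth: "j < r \<Longrightarrow> ip (residual r s g) (s j) = 0"
    and residual_norm: "ip (residual r s g) (residual r s g) = ip g g - (\<Sum>i<r. ip g (s i) * cnj (ip g (s i)))"
proof -
  have sv: "s i \<in> vac" if "i < r" for i using s that by (simp add: orthonormal_def)
  have t: "(\<lambda>x. ip g (s i) * s i x) \<in> vac" if "i < r" for i using sv[OF that] by (rule vac_scale)
  have pv: "(\<lambda>x. \<Sum>i<r. ip g (s i) * s i x) \<in> vac" using t by (intro vac_sum) auto
  show rv: "residual r s g \<in> vac"
    unfolding residual_def by (intro vac_add vac_scale g pv)
  have ipr: "ip (residual r s g) k = ip g k - (\<Sum>i<r. ip g (s i) * ip (s i) k)" if k: "k \<in> vac" for k
    unfolding residual_def
    using ip_add[OF g vac_scale[OF pv, of "-1"] k] ip_sum[of "{..<r}" "\<lambda>i x. ip g (s i) * s i x" k] t k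
    by (simp add: ip_scale ip_scale[of "-1", simplified])
  show orth: "ip (residual r s g) (s j) = 0" if j: "j < r" for j
  proof -
    have "(\<Sum>i<r. ip g (s i) * ip (s i) (s j)) = (\<Sum>i<r. if j = i then ip g (s i) else 0)"
      using s j by (intro sum.cong) (auto simp: orthonormal_def)
    then show ?thesis using ipr[OF sv[OF j]] j by simp
  qed
  have gs: "cnj (ip (s i) g) = ip g (s i)" for i using ip_cnj[of g "s i"] by simp
  have "ip (residual r s g) (residual r s g) = ip g (residual r s g) - (\<Sum>i<r. ip g (s i) * cnj (ip (residual r s g) (s i)))"
    using ipr[OF rv] ip_cnj[of "s _" "residual r s g"] by simp
  also have "\<dots> = ip g (residual r s g)" using orth by simp
  also have "\<dots> = cnj (ip g g - (\<Sum>i<r. ip g (s i) * ip (s i) g))"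
    using ip_cnj[of g "residual r s g"] ipr[OF g] by simp
  also have "\<dots> = cnj (ip g g) - (\<Sum>i<r. cnj (ip g (s i)) * cnj (ip (s i) g))"
    by (simp add: cnj_sum)
  also have "cnj (ip g g) = ip g g" using ip_cnj[of g g] by simp
  finally show "ip (residual r s g) (residual r s g) = ip g g - (\<Sum>i<r. ip g (s i) * cnj (ip g (s i)))"
    by (simp add: gs mult.commute)
qed

text \<open>By the reproducing formula the Fourier coefficients of \<open>theta x\<close> are the
  values of the system at \<open>x\<close>, up to conjugation and the factor
  \<open>Z\<close>.\<close>

lemma theta_norm_diff:
  assumes s: "orthonormal r s"
  shows "ip (residual r s (theta x)) (residual r s (theta x)) = Z * theta x x - Z\<^sup>2 * (\<Sum>i<r. s i x * cnj (s i x))"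
proof -
  have sv: "s i \<in> vac" if "i < r" for i using s that by (simp add: orthonormal_def)
  have "ip (theta x) (s i) * cnj (ip (theta x) (s i)) = Z\<^sup>2 * (s i x * cnj (s i x))" if "i < r" for i
    using ip_cnj[of "theta x" "s i"] reproducing[OF sv[OF that], of x] by (simp add: power2_eq_square mult_ac)
  then show ?thesis
    using residual_norm[OF s theta_vac] reproducing[OF theta_vac, of x x] by (simp add: sum_distrib_left)
qed

lemma integral_theta_norm_diff:
  assumes s: "orthonormal r s"
  shows "(\<integral>x. ip (residual r s (theta x)) (residual r s (theta x)) \<partial>torus) = Z - Z\<^sup>2 * r"
proof -
  have sv: "s i \<in> vac" if "i < r" for i using s that by (simp add: orthonormal_def)
  have iss: "integrable torus (\<lambda>x. s i x * cnj (s i x))" if "i < r" for i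
    using sv[OF that] by (intro ip_integrable vac_continuous)
  \<comment> \<open>A non-integrable function has integral 0 by convention, so the value 1 in
    \<open>trace\<close> certifies integrability.\<close>
  have it: "integrable torus (\<lambda>x. theta x x)"
    using trace not_integrable_integral_eq by fastforce
  have "(\<integral>x. (\<Sum>i<r. s i x * cnj (s i x)) \<partial>torus) = (\<Sum>i<r. ip (s i) (s i))"
    unfolding ip_def using iss by (intro Bochner_Integration.integral_sum) auto
  also have "\<dots> = r" using s by (simp add: orthonormal_def)
  finally have 1: "(\<integral>x. (\<Sum>i<r. s i x * cnj (s i x)) \<partial>torus) = r" .
  have "(\<integral>x. Z * theta x x - Z\<^sup>2 * (\<Sum>i<r. s i x * cnj (s i x)) \<partial>torus) =
      (\<integral>x. Z * theta x x \<partial>torus) - (\<integral>x. Z\<^sup>2 * (\<Sum>i<r. s i x * cnj (s i x)) \<partial>torus)"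
    using iss it by (intro Bochner_Integration.integral_diff integrable_mult_right Bochner_Integration.integrable_sum) auto
  also have "\<dots> = Z - Z\<^sup>2 * r" by (simp only: integral_mult_right_zero trace 1) simp
  finally show ?thesis by (simp only: theta_norm_diff[OF s])
qed

text \<open>Bessel's inequality for \<open>theta x\<close>, integrated over all \<open>x\<close>:
  the kernel contributes its trace 1, each member of the system its norm 1.\<close>

lemma orthonormal_bound:
  assumes s: "orthonormal r s"
  shows "real r * Z \<le> 1"
proof -
  have "ip (residual r s (theta x)) (residual r s (theta x)) =
      complex_of_real (\<integral>y. (norm (residual r s (theta x) y))\<^sup>2 \<partial>torus)" for x
    by (rule ip_self)
  then have "(\<integral>x. ip (residual r s (theta x)) (residual r s (theta x)) \<partial>torus) =
      complex_of_real (\<integral>x. \<integral>y. (norm (residual r s (theta x) y))\<^sup>2 \<partial>torus \<partial>torus)"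
    by simp
  then have "complex_of_real (\<integral>x. \<integral>y. (norm (residual r s (theta x) y))\<^sup>2 \<partial>torus \<partial>torus) = complex_of_real (Z - Z\<^sup>2 * r)"
    using integral_theta_norm_diff[OF s] by simp
  then have "(\<integral>x. \<integral>y. (norm (residual r s (theta x) y))\<^sup>2 \<partial>torus \<partial>torus) = Z - Z\<^sup>2 * r"
    by (simp only: of_real_eq_iff)
  moreover have "0 \<le> (\<integral>x. \<integral>y. (norm (residual r s (theta x) y))\<^sup>2 \<partial>torus \<partial>torus)" by simp
  ultimately have "Z * (real r * Z) \<le> Z * 1" by (simp add: power2_eq_square mult_ac)
  then show ?thesis using Z_pos by (simp add: mult_le_cancel_left_pos)
qed

text \<open>The bound yields an orthonormal system of maximal length. Any nonzero residual could be
  normalised and appended, so the system spans; in particular the residuals of all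
  \<open>theta x\<close> vanish and Bessel's inequality becomes an equality.\<close>

theorem vac_has_dim: "\<exists>d. has_dim fscale vac d \<and> real d * Z = 1"
proof -
  define N where "N = {r. \<exists>s. orthonormal r s}"
  have "N \<subseteq> {..nat \<lfloor>1 / Z\<rfloor>}"
  proof
    fix r assume "r \<in> N"
    then have "real r \<le> 1 / Z" using orthonormal_bound Z_pos by (auto simp: N_def field_simps)
    then show "r \<in> {..nat \<lfloor>1 / Z\<rfloor>}" by (simp add: le_nat_floor)
  qed
  then have fin: "finite N" using finite_subset by blast
  have "0 \<in> N" by (simp add: N_def orthonormal_def)
  define r where "r = Max N"
  have "r \<in> N" unfolding r_def using fin \<open>0 \<in> N\<close> by (intro Max_in) auto
  then obtain s where s: "orthonormal r s" by (auto simp: N_def)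
  have "Suc r \<notin> N" using Max_ge[OF fin, of "Suc r"] by (auto simp: r_def)
  have sv: "s i \<in> vac" if "i < r" for i using s that by (simp add: orthonormal_def)
  have res0: "residual r s g = (\<lambda>x. 0)" if g: "g \<in> vac" for g
  proof (rule ccontr)
    assume ne: "residual r s g \<noteq> (\<lambda>x. 0)"
    let ?u = "residual r s g"
    have uv: "?u \<in> vac" by (rule residual_vac[OF s g])
    define k where "k = (\<integral>x. (norm (?u x))\<^sup>2 \<partial>torus)"
    have uu: "ip ?u ?u = complex_of_real k" unfolding k_def by (rule ip_self)
    have "k \<noteq> 0" using ip_self_eq_0[OF uv] ne uu by (auto simp: fun_eq_iff)
    moreover have "k \<ge> 0" unfolding k_def by simp
    ultimately have k: "k > 0" by simp
    define u' where "u' = (\<lambda>x. complex_of_real (1 / sqrt k) * ?u x)"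
    have u'v: "u' \<in> vac" unfolding u'_def using uv by (rule vac_scale)
    have "complex_of_real (1 / sqrt k) * (complex_of_real (1 / sqrt k) * complex_of_real k) = complex_of_real (1 / sqrt k * (1 / sqrt k * k))"
      by (simp only: of_real_mult)
    also have "1 / sqrt k * (1 / sqrt k * k) = 1" using k by (simp add: field_simps)
    finally have u'1: "ip u' u' = 1" unfolding u'_def by (simp only: ip_scale ip_scale_right uu complex_cnj_complex_of_real of_real_1)
    have u's: "ip u' (s j) = 0" "ip (s j) u' = 0" if "j < r" for j
    proof -
      show "ip u' (s j) = 0" unfolding u'_def ip_scale using residual_orth[OF s g that] by simp
      then show "ip (s j) u' = 0" using ip_cnj[of "s j" u'] by simp
    qed
    have "orthonormal (Suc r) (s(r := u'))"
      using s u'v u'1 u's by (auto simp: orthonormal_def less_Suc_eq)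
    then show False using \<open>Suc r \<notin> N\<close> by (auto simp: N_def)
  qed
  have "has_dim fscale vac r"
    unfolding has_dim_def
  proof (intro exI[of _ s] conjI allI impI ballI)
    show "s i \<in> vac" if "i < r" for i using sv that .
    show "\<exists>u. g = (\<Sum>i<r. fscale (u i) (s i))" if g: "g \<in> vac" for g
    proof
      show "g = (\<Sum>i<r. fscale (ip g (s i)) (s i))"
        using res0[OF g] by (simp add: residual_def fun_eq_iff sum_fun_apply fscale_def)
    qed
    fix u j assume 0: "(\<Sum>i<r. fscale (u i) (s i)) = 0" and j: "j < r"
    have "ip (\<lambda>x. \<Sum>i<r. u i * s i x) (s j) = (\<Sum>i<r. u i * ip (s i) (s j))"
      using ip_sum[of "{..<r}" "\<lambda>i x. u i * s i x" "s j"] sv vac_scale j by (simp add: ip_scale)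
    also have "\<dots> = (\<Sum>i<r. if j = i then u i else 0)"
      using s j by (intro sum.cong) (auto simp: orthonormal_def)
    also have "\<dots> = u j" using j by simp
    finally have "ip (\<lambda>x. \<Sum>i<r. u i * s i x) (s j) = u j" .
    moreover have "(\<lambda>x. \<Sum>i<r. u i * s i x) = (\<lambda>x. 0)"
      using 0 by (simp add: fun_eq_iff sum_fun_apply fscale_def)
    ultimately show "u j = 0" by (simp add: ip_def)
  qed
  moreover have "real r * Z = 1"
  proof -
    have "ip (\<lambda>x. 0) (\<lambda>x. 0) = 0" by (simp add: ip_def)
    then have "complex_of_real (Z - Z\<^sup>2 * r) = 0"
      using integral_theta_norm_diff[OF s] res0[OF theta_vac] by simp
    then have "Z - Z\<^sup>2 * r = 0" by (simp only: of_real_eq_0_iff)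
    then show ?thesis using Z_pos by (simp add: power2_eq_square mult.commute)
  qed
  ultimately show ?thesis by blast
qed

end

section \<open>Parallel sections of flat bundles\<close>

text \<open>The potential is the radial integral
  \<open>F x = \<integral>\<^sub>0\<^sup>1 \<beta> (x\<^sub>0 + t (x - x\<^sub>0)) \<bullet> (x - x\<^sub>0) dt\<close>; by symmetry of \<open>B\<close>, the integrand of its
  differential is the derivative of \<open>t \<beta> (x\<^sub>0 + t (x - x\<^sub>0))\<close>.\<close>

lemma poincare_lemma:
  fixes \<beta> :: "'a::euclidean_space \<Rightarrow> 'a"
  assumes U: "convex U" "open U" "x0 \<in> U"
    and \<beta>: "\<And>x. x \<in> U \<Longrightarrow> (\<beta> has_derivative B x) (at x)"
    and cont: "\<And>u. continuous_on U (\<lambda>x. B x u)"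
    and sym: "\<And>x u w. x \<in> U \<Longrightarrow> B x u \<bullet> w = B x w \<bullet> u"
  obtains F where "\<And>x. x \<in> U \<Longrightarrow> (F has_derivative (\<lambda>u. \<beta> x \<bullet> u)) (at x)"
proof -
  define l where "l x t = x0 + t *\<^sub>R (x - x0)" for x and t :: real
  have lU: "l x t \<in> U" if "x \<in> U" "t \<in> cbox 0 1" for x t
    using convexD_alt[OF U(1,3) that(1), of t] that(2) by (simp add: l_def algebra_simps)
  define BB where "BB x = Blinfun (B x)" for x
  have BB: "blinfun_apply (BB x) = B x" if "x \<in> U" for x
    unfolding BB_def using \<beta>[OF that] has_derivative_bounded_linear bounded_linear_Blinfun_apply by blast
  have cBB: "continuous_on U BB"
    by (rule continuous_on_blinfun_componentwise) (use cont BB in \<open>auto cong: continuous_on_cong\<close>)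
  have c\<beta>: "continuous_on U \<beta>"
    using \<beta> has_derivative_at_withinI has_derivative_continuous_on by blast
  define fx where "fx x t = t *\<^sub>R (blinfun_inner_right (x - x0) o\<^sub>L BB (l x t)) + blinfun_inner_right (\<beta> (l x t))" for x t
  have cl: "continuous_on S (\<lambda>y. G (l (a y) (b y)))"
    if "continuous_on U G" "continuous_on S a" "continuous_on S b" "\<And>y. y \<in> S \<Longrightarrow> a y \<in> U \<and> b y \<in> cbox 0 1"
    for G :: "'a \<Rightarrow> 'c::topological_space" and a b and S :: "'d::topological_space set"
    by (rule continuous_on_compose2[OF that(1)]) (use that lU in \<open>auto simp: l_def intro!: continuous_intros\<close>)
  have cfx: "continuous_on (U \<times> cbox 0 1) (\<lambda>(x, t). fx x t)"
    unfolding fx_def case_prod_beta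
    by (intro continuous_intros cl cBB c\<beta> bounded_linear.continuous_on[OF bounded_linear_blinfun_inner_right]) auto
  have lin: "(\<lambda>t. \<beta> (l x t) \<bullet> (x - x0)) integrable_on cbox 0 1" if "x \<in> U" for x
    by (intro integrable_continuous continuous_intros cl c\<beta>) (use that in auto)
  define F where "F x = integral (cbox 0 1) (\<lambda>t. \<beta> (l x t) \<bullet> (x - x0))" for x
  show thesis
  proof
    fix x assume x: "x \<in> U"
    have "(F has_derivative integral (cbox 0 1) (fx x)) (at x within U)"
      unfolding F_def
    proof (rule leibniz_rule[OF _ lin cfx x U(1)])
      fix y and t :: real assume yt: "y \<in> U" "t \<in> cbox 0 1"
      have "((\<lambda>y. l y t) has_derivative (\<lambda>u. t *\<^sub>R u)) (at y within U)"
        unfolding l_def by (auto intro!: derivative_eq_intros)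
      from has_derivative_compose[OF this \<beta>[OF lU[OF yt]]]
      have "((\<lambda>y. \<beta> (l y t) \<bullet> (y - x0)) has_derivative
          (\<lambda>u. \<beta> (l y t) \<bullet> u + B (l y t) (t *\<^sub>R u) \<bullet> (y - x0))) (at y within U)"
        by (intro has_derivative_inner) (auto intro!: derivative_eq_intros)
      moreover have "blinfun_apply (fx y t) = (\<lambda>u. \<beta> (l y t) \<bullet> u + B (l y t) (t *\<^sub>R u) \<bullet> (y - x0))"
        using linear_scale[OF has_derivative_linear[OF \<beta>[OF lU[OF yt]]]] BB[OF lU[OF yt]]
        by (auto simp: fun_eq_iff fx_def blinfun.add_left blinfun.scaleR_left inner_commute)
      ultimately show "((\<lambda>y. \<beta> (l y t) \<bullet> (y - x0)) has_derivative blinfun_apply (fx y t)) (at y within U)" by simp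
    qed
    moreover have "blinfun_apply (integral (cbox 0 1) (fx x)) u = \<beta> x \<bullet> u" for u
    proof -
      have "fx x integrable_on cbox 0 1"
      proof (intro integrable_continuous)
        have "continuous_on (cbox 0 1) ((\<lambda>(x, t). fx x t) \<circ> (\<lambda>t. (x, t)))"
          by (intro continuous_on_compose continuous_on_subset[OF cfx] continuous_intros) (use x in auto)
        then show "continuous_on (cbox 0 1) (fx x)" by (simp add: o_def)
      qed
      then have "blinfun_apply (integral (cbox 0 1) (fx x)) u = integral (cbox 0 1) (\<lambda>t. blinfun_apply (fx x t) u)"
        by (rule blinfun_apply_integral)
      also have "\<dots> = 1 *\<^sub>R (\<beta> (l x 1) \<bullet> u) - 0 *\<^sub>R (\<beta> (l x 0) \<bullet> u)"
        unfolding cbox_interval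
      proof (intro integral_unique fundamental_theorem_of_calculus)
        fix t :: real assume "t \<in> {0..1}"
        then have lt: "l x t \<in> U" using lU x by simp
        have "((\<lambda>t. l x t) has_derivative (\<lambda>s. s *\<^sub>R (x - x0))) (at t within {0..1})"
          unfolding l_def by (auto intro!: derivative_eq_intros)
        from has_derivative_compose[OF this \<beta>[OF lt]]
        have "((\<lambda>t. t *\<^sub>R (\<beta> (l x t) \<bullet> u)) has_derivative
           (\<lambda>s. t *\<^sub>R (B (l x t) (s *\<^sub>R (x - x0)) \<bullet> u) + s *\<^sub>R (\<beta> (l x t) \<bullet> u))) (at t within {0..1})"
          by (auto intro!: derivative_eq_intros)
        moreover have "t *\<^sub>R (B (l x t) (s *\<^sub>R (x - x0)) \<bullet> u) + s *\<^sub>R (\<beta> (l x t) \<bullet> u) = s *\<^sub>R blinfun_apply (fx x t) u" for s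
          using linear_scale[OF has_derivative_linear[OF \<beta>[OF lt]], of s "x - x0"] sym[OF lt, of "x - x0" u]
          by (simp add: fx_def blinfun.add_left blinfun.scaleR_left BB[OF lt] inner_commute distrib_left
              mult.left_commute)
        ultimately show "((\<lambda>t. t *\<^sub>R (\<beta> (l x t) \<bullet> u)) has_vector_derivative blinfun_apply (fx x t) u) (at t within {0..1})"
          by (simp add: has_vector_derivative_def)
      qed simp
      finally show ?thesis by (simp add: l_def)
    qed
    then have "blinfun_apply (integral (cbox 0 1) (fx x)) = (\<lambda>u. \<beta> x \<bullet> u)" by (simp add: fun_eq_iff)
    ultimately show "(F has_derivative (\<lambda>u. \<beta> x \<bullet> u)) (at x)"
      using at_within_open[OF x U(2)] by simp
  qed
qed

text \<open>The connection form in the chart \<open>i\<close> is \<open>- \<alpha> i\<close>.\<close>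

locale flat_bundle =
  fixes ch :: "'i \<Rightarrow> (real^'n) set" and t :: "'i \<Rightarrow> 'i \<Rightarrow> real^'n \<Rightarrow> complex"
    and \<alpha> :: "'i \<Rightarrow> 'n \<Rightarrow> real^'n \<Rightarrow> complex"
  assumes open_ch: "\<And>i. open (ch i)" and cover: "(\<Union>i. ch i) = UNIV"
    and norm_t: "\<And>i j x. x \<in> ch i \<Longrightarrow> x \<in> ch j \<Longrightarrow> norm (t i j x) = 1"
    and cocycle: "\<And>i j k x. x \<in> ch i \<Longrightarrow> x \<in> ch j \<Longrightarrow> x \<in> ch k \<Longrightarrow> t i j x * t j k x = t i k x"
    and \<alpha>_smooth: "\<And>i p. smooth_on (\<alpha> i p) (ch i)"
    and \<alpha>_imaginary: "\<And>i p x. x \<in> ch i \<Longrightarrow> Re (\<alpha> i p x) = 0"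
    and \<alpha>_closed: "\<And>i p q x. x \<in> ch i \<Longrightarrow> partial_deriv p (\<alpha> i q) x = partial_deriv q (\<alpha> i p) x"
    and t_derivative: "\<And>i j x. x \<in> ch i \<Longrightarrow> x \<in> ch j \<Longrightarrow>
      (t i j has_derivative (\<lambda>u. (\<Sum>p\<in>UNIV. (\<alpha> i p x - \<alpha> j p x) * complex_of_real (u $ p)) * t i j x)) (at x)"
begin

definition A :: "'i \<Rightarrow> real^'n \<Rightarrow> real^'n \<Rightarrow> complex" where
  "A i x u = (\<Sum>p\<in>UNIV. \<alpha> i p x * complex_of_real (u $ p))"

text \<open>A parallel section of length 1 over \<open>U\<close>, given by its coefficients in the
  local frames.\<close>

definition parallel :: "(real^'n) set \<Rightarrow> ('i \<Rightarrow> real^'n \<Rightarrow> complex) \<Rightarrow> bool" where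
  "parallel U g \<longleftrightarrow> (\<forall>i. \<forall>x\<in>U \<inter> ch i. norm (g i x) = 1 \<and> (g i has_derivative (\<lambda>u. A i x u * g i x)) (at x)) \<and>
     (\<forall>i j. \<forall>x\<in>U \<inter> ch i \<inter> ch j. g i x = t i j x * g j x)"

lemma parallel_subset: "parallel U g \<Longrightarrow> V \<subseteq> U \<Longrightarrow> parallel V g"
  unfolding parallel_def by blast

lemma in_chart: obtains i where "x \<in> ch i"
  using cover by blast

lemma parallel_scale: "parallel U g \<Longrightarrow> norm c = 1 \<Longrightarrow> parallel U (\<lambda>i x. c * g i x)"
  by (auto simp: parallel_def norm_mult mult.left_commute intro!: has_derivative_mult_right[THEN has_derivative_eq_rhs])

lemma unit_cnj: "norm z = 1 \<Longrightarrow> z * cnj z = 1" "norm z = 1 \<Longrightarrow> cnj z * z = 1"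
  using complex_norm_square[of z] by (auto simp: mult.commute)

text \<open>The ratio of two parallel sections is independent of the chart, and its derivative
  vanishes because the connection form is imaginary; on a connected set it is constant.\<close>

lemma parallel_unique:
  assumes U: "open U" "connected U" and g: "parallel U g" and g': "parallel U g'"
    and x0: "x0 \<in> U" "x0 \<in> ch i0" "g' i0 x0 = g i0 x0" and x: "x \<in> U" "x \<in> ch i"
  shows "g' i x = g i x"
proof -
  define r where "r y = (let j = SOME j. y \<in> ch j in g' j y * cnj (g j y))" for y
  have r: "r y = g' j y * cnj (g j y)" if y: "y \<in> U" "y \<in> ch j" for y j
  proof -
    define k where "k = (SOME k. y \<in> ch k)"
    have k: "y \<in> ch k" unfolding k_def using y(2) by (rule someI)
    have "g' k y = t k j y * g' j y" "g k y = t k j y * g j y"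
      using g g' y k unfolding parallel_def by blast+
    then have "r y = t k j y * cnj (t k j y) * (g' j y * cnj (g j y))"
      by (simp add: r_def Let_def flip: k_def)
    then show ?thesis by (simp add: unit_cnj norm_t k y)
  qed
  have "(r has_derivative (\<lambda>_. 0)) (at y)" if y: "y \<in> U" for y
  proof -
    obtain j where j: "y \<in> ch j" by (rule in_chart)
    have "(g j has_derivative (\<lambda>u. A j y u * g j y)) (at y)" "(g' j has_derivative (\<lambda>u. A j y u * g' j y)) (at y)"
      using g g' y j unfolding parallel_def by blast+
    then have "((\<lambda>y. g' j y * cnj (g j y)) has_derivative (\<lambda>u. g' j y * cnj (A j y u * g j y) + A j y u * g' j y * cnj (g j y))) (at y)"
      by (intro has_derivative_mult has_derivative_cnj)
    moreover have "cnj (A j y u) = - A j y u" for u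
      using \<alpha>_imaginary[OF j] by (auto simp: complex_eq_iff A_def sum_negf)
    ultimately have "((\<lambda>y. g' j y * cnj (g j y)) has_derivative (\<lambda>_. 0)) (at y)"
      by (simp add: mult_ac)
    then show ?thesis
      by (rule has_derivative_transform_within_open[of _ _ _ _ "U \<inter> ch j"])
        (use U open_ch y j r in auto)
  qed
  from has_derivative_zero_unique_connected[OF U this x(1) x0(1)] have "r x = r x0" by simp
  moreover have n: "norm (g i0 x0) = 1" "norm (g i x) = 1" using g x0 x unfolding parallel_def by blast+
  ultimately have "g' i x * cnj (g i x) = 1" using r x x0 by (simp add: unit_cnj)
  then have "g' i x * (cnj (g i x) * g i x) = g i x" by (metis mult.assoc mult_1)
  then show ?thesis using unit_cnj(2)[OF n(2)] by simp
qed

lemma parallel_patch: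
  assumes op: "\<And>k. k \<in> K \<Longrightarrow> open (U k)" and g: "\<And>k. k \<in> K \<Longrightarrow> parallel (U k) (g k)"
    and comp: "\<And>k l i x. k \<in> K \<Longrightarrow> l \<in> K \<Longrightarrow> x \<in> U k \<Longrightarrow> x \<in> U l \<Longrightarrow> x \<in> ch i \<Longrightarrow> g k i x = g l i x"
  shows "\<exists>G. parallel (\<Union>k\<in>K. U k) G \<and> (\<forall>k\<in>K. \<forall>i. \<forall>x\<in>U k \<inter> ch i. G i x = g k i x)"
proof -
  define G where "G i x = g (SOME k. k \<in> K \<and> x \<in> U k) i x" for i x
  have G: "G i x = g k i x" if "k \<in> K" "x \<in> U k" "x \<in> ch i" for k i x
    unfolding G_def using someI[of "\<lambda>k. k \<in> K \<and> x \<in> U k" k] that by (intro comp) auto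
  have "parallel (\<Union>k\<in>K. U k) G"
    unfolding parallel_def
  proof (intro conjI allI ballI)
    fix i x assume "x \<in> (\<Union>k\<in>K. U k) \<inter> ch i"
    then obtain k where k: "k \<in> K" "x \<in> U k" "x \<in> ch i" by auto
    then have gk: "norm (g k i x) = 1" "(g k i has_derivative (\<lambda>u. A i x u * g k i x)) (at x)"
      using g[OF k(1)] unfolding parallel_def by blast+
    show "norm (G i x) = 1" using G[OF k] gk(1) by simp
    show "(G i has_derivative (\<lambda>u. A i x u * G i x)) (at x)"
      unfolding G[OF k]
      by (rule has_derivative_transform_within_open[OF gk(2), of "U k \<inter> ch i"])
        (use op k open_ch G in auto)
  next
    fix i j x assume "x \<in> (\<Union>k\<in>K. U k) \<inter> ch i \<inter> ch j"
    then obtain k where k: "k \<in> K" "x \<in> U k" "x \<in> ch i" "x \<in> ch j" by auto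
    have "g k i x = t i j x * g k j x" using g[OF k(1)] k unfolding parallel_def by blast
    then show "G i x = t i j x * G j x" by (simp add: G[OF k(1,2)] k)
  qed
  then show ?thesis using G by blast
qed

text \<open>In a ball inside one chart the closed imaginary form has a potential \<open>F\<close>,
  and the exponential of \<open>\<i> * F\<close> solves the equation there. Transition functions
  carry the solution to the other charts.\<close>

lemma parallel_local: "\<exists>e>0. \<exists>g. parallel (ball x0 e) g"
proof -
  obtain i0 where i0: "x0 \<in> ch i0" by (rule in_chart)
  obtain e where e: "e > 0" "ball x0 e \<subseteq> ch i0" using open_ch i0 open_contains_ball by blast
  have "\<exists>g. parallel (ball x0 e) g"
  proof -
    define \<beta> :: "real^'n \<Rightarrow> real^'n" where "\<beta> x = (\<chi> p. Im (\<alpha> i0 p x))" for x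
    define B :: "real^'n \<Rightarrow> real^'n \<Rightarrow> real^'n" where
      "B x u = (\<chi> p. Im (frechet_derivative (\<alpha> i0 p) (at x) u))" for x u
    have diff: "\<alpha> i0 p differentiable (at x)" if "x \<in> ch i0" for x p
      using smooth_on_imp_differentiable[OF \<alpha>_smooth open_ch that] .
    have Beq: "Im (frechet_derivative (\<alpha> i0 p) (at x) u) = (\<Sum>q\<in>UNIV. u $ q * Im (partial_deriv q (\<alpha> i0 p) x))"
      if "x \<in> ch i0" for x p u
      by (simp add: frechet_derivative_sum[OF diff[OF that]])
    obtain F where F: "\<And>x. x \<in> ball x0 e \<Longrightarrow> (F has_derivative (\<lambda>u. \<beta> x \<bullet> u)) (at x)"
    proof (rule poincare_lemma[of "ball x0 e" x0 \<beta> B])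
      fix x assume "x \<in> ball x0 e"
      then have x: "x \<in> ch i0" using e by auto
      show "(\<beta> has_derivative B x) (at x)"
        unfolding has_derivative_componentwise_within[of \<beta>]
      proof
        fix i :: "real^'n" assume "i \<in> Basis"
        then obtain p where i: "i = axis p 1" by (auto simp: Basis_vec_def)
        show "((\<lambda>x. \<beta> x \<bullet> i) has_derivative (\<lambda>u. B x u \<bullet> i)) (at x)"
          unfolding i \<beta>_def B_def inner_axis
          by (simp, rule bounded_linear.has_derivative[OF bounded_linear_Im frechet_works[OF diff[OF x]]])
      qed
      show "B x u \<bullet> w = B x w \<bullet> u" for u w
      proof -
        have "B x u \<bullet> w = (\<Sum>p\<in>UNIV. \<Sum>q\<in>UNIV. u $ q * Im (partial_deriv q (\<alpha> i0 p) x) * w $ p)"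
          by (simp add: B_def inner_vec_def Beq[OF x] sum_distrib_right)
        also have "\<dots> = (\<Sum>q\<in>UNIV. \<Sum>p\<in>UNIV. w $ p * Im (partial_deriv p (\<alpha> i0 q) x) * u $ q)"
          by (subst sum.swap) (intro sum.cong refl, simp add: \<alpha>_closed[OF x] mult_ac)
        also have "\<dots> = B x w \<bullet> u"
          by (simp add: B_def inner_vec_def Beq[OF x] sum_distrib_right)
        finally show ?thesis .
      qed
    next
      fix u
      have "smooth_on (\<lambda>x. frechet_derivative (\<alpha> i0 p) (at x) u) (ch i0)" for p
        by (rule smooth_on_frechet[OF \<alpha>_smooth open_ch])
      then have "continuous_on (ball x0 e) (\<lambda>x. frechet_derivative (\<alpha> i0 p) (at x) u)" for p
        using smooth_on_imp_continuous_on continuous_on_subset e(2) by blast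
      then show "continuous_on (ball x0 e) (\<lambda>x. B x u)"
        unfolding B_def by (intro continuous_intros continuous_on_vec_lambda)
    qed (use e in auto)
    define E where "E x = exp (\<i> * complex_of_real (F x))" for x
    have dE: "(E has_derivative (\<lambda>u. A i0 x u * E x)) (at x)" if "x \<in> ball x0 e" for x
    proof -
      have "((\<lambda>x. \<i> * complex_of_real (F x)) has_derivative (\<lambda>u. \<i> * complex_of_real (\<beta> x \<bullet> u))) (at x)"
        by (intro has_derivative_mult_right has_derivative_of_real F that)
      from has_derivative_compose[OF this DERIV_exp[THEN has_field_derivative_imp_has_derivative]]
      have "(E has_derivative (\<lambda>u. E x * (\<i> * complex_of_real (\<beta> x \<bullet> u)))) (at x)"
        by (simp add: E_def[abs_def])
      moreover have "\<i> * complex_of_real (\<beta> x \<bullet> u) = A i0 x u" for u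
        using \<alpha>_imaginary e that by (subst complex_eq_iff) (auto simp: A_def \<beta>_def inner_vec_def)
      ultimately show ?thesis by (simp add: mult.commute)
    qed
    have "parallel (ball x0 e) (\<lambda>i x. t i i0 x * E x)"
      unfolding parallel_def
    proof (intro conjI allI ballI)
      fix i x assume "x \<in> ball x0 e \<inter> ch i"
      then have x: "x \<in> ball x0 e" "x \<in> ch i" "x \<in> ch i0" using e by auto
      show "norm (t i i0 x * E x) = 1" by (simp add: norm_mult norm_t x E_def)
      show "((\<lambda>x. t i i0 x * E x) has_derivative (\<lambda>u. A i x u * (t i i0 x * E x))) (at x)"
        by (rule has_derivative_eq_rhs, rule has_derivative_mult[OF t_derivative[OF x(2,3)] dE[OF x(1)]])
          (simp add: A_def fun_eq_iff algebra_simps sum_subtractf)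
    next
      fix i j x assume "x \<in> ball x0 e \<inter> ch i \<inter> ch j"
      then show "t i i0 x * E x = t i j x * (t j i0 x * E x)"
        using cocycle[of x i j i0] e by auto
    qed
    then show ?thesis by blast
  qed
  with e show ?thesis by blast
qed

lemma parallel_normalised:
  assumes "parallel U g" "x0 \<in> U" "x0 \<in> ch i0" "norm c = 1"
  obtains g' where "parallel U g'" "g' i0 x0 = c"
proof -
  have n: "norm (g i0 x0) = 1" using assms unfolding parallel_def by blast
  show thesis
    by (rule that[OF parallel_scale[OF assms(1), of "c * cnj (g i0 x0)"]])
      (use n in \<open>auto simp: norm_mult assms unit_cnj mult.assoc\<close>)
qed

lemma parallel_agree:
  assumes "open U" "open V" "connected (U \<inter> V)" "U \<inter> V \<noteq> {}" "parallel U g" "parallel V g'"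
  shows "\<exists>g''. parallel V g'' \<and> (\<forall>i x. x \<in> U \<longrightarrow> x \<in> V \<longrightarrow> x \<in> ch i \<longrightarrow> g'' i x = g i x)"
proof -
  obtain x0 i0 where x0: "x0 \<in> U" "x0 \<in> V" "x0 \<in> ch i0" using assms(4) in_chart by blast
  have "norm (g i0 x0) = 1" using assms x0 unfolding parallel_def by blast
  then obtain g'' where g'': "parallel V g''" "g'' i0 x0 = g i0 x0"
    using parallel_normalised[OF assms(6) x0(2,3)] by blast
  have "g'' i x = g i x" if "x \<in> U" "x \<in> V" "x \<in> ch i" for i x
    by (rule parallel_unique[of "U \<inter> V" g g'' x0 i0])
      (use assms x0 g'' that parallel_subset[of _ _ "U \<inter> V"] in auto)
  then show ?thesis using g''(1) by blast
qed

text \<open>The boundary sphere is covered by balls of one radius that carry parallel sections, each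
  normalised to agree with \<open>g\<close> on its convex overlap with the big ball. Uniqueness
  makes neighbouring sections agree, so all of them glue.\<close>

lemma parallel_extend_ball:
  assumes R: "R > 0" and g: "parallel (ball 0 R) g"
  shows "\<exists>e>0. \<exists>G. parallel (ball 0 (R + e)) G"
proof -
  define \<G> where "\<G> = {G. open G \<and> (\<exists>g. parallel G g)}"
  have "sphere 0 R \<subseteq> \<Union>\<G>"
  proof
    fix x :: "real^'n"
    obtain e g where "e > 0" "parallel (ball x e) g" using parallel_local by blast
    then have "ball x e \<in> \<G>" "x \<in> ball x e" by (auto simp: \<G>_def)
    then show "x \<in> \<Union>\<G>" by blast
  qed
  \<comment> \<open>\<open>e\<close> is a Lebesgue number of the cover, the same for all points of
    the sphere.\<close>
  then obtain e where e: "e > 0" "\<And>x. x \<in> sphere (0::real^'n) R \<Longrightarrow> \<exists>G\<in>\<G>. ball x e \<subseteq> G"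
    using Heine_Borel_lemma[OF compact_sphere] unfolding \<G>_def by (metis (no_types, lifting) mem_Collect_eq)
  have near: "norm ((1 - s) *\<^sub>R x) < R \<and> dist x ((1 - s) *\<^sub>R x) < e"
    if "norm x = R" "0 < s" "s < 1" "s * R < e" for x :: "real^'n" and s
  proof -
    have "norm ((1 - s) *\<^sub>R x) = (1 - s) * R" using that by simp
    also have "\<dots> = R - s * R" by (simp add: algebra_simps)
    also have "\<dots> < R" using that R by simp
    finally have 1: "norm ((1 - s) *\<^sub>R x) < R" .
    have "x - (1 - s) *\<^sub>R x = s *\<^sub>R x" by (simp add: algebra_simps)
    then show ?thesis using that 1 by (simp add: dist_norm)
  qed
  have ex: "\<exists>g'. parallel (ball x e) g' \<and> (\<forall>i y. y \<in> ball 0 R \<longrightarrow> y \<in> ball x e \<longrightarrow> y \<in> ch i \<longrightarrow> g' i y = g i y)"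
    if x: "norm x = R" for x
  proof -
    have "x \<in> sphere 0 R" using x by simp
    from e(2)[OF this] obtain G where "G \<in> \<G>" "ball x e \<subseteq> G" by blast
    then obtain g' where g': "parallel (ball x e) g'"
      unfolding \<G>_def using parallel_subset by blast
    \<comment> \<open>Moving \<open>x\<close> towards the centre by the fraction \<open>s\<close>
      enters the big ball while staying within distance \<open>e\<close> of \<open>x\<close>, so the
      two balls meet.\<close>
    define s where "s = min (1/2) (e / (2 * R))"
    have s: "0 < s" "s < 1" "s * R < e"
    proof -
      show "0 < s" "s < 1" using R e by (auto simp: s_def)
      have "s * R \<le> e / (2 * R) * R" using R by (intro mult_right_mono) (auto simp: s_def)
      also have "\<dots> < e" using R e by simp
      finally show "s * R < e" .
    qed
    have "(1 - s) *\<^sub>R x \<in> ball 0 R \<inter> ball x e" using near[OF x s] by simp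
    then have ne: "ball 0 R \<inter> ball x e \<noteq> {}" by blast
    have "connected (ball 0 R \<inter> ball x e)" by (intro convex_connected convex_Int convex_ball)
    then show ?thesis by (rule parallel_agree[OF open_ball open_ball _ ne g g'])
  qed
  define g' where "g' x = (SOME g'. parallel (ball x e) g' \<and>
    (\<forall>i y. y \<in> ball 0 R \<longrightarrow> y \<in> ball x e \<longrightarrow> y \<in> ch i \<longrightarrow> g' i y = g i y))" for x
  have g': "parallel (ball x e) (g' x)"
      "\<And>i y. y \<in> ball 0 R \<Longrightarrow> y \<in> ball x e \<Longrightarrow> y \<in> ch i \<Longrightarrow> g' x i y = g i y" if "norm x = R" for x
    using someI_ex[OF ex[OF that], folded g'_def] by simp_all
  define U where "U x = (if norm x = R then ball x e else ball 0 R)" for x :: "real^'n"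
  define gg where "gg x = (if norm x = R then g' x else g)" for x
  define K :: "(real^'n) set" where "K = insert 0 (sphere 0 R)"
  have "\<exists>G. parallel (\<Union>x\<in>K. U x) G \<and> (\<forall>k\<in>K. \<forall>i. \<forall>x\<in>U k \<inter> ch i. G i x = gg k i x)"
  proof (rule parallel_patch)
    fix k l i x assume kl: "k \<in> K" "l \<in> K" "x \<in> U k" "x \<in> U l" "x \<in> ch i"
    consider "k = 0 \<or> l = 0" | "norm k = R" "norm l = R" using kl by (auto simp: K_def)
    then show "gg k i x = gg l i x"
    proof cases
      case 1
      then show ?thesis using kl R g'(2) by (auto simp: K_def U_def gg_def split: if_splits)
    next
      case 2
      \<comment> \<open>the midpoint of \<open>k\<close> and \<open>l\<close> lies in both balls and in the big ball\<close>
      have x: "x \<in> ball k e \<inter> ball l e" using kl 2 by (simp add: U_def)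
      have "g' k i x = g' l i x"
      proof (cases "k = l")
        case False
        define m where "m = (1/2) *\<^sub>R (k + l)"
        have dkl: "dist k l < 2 * e" using x dist_triangle2[of k l x] by (auto simp: dist_commute)
        have dm: "dist k m = dist k l / 2" "dist l m = dist k l / 2"
        proof -
          have "k - m = (1/2) *\<^sub>R (k - l)" "l - m = (1/2) *\<^sub>R (l - k)"
            by (simp_all add: m_def scaleR_diff_right scaleR_add_right)
          then show "dist k m = dist k l / 2" "dist l m = dist k l / 2"
            by (simp_all add: dist_norm norm_minus_commute)
        qed
        have "norm (k + l) < 2 * R"
        proof (rule ccontr)
          assume "\<not> norm (k + l) < 2 * R"
          then have "norm (k + l) = norm k + norm l" using norm_triangle_ineq[of k l] 2 by linarith
          then show False using norm_triangle_eq[of k l] 2 False R by simp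
        qed
        then have m: "m \<in> ball 0 R" "m \<in> ball k e" "m \<in> ball l e"
          using dkl dm by (auto simp: m_def)
        obtain j where j: "m \<in> ch j" by (rule in_chart)
        show ?thesis
        proof (rule parallel_unique[of "ball k e \<inter> ball l e" "g' l" "g' k" m j])
          show "connected (ball k e \<inter> ball l e)" by (intro convex_connected convex_Int convex_ball)
          show "parallel (ball k e \<inter> ball l e) (g' l)" "parallel (ball k e \<inter> ball l e) (g' k)"
            using g'(1) 2 parallel_subset by blast+
          show "g' k j m = g' l j m" using g'(2) 2 m j by simp
        qed (use m j x kl in auto)
      qed simp
      then show ?thesis using 2 by (simp add: gg_def)
    qed
  next
    show "open (U k)" for k by (simp add: U_def)
    show "parallel (U k) (gg k)" for k using g g'(1)[of k] by (simp add: U_def gg_def)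
  qed
  then obtain G where G: "parallel (\<Union>x\<in>K. U x) G" by blast
  have "ball 0 (R + e) \<subseteq> (\<Union>x\<in>K. U x)"
  proof
    fix x :: "real^'n" assume x: "x \<in> ball 0 (R + e)"
    show "x \<in> (\<Union>x\<in>K. U x)"
    proof (cases "norm x < R")
      case True
      then show ?thesis using R by (auto simp: K_def U_def)
    next
      case False
      define y where "y = (R / norm x) *\<^sub>R x"
      have y: "norm y = R" using False R by (auto simp: y_def)
      have "x - y = ((norm x - R) / norm x) *\<^sub>R x" using False R by (auto simp: y_def algebra_simps diff_divide_distrib)
      then have "dist x y = norm x - R" using False R by (auto simp: dist_norm)
      then show ?thesis using x y by (auto simp: K_def U_def dist_commute intro!: bexI[of _ y])
    qed
  qed
  then show ?thesis using G parallel_subset e(1) by blast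
qed

text \<open>The radii of balls with a parallel section are unbounded: at a finite supremum the
  sections would glue to a section over the limit ball, which could be extended. Normalisation at
  the origin makes sections over different balls compatible.\<close>

lemma parallel_global: "\<exists>g. parallel UNIV g"
proof -
  obtain i0 where i0: "0 \<in> ch i0" by (rule in_chart)
  define X where "X = {R. R > 0 \<and> (\<exists>g. parallel (ball 0 R) g)}"
  have patch: "\<exists>g. parallel (\<Union>R\<in>Y. ball 0 R) g" if Y: "Y \<subseteq> X" for Y
  proof -
    have ex: "\<exists>g. parallel (ball 0 R) g \<and> g i0 0 = 1" if R: "R \<in> Y" for R
    proof -
      obtain g where "parallel (ball 0 R) g" "R > 0" using R Y by (auto simp: X_def)
      then obtain g' where "parallel (ball 0 R) g'" "g' i0 0 = 1"
        using parallel_normalised[of "ball 0 R" g 0 i0 1] i0 by auto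
      then show ?thesis by blast
    qed
    define g where "g R = (SOME g. parallel (ball 0 R) g \<and> g i0 0 = 1)" for R
    have g: "parallel (ball 0 R) (g R)" "g R i0 0 = 1" if "R \<in> Y" for R
      using someI_ex[OF ex[OF that], folded g_def] by simp_all
    have "\<exists>G. parallel (\<Union>R\<in>Y. ball 0 R) G \<and> (\<forall>k\<in>Y. \<forall>i. \<forall>x\<in>ball 0 k \<inter> ch i. G i x = g k i x)"
    proof (rule parallel_patch)
      fix R S i x assume *: "R \<in> Y" "S \<in> Y" "x \<in> ball 0 R" "x \<in> ball 0 S" "x \<in> ch i"
      show "g R i x = g S i x"
      proof (rule parallel_unique[of "ball 0 R \<inter> ball 0 S" "g S" "g R" 0 i0])
        show "connected (ball (0::real^'n) R \<inter> ball 0 S)" by (intro convex_connected convex_Int convex_ball)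
        show "parallel (ball 0 R \<inter> ball 0 S) (g S)" "parallel (ball 0 R \<inter> ball 0 S) (g R)"
          using g(1) * parallel_subset by blast+
      qed (use * g i0 Y in \<open>auto simp: X_def\<close>)
    qed (use g in auto)
    then show ?thesis by blast
  qed
  obtain e g where e: "e > 0" "parallel (ball 0 e) g" using parallel_local by blast
  then have eX: "e \<in> X" by (auto simp: X_def)
  have "\<not> bdd_above X"
  proof
    assume bdd: "bdd_above X"
    define R where "R = Sup X"
    have pos: "R > 0" using cSup_upper[OF eX bdd] e by (simp add: R_def)
    have "ball 0 R \<subseteq> (\<Union>R\<in>X. ball (0::real^'n) R)"
    proof
      fix x :: "real^'n" assume "x \<in> ball 0 R"
      then obtain S where "S \<in> X" "norm x < S"
        using less_cSup_iff[of X "norm x"] eX bdd by (auto simp: R_def)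
      then show "x \<in> (\<Union>R\<in>X. ball 0 R)" by auto
    qed
    then obtain g where "parallel (ball 0 R) g" using patch[of X] parallel_subset by blast
    from parallel_extend_ball[OF pos this] obtain d G where "d > 0" "parallel (ball 0 (R + d)) G" by blast
    then have "R + d \<in> X" "d > 0" using pos by (auto simp: X_def)
    then show False using cSup_upper[OF _ bdd, of "R + d"] by (simp add: R_def)
  qed
  moreover have "x \<in> (\<Union>R\<in>X. ball 0 R)" for x :: "real^'n"
  proof -
    obtain R where "R \<in> X" "norm x < R" using \<open>\<not> bdd_above X\<close> unfolding bdd_above_def by (meson not_le)
    then show ?thesis by auto
  qed
  ultimately show ?thesis using patch[of X] by (metis UNIV_eq_I order_refl)
qed

end

section \<open>Trivialisation of the pulled-back bundle\<close>

lemma has_derivative_scaled_bilinear: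
  fixes \<omega> :: "real^'n \<Rightarrow> real^'n \<Rightarrow> real"
  assumes "bilinear \<omega>"
  shows "((\<lambda>x. c * complex_of_real (\<omega> x u)) has_derivative (\<lambda>w. c * complex_of_real (\<omega> w u))) (at x)"
proof -
  have "linear (\<lambda>x. \<omega> x u)" using assms by (simp add: bilinear_def)
  then show ?thesis
    by (intro has_derivative_mult_right bounded_linear_imp_has_derivative bounded_linear_compose[OF bounded_linear_of_real])
      (simp add: linear_linear)
qed

text \<open>\<open>g i\<close> is the coefficient of a global frame in the local one, and \<rho> its
  monodromy. Translating the frame by a lattice vector and correcting by the shift of the model
  connection gives another parallel frame, hence a constant multiple of the first.\<close>

theorem prequantum_trivialisation:
  fixes \<omega> :: "real^'n \<Rightarrow> real^'n \<Rightarrow> real" and L :: "('i, 'n) line_bundle"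
  assumes bl: "bilinear \<omega>" and alt: "\<And>u. \<omega> u u = 0" and L: "prequantum_bundle \<omega> L"
  obtains g \<rho> where "\<And>i x. x \<in> chart L i \<Longrightarrow> norm (g i x) = 1"
    and "\<And>i x. x \<in> chart L i \<Longrightarrow> (g i has_derivative (\<lambda>u. (\<Sum>p\<in>UNIV. (- \<i> * pi * \<omega> x (axis p 1) - conn L i p x) *
        complex_of_real (u $ p)) * g i x)) (at x)"
    and "\<And>i j x. x \<in> chart L i \<Longrightarrow> x \<in> chart L j \<Longrightarrow> g i x = trans L i j x * g j x"
    and "\<And>i. smooth_on (g i) (chart L i)"
    and "\<And>v. v \<in> int_lattice \<Longrightarrow> norm (\<rho> v) = 1"
    and "\<And>v w. v \<in> int_lattice \<Longrightarrow> w \<in> int_lattice \<Longrightarrow> \<rho> (v + w) = \<rho> v * \<rho> w * cis (- pi * \<omega> w v)"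
    and "\<And>i x v. x \<in> chart L i \<Longrightarrow> v \<in> int_lattice \<Longrightarrow> g i (x + v) = \<rho> v * cis (- pi * \<omega> v x) * g i x"
proof -
  note L' = L[unfolded prequantum_bundle_def hermitian_line_bundle_def]
  note bl_simps = bilinear_ladd[OF bl] bilinear_radd[OF bl] bilinear_lzero[OF bl] bilinear_rzero[OF bl]
  \<comment> \<open>Model connection form minus the given one. Both have curvature
    \<open>- 2 * pi * \<i> * \<omega>\<close>, so the difference is closed.\<close>
  define \<alpha> where "\<alpha> i p x = - \<i> * pi * complex_of_real (\<omega> x (axis p 1)) - conn L i p x" for i p x
  have op: "open (chart L i)" for i using L' by blast
  have per: "x + v \<in> chart L i" if "x \<in> chart L i" "v \<in> int_lattice" for i x v
    using L' that unfolding periodic_set_def by blast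
  have conn_per: "conn L i p (x + v) = conn L i p x" if "x \<in> chart L i" "v \<in> int_lattice" for i p x v
    using L' that unfolding periodic_on_def by blast
  have trans_per: "trans L i j (x + v) = trans L i j x"
    if "x \<in> chart L i" "x \<in> chart L j" "v \<in> int_lattice" for i j x v
    using L' that unfolding periodic_on_def by blast
  have smooth_conn: "smooth_on (conn L i p) (chart L i)" for i p using L' by blast
  have lin: "linear (\<lambda>x. \<omega> x u)" for u using bl by (simp add: bilinear_def)
  interpret flat_bundle "chart L" "trans L" \<alpha>
  proof
    fix i j k x
    show "open (chart L i)" by (rule op)
    show "(\<Union>i. chart L i) = UNIV" using L' by blast
    show "norm (trans L i j x) = 1" if "x \<in> chart L i" "x \<in> chart L j" using L' that by blast
    show "trans L i j x * trans L j k x = trans L i k x" if "x \<in> chart L i" "x \<in> chart L j" "x \<in> chart L k"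
      using L' that by blast
    show "smooth_on (\<alpha> i p) (chart L i)" for p
      unfolding \<alpha>_def[abs_def]
      by (intro smooth_on_diff smooth_on_mult smooth_on_const smooth_on_of_real_linear lin smooth_conn op)
    show "Re (\<alpha> i p x) = 0" if "x \<in> chart L i" for p using L' that by (simp add: \<alpha>_def)
    show "partial_deriv p (\<alpha> i q) x = partial_deriv q (\<alpha> i p) x" if x: "x \<in> chart L i" for p q
    proof -
      have eq: "partial_deriv p (\<alpha> i q) x = - \<i> * pi * complex_of_real (\<omega> (axis p 1) (axis q 1)) - partial_deriv p (conn L i q) x"
        for p q
        unfolding \<alpha>_def[abs_def] partial_deriv_def[of p "conn L i q"]
        by (rule partial_deriv_eqI[OF has_derivative_diff[OF has_derivative_scaled_bilinear[OF bl] frechet_works]])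
          (rule smooth_on_imp_differentiable[OF smooth_conn op x])
      have "partial_deriv p (conn L i q) x - partial_deriv q (conn L i p) x =
          - 2 * pi * \<i> * complex_of_real (\<omega> (axis p 1) (axis q 1))"
        using L' x by blast
      moreover have "\<omega> (axis q 1) (axis p 1) = - \<omega> (axis p 1) (axis q 1)"
        by (rule alternating_skew[OF bl alt])
      ultimately show ?thesis unfolding eq[of p q] eq[of q p] by (simp add: algebra_simps)
    qed
    show "(trans L i j has_derivative (\<lambda>u. (\<Sum>p\<in>UNIV. (\<alpha> i p x - \<alpha> j p x) * complex_of_real (u $ p)) * trans L i j x)) (at x)"
      if x: "x \<in> chart L i" "x \<in> chart L j"
    proof -
      have sm: "smooth_on (trans L i j) (chart L i \<inter> chart L j)" using L' by blast
      have d: "trans L i j differentiable (at x)"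
        by (rule smooth_on_imp_differentiable[OF sm]) (use op x in auto)
      have eq: "partial_deriv p (trans L i j) x = (\<alpha> i p x - \<alpha> j p x) * trans L i j x" for p
      proof -
        have "trans L i j x * conn L j p x = partial_deriv p (trans L i j) x + trans L i j x * conn L i p x"
          using L' x by blast
        then show ?thesis by (simp add: \<alpha>_def algebra_simps)
      qed
      show ?thesis
        by (rule has_derivative_eq_rhs[OF frechet_works[OF d]])
          (simp add: fun_eq_iff frechet_derivative_sum[OF d] eq sum_distrib_right sum_distrib_left mult_ac)
    qed
  qed
  obtain g where g: "parallel UNIV g" using parallel_global by blast
  have norm_g: "norm (g i x) = 1" if "x \<in> chart L i" for i x using g that unfolding parallel_def by blast
  have g_deriv: "(g i has_derivative (\<lambda>u. A i x u * g i x)) (at x)" if "x \<in> chart L i" for i x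
    using g that unfolding parallel_def by blast
  have g_trans: "g i x = trans L i j x * g j x" if "x \<in> chart L i" "x \<in> chart L j" for i j x
    using g that unfolding parallel_def by blast
  have "smooth_on (g i) (chart L i)" for i
  proof -
    have "Ck_on k (g i) (chart L i)" for k
    proof (induction k)
      case 0
      then show ?case using has_derivative_continuous_on[OF has_derivative_at_withinI[OF g_deriv]] by simp
    next
      case (Suc k)
      have "Ck_on k (partial_deriv p (g i)) (chart L i)" for p
      proof (rule Ck_on_cong[OF op, THEN iffD2])
        show "partial_deriv p (g i) x = \<alpha> i p x * g i x" if "x \<in> chart L i" for x
          by (subst partial_deriv_eqI[OF g_deriv[OF that]]) (simp add: A_def axis_def if_distrib[of complex_of_real] if_distrib[of "(*) _"] cong: if_cong)
        show "Ck_on k (\<lambda>x. \<alpha> i p x * g i x) (chart L i)"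
          using \<alpha>_smooth Suc by (intro Ck_on_mult op) (auto simp: smooth_on_def)
      qed
      moreover have "g i differentiable_on chart L i"
        unfolding differentiable_on_open_at[OF op] using g_deriv differentiableI by blast
      ultimately show ?case by simp
    qed
    then show ?thesis by (simp add: smooth_on_def)
  qed
  moreover
  obtain i0 where i0: "0 \<in> chart L i0" by (rule in_chart)
  define \<rho> where "\<rho> v = g i0 v * cnj (g i0 0)" for v
  have lat: "v \<in> chart L i0" if "v \<in> int_lattice" for v using per[OF i0 that] by simp
  have norm_\<rho>: "norm (\<rho> v) = 1" if "v \<in> int_lattice" for v
    using norm_g[OF lat[OF that]] norm_g[OF i0] by (simp add: \<rho>_def norm_mult)
  have cc: "cis a * cis (- a) = 1" for a by (simp add: cis_mult)
  have g_per: "g i (x + v) = \<rho> v * cis (- pi * \<omega> v x) * g i x" if x: "x \<in> chart L i" and v: "v \<in> int_lattice" for i x v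
  proof -
    \<comment> \<open>The factor \<open>cis\<close> cancels the change of \<alpha> under translation
      by \<open>v\<close>, so \<open>G\<close> is parallel for the same connection.\<close>
    define G where "G i x = g i (x + v) * cis (pi * \<omega> v x)" for i x
    have "parallel UNIV G"
      unfolding parallel_def
    proof (intro conjI allI ballI)
      fix i x assume "x \<in> UNIV \<inter> chart L i"
      then have x: "x \<in> chart L i" by simp
      show "norm (G i x) = 1" using norm_g[OF per[OF x v]] by (simp add: G_def norm_mult)
      have "((\<lambda>x. x + v) has_derivative (\<lambda>u. u)) (at x)" by (auto intro!: derivative_eq_intros)
      from has_derivative_compose[OF this g_deriv[OF per[OF x v]]]
      have d1: "((\<lambda>x. g i (x + v)) has_derivative (\<lambda>u. A i (x + v) u * g i (x + v))) (at x)" .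
      have "linear (\<omega> v)" using bl by (simp add: bilinear_def)
      then have "((\<lambda>x. \<i> * complex_of_real (pi * \<omega> v x)) has_derivative (\<lambda>u. \<i> * complex_of_real (pi * \<omega> v u))) (at x)"
        by (intro has_derivative_mult_right bounded_linear_imp_has_derivative bounded_linear_compose[OF bounded_linear_of_real]
            bounded_linear_const_mult) (simp add: linear_linear)
      from has_derivative_compose[OF this DERIV_exp[THEN has_field_derivative_imp_has_derivative]]
      have d2: "((\<lambda>x. cis (pi * \<omega> v x)) has_derivative (\<lambda>u. cis (pi * \<omega> v x) * (\<i> * complex_of_real (pi * \<omega> v u)))) (at x)"
        by (simp add: cis_conv_exp)
      have \<alpha>_shift: "\<alpha> i p (x + v) = \<alpha> i p x - \<i> * pi * \<omega> v (axis p 1)" for p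
        by (simp only: \<alpha>_def bl_simps conn_per[OF x v]) (simp add: algebra_simps)
      have \<omega>_sum: "\<omega> v u = (\<Sum>p\<in>UNIV. \<omega> v (axis p 1) * u $ p)" for u
      proof -
        have "\<omega> v u = \<omega> v (\<Sum>p\<in>UNIV. (u $ p) *\<^sub>R axis p 1)"
          by (simp add: basis_expansion flip: scalar_mult_eq_scaleR)
        also have "\<dots> = (\<Sum>p\<in>UNIV. \<omega> v (axis p 1) * u $ p)"
          using \<open>linear (\<omega> v)\<close> by (simp add: linear_sum linear_scale mult.commute)
        finally show ?thesis .
      qed
      have A_shift: "A i (x + v) u = A i x u - \<i> * complex_of_real (pi * \<omega> v u)" for u
      proof -
        have "A i (x + v) u = (\<Sum>p\<in>UNIV. \<alpha> i p x * complex_of_real (u $ p) -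
            \<i> * (pi * complex_of_real (\<omega> v (axis p 1) * u $ p)))"
          unfolding A_def by (intro sum.cong refl) (simp add: \<alpha>_shift left_diff_distrib mult.assoc)
        also have "\<dots> = A i x u - \<i> * (pi * complex_of_real (\<omega> v u))"
          unfolding A_def sum_subtractf \<omega>_sum[of u] of_real_sum sum_distrib_left ..
        finally show ?thesis by simp
      qed
      show "(G i has_derivative (\<lambda>u. A i x u * G i x)) (at x)"
        unfolding G_def[abs_def]
        by (rule has_derivative_eq_rhs[OF has_derivative_mult[OF d1 d2]])
          (simp only: A_shift, simp add: fun_eq_iff algebra_simps)
    next
      fix i j x assume "x \<in> UNIV \<inter> chart L i \<inter> chart L j"
      then have x: "x \<in> chart L i" "x \<in> chart L j" by auto
      show "G i x = trans L i j x * G j x"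
        using g_trans[OF per[OF x(1) v] per[OF x(2) v]] trans_per[OF x v] by (simp add: G_def)
    qed
    moreover have "parallel UNIV (\<lambda>i x. \<rho> v * g i x)" using parallel_scale[OF g norm_\<rho>[OF v]] .
    moreover have "G i0 0 = \<rho> v * g i0 0"
      using unit_cnj(2)[OF norm_g[OF i0]] by (simp add: G_def \<rho>_def bl_simps mult.assoc)
    ultimately have "G i x = \<rho> v * g i x"
      using parallel_unique[of UNIV "\<lambda>i x. \<rho> v * g i x" G 0 i0 x i] i0 x convex_connected[OF convex_UNIV] by auto
    then have "g i (x + v) * (cis (pi * \<omega> v x) * cis (- (pi * \<omega> v x))) = \<rho> v * cis (- pi * \<omega> v x) * g i x"
      by (simp add: G_def flip: mult.assoc)
    then show ?thesis by (simp only: cc mult_1_right)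
  qed
  moreover have "\<rho> (v + w) = \<rho> v * \<rho> w * cis (- pi * \<omega> w v)" if v: "v \<in> int_lattice" and w: "w \<in> int_lattice" for v w
  proof -
    have "g i0 (v + w) = \<rho> w * cis (- pi * \<omega> w v) * g i0 v"
      by (rule g_per[OF lat[OF v] w])
    then show ?thesis by (simp add: \<rho>_def)
  qed
  ultimately show thesis
    using that[of g \<rho>] norm_g g_deriv g_trans norm_\<rho> unfolding A_def \<alpha>_def by blast
qed

section \<open>The spectrum of the magnetic Laplacian\<close>

lemma (in quasi_periodic) D_sum_fun:
  fixes F :: "'k \<Rightarrow> real^'n \<Rightarrow> complex"
  assumes "\<And>i. i \<in> I \<Longrightarrow> F i \<in> qp"
  shows "D u (\<lambda>x. \<Sum>i\<in>I. r i * F i x) x = (\<Sum>i\<in>I. r i * D u (F i) x) \<and> (\<lambda>x. \<Sum>i\<in>I. r i * F i x) \<in> qp"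
  using assms
proof (induction I rule: infinite_finite_induct)
  case (insert i I)
  then have i: "(\<lambda>x. r i * F i x) \<in> qp" and I: "(\<lambda>x. \<Sum>i\<in>I. r i * F i x) \<in> qp" by (auto intro: qp_scale)
  have "D u (\<lambda>x. r i * F i x + (\<Sum>i\<in>I. r i * F i x)) x = r i * D u (F i) x + (\<Sum>i\<in>I. r i * D u (F i) x)"
    using insert qp_smooth[OF i] qp_smooth[OF I] by (simp add: D_add D_scale[OF qp_smooth])
  then show ?case using insert.hyps qp_add[OF i I] by simp
qed (auto simp: D_def qp_def smooth_on_const)

locale magnetic = symplectic_frame h \<omega> b \<sigma> s a + quasi_periodic \<omega> c
  for h \<omega> :: "real^'n \<Rightarrow> real^'n \<Rightarrow> real" and b :: "'n \<Rightarrow> real^'n" and \<sigma> :: "'n \<Rightarrow> 'n" and s a :: "'n \<Rightarrow> real"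
    and c :: "real^'n \<Rightarrow> complex" +
  assumes integral_\<omega>: "integral_class \<omega>"
begin

definition lap :: "(real^'n \<Rightarrow> complex) \<Rightarrow> real^'n \<Rightarrow> complex" where
  "lap f x = - (\<Sum>p\<in>UNIV. D (b p) (D (b p) f) x)"

definition lower :: "'n \<Rightarrow> (real^'n \<Rightarrow> complex) \<Rightarrow> real^'n \<Rightarrow> complex" where
  "lower p = lad 1 (b p) (b (\<sigma> p))"

definition raise :: "'n \<Rightarrow> (real^'n \<Rightarrow> complex) \<Rightarrow> real^'n \<Rightarrow> complex" where
  "raise p = lad (- 1) (b p) (b (\<sigma> p))"

definition zero_point :: real where "zero_point = 2 * pi * (\<Sum>p\<in>freq_modes. a p)"

lemma zero_point_nonneg: "zero_point \<ge> 0"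
  unfolding zero_point_def by (intro mult_nonneg_nonneg sum_nonneg) (use a in \<open>auto intro: less_imp_le\<close>)

text \<open>The mixed terms form a commutator, a constant by the curvature; this is the zero-point
  term of one mode.\<close>

lemma raise_lower:
  fixes f :: "real^'n \<Rightarrow> complex"
  assumes f: "f \<in> qp" and p: "p \<in> freq_modes"
  shows "raise p (lower p f) x = - D (b p) (D (b p) f) x - D (b (\<sigma> p)) (D (b (\<sigma> p)) f) x - 2 * pi * a p * f x"
proof -
  have eq: "D (b p) (D (b (\<sigma> p)) f) x = D (b (\<sigma> p)) (D (b p) f) x - 2 * pi * \<i> * a p * f x"
    using D_commute[OF qp_smooth[OF f], of "b p" "b (\<sigma> p)" x] p by (simp add: \<omega>b freq_modes_def)
  have ii: "\<i> * (\<i> * r) = - r" for r by simp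
  show ?thesis
    unfolding raise_def lower_def lad_def[of _ _ _ "lad _ _ _ f"] D_lad[OF f] eq
    by (simp add: algebra_simps ii)
qed

text \<open>\<open>sum_modes\<close> applies to the summand symmetrised under \<sigma>, which counts
  every plane twice on both sides; the factor 2 is cancelled.\<close>

lemma lap_eq:
  fixes f :: "real^'n \<Rightarrow> complex"
  assumes f: "f \<in> qp"
  shows "lap f x = (\<Sum>p\<in>freq_modes. raise p (lower p f) x) + zero_point * f x"
proof -
  let ?g = "\<lambda>p. D (b p) (D (b p) f) x"
  have "(\<Sum>p\<in>UNIV. ?g p + ?g (\<sigma> p)) =
      (\<Sum>p\<in>freq_modes. ?g p + ?g (\<sigma> p)) + (\<Sum>p\<in>freq_modes. ?g p + ?g (\<sigma> p))"
    by (rule sum_modes) (simp add: \<sigma> add.commute)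
  moreover have "(\<Sum>p\<in>UNIV. ?g (\<sigma> p)) = (\<Sum>p\<in>UNIV. ?g p)"
    by (rule sum.reindex_bij_witness[of _ \<sigma> \<sigma>]) (auto simp: \<sigma>)
  ultimately have "2 * (\<Sum>p\<in>UNIV. ?g p) = 2 * (\<Sum>p\<in>freq_modes. ?g p + ?g (\<sigma> p))"
    by (simp add: sum.distrib)
  then have "(\<Sum>p\<in>UNIV. ?g p) = (\<Sum>p\<in>freq_modes. ?g p + ?g (\<sigma> p))"
    by (simp only: mult_cancel_left zero_neq_numeral[symmetric]) auto
  moreover have "(\<Sum>p\<in>freq_modes. raise p (lower p f) x) =
      (\<Sum>p\<in>freq_modes. - (?g p + ?g (\<sigma> p)) - complex_of_real (2 * pi * a p) * f x)"
    by (intro sum.cong refl) (simp add: raise_lower[OF f])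
  ultimately show ?thesis
    by (simp add: lap_def zero_point_def sum.distrib sum_subtractf sum_negf sum_distrib_right sum_distrib_left mult.assoc)
qed

lemma \<omega>_modes:
  assumes "p \<in> freq_modes" "q \<in> freq_modes"
  shows "\<omega> (b p) (b q) = 0" "\<omega> (b (\<sigma> p)) (b (\<sigma> q)) = 0"
    "\<omega> (b p) (b (\<sigma> q)) = (if p = q then a p else 0)" "\<omega> (b (\<sigma> p)) (b q) = (if p = q then - a p else 0)"
proof -
  have s1: "s p = 1" "s q = 1" using assms by (auto simp: freq_modes_def)
  have inj: "\<sigma> q = \<sigma> p \<longleftrightarrow> p = q" by (metis \<sigma>)
  have "q \<noteq> \<sigma> p" "\<sigma> q \<noteq> p" using s1 s(2)[of p] s(2)[of q] by auto
  then show "\<omega> (b p) (b q) = 0" "\<omega> (b (\<sigma> p)) (b (\<sigma> q)) = 0"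
    "\<omega> (b p) (b (\<sigma> q)) = (if p = q then a p else 0)" "\<omega> (b (\<sigma> p)) (b q) = (if p = q then - a p else 0)"
    using s1 by (auto simp: \<omega>b \<sigma> inj s(2) a(2))
qed

sublocale Fun: vector_space fscale
  by (rule vector_space_fscale)

lemma subspace_qp: "Fun.subspace qp"
  unfolding Fun.subspace_def
  by (auto simp: fscale_def plus_fun_def zero_fun_def intro: qp_add qp_scale) (simp add: qp_def smooth_on_const)

text \<open>The commutator of lowering and raising operators receives \<open>2 * pi * a p\<close>
  from each of its two mixed terms. The lower bound is the maximum principle for the Laplacian,
  shifted by the zero-point energy.\<close>

lemma ladder_frequencies: "ladder fscale qp lower raise freq_modes (\<lambda>p. 4 * pi * a p) zero_point"
proof unfold_locales
  show "Fun.subspace qp" by (rule subspace_qp)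
  show "finite freq_modes" by simp
  show "zero_point \<ge> 0" by (rule zero_point_nonneg)
  show "4 * pi * a p > 0" for p using a by simp
  fix p q f g and k :: complex
  assume f: "f \<in> qp"
  show "lower p f \<in> qp" "raise p f \<in> qp"
    unfolding lower_def raise_def using lad_qp[OF f] by auto
  show "lower p (fscale k f) = fscale k (lower p f)" "raise p (fscale k f) = fscale k (raise p f)"
    unfolding lower_def raise_def fscale_def using lad_scale[OF f] by (auto simp: fun_eq_iff)
  show "lower p (f + g) = lower p f + lower p g" "raise p (f + g) = raise p f + raise p g" if "g \<in> qp"
    unfolding lower_def raise_def plus_fun_def using lad_add[OF f that] by (auto simp: fun_eq_iff)
  show "f = 0" if "(\<Sum>p\<in>freq_modes. raise p (lower p f)) = fscale \<mu> f" "Re \<mu> < - zero_point" for \<mu>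
  proof
    fix x
    have eq: "lap f y = (\<mu> + zero_point) * f y" for y
      using fun_cong[OF that(1), of y] unfolding lap_eq[OF f]
      by (simp add: sum_fun_apply fscale_def algebra_simps)
    have "f x = 0"
      by (rule laplacian_eigenvalue_nonneg[OF f eq[unfolded lap_def]]) (use that(2) in simp)
    then show "f x = 0 x" by simp
  qed
  assume pq: "p \<in> freq_modes" "q \<in> freq_modes"
  show "lower p (lower q f) = lower q (lower p f)" "raise p (raise q f) = raise q (raise p f)"
    unfolding lower_def raise_def
    using lad_commute[OF f, of 1 "b p" "b (\<sigma> p)" 1 "b q" "b (\<sigma> q)"]
      lad_commute[OF f, of "- 1" "b p" "b (\<sigma> p)" "- 1" "b q" "b (\<sigma> q)"]
    by (auto simp: fun_eq_iff \<omega>_modes[OF pq])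
  show "lower p (raise q f) = raise q (lower p f) +
      fscale (if p = q then complex_of_real (4 * pi * a p) else 0) f"
    unfolding lower_def raise_def
    using lad_commute[OF f, of 1 "b p" "b (\<sigma> p)" "- 1" "b q" "b (\<sigma> q)"]
    by (auto simp: fun_eq_iff \<omega>_modes[OF pq] fscale_def algebra_simps)
qed

lemma bergman: "bergman \<omega> c complex_structure (column_matrix scaled_basis)"
proof unfold_locales
  show "integral_class \<omega>" by (rule integral_\<omega>)
  show "nondegenerate \<omega>" using \<omega> by (simp add: symplectic_form_def)
  show "complex_structure (x + y) = complex_structure x + complex_structure y"
    "complex_structure (r *\<^sub>R x) = r *\<^sub>R complex_structure x" for x y r
    using linear_complex_structure by (simp_all add: linear_add linear_scale)
  show "complex_structure (complex_structure x) = - x" for x by (rule complex_structure_square)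
  show "\<omega> x (complex_structure y) = \<omega> y (complex_structure x)" for x y
    unfolding \<omega>_complex_structure by (intro sum.cong refl) simp
  show "\<omega> (column_matrix scaled_basis *v z) (complex_structure (column_matrix scaled_basis *v w)) = z \<bullet> w" for z w
    by (rule scaled_basis_isometry)
  show "det (column_matrix scaled_basis) \<noteq> 0" using det_scaled_basis by auto
qed

text \<open>\<open>lower p f = 0\<close> is the Cauchy-Riemann equation in the direction
  \<open>b p\<close>; for the partner direction it is the same equation multiplied by
  \<open>\<i>\<close>. Linearity in the direction covers all vectors.\<close>

lemma vacuum_eq: "{f \<in> qp. \<forall>p\<in>freq_modes. lower p f = 0} = bergman.vac \<omega> c complex_structure"
proof -
  interpret B: bergman \<omega> c complex_structure "column_matrix scaled_basis" by (rule bergman)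
  have "(\<forall>p\<in>freq_modes. lower p f = 0) \<longleftrightarrow> (\<forall>v x. D (complex_structure v) f x = \<i> * D v f x)" if f: "f \<in> qp" for f
  proof
    assume low: "\<forall>p\<in>freq_modes. lower p f = 0"
    have modes: "D (b p) f x + \<i> * D (b (\<sigma> p)) f x = 0" if "p \<in> freq_modes" for p x
      using fun_cong[OF bspec[OF low that], of x] by (simp add: lower_def lad_def)
    have basis: "D (complex_structure (b p)) f x = \<i> * D (b p) f x" for p x
    proof (cases "s p = 1")
      case True
      then have "D (b p) f x = - (\<i> * D (b (\<sigma> p)) f x)"
        using modes[of p x] by (simp add: freq_modes_def eq_neg_iff_add_eq_0)
      then show ?thesis using True by (simp add: complex_structure_basis)
    next
      case False
      then have sp: "s p = - 1" using s(1)[of p] by auto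
      then have "D (b (\<sigma> p)) f x + \<i> * D (b p) f x = 0"
        using modes[of "\<sigma> p" x] s(2)[of p] by (simp add: freq_modes_def \<sigma>)
      then show ?thesis using sp D_linear(3)[OF qp_smooth[OF f], of "b (\<sigma> p)" x]
        by (simp add: complex_structure_basis neg_eq_iff_add_eq_0)
    qed
    show "\<forall>v x. D (complex_structure v) f x = \<i> * D v f x"
    proof (intro allI)
      fix v x
      define r where "r p = h (b p) v" for p
      have v: "v = (\<Sum>p\<in>UNIV. r p *\<^sub>R b p)" unfolding r_def by (rule orthonormal_expansion)
      have "complex_structure v = (\<Sum>p\<in>UNIV. r p *\<^sub>R complex_structure (b p))"
        by (subst v) (simp add: linear_sum[OF linear_complex_structure] linear_scale[OF linear_complex_structure])
      then have "D (complex_structure v) f x = (\<Sum>p\<in>UNIV. r p * D (complex_structure (b p)) f x)"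
        by (simp add: D_sum[OF qp_smooth[OF f]])
      also have "\<dots> = \<i> * D v f x"
        by (subst v) (simp add: D_sum[OF qp_smooth[OF f]] basis sum_distrib_left mult_ac)
      finally show "D (complex_structure v) f x = \<i> * D v f x" .
    qed
  next
    assume vac: "\<forall>v x. D (complex_structure v) f x = \<i> * D v f x"
    show "\<forall>p\<in>freq_modes. lower p f = 0"
    proof
      fix p assume "p \<in> freq_modes"
      then have "D (b (\<sigma> p)) f x = \<i> * D (b p) f x" for x
        using vac[rule_format, of "b p" x] by (simp add: complex_structure_basis freq_modes_def)
      then show "lower p f = 0" by (simp add: lower_def lad_def fun_eq_iff)
    qed
  qed
  then show ?thesis unfolding B.vac_def by blast
qed

text \<open>The determinant of the scaled basis is, up to sign, the reciprocal of the volume, so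
  \<open>d * Z = 1\<close> becomes the relation of \<open>d\<close> to the volume. The Gaussian
  integral stays symbolic, being the same for every form on this space.\<close>

theorem laplacian_spectrum:
  "\<exists>d. real d * (\<integral>x. exp (- pi * ((x :: real^'n) \<bullet> x)) \<partial>lborel) = symplectic_volume \<omega> \<and>
    (\<forall>\<nu> ps. distinct ps \<longrightarrow> set ps = freq_modes \<longrightarrow>
      has_dim fscale {f \<in> qp. lap f = fscale \<nu> f}
        (if Im \<nu> = 0 then d * tuple_count (map (\<lambda>p. 4 * pi * a p) ps) (Re \<nu> - zero_point) else 0))"
proof -
  interpret B: bergman \<omega> c complex_structure "column_matrix scaled_basis" by (rule bergman)
  interpret L: ladder fscale qp lower raise freq_modes "\<lambda>p. 4 * pi * a p" zero_point by (rule ladder_frequencies)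
  obtain d where d: "has_dim fscale B.vac d" "real d * B.Z = 1" using B.vac_has_dim by blast
  let ?T = "det (column_matrix scaled_basis)" and ?g = "det (gram \<omega>)"
  have g: "?T\<^sup>2 * ?g = 1" by (rule det_scaled_basis)
  then have gpos: "?g > 0" by (metis zero_less_mult_pos zero_less_one zero_less_power2 mult_zero_left zero_neq_one power2_eq_iff_nonneg power_zero_numeral mult_eq_0_iff)
  have "(\<bar>?T\<bar> * sqrt ?g)\<^sup>2 = 1" using g gpos by (simp add: power_mult_distrib)
  then have "\<bar>?T\<bar> * sqrt ?g = 1" using gpos by (simp add: power2_eq_1_iff) (smt (verit) mult_nonneg_nonneg real_sqrt_ge_zero)
  then have T: "\<bar>?T\<bar> * symplectic_volume \<omega> = 1" by (simp add: symplectic_volume_def)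
  let ?\<kappa> = "\<integral>x. exp (- pi * ((x :: real^'n) \<bullet> x)) \<partial>lborel"
  have "\<bar>?T\<bar> * (real d * ?\<kappa>) = \<bar>?T\<bar> * symplectic_volume \<omega>"
    using d(2) T by (simp add: B.Z_eq mult.left_commute)
  moreover have "\<bar>?T\<bar> \<noteq> 0" using T by auto
  ultimately have vol: "real d * ?\<kappa> = symplectic_volume \<omega>" using mult_left_cancel by blast
  have "has_dim fscale {f \<in> qp. lap f = fscale \<nu> f}
        (if Im \<nu> = 0 then d * tuple_count (map (\<lambda>p. 4 * pi * a p) ps) (Re \<nu> - zero_point) else 0)"
    if ps: "distinct ps" "set ps = freq_modes" for \<nu> ps
  proof -
    have "has_dim fscale (L.E (set ps) (\<nu> - zero_point))
       (if Im (\<nu> - zero_point) = 0 then d * tuple_count (map (\<lambda>p. 4 * pi * a p) ps) (Re (\<nu> - zero_point)) else 0)"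
      by (rule L.has_dim_E) (use d ps vacuum_eq in auto)
    moreover have "L.E (set ps) (\<nu> - zero_point) = {f \<in> qp. lap f = fscale \<nu> f}"
    proof -
      have "L.H f = fscale (\<nu> - zero_point) f \<longleftrightarrow> lap f = fscale \<nu> f" if "f \<in> qp" for f
        by (simp add: fun_eq_iff L.H_def lap_eq[OF that] sum_fun_apply fscale_def algebra_simps eq_diff_eq)
      then show ?thesis by (auto simp: L.E_def ps)
    qed
    ultimately show ?thesis by (cases "Im \<nu> = 0") simp_all
  qed
  then show ?thesis using vol by blast
qed

end

section \<open>From quasi-periodic functions back to sections of tensor powers\<close>

lemma symplectic_frame_scale:
  assumes "symplectic_frame h \<omega> b \<sigma> s a" and k: "k > 0"
  shows "symplectic_frame h (\<lambda>u v. k * \<omega> u v) b \<sigma> s (\<lambda>p. k * a p)"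
proof -
  interpret symplectic_frame h \<omega> b \<sigma> s a by fact
  have "bilinear (\<lambda>u v. k * \<omega> u v)"
    using \<omega> unfolding symplectic_form_def bilinear_def
    by (auto intro!: linear_compose_scale_right[where 'b = real, simplified])
  then have "symplectic_form (\<lambda>u v. k * \<omega> u v)"
    using \<omega> k by (auto simp: symplectic_form_def nondegenerate_def)
  then show ?thesis
    using h orth \<sigma> s a k \<omega>b by unfold_locales auto
qed

text \<open>Multiplication by the \<open>k\<close>-th power of the global frame identifies
  quasi-periodic functions for \<open>k\<close> times \<omega> with sections of the tensor power and
  intertwines the Laplacians. Eigenspaces correspond, and so do their dimensions.\<close>

theorem section_spectrum:
  fixes h \<omega> :: "real^'n \<Rightarrow> real^'n \<Rightarrow> real" and L :: "('i, 'n) line_bundle"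
  assumes frame: "symplectic_frame h \<omega> b \<sigma> s a" and integral: "integral_class \<omega>"
    and L: "prequantum_bundle \<omega> L" and k: "k \<ge> 1"
  shows "\<exists>d. real d * (\<integral>x. exp (- pi * ((x :: real^'n) \<bullet> x)) \<partial>lborel) = symplectic_volume (\<lambda>u v. real k * \<omega> u v) \<and>
    (\<forall>\<mu> ps. distinct ps \<longrightarrow> set ps = {p. s p = 1} \<longrightarrow>
      hamiltonian_spectrum k h L \<mu> = (if Im \<mu> = 0 then d * tuple_count (map (\<lambda>p. 4 * pi * (real k * a p)) ps)
         (2 * (real k)\<^sup>2 * Re \<mu> - 2 * pi * (\<Sum>p | s p = 1. real k * a p)) else 0))"
proof -
  have bl: "bilinear \<omega>" and alt: "\<And>u. \<omega> u u = 0"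
    using frame by (auto simp: symplectic_frame_def symplectic_form_def)
  obtain g \<rho> where norm_g: "\<And>i x. x \<in> chart L i \<Longrightarrow> norm (g i x) = 1"
    and g_deriv: "\<And>i x. x \<in> chart L i \<Longrightarrow> (g i has_derivative (\<lambda>u. (\<Sum>p\<in>UNIV. (- \<i> * pi * \<omega> x (axis p 1) - conn L i p x) *
        complex_of_real (u $ p)) * g i x)) (at x)"
    and g_trans: "\<And>i j x. x \<in> chart L i \<Longrightarrow> x \<in> chart L j \<Longrightarrow> g i x = trans L i j x * g j x"
    and g_smooth: "\<And>i. smooth_on (g i) (chart L i)"
    and norm_\<rho>: "\<And>v. v \<in> int_lattice \<Longrightarrow> norm (\<rho> v) = 1"
    and \<rho>_add: "\<And>v w. v \<in> int_lattice \<Longrightarrow> w \<in> int_lattice \<Longrightarrow> \<rho> (v + w) = \<rho> v * \<rho> w * cis (- pi * \<omega> w v)"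
    and g_per: "\<And>i x v. x \<in> chart L i \<Longrightarrow> v \<in> int_lattice \<Longrightarrow> g i (x + v) = \<rho> v * cis (- pi * \<omega> v x) * g i x"
    using prequantum_trivialisation[OF bl alt L] by blast
  note L' = L[unfolded prequantum_bundle_def hermitian_line_bundle_def]
  have op: "open (chart L i)" for i using L' by blast
  have cover: "(\<Union>i. chart L i) = UNIV" using L' by blast
  have per: "x + v \<in> chart L i" if "x \<in> chart L i" "v \<in> int_lattice" for i x v
    using L' that unfolding periodic_set_def by blast
  have norm_t: "norm (trans L i j x) = 1" if "x \<in> chart L i" "x \<in> chart L j" for i j x
    using L' that by blast
  \<comment> \<open>A function is a section divided by the frame power, and sections are periodic;
    the function therefore carries the inverse, hence conjugate, monodromy.\<close>
  define c where "c v = cnj (\<rho> v) ^ k" for v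
  define \<omega>k where "\<omega>k u v = real k * \<omega> u v" for u v
  have cis_power: "cis (pi * \<omega> u v) ^ k = cis (pi * \<omega>k u v)" "cis (- pi * \<omega> u v) ^ k = cis (- pi * \<omega>k u v)" for u v
    unfolding \<omega>k_def Complex.DeMoivre by (simp_all only: mult.left_commute)
  interpret M: magnetic h \<omega>k b \<sigma> s "\<lambda>p. real k * a p" c
  proof (intro magnetic.intro magnetic_axioms.intro)
    show "symplectic_frame h \<omega>k b \<sigma> s (\<lambda>p. real k * a p)"
      unfolding \<omega>k_def[abs_def] by (rule symplectic_frame_scale[OF frame]) (use k in simp)
    then have "symplectic_form \<omega>k" by (simp add: symplectic_frame_def)
    then show "quasi_periodic \<omega>k c"
    proof unfold_locales
      show "norm (c v) = 1" if "v \<in> int_lattice" for v by (simp add: c_def norm_power norm_\<rho>[OF that])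
      show "c (v + w) = c v * c w * cis (pi * \<omega>k w v)" if "v \<in> int_lattice" "w \<in> int_lattice" for v w
        by (simp add: c_def \<rho>_add[OF that] power_mult_distrib cis_cnj cis_power)
    qed (auto simp: symplectic_form_def)
    show "integral_class \<omega>k"
      using integral by (auto simp: integral_class_def \<omega>k_def)
  qed
  let ?L = "tensor_power k L"
  have chart_L: "chart ?L = chart L" and trans_L: "trans ?L i j x = trans L i j x ^ k"
    and conn_L: "conn ?L i p x = of_nat k * conn L i p x" for i j p x
    by (simp_all add: tensor_power_def)
  have unit: "g i x ^ k * cnj (g i x) ^ k = 1" if "x \<in> chart L i" for i x
    using norm_g[OF that] complex_norm_square[of "g i x"] by (simp flip: power_mult_distrib)
  define \<Phi> where "\<Phi> f i x = (if x \<in> chart L i then f x * g i x ^ k else 0)" for f i x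
  \<comment> \<open>An arbitrary chart at \<open>x\<close>; section and frame coefficients change by
    the same unit factor, so \<Psi> does not depend on the choice.\<close>
  define j where "j x = (SOME i. x \<in> chart L i)" for x
  have j: "x \<in> chart L (j x)" for x
    unfolding j_def using cover by (metis UNIV_I UN_iff someI_ex)
  define \<Psi> where "\<Psi> t x = t (j x) x * cnj (g (j x) x) ^ k" for t x
  have \<Psi>\<Phi>: "\<Psi> (\<Phi> f) = f" for f
    using unit[OF j] j by (simp add: fun_eq_iff \<Psi>_def \<Phi>_def mult.assoc)
  have \<Psi>_eq: "\<Psi> t x = t i x * cnj (g i x) ^ k" if t: "t \<in> sections ?L" and x: "x \<in> chart L i" for t i x
  proof -
    have "t i x = trans L i (j x) x ^ k * t (j x) x"
      using t x j[of x] unfolding sections_def chart_L trans_L by blast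
    moreover have "g i x = trans L i (j x) x * g (j x) x" by (rule g_trans[OF x j])
    moreover have "trans L i (j x) x ^ k * cnj (trans L i (j x) x) ^ k = 1"
      using norm_t[OF x j] complex_norm_square[of "trans L i (j x) x"] by (simp flip: power_mult_distrib)
    ultimately show ?thesis
      by (simp add: \<Psi>_def power_mult_distrib)
  qed
  have \<Phi>\<Psi>: "\<Phi> (\<Psi> t) = t" if t: "t \<in> sections ?L" for t
  proof (intro ext)
    fix i x
    show "\<Phi> (\<Psi> t) i x = t i x"
    proof (cases "x \<in> chart L i")
      case True
      have "\<Phi> (\<Psi> t) i x = t i x * (g i x ^ k * cnj (g i x) ^ k)"
        using True by (simp add: \<Phi>_def \<Psi>_eq[OF t True] mult_ac)
      then show ?thesis by (simp add: unit[OF True])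
    next
      case False
      then show ?thesis using t by (simp add: \<Phi>_def sections_def chart_L)
    qed
  qed
  have \<Psi>_qp: "\<Psi> t \<in> M.qp" if t: "t \<in> sections ?L" for t
  proof -
    have "smooth_on (\<Psi> t) (chart L i)" for i
    proof (rule smooth_on_cong[OF op \<Psi>_eq[OF t], THEN iffD2])
      show "smooth_on (\<lambda>x. t i x * cnj (g i x) ^ k) (chart L i)"
        using t by (intro smooth_on_mult smooth_on_power smooth_on_cnj op g_smooth) (auto simp: sections_def chart_L)
    qed
    then have "smooth_on (\<Psi> t) (\<Union>i. chart L i)" by (intro smooth_on_Union op)
    then have sm: "smooth_on (\<Psi> t) UNIV" by (simp add: cover)
    have "\<Psi> t (x + v) = c v * cis (pi * \<omega>k v x) * \<Psi> t x" if v: "v \<in> int_lattice" for x v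
    proof -
      have "t (j x) (x + v) = t (j x) x"
        using t j[of x] v unfolding sections_def chart_L periodic_on_def by blast
      then show ?thesis
        unfolding \<Psi>_eq[OF t per[OF j v, of x]] \<Psi>_eq[OF t j[of x]] g_per[OF j v] c_def
        by (simp add: power_mult_distrib cis_cnj cis_power)
    qed
    then show ?thesis using sm by (simp add: M.qp_def)
  qed
  have \<Phi>_sections: "\<Phi> f \<in> sections ?L" if f: "f \<in> M.qp" for f
    unfolding sections_def chart_L
  proof (intro CollectI conjI allI ballI impI)
    fix i
    show "smooth_on (\<Phi> f i) (chart L i)"
    proof (rule smooth_on_cong[OF op, THEN iffD2])
      show "smooth_on (\<lambda>x. f x * g i x ^ k) (chart L i)"
        using smooth_on_subset[OF M.qp_smooth[OF f]] by (intro smooth_on_mult smooth_on_power op g_smooth) auto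
    qed (simp add: \<Phi>_def)
    show "periodic_on (chart L i) (\<Phi> f i)"
      unfolding periodic_on_def
    proof (intro ballI)
      fix x v assume x: "x \<in> chart L i" and v: "v \<in> (int_lattice :: (real^'n) set)"
      have fv: "f (x + v) = c v * cis (pi * \<omega>k v x) * f x" using f v by (simp add: M.qp_def)
      have "\<rho> v ^ k * cnj (\<rho> v) ^ k = 1"
        using norm_\<rho>[OF v] complex_norm_square[of "\<rho> v"] by (simp flip: power_mult_distrib)
      moreover have "cis (pi * \<omega>k v x) * cis (- pi * \<omega> v x) ^ k = 1"
        by (simp only: cis_power cis_mult) simp
      moreover have "f (x + v) * g i (x + v) ^ k = (\<rho> v ^ k * cnj (\<rho> v) ^ k) *
          (cis (pi * \<omega>k v x) * cis (- pi * \<omega> v x) ^ k) * (f x * g i x ^ k)"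
        unfolding g_per[OF x v] fv c_def power_mult_distrib by (simp only: mult_ac)
      ultimately have "f (x + v) * g i (x + v) ^ k = f x * g i x ^ k" by simp
      then show "\<Phi> f i (x + v) = \<Phi> f i x" using x per[OF x v] by (simp add: \<Phi>_def)
    qed
    show "\<Phi> f i x = trans ?L i l x * \<Phi> f l x" if "x \<in> chart L i \<inter> chart L l" for l x
      using that g_trans[of x i l] by (simp add: \<Phi>_def trans_L power_mult_distrib)
  qed (simp add: \<Phi>_def)
  have cov: "covariant_deriv ?L p (\<Phi> f) = \<Phi> (M.D (axis p 1) f)" if f: "f \<in> M.qp" for f p
  proof (intro ext)
    fix i x
    show "covariant_deriv ?L p (\<Phi> f) i x = \<Phi> (M.D (axis p 1) f) i x"
    proof (cases "x \<in> chart L i")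
      case True
      let ?A = "\<lambda>u. \<Sum>p\<in>UNIV. (- \<i> * pi * \<omega> x (axis p 1) - conn L i p x) * complex_of_real (u $ p)"
      have "((\<lambda>x. f x * g i x ^ k) has_derivative
          (\<lambda>u. f x * (of_nat k * (?A u * g i x) * g i x ^ (k - 1)) + frechet_derivative f (at x) u * g i x ^ k)) (at x)"
        by (intro has_derivative_mult has_derivative_power g_deriv True smooth_has_derivative M.qp_smooth f)
      then have "(\<Phi> f i has_derivative
          (\<lambda>u. f x * (of_nat k * (?A u * g i x) * g i x ^ (k - 1)) + frechet_derivative f (at x) u * g i x ^ k)) (at x)"
        by (rule has_derivative_transform_within_open[OF _ op True]) (simp add: \<Phi>_def)
      from partial_deriv_eqI[OF this]
      have pd: "partial_deriv p (\<Phi> f i) x = f x * (of_nat k * (?A (axis p 1) * g i x) * g i x ^ (k - 1)) +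
          frechet_derivative f (at x) (axis p 1) * g i x ^ k" .
      have A: "?A (axis p 1) = - \<i> * pi * \<omega> x (axis p 1) - conn L i p x"
        by (simp add: axis_def if_distrib[of complex_of_real] if_distrib[of "(*) _"] cong: if_cong)
      have gk: "g i x * g i x ^ (k - 1) = g i x ^ k" using k by (cases k) auto
      have "partial_deriv p (\<Phi> f i) x = (f x * (of_nat k * (- \<i> * pi * \<omega> x (axis p 1) - conn L i p x)) +
          frechet_derivative f (at x) (axis p 1)) * g i x ^ k"
        unfolding pd A gk[symmetric] by (simp only: distrib_right mult.assoc)
      then show ?thesis
        using True by (simp add: covariant_deriv_def chart_L conn_L \<Phi>_def M.D_def \<omega>k_def algebra_simps)
    qed (simp add: covariant_deriv_def \<Phi>_def chart_L)
  qed
  have lap: "bundle_laplacian h ?L (\<Phi> f) = \<Phi> (M.lap f)" if f: "f \<in> M.qp" for f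
  proof -
    let ?D = "\<lambda>p q x. M.D (axis p 1) (M.D (axis q 1) f) x"
    have Db: "M.D (b r) F x = (\<Sum>p\<in>UNIV. complex_of_real (b r $ p) * M.D (axis p 1) F x)" if F: "F \<in> M.qp" for r F x
    proof -
      have "b r = (\<Sum>p\<in>UNIV. (b r $ p) *\<^sub>R axis p 1)"
        by (simp add: basis_expansion flip: scalar_mult_eq_scaleR)
      then show ?thesis by (metis M.D_sum[OF M.qp_smooth[OF F]])
    qed
    have "M.lap f x = - (\<Sum>p\<in>UNIV. \<Sum>q\<in>UNIV. complex_of_real (matrix_inv (gram h) $ p $ q) * ?D p q x)" for x
    proof -
      have "M.D (b r) (M.D (b r) f) x = (\<Sum>p\<in>UNIV. \<Sum>q\<in>UNIV. complex_of_real (b r $ p * b r $ q) * ?D p q x)" for r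
      proof -
        have "M.D (axis p 1) (M.D (b r) f) x = (\<Sum>q\<in>UNIV. complex_of_real (b r $ q) * ?D p q x)" for p
          unfolding Db[OF f, abs_def]
          using M.D_sum_fun[of UNIV "\<lambda>q. M.D (axis q 1) f" "axis p 1" "\<lambda>q. complex_of_real (b r $ q)" x] M.qp_D[OF f] by simp
        then show ?thesis
          unfolding Db[OF M.qp_D[OF f]] by (simp add: sum_distrib_left mult.assoc)
      qed
      then have "M.lap f x = - (\<Sum>r\<in>UNIV. \<Sum>p\<in>UNIV. \<Sum>q\<in>UNIV. complex_of_real (b r $ p * b r $ q) * ?D p q x)"
        by (simp add: M.lap_def)
      also have "(\<Sum>r\<in>UNIV. \<Sum>p\<in>UNIV. \<Sum>q\<in>UNIV. complex_of_real (b r $ p * b r $ q) * ?D p q x) =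
          (\<Sum>p\<in>UNIV. \<Sum>q\<in>UNIV. \<Sum>r\<in>UNIV. complex_of_real (b r $ p * b r $ q) * ?D p q x)"
        by (rule trans[OF sum.swap], rule sum.cong[OF refl], rule sum.swap)
      also have "\<dots> = (\<Sum>p\<in>UNIV. \<Sum>q\<in>UNIV. complex_of_real (matrix_inv (gram h) $ p $ q) * ?D p q x)"
        by (simp add: M.matrix_inv_gram column_matrix_def matrix_matrix_mult_def transpose_def sum_distrib_right)
      finally show ?thesis .
    qed
    then show ?thesis
      by (simp add: fun_eq_iff bundle_laplacian_def cov f M.qp_D)
        (simp add: \<Phi>_def sum_distrib_right mult.assoc)
  qed
  have \<Phi>_inj: "\<Phi> f = \<Phi> f' \<longleftrightarrow> f = f'" for f f' by (metis \<Psi>\<Phi>)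
  \<comment> \<open>The factor \<open>2 * (real k)\<^sup>2\<close> undoes
    \<open>hbar\<^sup>2 / 2\<close> with \<open>hbar = 1 / k\<close>.\<close>
  have eigen: "hamiltonian k h L (\<Phi> f) = scale_section \<mu> (\<Phi> f) \<longleftrightarrow> M.lap f = fscale (2 * (real k)\<^sup>2 * \<mu>) f"
    if f: "f \<in> M.qp" for f and \<mu> :: complex
  proof -
    have sc: "scale_section z (\<Phi> f) = \<Phi> (fscale z f)" for z f
      by (simp add: fun_eq_iff scale_section_def \<Phi>_def fscale_def)
    have "hamiltonian k h L (\<Phi> f) = \<Phi> (fscale (complex_of_real ((1 / real k)\<^sup>2 / 2)) (M.lap f))"
      by (simp add: hamiltonian_def Let_def lap[OF f] sc)
    then have "hamiltonian k h L (\<Phi> f) = scale_section \<mu> (\<Phi> f) \<longleftrightarrow>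
        fscale (complex_of_real ((1 / real k)\<^sup>2 / 2)) (M.lap f) = fscale \<mu> f"
      by (simp add: sc \<Phi>_inj)
    also have "\<dots> \<longleftrightarrow> M.lap f = fscale (2 * (real k)\<^sup>2 * \<mu>) f"
      using k by (simp add: fscale_def fun_eq_iff field_simps power2_eq_square)
    finally show ?thesis .
  qed
  interpret S: vector_space scale_section by (rule vector_space_scale_section)
  interpret VP: vector_space_pair scale_section fscale ..
  have \<Psi>_add: "\<Psi> (t + t') = \<Psi> t + \<Psi> t'" and \<Psi>_scale: "\<Psi> (scale_section z t) = fscale z (\<Psi> t)" for t t' z
    by (simp_all add: fun_eq_iff \<Psi>_def scale_section_def fscale_def algebra_simps)
  have spectrum: "hamiltonian_spectrum k h L \<mu> = n"
    if n: "has_dim fscale {f \<in> M.qp. M.lap f = fscale (2 * (real k)\<^sup>2 * \<mu>) f} n" for \<mu> :: complex and n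
  proof -
    define ES where "ES = {t \<in> sections ?L. hamiltonian k h L t = scale_section \<mu> t}"
    define EF where "EF = {f \<in> M.qp. M.lap f = fscale (2 * (real k)\<^sup>2 * \<mu>) f}"
    have \<Psi>_ES: "\<Psi> t \<in> EF" if "t \<in> ES" for t
      using that eigen[OF \<Psi>_qp, of t \<mu>] \<Psi>_qp \<Phi>\<Psi> by (auto simp: ES_def EF_def)
    have \<Phi>_EF: "\<Phi> f \<in> ES" if "f \<in> EF" for f
      using that eigen[of f \<mu>] \<Phi>_sections by (auto simp: ES_def EF_def)
    have ES: "ES = \<Phi> ` EF"
    proof
      show "ES \<subseteq> \<Phi> ` EF"
      proof
        fix t assume t: "t \<in> ES"
        then have "t = \<Phi> (\<Psi> t)" using \<Phi>\<Psi>[of t] by (simp add: ES_def)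
        then show "t \<in> \<Phi> ` EF" using \<Psi>_ES[OF t] by (rule image_eqI)
      qed
      show "\<Phi> ` EF \<subseteq> ES" using \<Phi>_EF by blast
    qed
    have "M.Fun.subspace EF"
    proof -
      have "M.lap (f + f') x = M.lap f x + M.lap f' x \<and> M.lap (fscale z f) x = z * M.lap f x"
        if "f \<in> M.qp" "f' \<in> M.qp" for f f' z x
      proof -
        have "M.D u (M.D u (f + f')) x = M.D u (M.D u f) x + M.D u (M.D u f') x" for u
          unfolding plus_fun_def M.D_add[OF M.qp_smooth M.qp_smooth, OF that, abs_def]
          by (simp add: M.D_add M.qp_smooth M.qp_D that)
        moreover have "M.D u (M.D u (fscale z f)) x = z * M.D u (M.D u f) x" for u
          unfolding fscale_def M.D_scale[OF M.qp_smooth[OF that(1)], abs_def]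
          by (simp add: M.D_scale M.qp_smooth M.qp_D that)
        ultimately show ?thesis by (simp add: M.lap_def sum.distrib sum_distrib_left)
      qed
      note lin = this
      have "0 \<in> EF"
        using M.Fun.subspace_0[OF M.subspace_qp] lin[of 0 0] by (auto simp: EF_def fscale_def fun_eq_iff)
      then show ?thesis
        using M.subspace_qp lin unfolding M.Fun.subspace_def EF_def
        by (auto simp: fun_eq_iff fscale_def algebra_simps)
    qed
    then have "S.subspace ES"
    proof -
      assume sub: "M.Fun.subspace EF"
      have *: "\<Phi> f + \<Phi> f' = \<Phi> (f + f')" "scale_section z (\<Phi> f) = \<Phi> (fscale z f)" "0 = \<Phi> 0" for f f' z
        by (auto simp: fun_eq_iff \<Phi>_def scale_section_def fscale_def algebra_simps)
      show ?thesis
        using sub unfolding S.subspace_def M.Fun.subspace_def ES by (auto simp: *)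
    qed
    moreover have "{t \<in> ES. \<Psi> t = 0} = {0}"
    proof -
      have "t = 0" if "t \<in> ES" "\<Psi> t = 0" for t
      proof -
        have "t = \<Phi> 0" using that \<Phi>\<Psi>[of t] by (simp add: ES_def)
        then show ?thesis by (simp add: \<Phi>_def fun_eq_iff)
      qed
      moreover have "\<Psi> 0 = 0" by (simp add: \<Psi>_def fun_eq_iff)
      ultimately show ?thesis using S.subspace_0[OF \<open>S.subspace ES\<close>] by auto
    qed
    then have "has_dim scale_section {t \<in> ES. \<Psi> t = 0} 0" using S.has_dim_zero by simp
    moreover have "\<Psi> ` ES = EF" unfolding ES image_image by (simp add: \<Psi>\<Phi>)
    \<comment> \<open>\<Psi> is injective on the eigenspace, so the exact sequence with trivial
      kernel transports the dimension to sections.\<close>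
    ultimately have "has_dim scale_section ES (0 + n)"
      using n \<Psi>_add \<Psi>_scale unfolding EF_def by (intro VP.has_dim_exact_sequence[where T = \<Psi>])
    then have "S.dim ES = n" using S.has_dim_imp_dim by simp
    then show ?thesis by (simp add: hamiltonian_spectrum_def ES_def)
  qed
  obtain d where d: "real d * (\<integral>x. exp (- pi * ((x :: real^'n) \<bullet> x)) \<partial>lborel) = symplectic_volume \<omega>k"
    and dims: "\<And>\<nu> ps. distinct ps \<Longrightarrow> set ps = M.freq_modes \<Longrightarrow>
      has_dim fscale {f \<in> M.qp. M.lap f = fscale \<nu> f}
        (if Im \<nu> = 0 then d * tuple_count (map (\<lambda>p. 4 * pi * (real k * a p)) ps) (Re \<nu> - M.zero_point) else 0)"
    using M.laplacian_spectrum by blast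
  have im: "Im (2 * (real k)\<^sup>2 * \<mu>) = 2 * (real k)\<^sup>2 * Im \<mu>" "Re (2 * (real k)\<^sup>2 * \<mu>) = 2 * (real k)\<^sup>2 * Re \<mu>" for \<mu> :: complex
    by (simp_all add: Re_power2 Im_power2)
  show ?thesis
  proof (intro exI[of _ d] conjI allI impI)
    show "real d * (\<integral>x. exp (- pi * ((x :: real^'n) \<bullet> x)) \<partial>lborel) = symplectic_volume (\<lambda>u v. real k * \<omega> u v)"
      using d by (simp add: \<omega>k_def[abs_def])
    fix \<mu> ps assume "distinct ps" "set ps = {p. s p = 1}"
    then show "hamiltonian_spectrum k h L \<mu> = (if Im \<mu> = 0 then d * tuple_count (map (\<lambda>p. 4 * pi * (real k * a p)) ps)
         (2 * (real k)\<^sup>2 * Re \<mu> - 2 * pi * (\<Sum>p | s p = 1. real k * a p)) else 0)"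
      using spectrum[OF dims[of ps "2 * (real k)\<^sup>2 * \<mu>"]] k unfolding im
      by (simp add: M.freq_modes_def M.zero_point_def)
  qed
qed

text \<open>Since \<open>flat B u\<close> puts \<open>u\<close> into the second slot, it corresponds
  to the column \<open>gram B *v u\<close>, and the composition is the matrix product without
  transposes. \<open>sharp\<close> may be evaluated through injectivity because the functional is
  exhibited in the range of \<open>flat h\<close>.\<close>

lemma sharp_flat_matrix:
  fixes h \<omega> :: "real^'n \<Rightarrow> real^'n \<Rightarrow> real"
  assumes h: "flat_metric h" and \<omega>: "symplectic_form \<omega>"
  shows "matrix (sharp h \<circ> flat \<omega>) = matrix_inv (gram h) ** gram \<omega>"
proof -
  note blh = flat_metricD(1)[OF h]
  have bl\<omega>: "bilinear \<omega>" using \<omega> by (simp add: symplectic_form_def)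
  have form: "B v u = v \<bullet> (gram B *v u)" if "bilinear B" for B :: "real^'n \<Rightarrow> real^'n \<Rightarrow> real" and u v
    unfolding bilinear_gram[OF that, of v u]
    by (simp add: inner_vec_def matrix_vector_mult_def sum_distrib_left mult.assoc)
  have "x = 0" if "gram h *v x = 0" for x
    using form[OF blh, of x x] flat_metricD(3)[OF h, of x] that by fastforce
  then have "invertible (gram h)"
    by (simp add: invertible_left_inverse matrix_left_invertible_ker)
  then have inv: "gram h ** matrix_inv (gram h) = mat 1"
    unfolding invertible_def using matrix_inv_eqI by metis
  have "inj (flat h)"
  proof (rule injI)
    fix u w assume eq: "flat h u = flat h w"
    have "h (u - w) (u - w) = h (u - w) u - h (u - w) w" by (rule bilinear_rsub[OF blh])
    also have "\<dots> = 0" using fun_cong[OF eq, of "u - w"] by (simp add: flat_def)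
    finally show "u = w" using flat_metricD(3)[OF h, of "u - w"] by fastforce
  qed
  moreover have "flat h ((matrix_inv (gram h) ** gram \<omega>) *v u) = flat \<omega> u" for u
    by (simp add: flat_def fun_eq_iff form[OF blh] form[OF bl\<omega>] matrix_vector_mul_assoc matrix_mul_assoc inv)
  ultimately have "sharp h (flat \<omega> u) = (matrix_inv (gram h) ** gram \<omega>) *v u" for u
    unfolding sharp_def by (metis inv_f_f)
  then have "sharp h \<circ> flat \<omega> = (*v) (matrix_inv (gram h) ** gram \<omega>)" by auto
  then show ?thesis by simp
qed

section \<open>Comparison of two spectra\<close>

lemma symplectic_volume_scale:
  fixes \<omega> :: "real^'n \<Rightarrow> real^'n \<Rightarrow> real"
  shows "symplectic_volume (\<lambda>u v. k * \<omega> u v) = sqrt (k ^ CARD('n)) * symplectic_volume \<omega>"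
proof -
  have "gram (\<lambda>u v. k * \<omega> u v) = (\<chi> p. k *s (gram \<omega> $ p))"
    by (simp add: gram_def vec_eq_iff)
  then have "det (gram (\<lambda>u v. k * \<omega> u v)) = k ^ CARD('n) * det (gram \<omega>)"
    using det_rows_mul[of "\<lambda>_. k" "\<lambda>p. gram \<omega> $ p"] by (simp add: vec_lambda_eta)
  then show ?thesis by (simp add: symplectic_volume_def real_sqrt_mult)
qed

text \<open>The frequencies are collected in a sorted list, so that equality of eigenvalue multisets
  turns into equality of lists. Only this list and the volume enter the formulas for the
  spectra.\<close>

lemma spectral_data:
  fixes h \<omega> :: "real^'n \<Rightarrow> real^'n \<Rightarrow> real" and L :: "('i, 'n) line_bundle"
  assumes "symplectic_form \<omega>" "integral_class \<omega>" "flat_metric h" "prequantum_bundle \<omega> L"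
  obtains F :: "real list" where "sorted F" "\<And>x. x \<in> set F \<Longrightarrow> x > 0" "2 * length F = CARD('n)"
    "eigenvalue_spectrum (matrix_inv (gram h) ** gram \<omega>) =
      (\<Sum>x\<in>#mset F. {#\<i> * complex_of_real x, - \<i> * complex_of_real x#})"
    "symplectic_volume \<omega> > 0"
    "\<And>k. k \<ge> 1 \<Longrightarrow> \<exists>d. real d * (\<integral>x. exp (- pi * ((x :: real^'n) \<bullet> x)) \<partial>lborel) = sqrt (real k ^ CARD('n)) * symplectic_volume \<omega> \<and>
      (\<forall>\<mu>. hamiltonian_spectrum k h L \<mu> = (if Im \<mu> = 0 then d * tuple_count (map (\<lambda>x. 4 * pi * (real k * x)) F)
        (2 * (real k)\<^sup>2 * Re \<mu> - 2 * pi * real k * sum_list F) else 0))"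
proof -
  obtain b :: "'n \<Rightarrow> real^'n" and \<sigma> :: "'n \<Rightarrow> 'n" and s a :: "'n \<Rightarrow> real"
    where frame: "symplectic_frame h \<omega> b \<sigma> s a"
    by (rule symplectic_basis[OF assms(3,1)]) (use assms in \<open>auto simp: symplectic_frame_def\<close>)
  interpret symplectic_frame h \<omega> b \<sigma> s a by fact
  obtain qs where qs: "set qs = {p. s p = 1}" "distinct qs" using finite_distinct_list[of "{p. s p = 1}"] by auto
  define ps where "ps = sort_key a qs"
  have ps: "set ps = {p. s p = 1}" "distinct ps" using qs by (auto simp: ps_def)
  have sum_ps: "(\<Sum>p | s p = 1. f p) = sum_list (map f ps)" for f :: "'n \<Rightarrow> real"
    using sum_list_distinct_conv_sum_set[OF ps(2), of f] ps(1) by simp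
  show thesis
  proof (rule that[of "map a ps"])
    show "sorted (map a ps)" by (simp add: ps_def)
    show "x > 0" if "x \<in> set (map a ps)" for x using that a by auto
    have "card (UNIV :: 'n set) = card freq_modes + card freq_modes"
      using sum_modes[of "\<lambda>_. 1 :: nat"] by simp
    then show "2 * length (map a ps) = CARD('n)"
      using distinct_card[OF ps(2)] ps(1) by (simp add: freq_modes_def)
    have "mset ps = mset_set freq_modes" using mset_set_set[OF ps(2)] ps(1) by (simp add: freq_modes_def)
    then show "eigenvalue_spectrum (matrix_inv (gram h) ** gram \<omega>) =
      (\<Sum>x\<in>#mset (map a ps). {#\<i> * complex_of_real x, - \<i> * complex_of_real x#})"
      unfolding eigenvalue_spectrum_frequencies by (simp add: sum_unfold_sum_mset image_mset.compositionality o_def)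
    have "det (gram \<omega>) > 0"
      using det_scaled_basis by (metis mult_zero_left not_less_iff_gr_or_eq zero_less_mult_pos zero_less_one zero_less_power2 power_zero_numeral zero_neq_one)
    then show "symplectic_volume \<omega> > 0" by (simp add: symplectic_volume_def)
    fix k :: nat assume k: "k \<ge> 1"
    obtain d where "real d * (\<integral>x. exp (- pi * ((x :: real^'n) \<bullet> x)) \<partial>lborel) = symplectic_volume (\<lambda>u v. real k * \<omega> u v)"
      "\<And>\<mu> ps. distinct ps \<Longrightarrow> set ps = {p. s p = 1} \<Longrightarrow>
        hamiltonian_spectrum k h L \<mu> = (if Im \<mu> = 0 then d * tuple_count (map (\<lambda>p. 4 * pi * (real k * a p)) ps)
         (2 * (real k)\<^sup>2 * Re \<mu> - 2 * pi * (\<Sum>p | s p = 1. real k * a p)) else 0)"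
      using section_spectrum[OF frame assms(2,4) k] by blast
    note d = this(1) this(2)[OF ps(2,1)]
    show "\<exists>d. real d * (\<integral>x. exp (- pi * ((x :: real^'n) \<bullet> x)) \<partial>lborel) = sqrt (real k ^ CARD('n)) * symplectic_volume \<omega> \<and>
      (\<forall>\<mu>. hamiltonian_spectrum k h L \<mu> = (if Im \<mu> = 0 then d * tuple_count (map (\<lambda>x. 4 * pi * (real k * x)) (map a ps))
        (2 * (real k)\<^sup>2 * Re \<mu> - 2 * pi * real k * sum_list (map a ps)) else 0))"
      by (rule exI[of _ d])
        (use d(1) in \<open>auto simp: d(2) symplectic_volume_scale o_def sum_distrib_left mult.assoc simp flip: sum_ps\<close>)
  qed
qed

text \<open>Each frequency contributes exactly one eigenvalue in the upper half plane, so the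
  conjugate pairs can be undone.\<close>

lemma frequencies_from_spectrum:
  fixes F :: "real list"
  assumes "\<And>x. x \<in> set F \<Longrightarrow> x > 0"
  shows "image_mset Im (filter_mset (\<lambda>z. Im z > 0)
    (\<Sum>x\<in>#mset F. {#\<i> * complex_of_real x, - \<i> * complex_of_real x#})) = mset F"
  using assms
proof (induction F)
  case (Cons a F)
  have "a > 0" using Cons.prems[of a] by simp
  moreover have "image_mset Im (filter_mset (\<lambda>z. Im z > 0)
    (\<Sum>x\<in>#mset F. {#\<i> * complex_of_real x, - \<i> * complex_of_real x#})) = mset F"
    using Cons.prems by (intro Cons.IH) simp
  ultimately show ?case by simp
qed simp

theorem theorem4p6:
  fixes m :: nat
    and \<omega> \<omega>' h h' :: "real^'n \<Rightarrow> real^'n \<Rightarrow> real"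
    and L :: "('i, 'n) line_bundle" and L' :: "('j, 'n) line_bundle"
  assumes "m \<ge> 1" and "CARD('n) = 2 * m"
    and "symplectic_form \<omega>" and "integral_class \<omega>"
    and "symplectic_form \<omega>'" and "integral_class \<omega>'"
    and "flat_metric h" and "flat_metric h'"
    and "prequantum_bundle \<omega> L" and "prequantum_bundle \<omega>' L'"
  shows "((hamiltonian_spectrum 1 h L = hamiltonian_spectrum 1 h' L') \<longleftrightarrow>
           (\<forall>k\<ge>1. hamiltonian_spectrum k h L = hamiltonian_spectrum k h' L')) \<and>
         ((\<forall>k\<ge>1. hamiltonian_spectrum k h L = hamiltonian_spectrum k h' L') \<longleftrightarrow>
           (eigenvalue_spectrum (matrix (sharp h \<circ> flat \<omega>)) =
              eigenvalue_spectrum (matrix (sharp h' \<circ> flat \<omega>')) \<and>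
            symplectic_volume \<omega> = symplectic_volume \<omega>')) \<and>
         ((eigenvalue_spectrum (matrix (sharp h \<circ> flat \<omega>)) =
             eigenvalue_spectrum (matrix (sharp h' \<circ> flat \<omega>'))) \<longleftrightarrow>
          (eigenvalue_spectrum (matrix_inv (gram h) ** gram \<omega>) =
             eigenvalue_spectrum (matrix_inv (gram h') ** gram \<omega>')))"
proof -
  let ?S = "eigenvalue_spectrum (matrix_inv (gram h) ** gram \<omega>)"
    and ?S' = "eigenvalue_spectrum (matrix_inv (gram h') ** gram \<omega>')"
    and ?\<kappa> = "\<integral>x. exp (- pi * ((x :: real^'n) \<bullet> x)) \<partial>lborel"
  obtain F where F: "sorted F" "\<And>x. x \<in> set F \<Longrightarrow> x > 0" "2 * length F = CARD('n)"
    and S: "?S = (\<Sum>x\<in>#mset F. {#\<i> * complex_of_real x, - \<i> * complex_of_real x#})"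
    and V: "symplectic_volume \<omega> > 0"
    and spec: "\<And>k. k \<ge> 1 \<Longrightarrow> \<exists>d. real d * ?\<kappa> = sqrt (real k ^ CARD('n)) * symplectic_volume \<omega> \<and>
      (\<forall>\<mu>. hamiltonian_spectrum k h L \<mu> = (if Im \<mu> = 0 then d * tuple_count (map (\<lambda>x. 4 * pi * (real k * x)) F)
        (2 * (real k)\<^sup>2 * Re \<mu> - 2 * pi * real k * sum_list F) else 0))"
    using spectral_data[OF assms(3,4,7,9)] by blast
  obtain F' where F': "sorted F'" "\<And>x. x \<in> set F' \<Longrightarrow> x > 0" "2 * length F' = CARD('n)"
    and S': "?S' = (\<Sum>x\<in>#mset F'. {#\<i> * complex_of_real x, - \<i> * complex_of_real x#})"
    and V': "symplectic_volume \<omega>' > 0"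
    and spec': "\<And>k. k \<ge> 1 \<Longrightarrow> \<exists>d. real d * ?\<kappa> = sqrt (real k ^ CARD('n)) * symplectic_volume \<omega>' \<and>
      (\<forall>\<mu>. hamiltonian_spectrum k h' L' \<mu> = (if Im \<mu> = 0 then d * tuple_count (map (\<lambda>x. 4 * pi * (real k * x)) F')
        (2 * (real k)\<^sup>2 * Re \<mu> - 2 * pi * real k * sum_list F') else 0))"
    using spectral_data[OF assms(5,6,8,10)] by blast
  have SF: "?S = ?S' \<longleftrightarrow> F = F'"
  proof
    assume "?S = ?S'"
    then have "mset F = mset F'" using frequencies_from_spectrum F(2) F'(2) S S' by metis
    then show "F = F'" using F(1) F'(1) by (metis properties_for_sort sorted_sort_id)
  qed (use S S' in simp)
  have up: "hamiltonian_spectrum k h L = hamiltonian_spectrum k h' L'"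
    if eq: "F = F'" "symplectic_volume \<omega> = symplectic_volume \<omega>'" and k: "k \<ge> 1" for k
  proof -
    obtain d d' where d: "real d * ?\<kappa> = sqrt (real k ^ CARD('n)) * symplectic_volume \<omega>"
      "\<And>\<mu>. hamiltonian_spectrum k h L \<mu> = (if Im \<mu> = 0 then d * tuple_count (map (\<lambda>x. 4 * pi * (real k * x)) F)
        (2 * (real k)\<^sup>2 * Re \<mu> - 2 * pi * real k * sum_list F) else 0)"
      and d': "real d' * ?\<kappa> = sqrt (real k ^ CARD('n)) * symplectic_volume \<omega>'"
      "\<And>\<mu>. hamiltonian_spectrum k h' L' \<mu> = (if Im \<mu> = 0 then d' * tuple_count (map (\<lambda>x. 4 * pi * (real k * x)) F')
        (2 * (real k)\<^sup>2 * Re \<mu> - 2 * pi * real k * sum_list F') else 0)"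
      using spec[OF k] spec'[OF k] by blast
    have "sqrt (real k ^ CARD('n)) * symplectic_volume \<omega> > 0" using V k by simp
    \<comment> \<open>A positive volume is a multiple of the Gaussian integral, so the integral is
      nonzero and can be cancelled to compare \<open>d\<close> with \<open>d'\<close>.\<close>
    then have "?\<kappa> \<noteq> 0" using d(1) by (metis less_irrefl mult_zero_right)
    moreover have "real d * ?\<kappa> = real d' * ?\<kappa>" using d(1) d'(1) eq(2) by simp
    ultimately have "d = d'" by (simp only: mult_cancel_right of_nat_eq_iff) simp
    then show ?thesis by (simp add: fun_eq_iff d(2) d'(2) eq(1))
  qed
  have down: "F = F' \<and> symplectic_volume \<omega> = symplectic_volume \<omega>'"
    if eq: "hamiltonian_spectrum 1 h L = hamiltonian_spectrum 1 h' L'"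
  proof -
    define G G' c c' where defs: "G = map (\<lambda>x. 4 * pi * x) F" "G' = map (\<lambda>x. 4 * pi * x) F'"
      "c = 2 * pi * sum_list F" "c' = 2 * pi * sum_list F'"
    obtain d where d: "real d * ?\<kappa> = symplectic_volume \<omega>"
      "\<And>\<mu>. hamiltonian_spectrum 1 h L \<mu> = (if Im \<mu> = 0 then d * tuple_count G (2 * Re \<mu> - c) else 0)"
      using spec[of 1] by (auto simp: defs)
    obtain d' where d': "real d' * ?\<kappa> = symplectic_volume \<omega>'"
      "\<And>\<mu>. hamiltonian_spectrum 1 h' L' \<mu> = (if Im \<mu> = 0 then d' * tuple_count G' (2 * Re \<mu> - c') else 0)"
      using spec'[of 1] by (auto simp: defs)
    have pos: "x > 0" if "x \<in> set G" for x using that F(2) by (auto simp: defs)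
    have pos': "x > 0" if "x \<in> set G'" for x using that F'(2) by (auto simp: defs)
    \<comment> \<open>For \<open>k = 1\<close> the eigenvalue \<open>x / 2\<close> of the
      Hamiltonian is \<open>x\<close> for the Laplacian.\<close>
    have eq': "d * tuple_count G (x - c) = d' * tuple_count G' (x - c')" for x
      using fun_cong[OF eq, of "complex_of_real (x / 2)"] unfolding d(2) d'(2) by simp
    have "real d * ?\<kappa> \<noteq> 0" "real d' * ?\<kappa> \<noteq> 0" unfolding d(1) d'(1) using V V' by simp_all
    then have d_pos: "d \<noteq> 0" "d' \<noteq> 0" by (simp_all only: mult_eq_0_iff) simp_all
    have zero: "tuple_count G 0 = 1" "tuple_count G' 0 = 1" by (rule tuple_count_zero, use pos pos' in simp)+
    have neg: "tuple_count G x = 0" "tuple_count G' x = 0" if "x < 0" for x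
      by (rule tuple_count_neg, use pos pos' that in simp_all)+
    \<comment> \<open>\<open>c\<close> is the lowest level of the first spectrum. Were
      \<open>c'\<close> larger, the second count at this level would have a negative argument and
      vanish.\<close>
    have "\<not> c < c'" using eq'[of c] zero(1) neg(2)[of "c - c'"] d_pos by auto
    moreover have "\<not> c' < c" using eq'[of c'] zero(2) neg(1)[of "c' - c"] d_pos by auto
    ultimately have cc: "c = c'" by simp
    \<comment> \<open>At the common lowest level both counts are 1, so its multiplicities are the
      vacuum dimensions themselves.\<close>
    have dd: "d = d'" using eq'[of c] zero by (simp add: cc)
    have "tuple_count G x = tuple_count G' x" for x using eq'[of "x + c"] d_pos by (simp add: cc dd)
    moreover have "sorted G" "sorted G'" using F(1) F'(1) by (auto simp: defs sorted_iff_nth_mono_less)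
    moreover have "length G = length G'" using F(3) F'(3) by (simp add: defs)
    ultimately have "G = G'" using pos pos' by (intro tuple_count_inject)
    then have "F = F'" unfolding defs by (rule inj_onD[OF inj_mapI, rotated]) (auto intro!: injI)
    then show ?thesis using d(1) d'(1) dd by simp
  qed
  show ?thesis
    unfolding sharp_flat_matrix[OF assms(7,3)] sharp_flat_matrix[OF assms(8,5)]
    using SF up down by (metis order_refl)
qed

end
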